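(* Let $R$ and $S$ be rings, let $d\ge 1$ be an integer, let $n$ be an integer or $n=\infty$ with $n>d+1$, and let ${}_S(K_{d-1})_R$ be a special semidualizing bimodule (with respect to some super finitely presented bimodule ${}_SC_R$). Then: (1) $\mathcal{I}^{(n,d)}(S)\subseteq\mathcal{B}_{K_{d-1}}(S)$; (2) $\mathcal{F}^{(n,d)}(R)\subseteq\mathcal{A}_{K_{d-1}}(R)$.
   Context: Rings are associative with unity; modules are unital left modules; right $R$-modules are identified with left $R^{op}$-modules. A module $U$ over a ring $T$ is finitely $n$-presented ($n$ finite) if there is an exact sequence $F_n\to F_{n-1}\to\cdots\to F_0\to U\to 0$ of $T$-modules with each $F_i$ finitely generated free; for $n=\infty$, finitely $\infty$-presented means super finitely presented, i.e. there is an exact sequence $\cdots\to F_1\to F_0\to U\to 0$ with each $F_i$ finitely generated free. An $S$-module $M$ is $(n,d)$-injective if $\mathrm{Ext}_S^{d+1}(U,M)=0$ for every finitely $n$-presented $S$-module $U$. An $R$-module $N$ is $(n,d)$-flat if $\mathrm{Tor}^R_{d+1}(U,N)=0$ for every finitely $n$-presented $R^{op}$-module $U$. $\mathcal{I}^{(n,d)}(S)$ and $\mathcal{F}^{(n,d)}(R)$ denote the classes of all $(n,d)$-injective $S$-modules and all $(n,d)$-flat $R$-modules. An $(S,R)$-bimodule $K$ is semidualizing if: ${}_SK$ and $K_R$ each have a resolution by finitely generated projectives (over $S$, resp. $R^{op}$); the homothety maps $S\to\mathrm{Hom}_{R^{op}}(K,K)$ and $R\to\mathrm{Hom}_S(K,K)$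 are isomorphisms; and $\mathrm{Ext}_S^i(K,K)=0=\mathrm{Ext}_{R^{op}}^i(K,K)$ for all $i\ge1$. Special semidualizing: let ${}_SC_R$ be a super finitely presented bimodule, i.e. there is an exact sequence of $(S,R)$-bimodules $\cdots\to F_1\to F_0\to C\to 0$ with each $F_i$ finitely generated free as a left $S$-module and as a right $R$-module. Put $K_{d-1}=\mathrm{Ker}(F_{d-1}\to F_{d-2})$ (with $F_{-1}=C$), the $(d-1)$th syzygy. If $K_{d-1}$ is a semidualizing $(S,R)$-bimodule, then $K_{d-1}$ is called a special semidualizing bimodule (with respect to $C$). For $K=K_{d-1}$: the Auslander class $\mathcal{A}_K(R)$ consists of the $R$-modules $M$ with $\mathrm{Tor}_i^R(K,M)=0$ and $\mathrm{Ext}_S^i(K,K\otimes_RM)=0$ for all $i\ge1$ and with the natural map $\mu_M:M\to\mathrm{Hom}_S(K,K\otimes_RM)$ an isomorphism. The Bass class $\mathcal{B}_K(S)$ consists of the $S$-modules $N$ with $\mathrm{Ext}_S^i(K,N)=0$ and $\mathrm{Tor}_i^R(K,\mathrm{Hom}_S(K,N))=0$ for all $i\ge1$ and with the natural evaluation map $\nu_N:K\otimes_R\mathrm{Hom}_S(K,N)\to N$ an isomorphism. *)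

theory Defs
  imports "HOL-Algebra.Module" "HOL-Algebra.AbelCoset" "HOL-Algebra.Free_Abelian_Groups"
    "HOL-Library.Extended_Nat"
begin

section \<open>Modules and bimodules over noncommutative rings\<close>

text \<open>Modules use the record type of HOL-Algebra, whose locale \<^locale>\<open>module\<close> however insists on a
  commutative ring of scalars. As there, the fields \<open>mult\<close> and \<open>one\<close> of a module are irrelevant.\<close>

locale left_module = R?: ring R + M?: abelian_group M
  for R :: "('r, 'x) ring_scheme" (structure) and M :: "('r, 'a, 'y) module_scheme" (structure) +
  assumes smult_closed [simp, intro]:
      "\<lbrakk>a \<in> carrier R; x \<in> carrier M\<rbrakk> \<Longrightarrow> a \<odot>\<^bsub>M\<^esub> x \<in> carrier M"
    and smult_l_distr:
      "\<lbrakk>a \<in> carrier R; b \<in> carrier R; x \<in> carrier M\<rbrakk> \<Longrightarrow>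
        (a \<oplus> b) \<odot>\<^bsub>M\<^esub> x = a \<odot>\<^bsub>M\<^esub> x \<oplus>\<^bsub>M\<^esub> b \<odot>\<^bsub>M\<^esub> x"
    and smult_r_distr:
      "\<lbrakk>a \<in> carrier R; x \<in> carrier M; y \<in> carrier M\<rbrakk> \<Longrightarrow>
        a \<odot>\<^bsub>M\<^esub> (x \<oplus>\<^bsub>M\<^esub> y) = a \<odot>\<^bsub>M\<^esub> x \<oplus>\<^bsub>M\<^esub> a \<odot>\<^bsub>M\<^esub> y"
    and smult_assoc1:
      "\<lbrakk>a \<in> carrier R; b \<in> carrier R; x \<in> carrier M\<rbrakk> \<Longrightarrow>
        (a \<otimes> b) \<odot>\<^bsub>M\<^esub> x = a \<odot>\<^bsub>M\<^esub> (b \<odot>\<^bsub>M\<^esub> x)"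
    and smult_one [simp]: "x \<in> carrier M \<Longrightarrow> \<one> \<odot>\<^bsub>M\<^esub> x = x"

definition op_ring :: "('r, 'x) ring_scheme \<Rightarrow> ('r, 'x) ring_scheme" where
  "op_ring R = R\<lparr>mult := \<lambda>x y. y \<otimes>\<^bsub>R\<^esub> x\<rparr>"

text \<open>A bimodule is a left module over the first ring with an additional scalar multiplication from
  the right; forgetting the left one gives a left module over the opposite of the second ring.\<close>

record ('s, 'r, 'b) bimodule = "('s, 'b) module" +
  rsmult :: "'b \<Rightarrow> 'r \<Rightarrow> 'b"

definition right_mod :: "('s, 'r, 'b) bimodule \<Rightarrow> ('r, 'b) module" where
  "right_mod K = \<lparr>carrier = carrier K, mult = mult K, one = one K,
     ring.zero = ring.zero K, add = add K, smult = (\<lambda>r x. rsmult K x r)\<rparr>"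

definition is_bimodule ::
    "('s, 'y) ring_scheme \<Rightarrow> ('r, 'x) ring_scheme \<Rightarrow> ('s, 'r, 'b) bimodule \<Rightarrow> bool" where
  "is_bimodule S R K \<longleftrightarrow> left_module S K \<and> left_module (op_ring R) (right_mod K) \<and>
     (\<forall>s\<in>carrier S. \<forall>r\<in>carrier R. \<forall>x\<in>carrier K.
        rsmult K (s \<odot>\<^bsub>K\<^esub> x) r = s \<odot>\<^bsub>K\<^esub> rsmult K x r)"

definition lin_maps ::
    "('r, 'x) ring_scheme \<Rightarrow> ('r, 'a, 'y) module_scheme \<Rightarrow> ('r, 'b, 'z) module_scheme \<Rightarrow> ('a \<Rightarrow> 'b) set"
  where
  "lin_maps R A B = {f \<in> carrier A \<rightarrow> carrier B.
     (\<forall>x\<in>carrier A. \<forall>y\<in>carrier A. f (x \<oplus>\<^bsub>A\<^esub> y) = f x \<oplus>\<^bsub>B\<^esub> f y) \<and>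
     (\<forall>r\<in>carrier R. \<forall>x\<in>carrier A. f (r \<odot>\<^bsub>A\<^esub> x) = r \<odot>\<^bsub>B\<^esub> f x)}"

definition lin_isos ::
    "('r, 'x) ring_scheme \<Rightarrow> ('r, 'a, 'y) module_scheme \<Rightarrow> ('r, 'b, 'z) module_scheme \<Rightarrow> ('a \<Rightarrow> 'b) set"
  where
  "lin_isos R A B = {f \<in> lin_maps R A B. bij_betw f (carrier A) (carrier B)}"

text \<open>The free module with basis \<open>X\<close>: functions with finite support contained in \<open>X\<close>.\<close>

definition free_module :: "('r, 'x) ring_scheme \<Rightarrow> 'i set \<Rightarrow> ('r, 'i \<Rightarrow> 'r) module" where
  "free_module R X = \<lparr>carrier = {f. (\<forall>i\<in>X. f i \<in> carrier R) \<and> (\<forall>i. i \<notin> X \<longrightarrow> f i = \<zero>\<^bsub>R\<^esub>) \<and>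
       finite {i. f i \<noteq> \<zero>\<^bsub>R\<^esub>}},
     mult = undefined, one = undefined,
     ring.zero = (\<lambda>i. \<zero>\<^bsub>R\<^esub>), add = (\<lambda>f g i. f i \<oplus>\<^bsub>R\<^esub> g i),
     smult = (\<lambda>r f i. if i \<in> X then r \<otimes>\<^bsub>R\<^esub> f i else \<zero>\<^bsub>R\<^esub>)\<rparr>"

definition fg_free :: "('r, 'x) ring_scheme \<Rightarrow> ('r, 'a, 'y) module_scheme \<Rightarrow> bool" where
  "fg_free R M \<longleftrightarrow> (\<exists>k::nat. lin_isos R M (free_module R {..<k}) \<noteq> {})"

text \<open>Projective modules are the direct summands of free modules; the free module may be taken on
  (a subset of) the module itself.\<close>

definition projective :: "('r, 'x) ring_scheme \<Rightarrow> ('r, 'a, 'y) module_scheme \<Rightarrow> bool" where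
  "projective R P \<longleftrightarrow> left_module R P \<and>
     (\<exists>(X :: 'a set) i p. i \<in> lin_maps R P (free_module R X) \<and> p \<in> lin_maps R (free_module R X) P \<and>
        (\<forall>x\<in>carrier P. p (i x) = x))"

definition fg_projective :: "('r, 'x) ring_scheme \<Rightarrow> ('r, 'a, 'y) module_scheme \<Rightarrow> bool" where
  "fg_projective R P \<longleftrightarrow> projective R P \<and>
     (\<exists>(k::nat) p. p \<in> lin_maps R (free_module R {..<k}) P \<and>
        p ` carrier (free_module R {..<k}) = carrier P)"


section \<open>Resolutions\<close>

text \<open>For modules and maps as in \<open>\<dots> \<rightarrow> F 1 \<rightarrow> F 0 \<rightarrow> U \<rightarrow> 0\<close>, where \<open>\<delta> i\<close> goes from \<open>F (Suc i)\<close> to \<open>F i\<close>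
  and \<open>\<epsilon>\<close> from \<open>F 0\<close> to \<open>U\<close>, the \<open>i\<close>th syzygy is the kernel of the map leaving \<open>F i\<close>.\<close>

definition syzygy ::
    "(nat \<Rightarrow> ('r, 'f, 'y) module_scheme) \<Rightarrow> (nat \<Rightarrow> 'f \<Rightarrow> 'f) \<Rightarrow> ('f \<Rightarrow> 'u) \<Rightarrow> ('r, 'u, 'z) module_scheme \<Rightarrow>
     nat \<Rightarrow> 'f set" where
  "syzygy F \<delta> \<epsilon> U i = (case i of
      0 \<Rightarrow> {x \<in> carrier (F 0). \<epsilon> x = \<zero>\<^bsub>U\<^esub>}
    | Suc j \<Rightarrow> {x \<in> carrier (F i). \<delta> j x = \<zero>\<^bsub>F j\<^esub>})"

text \<open>Exactness of \<open>F n \<rightarrow> \<dots> \<rightarrow> F 0 \<rightarrow> U \<rightarrow> 0\<close>, and of the infinite sequence if \<open>n = \<infinity>\<close>. Nothing is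
  required of \<open>F i\<close> for \<open>i > n\<close>.\<close>

definition resolution ::
    "('r, 'x) ring_scheme \<Rightarrow> enat \<Rightarrow> (nat \<Rightarrow> ('r, 'f, 'y) module_scheme) \<Rightarrow> (nat \<Rightarrow> 'f \<Rightarrow> 'f) \<Rightarrow>
     ('f \<Rightarrow> 'u) \<Rightarrow> ('r, 'u, 'z) module_scheme \<Rightarrow> bool" where
  "resolution R n F \<delta> \<epsilon> U \<longleftrightarrow>
     left_module R U \<and> (\<forall>i. enat i \<le> n \<longrightarrow> left_module R (F i)) \<and>
     \<epsilon> \<in> lin_maps R (F 0) U \<and> \<epsilon> ` carrier (F 0) = carrier U \<and>
     (\<forall>i. enat (Suc i) \<le> n \<longrightarrow> \<delta> i \<in> lin_maps R (F (Suc i)) (F i) \<and>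
        \<delta> i ` carrier (F (Suc i)) = syzygy F \<delta> \<epsilon> U i)"

text \<open>Finitely generated free modules, and likewise finitely generated projective ones, are up to
  isomorphism carried by the type \<^typ>\<open>nat \<Rightarrow> 'r\<close>.\<close>

definition fin_presented :: "('r, 'x) ring_scheme \<Rightarrow> enat \<Rightarrow> ('r, 'u, 'z) module_scheme \<Rightarrow> bool" where
  "fin_presented R n U \<longleftrightarrow>
     (\<exists>(F :: nat \<Rightarrow> ('r, nat \<Rightarrow> 'r) module) \<delta> \<epsilon>. resolution R n F \<delta> \<epsilon> U \<and>
        (\<forall>i. enat i \<le> n \<longrightarrow> fg_free R (F i)))"

definition has_fg_proj_resolution :: "('r, 'x) ring_scheme \<Rightarrow> ('r, 'u, 'z) module_scheme \<Rightarrow> bool" where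
  "has_fg_proj_resolution R U \<longleftrightarrow>
     (\<exists>(F :: nat \<Rightarrow> ('r, nat \<Rightarrow> 'r) module) \<delta> \<epsilon>. resolution R \<infinity> F \<delta> \<epsilon> U \<and>
        (\<forall>i. fg_projective R (F i)))"

text \<open>The derived functors are computed from a projective resolution of the first argument. For all
  its modules to live in one type, we use a type of labels that is large enough to index a
  free resolution of any module with elements in \<open>'u\<close>: the modules of the resolution are carried
  by \<open>('r, 'u) label \<Rightarrow> 'r\<close>. Existence is shown in \<open>ex_proj_resolution\<close> below.\<close>

datatype ('r, 'u) label = Gen 'u | Syz "(('r, 'u) label \<times> 'r) list"

definition is_proj_resolution ::
    "('r, 'x) ring_scheme \<Rightarrow> ('r, 'u, 'z) module_scheme \<Rightarrow> (nat \<Rightarrow> ('r, 'f, 'y) module_scheme) \<Rightarrow>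
     (nat \<Rightarrow> 'f \<Rightarrow> 'f) \<Rightarrow> bool" where
  "is_proj_resolution R U F \<delta> \<longleftrightarrow> (\<exists>\<epsilon>. resolution R \<infinity> F \<delta> \<epsilon> U) \<and> (\<forall>i. projective R (F i))"

definition proj_resolution ::
    "('r, 'x) ring_scheme \<Rightarrow> ('r, 'u, 'z) module_scheme \<Rightarrow>
     (nat \<Rightarrow> ('r, ('r, 'u) label \<Rightarrow> 'r) module) \<times>
     (nat \<Rightarrow> (('r, 'u) label \<Rightarrow> 'r) \<Rightarrow> (('r, 'u) label \<Rightarrow> 'r))" where
  "proj_resolution R U = (SOME (F, \<delta>). is_proj_resolution R U F \<delta>)"

subsection \<open>Existence of projective resolutions\<close>

context left_module
begin

lemma smult_zero_left [simp]: "x \<in> carrier M \<Longrightarrow> \<zero> \<odot>\<^bsub>M\<^esub> x = \<zero>\<^bsub>M\<^esub>"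
  by (metis M.add.l_cancel_one' R.add.one_closed R.add.r_one smult_closed smult_l_distr)

lemma smult_zero_right [simp]: "a \<in> carrier R \<Longrightarrow> a \<odot>\<^bsub>M\<^esub> \<zero>\<^bsub>M\<^esub> = \<zero>\<^bsub>M\<^esub>"
  by (metis M.add.l_cancel_one' M.add.one_closed M.add.r_one smult_closed smult_r_distr)

lemma smult_finsum:
  assumes "finite A" "a \<in> carrier R" "f \<in> A \<rightarrow> carrier M"
  shows "a \<odot>\<^bsub>M\<^esub> finsum M f A = finsum M (\<lambda>i. a \<odot>\<^bsub>M\<^esub> f i) A"
  using assms(1,3)
proof (induction A)
  case empty
  then show ?case using assms(2) by simp
next
  case (insert x A)
  then have "f x \<in> carrier M" "f \<in> A \<rightarrow> carrier M" by auto
  moreover have "(\<lambda>i. a \<odot>\<^bsub>M\<^esub> f i) \<in> A \<rightarrow> carrier M" using insert assms(2) by auto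
  ultimately show ?case using insert assms(2) by (simp add: smult_r_distr)
qed

end

lemma left_module_free_module:
  fixes R :: "('r, 'x) ring_scheme" and X :: "'i set"
  assumes "ring R"
  shows "left_module R (free_module R X)"
proof -
  interpret R: ring R by fact
  have fin: "finite {i. f i \<oplus>\<^bsub>R\<^esub> g i \<noteq> \<zero>\<^bsub>R\<^esub>}"
    if "finite {i. f i \<noteq> \<zero>\<^bsub>R\<^esub>}" "finite {i. g i \<noteq> \<zero>\<^bsub>R\<^esub>}" for f g :: "'i \<Rightarrow> 'r"
    by (rule finite_subset[OF _ finite_UnI[OF that]]) auto
  have car: "f i \<in> carrier R" if "f \<in> carrier (free_module R X)" for f i
    using that by (cases "i \<in> X") (auto simp: free_module_def)
  have "abelian_group (free_module R X)"
  proof (rule abelian_groupI)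
    fix f assume f: "f \<in> carrier (free_module R X)"
    then have *: "\<ominus>\<^bsub>R\<^esub> f i = \<zero>\<^bsub>R\<^esub> \<longleftrightarrow> f i = \<zero>\<^bsub>R\<^esub>" for i
      using car[OF f, of i] R.minus_zero R.minus_minus by metis
    show "\<exists>g\<in>carrier (free_module R X). g \<oplus>\<^bsub>free_module R X\<^esub> f = \<zero>\<^bsub>free_module R X\<^esub>"
      using f car[OF f] * by (intro bexI[of _ "\<lambda>i. \<ominus>\<^bsub>R\<^esub> f i"])
        (auto simp: free_module_def R.l_neg)
  next
    fix f g assume "f \<in> carrier (free_module R X)" "g \<in> carrier (free_module R X)"
    then show "f \<oplus>\<^bsub>free_module R X\<^esub> g \<in> carrier (free_module R X)"
      using fin[of f g] by (auto simp: free_module_def)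
  next
    fix f g h assume "f \<in> carrier (free_module R X)" "g \<in> carrier (free_module R X)"
      "h \<in> carrier (free_module R X)"
    from this[THEN car] show "f \<oplus>\<^bsub>free_module R X\<^esub> g \<oplus>\<^bsub>free_module R X\<^esub> h =
        f \<oplus>\<^bsub>free_module R X\<^esub> (g \<oplus>\<^bsub>free_module R X\<^esub> h)"
      by (auto simp: free_module_def R.a_assoc)
  next
    fix f g assume "f \<in> carrier (free_module R X)" "g \<in> carrier (free_module R X)"
    from this[THEN car] show "f \<oplus>\<^bsub>free_module R X\<^esub> g = g \<oplus>\<^bsub>free_module R X\<^esub> f"
      by (auto simp: free_module_def R.a_comm)
  next
    fix f assume "f \<in> carrier (free_module R X)"
    from this[THEN car] show "\<zero>\<^bsub>free_module R X\<^esub> \<oplus>\<^bsub>free_module R X\<^esub> f = f"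
      by (auto simp: free_module_def)
  qed (auto simp: free_module_def)
  then interpret M: abelian_group "free_module R X" .
  have fin2: "finite {i \<in> X. a \<otimes>\<^bsub>R\<^esub> f i \<noteq> \<zero>\<^bsub>R\<^esub>}"
    if "finite {i. f i \<noteq> \<zero>\<^bsub>R\<^esub>}" "a \<in> carrier R" for f a
    by (rule finite_subset[OF _ that(1)]) (use that in auto)
  have fin3: "{i. (if i \<in> X then a \<otimes>\<^bsub>R\<^esub> f i else \<zero>\<^bsub>R\<^esub>) \<noteq> \<zero>\<^bsub>R\<^esub>} = {i \<in> X. a \<otimes>\<^bsub>R\<^esub> f i \<noteq> \<zero>\<^bsub>R\<^esub>}" for a f
    by auto
  show ?thesis
  proof
    fix a f assume "a \<in> carrier R" "f \<in> carrier (free_module R X)"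
    then show "a \<odot>\<^bsub>free_module R X\<^esub> f \<in> carrier (free_module R X)"
      by (simp add: free_module_def fin2 fin3)
  next
    fix a b f assume "a \<in> carrier R" "b \<in> carrier R" "f \<in> carrier (free_module R X)"
    then show "(a \<oplus>\<^bsub>R\<^esub> b) \<odot>\<^bsub>free_module R X\<^esub> f =
        a \<odot>\<^bsub>free_module R X\<^esub> f \<oplus>\<^bsub>free_module R X\<^esub> b \<odot>\<^bsub>free_module R X\<^esub> f"
      by (auto simp: free_module_def R.l_distr)
  next
    fix a f g assume "a \<in> carrier R" "f \<in> carrier (free_module R X)" "g \<in> carrier (free_module R X)"
    then show "a \<odot>\<^bsub>free_module R X\<^esub> (f \<oplus>\<^bsub>free_module R X\<^esub> g) =
        a \<odot>\<^bsub>free_module R X\<^esub> f \<oplus>\<^bsub>free_module R X\<^esub> a \<odot>\<^bsub>free_module R X\<^esub> g"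
      by (auto simp: free_module_def R.r_distr)
  next
    fix a b f assume "a \<in> carrier R" "b \<in> carrier R" "f \<in> carrier (free_module R X)"
    then show "(a \<otimes>\<^bsub>R\<^esub> b) \<odot>\<^bsub>free_module R X\<^esub> f =
        a \<odot>\<^bsub>free_module R X\<^esub> (b \<odot>\<^bsub>free_module R X\<^esub> f)"
      by (auto simp: free_module_def R.m_assoc)
  next
    fix f assume "f \<in> carrier (free_module R X)"
    then show "\<one>\<^bsub>R\<^esub> \<odot>\<^bsub>free_module R X\<^esub> f = f"
      by (auto simp: free_module_def)
  qed
qed

definition lin_ext ::
    "('r, 'x) ring_scheme \<Rightarrow> ('r, 'a, 'y) module_scheme \<Rightarrow> ('i \<Rightarrow> 'a) \<Rightarrow> ('i \<Rightarrow> 'r) \<Rightarrow> 'a" where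
  "lin_ext R M g f = (\<Oplus>\<^bsub>M\<^esub>i\<in>{i. f i \<noteq> \<zero>\<^bsub>R\<^esub>}. f i \<odot>\<^bsub>M\<^esub> g i)"

definition unit_vector :: "('r, 'x) ring_scheme \<Rightarrow> 'i \<Rightarrow> 'i \<Rightarrow> 'r" where
  "unit_vector R j = (\<lambda>i. if i = j then \<one>\<^bsub>R\<^esub> else \<zero>\<^bsub>R\<^esub>)"

lemma unit_vector_closed: "ring R \<Longrightarrow> j \<in> X \<Longrightarrow> unit_vector R j \<in> carrier (free_module R X)"
  using ring.ring_simprules(6)[of R] ring.ring_simprules(2)[of R]
  by (auto simp: unit_vector_def free_module_def)

lemma lin_ext_eq_finsum:
  assumes "left_module R M" "g \<in> X \<rightarrow> carrier M" "f \<in> carrier (free_module R X)"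
    "finite A" "{i. f i \<noteq> \<zero>\<^bsub>R\<^esub>} \<subseteq> A" "A \<subseteq> X"
  shows "lin_ext R M g f = (\<Oplus>\<^bsub>M\<^esub>i\<in>A. f i \<odot>\<^bsub>M\<^esub> g i)"
proof -
  interpret left_module R M by fact
  have "f i \<odot>\<^bsub>M\<^esub> g i \<in> carrier M" if "i \<in> A" for i
    using that assms by (auto simp: free_module_def intro!: smult_closed)
  moreover have "f i \<odot>\<^bsub>M\<^esub> g i = \<zero>\<^bsub>M\<^esub>" if "i \<in> A - {i. f i \<noteq> \<zero>\<^bsub>R\<^esub>}" for i
    using that assms by (auto simp: Pi_iff)
  ultimately show ?thesis
    unfolding lin_ext_def using assms(4,5)
    by (intro M.add.finprod_mono_neutral_cong_left) auto
qed

lemma lin_ext_lin_maps: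
  assumes "left_module R M" "g \<in> X \<rightarrow> carrier M"
  shows "lin_ext R M g \<in> lin_maps R (free_module R X) M"
proof -
  interpret left_module R M by fact
  interpret F: left_module R "free_module R X"
    by (rule left_module_free_module) (rule R.ring_axioms)
  have gc: "g i \<in> carrier M" if "i \<in> X" for i using assms that by auto
  have supp: "finite {i. f i \<noteq> \<zero>\<^bsub>R\<^esub>}" "{i. f i \<noteq> \<zero>\<^bsub>R\<^esub>} \<subseteq> X" "\<And>i. f i \<in> carrier R"
    if "f \<in> carrier (free_module R X)" for f
    subgoal using that by (simp add: free_module_def)
    subgoal using that by (auto simp: free_module_def)
    subgoal for i using that by (cases "i \<in> X") (auto simp: free_module_def)
    done
  show ?thesis
    unfolding lin_maps_def
  proof (intro CollectI conjI ballI)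
    show "lin_ext R M g \<in> carrier (free_module R X) \<rightarrow> carrier M"
    proof
      fix f assume f: "f \<in> carrier (free_module R X)"
      show "lin_ext R M g f \<in> carrier M"
        unfolding lin_ext_def using supp[OF f] gc by (intro M.finsum_closed) auto
    qed
  next
    fix f h assume f: "f \<in> carrier (free_module R X)" and h: "h \<in> carrier (free_module R X)"
    define A where "A = {i. f i \<noteq> \<zero>\<^bsub>R\<^esub>} \<union> {i. h i \<noteq> \<zero>\<^bsub>R\<^esub>}"
    have A: "finite A" "A \<subseteq> X" using supp[OF f] supp[OF h] by (auto simp: A_def)
    have fh: "f \<oplus>\<^bsub>free_module R X\<^esub> h = (\<lambda>i. f i \<oplus>\<^bsub>R\<^esub> h i)" by (simp add: free_module_def)
    have "lin_ext R M g (f \<oplus>\<^bsub>free_module R X\<^esub> h) =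
        (\<Oplus>\<^bsub>M\<^esub>i\<in>A. (f \<oplus>\<^bsub>free_module R X\<^esub> h) i \<odot>\<^bsub>M\<^esub> g i)"
      using f h A F.M.add.m_closed[OF f h]
      by (intro lin_ext_eq_finsum[OF assms]) (auto simp: fh A_def)
    also have "\<dots> = (\<Oplus>\<^bsub>M\<^esub>i\<in>A. f i \<odot>\<^bsub>M\<^esub> g i \<oplus>\<^bsub>M\<^esub> h i \<odot>\<^bsub>M\<^esub> g i)"
      using A supp(3)[OF f] supp(3)[OF h] gc
      by (intro M.add.finprod_cong') (auto simp: fh smult_l_distr subset_iff)
    also have "\<dots> = (\<Oplus>\<^bsub>M\<^esub>i\<in>A. f i \<odot>\<^bsub>M\<^esub> g i) \<oplus>\<^bsub>M\<^esub> (\<Oplus>\<^bsub>M\<^esub>i\<in>A. h i \<odot>\<^bsub>M\<^esub> g i)"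
      using A supp(3)[OF f] supp(3)[OF h] gc
      by (intro M.finsum_addf) (auto simp: subset_iff)
    also have "\<dots> = lin_ext R M g f \<oplus>\<^bsub>M\<^esub> lin_ext R M g h"
      using lin_ext_eq_finsum[OF assms f A(1) _ A(2)] lin_ext_eq_finsum[OF assms h A(1) _ A(2)]
      by (simp add: A_def)
    finally show "lin_ext R M g (f \<oplus>\<^bsub>free_module R X\<^esub> h) =
      lin_ext R M g f \<oplus>\<^bsub>M\<^esub> lin_ext R M g h" .
  next
    fix r f assume r: "r \<in> carrier R" and f: "f \<in> carrier (free_module R X)"
    let ?A = "{i. f i \<noteq> \<zero>\<^bsub>R\<^esub>}"
    have sub: "{i. (r \<odot>\<^bsub>free_module R X\<^esub> f) i \<noteq> \<zero>\<^bsub>R\<^esub>} \<subseteq> ?A"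
      using r by (auto simp: free_module_def)
    have "lin_ext R M g (r \<odot>\<^bsub>free_module R X\<^esub> f) =
        (\<Oplus>\<^bsub>M\<^esub>i\<in>?A. (r \<odot>\<^bsub>free_module R X\<^esub> f) i \<odot>\<^bsub>M\<^esub> g i)"
      by (rule lin_ext_eq_finsum[OF assms F.smult_closed[OF r f] supp(1)[OF f] sub supp(2)[OF f]])
    also have "\<dots> = (\<Oplus>\<^bsub>M\<^esub>i\<in>?A. r \<odot>\<^bsub>M\<^esub> (f i \<odot>\<^bsub>M\<^esub> g i))"
      using supp[OF f] gc r
      by (intro M.add.finprod_cong') (auto simp: free_module_def smult_assoc1 subset_iff)
    also have "\<dots> = r \<odot>\<^bsub>M\<^esub> lin_ext R M g f"
      unfolding lin_ext_def using supp[OF f] gc r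
      by (intro smult_finsum[symmetric]) (auto simp: subset_iff)
    finally show "lin_ext R M g (r \<odot>\<^bsub>free_module R X\<^esub> f) = r \<odot>\<^bsub>M\<^esub> lin_ext R M g f" .
  qed
qed

lemma lin_ext_zero:
  assumes "left_module R M"
  shows "lin_ext R M g \<zero>\<^bsub>free_module R X\<^esub> = \<zero>\<^bsub>M\<^esub>"
proof -
  interpret left_module R M by fact
  have "{i. \<zero>\<^bsub>free_module R X\<^esub> i \<noteq> \<zero>\<^bsub>R\<^esub>} = {}" by (simp add: free_module_def)
  then show ?thesis by (simp add: lin_ext_def)
qed

lemma lin_ext_unit_vector:
  assumes "left_module R M" "g \<in> X \<rightarrow> carrier M" "j \<in> X"
  shows "lin_ext R M g (unit_vector R j) = g j"
proof -
  interpret left_module R M by fact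
  have g: "g j \<in> carrier M" using assms by auto
  have "lin_ext R M g (unit_vector R j) = (\<Oplus>\<^bsub>M\<^esub>i\<in>{j}. unit_vector R j i \<odot>\<^bsub>M\<^esub> g i)"
    using assms R.ring_axioms
    by (intro lin_ext_eq_finsum[OF assms(1,2)] unit_vector_closed) (auto simp: unit_vector_def)
  also have "\<dots> = g j" using g by (simp add: unit_vector_def)
  finally show ?thesis .
qed

lemma lin_ext_unit_vectors:
  assumes "ring R" "f \<in> carrier (free_module R X)"
  shows "lin_ext R (free_module R X) (unit_vector R) f = f"
proof
  fix j
  interpret F: left_module R "free_module R X" by (rule left_module_free_module) fact
  let ?F = "free_module R X"
  have f: "f i \<in> carrier R" for i using assms by (cases "i \<in> X") (auto simp: free_module_def)
  have ev: "finsum ?F h A j = (\<Oplus>\<^bsub>R\<^esub>i\<in>A. h i j)" if "finite A" "h \<in> A \<rightarrow> carrier ?F" for h A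
    using that
  proof (induction A)
    case empty
    have "\<zero>\<^bsub>?F\<^esub> j = \<zero>\<^bsub>R\<^esub>" by (simp add: free_module_def)
    then show ?case by simp
  next
    case (insert x A)
    then have *: "h x \<in> carrier ?F" "h \<in> A \<rightarrow> carrier ?F" by auto
    have "g j \<in> carrier R" if "g \<in> carrier ?F" for g
      using that by (cases "j \<in> X") (auto simp: free_module_def)
    with * have "h x j \<in> carrier R" "(\<lambda>i. h i j) \<in> A \<rightarrow> carrier R" by auto
    moreover have "(u \<oplus>\<^bsub>?F\<^esub> v) j = u j \<oplus>\<^bsub>R\<^esub> v j" for u v by (simp add: free_module_def)
    ultimately show ?case using insert * by simp
  qed
  let ?A = "{i. f i \<noteq> \<zero>\<^bsub>R\<^esub>}"
  have A: "finite ?A" "?A \<subseteq> X" using assms by (auto simp: free_module_def)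
  have "lin_ext R ?F (unit_vector R) f j = (\<Oplus>\<^bsub>R\<^esub>i\<in>?A. (f i \<odot>\<^bsub>?F\<^esub> unit_vector R i) j)"
    unfolding lin_ext_def using A f
    by (intro ev) (auto intro!: F.smult_closed unit_vector_closed[OF assms(1)])
  also have "\<dots> = (\<Oplus>\<^bsub>R\<^esub>i\<in>?A. if j = i then f i else \<zero>\<^bsub>R\<^esub>)"
    using A f by (intro F.R.add.finprod_cong') (auto simp: free_module_def unit_vector_def)
  also have "\<dots> = f j"
  proof (cases "j \<in> ?A")
    case True
    then show ?thesis using A f F.R.finsum_singleton[OF True A(1), of f] by simp
  next
    case False
    then have "(\<Oplus>\<^bsub>R\<^esub>i\<in>?A. if j = i then f i else \<zero>\<^bsub>R\<^esub>) = (\<Oplus>\<^bsub>R\<^esub>i\<in>?A. \<zero>\<^bsub>R\<^esub>)"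
      by (intro F.R.add.finprod_cong') auto
    then show ?thesis using False by simp
  qed
  finally show "lin_ext R ?F (unit_vector R) f j = f j" .
qed

lemma projective_free_module:
  assumes "ring R"
  shows "projective R (free_module R X)"
proof -
  let ?F = "free_module R X"
  let ?G = "free_module R (carrier ?F)"
  have F: "left_module R ?F" and G: "left_module R ?G" using assms by (auto intro: left_module_free_module)
  let ?g = "\<lambda>j. unit_vector R (unit_vector R j)"
  have g: "?g \<in> X \<rightarrow> carrier ?G" using assms by (auto intro!: unit_vector_closed)
  have id: "(\<lambda>x. x) \<in> carrier ?F \<rightarrow> carrier ?F" by auto
  let ?i = "lin_ext R ?G ?g" and ?p = "lin_ext R ?F (\<lambda>x. x)"
  have i: "?i \<in> lin_maps R ?F ?G" by (rule lin_ext_lin_maps[OF G g])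
  have p: "?p \<in> lin_maps R ?G ?F" by (rule lin_ext_lin_maps[OF F id])
  have "?p (?i f) = f" if f: "f \<in> carrier ?F" for f
  proof -
    interpret F: left_module R ?F by fact
    interpret G: left_module R ?G by fact
    let ?A = "{i. f i \<noteq> \<zero>\<^bsub>R\<^esub>}"
    have A: "finite ?A" "?A \<subseteq> X" using f by (auto simp: free_module_def)
    have fc: "f i \<in> carrier R" for i using f by (cases "i \<in> X") (auto simp: free_module_def)
    have add: "?p (x \<oplus>\<^bsub>?G\<^esub> y) = ?p x \<oplus>\<^bsub>?F\<^esub> ?p y" if "x \<in> carrier ?G" "y \<in> carrier ?G" for x y
      using p that unfolding lin_maps_def by blast
    have sm: "?p (r \<odot>\<^bsub>?G\<^esub> x) = r \<odot>\<^bsub>?F\<^esub> ?p x" if "r \<in> carrier R" "x \<in> carrier ?G" for r x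
      using p that unfolding lin_maps_def by blast
    have pc: "?p x \<in> carrier ?F" if "x \<in> carrier ?G" for x
      using p that unfolding lin_maps_def by blast
    have zero: "?p \<zero>\<^bsub>?G\<^esub> = \<zero>\<^bsub>?F\<^esub>" by (simp add: lin_ext_def free_module_def[of R "carrier ?F"])
    have "?p (finsum ?G h B) = (\<Oplus>\<^bsub>?F\<^esub>i\<in>B. ?p (h i))" if "finite B" "h \<in> B \<rightarrow> carrier ?G" for h B
      using that
    proof (induction B)
      case empty
      then show ?case by (simp add: zero)
    next
      case (insert x B)
      then have *: "h x \<in> carrier ?G" "h \<in> B \<rightarrow> carrier ?G" by auto
      then have "?p (h x) \<in> carrier ?F" "(\<lambda>i. ?p (h i)) \<in> B \<rightarrow> carrier ?F" using pc by auto
      with insert * show ?case by (simp add: add)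
    qed
    moreover have "(\<lambda>i. f i \<odot>\<^bsub>?G\<^esub> ?g i) \<in> ?A \<rightarrow> carrier ?G"
      using A(2) fc g by (auto intro!: G.smult_closed)
    ultimately have "?p (?i f) = (\<Oplus>\<^bsub>?F\<^esub>i\<in>?A. ?p (f i \<odot>\<^bsub>?G\<^esub> ?g i))"
      unfolding lin_ext_def[of R ?G] using A(1) by blast
    also have "\<dots> = (\<Oplus>\<^bsub>?F\<^esub>i\<in>?A. f i \<odot>\<^bsub>?F\<^esub> unit_vector R i)"
    proof (rule F.M.add.finprod_cong')
      show "(\<lambda>i. f i \<odot>\<^bsub>?F\<^esub> unit_vector R i) \<in> ?A \<rightarrow> carrier ?F"
        using A fc by (auto intro!: F.smult_closed unit_vector_closed[OF assms])
      fix i assume "i \<in> ?A"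
      then have "i \<in> X" using A by auto
      then have "?g i \<in> carrier ?G" "unit_vector R i \<in> carrier ?F"
        using g unit_vector_closed[OF assms] by auto
      then show "?p (f i \<odot>\<^bsub>?G\<^esub> ?g i) = f i \<odot>\<^bsub>?F\<^esub> unit_vector R i"
        using sm fc lin_ext_unit_vector[OF F id] by simp
    qed simp
    also have "\<dots> = f" using lin_ext_unit_vectors[OF assms f] by (simp add: lin_ext_def)
    finally show ?thesis .
  qed
  with i p F show ?thesis unfolding projective_def by blast
qed

primrec label_value :: "('r, 'x) ring_scheme \<Rightarrow> ('r, 'u) label \<Rightarrow> ('r, 'u) label \<Rightarrow> 'r" where
  "label_value R (Gen u) = (\<lambda>_. \<zero>\<^bsub>R\<^esub>)"
| "label_value R (Syz xs) = (\<lambda>i. case map_of xs i of None \<Rightarrow> \<zero>\<^bsub>R\<^esub> | Some r \<Rightarrow> r)"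

text \<open>The basis of the \<open>i\<close>th module of the standard free resolution and its \<open>i\<close>th syzygy. The kernel
  elements themselves, coded as lists of coefficients, label the next basis.\<close>

primrec std_basis ::
    "('r, 'x) ring_scheme \<Rightarrow> ('r, 'u, 'z) module_scheme \<Rightarrow> nat \<Rightarrow>
     ('r, 'u) label set \<times> (('r, 'u) label \<Rightarrow> 'r) set" where
  "std_basis R U 0 = (Gen ` carrier U,
     {f \<in> carrier (free_module R (Gen ` carrier U)).
        lin_ext R U (\<lambda>l. case l of Gen u \<Rightarrow> u | Syz _ \<Rightarrow> \<zero>\<^bsub>U\<^esub>) f = \<zero>\<^bsub>U\<^esub>})"
| "std_basis R U (Suc i) =
     (let B = {l. (\<exists>xs. l = Syz xs) \<and> label_value R l \<in> snd (std_basis R U i)};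
          F = free_module R (fst (std_basis R U i)) in
      (B, {f \<in> carrier (free_module R B). lin_ext R F (label_value R) f = \<zero>\<^bsub>F\<^esub>}))"

theorem ex_proj_resolution:
  fixes R :: "('r, 'x) ring_scheme" and U :: "('r, 'u, 'z) module_scheme"
  assumes "left_module R U"
  shows "\<exists>(F :: nat \<Rightarrow> ('r, ('r, 'u) label \<Rightarrow> 'r) module) \<delta>. is_proj_resolution R U F \<delta>"
proof -
  interpret U: left_module R U by fact
  note ringR = U.R.ring_axioms
  define B where "B i = fst (std_basis R U i)" for i
  define Z where "Z i = snd (std_basis R U i)" for i
  define F where "F i = free_module R (B i)" for i
  define e where "e = (\<lambda>l. case l of Gen u \<Rightarrow> u | Syz (_ :: (('r, 'u) label \<times> 'r) list) \<Rightarrow> \<zero>\<^bsub>U\<^esub>)"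
  define \<epsilon> where "\<epsilon> = lin_ext R U e"
  define \<delta> where "\<delta> i = lin_ext R (F i) (label_value R)" for i
  have F: "left_module R (F i)" for i by (simp add: F_def left_module_free_module ringR)
  have B0: "B 0 = Gen ` carrier U" by (simp add: B_def)
  have e: "e \<in> B 0 \<rightarrow> carrier U" by (auto simp: B0 e_def)
  have \<epsilon>: "\<epsilon> \<in> lin_maps R (F 0) U"
    unfolding \<epsilon>_def F_def by (rule lin_ext_lin_maps[OF assms e])
  have surj: "\<epsilon> ` carrier (F 0) = carrier U"
  proof
    show "\<epsilon> ` carrier (F 0) \<subseteq> carrier U" using \<epsilon> by (auto simp: lin_maps_def)
    show "carrier U \<subseteq> \<epsilon> ` carrier (F 0)"
    proof
      fix u assume u: "u \<in> carrier U"
      then have G: "Gen u \<in> B 0" by (simp add: B0)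
      have "\<epsilon> (unit_vector R (Gen u)) = u"
        unfolding \<epsilon>_def by (subst lin_ext_unit_vector[OF assms e G]) (simp add: e_def)
      moreover have "unit_vector R (Gen u) \<in> carrier (F 0)"
        unfolding F_def by (rule unit_vector_closed[OF ringR G])
      ultimately show "u \<in> \<epsilon> ` carrier (F 0)" by force
    qed
  qed
  have BS: "B (Suc i) = {l. (\<exists>xs. l = Syz xs) \<and> label_value R l \<in> Z i}" for i
    by (simp add: B_def Z_def Let_def)
  have Z: "Z i = syzygy F \<delta> \<epsilon> U i" for i
  proof (cases i)
    case 0
    then show ?thesis
      by (simp add: Z_def syzygy_def F_def B_def \<epsilon>_def e_def)
  next
    case (Suc j)
    have "Z (Suc j) = {f \<in> carrier (free_module R (B (Suc j))).
        lin_ext R (F j) (label_value R) f = \<zero>\<^bsub>F j\<^esub>}"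
      by (simp add: Z_def F_def B_def Let_def)
    then show ?thesis using Suc by (simp add: syzygy_def \<delta>_def F_def)
  qed
  have Zsub: "Z i \<subseteq> carrier (F i)" for i by (auto simp: Z syzygy_def split: nat.splits)
  have lv: "label_value R \<in> B (Suc i) \<rightarrow> carrier (F i)" for i
    using Zsub by (auto simp: BS)
  have \<delta>: "\<delta> i \<in> lin_maps R (F (Suc i)) (F i)" for i
    unfolding \<delta>_def F_def[of "Suc i"] by (rule lin_ext_lin_maps[OF F lv])
  have kerclosed: "finsum (F i) (\<lambda>x. f x \<odot>\<^bsub>F i\<^esub> g x) A \<in> Z i"
    if "finite A" "\<forall>x\<in>A. f x \<in> carrier R \<and> g x \<in> Z i" for i A
      and f :: "('r, 'u) label \<Rightarrow> 'r" and g
  proof -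
    interpret Fi: left_module R "F i" by (rule F)
    have z0: "\<zero>\<^bsub>F i\<^esub> \<in> Z i"
    proof (cases i)
      case 0
      have "\<epsilon> \<zero>\<^bsub>F 0\<^esub> = \<zero>\<^bsub>U\<^esub>" unfolding \<epsilon>_def F_def by (rule lin_ext_zero[OF assms])
      then show ?thesis using Fi.M.zero_closed by (simp add: Z syzygy_def 0)
    next
      case (Suc j)
      have "\<delta> j \<zero>\<^bsub>F (Suc j)\<^esub> = \<zero>\<^bsub>F j\<^esub>"
        unfolding \<delta>_def F_def[of "Suc j"] by (rule lin_ext_zero[OF F])
      then show ?thesis using Fi.M.zero_closed by (simp add: Z syzygy_def Suc)
    qed
    have step: "a \<odot>\<^bsub>F i\<^esub> x \<oplus>\<^bsub>F i\<^esub> y \<in> Z i" if a: "a \<in> carrier R" and x: "x \<in> Z i" and y: "y \<in> Z i"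
      for a x y
    proof -
      have xy: "x \<in> carrier (F i)" "y \<in> carrier (F i)" using x y Zsub by auto
      then have cl: "a \<odot>\<^bsub>F i\<^esub> x \<in> carrier (F i)" "a \<odot>\<^bsub>F i\<^esub> x \<oplus>\<^bsub>F i\<^esub> y \<in> carrier (F i)"
        using a by auto
      show ?thesis
      proof (cases i)
        case 0
        have "\<epsilon> (a \<odot>\<^bsub>F i\<^esub> x \<oplus>\<^bsub>F i\<^esub> y) = a \<odot>\<^bsub>U\<^esub> \<epsilon> x \<oplus>\<^bsub>U\<^esub> \<epsilon> y"
          using \<epsilon> a xy Fi.smult_closed unfolding lin_maps_def 0 by simp
        then show ?thesis using a x y cl by (simp add: Z syzygy_def 0)
      next
        case (Suc j)
        interpret Fj: left_module R "F j" by (rule F)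
        have "\<delta> j (a \<odot>\<^bsub>F i\<^esub> x \<oplus>\<^bsub>F i\<^esub> y) = a \<odot>\<^bsub>F j\<^esub> \<delta> j x \<oplus>\<^bsub>F j\<^esub> \<delta> j y"
          using \<delta>[of j] a xy Fi.smult_closed unfolding lin_maps_def Suc by simp
        then show ?thesis using a x y cl by (simp add: Z syzygy_def Suc)
      qed
    qed
    show ?thesis
      using that
    proof (induction A)
      case empty
      then show ?case by (simp add: z0)
    next
      case (insert x A)
      have "(\<lambda>x. f x \<odot>\<^bsub>F i\<^esub> g x) \<in> A \<rightarrow> carrier (F i)" "f x \<odot>\<^bsub>F i\<^esub> g x \<in> carrier (F i)"
        using insert.prems Zsub by (auto intro!: Fi.smult_closed)
      then show ?case using insert step by simp
    qed
  qed
  have exact: "\<delta> i ` carrier (F (Suc i)) = Z i" for i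
  proof
    show "\<delta> i ` carrier (F (Suc i)) \<subseteq> Z i"
    proof
      fix y assume "y \<in> \<delta> i ` carrier (F (Suc i))"
      then obtain f where f: "f \<in> carrier (F (Suc i))" and y: "y = \<delta> i f" by auto
      let ?A = "{l. f l \<noteq> \<zero>\<^bsub>R\<^esub>}"
      have "finite ?A" "\<forall>l\<in>?A. l \<in> B (Suc i) \<and> f l \<in> carrier R"
        using f by (auto simp: F_def free_module_def)
      then show "y \<in> Z i"
        unfolding y \<delta>_def lin_ext_def by (intro kerclosed) (auto simp: BS)
    qed
    show "Z i \<subseteq> \<delta> i ` carrier (F (Suc i))"
    proof
      fix f assume f: "f \<in> Z i"
      then have "finite {l. f l \<noteq> \<zero>\<^bsub>R\<^esub>}" using Zsub[of i] by (auto simp: F_def free_module_def)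
      then obtain ls where ls: "set ls = {l. f l \<noteq> \<zero>\<^bsub>R\<^esub>}" using finite_list by blast
      have v: "label_value R (Syz (map (\<lambda>l. (l, f l)) ls)) = f"
      proof
        fix l
        show "label_value R (Syz (map (\<lambda>l. (l, f l)) ls)) l = f l"
          using ls by (cases "l \<in> set ls")
            (auto simp: map_of_map_restrict restrict_map_def split: option.splits)
      qed
      let ?l = "Syz (map (\<lambda>l. (l, f l)) ls)"
      have l: "?l \<in> B (Suc i)" using f by (simp add: BS v del: label_value.simps)
      have "\<delta> i (unit_vector R ?l) = f"
        unfolding \<delta>_def by (subst lin_ext_unit_vector[OF F lv l]) (rule v)
      moreover have "unit_vector R ?l \<in> carrier (F (Suc i))"
        unfolding F_def by (rule unit_vector_closed[OF ringR l])
      ultimately show "f \<in> \<delta> i ` carrier (F (Suc i))" by (metis imageI)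
    qed
  qed
  have "resolution R \<infinity> F \<delta> \<epsilon> U"
    unfolding resolution_def using assms F \<epsilon> surj \<delta> exact Z by simp
  moreover have "projective R (F i)" for i
    unfolding F_def by (rule projective_free_module[OF ringR])
  ultimately show ?thesis unfolding is_proj_resolution_def by blast
qed

corollary is_proj_resolution_proj_resolution:
  assumes "left_module R U"
  shows "is_proj_resolution R U (fst (proj_resolution R U)) (snd (proj_resolution R U))"
  using someI_ex[of "\<lambda>p. is_proj_resolution R U (fst p) (snd p)"] ex_proj_resolution[OF assms]
  unfolding proj_resolution_def case_prod_unfold by auto


section \<open>Hom and Ext\<close>

definition hom_group ::
    "('r, 'x) ring_scheme \<Rightarrow> ('r, 'a, 'y) module_scheme \<Rightarrow> ('r, 'b, 'z) module_scheme \<Rightarrow> ('a \<Rightarrow> 'b) ring"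
  where
  "hom_group R A B = \<lparr>carrier = lin_maps R A B \<inter> extensional (carrier A),
     mult = undefined, one = undefined,
     ring.zero = (\<lambda>x\<in>carrier A. \<zero>\<^bsub>B\<^esub>), add = (\<lambda>f g. \<lambda>x\<in>carrier A. f x \<oplus>\<^bsub>B\<^esub> g x)\<rparr>"

text \<open>For an \<open>(S,R)\<close>-bimodule \<open>K\<close> and a left \<open>S\<close>-module \<open>N\<close>, the group \<open>Hom\<^sub>S(K,N)\<close> is a left
  \<open>R\<close>-module by \<open>(r f)(k) = f(k r)\<close>.\<close>

definition hom_module ::
    "('s, 'y) ring_scheme \<Rightarrow> ('s, 'r, 'k) bimodule \<Rightarrow> ('s, 'b, 'z) module_scheme \<Rightarrow> ('r, 'k \<Rightarrow> 'b) module"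
  where
  "hom_module S K N = \<lparr>carrier = carrier (hom_group S K N), mult = undefined, one = undefined,
     ring.zero = ring.zero (hom_group S K N), add = add (hom_group S K N),
     smult = (\<lambda>r f. \<lambda>k\<in>carrier K. f (rsmult K k r))\<rparr>"

text \<open>The \<open>i\<close>th cohomology group of \<open>Hom\<^sub>R(F,M)\<close>, where \<open>F\<close> is a projective resolution of \<open>U\<close>.\<close>

definition Ext ::
    "('r, 'x) ring_scheme \<Rightarrow> nat \<Rightarrow> ('r, 'u, 'y) module_scheme \<Rightarrow> ('r, 'm, 'z) module_scheme \<Rightarrow>
     ((('r, 'u) label \<Rightarrow> 'r) \<Rightarrow> 'm) set monoid" where
  "Ext R i U M = (let (F, \<delta>) = proj_resolution R U;
      H = (\<lambda>j. hom_group R (F j) M);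
      b = (\<lambda>j f. compose (carrier (F (Suc j))) f (\<delta> j));
      cocycles = {f \<in> carrier (H i). b i f = \<zero>\<^bsub>H (Suc i)\<^esub>};
      coboundaries = (case i of 0 \<Rightarrow> {\<zero>\<^bsub>H 0\<^esub>} | Suc j \<Rightarrow> b j ` carrier (H j))
    in (H i)\<lparr>carrier := cocycles\<rparr> A_Mod coboundaries)"


section \<open>Tensor products and Tor\<close>

text \<open>A right \<open>R\<close>-module \<open>A\<close> is given as a left module over the opposite ring, so \<open>r \<odot>\<^bsub>A\<^esub> a\<close> stands for
  \<open>a r\<close>. The tensor product is the free abelian group on pairs modulo the usual relations; in
  \<^const>\<open>free_Abelian_group\<close> the group operation is addition of formal sums.\<close>

definition tensor_relations ::
    "('r, 'x) ring_scheme \<Rightarrow> ('r, 'a, 'y) module_scheme \<Rightarrow> ('r, 'b, 'z) module_scheme \<Rightarrow>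
     ('a \<times> 'b \<Rightarrow>\<^sub>0 int) set" where
  "tensor_relations R A B = generate (free_Abelian_group (carrier A \<times> carrier B))
     ({frag_of (a \<oplus>\<^bsub>A\<^esub> a', b) - frag_of (a, b) - frag_of (a', b) | a a' b.
         a \<in> carrier A \<and> a' \<in> carrier A \<and> b \<in> carrier B} \<union>
      {frag_of (a, b \<oplus>\<^bsub>B\<^esub> b') - frag_of (a, b) - frag_of (a, b') | a b b'.
         a \<in> carrier A \<and> b \<in> carrier B \<and> b' \<in> carrier B} \<union>
      {frag_of (r \<odot>\<^bsub>A\<^esub> a, b) - frag_of (a, r \<odot>\<^bsub>B\<^esub> b) | a b r.
         a \<in> carrier A \<and> b \<in> carrier B \<and> r \<in> carrier R})"

definition tensor_class ::
    "('r, 'x) ring_scheme \<Rightarrow> ('r, 'a, 'y) module_scheme \<Rightarrow> ('r, 'b, 'z) module_scheme \<Rightarrow>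
     ('a \<times> 'b \<Rightarrow>\<^sub>0 int) \<Rightarrow> ('a \<times> 'b \<Rightarrow>\<^sub>0 int) set" where
  "tensor_class R A B x =
     tensor_relations R A B #>\<^bsub>free_Abelian_group (carrier A \<times> carrier B)\<^esub> x"

definition tensor_group ::
    "('r, 'x) ring_scheme \<Rightarrow> ('r, 'a, 'y) module_scheme \<Rightarrow> ('r, 'b, 'z) module_scheme \<Rightarrow>
     ('a \<times> 'b \<Rightarrow>\<^sub>0 int) set ring" where
  "tensor_group R A B =
     (let Q = free_Abelian_group (carrier A \<times> carrier B) Mod tensor_relations R A B in
      \<lparr>carrier = carrier Q, mult = undefined, one = undefined, ring.zero = one Q, add = mult Q\<rparr>)"

text \<open>The map \<open>f \<otimes> g : A \<otimes>\<^sub>R B \<rightarrow> A' \<otimes>\<^sub>R B'\<close>; the union is over the representatives of a class, all of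
  which yield the same class.\<close>

definition tensor_map ::
    "('r, 'x) ring_scheme \<Rightarrow> ('r, 'c, 'y) module_scheme \<Rightarrow> ('r, 'e, 'z) module_scheme \<Rightarrow>
     ('a \<Rightarrow> 'c) \<Rightarrow> ('b \<Rightarrow> 'e) \<Rightarrow> ('a \<times> 'b \<Rightarrow>\<^sub>0 int) set \<Rightarrow> ('c \<times> 'e \<Rightarrow>\<^sub>0 int) set" where
  "tensor_map R A' B' f g X =
     (\<Union>x\<in>X. tensor_class R A' B' (frag_extend (\<lambda>(a, b). frag_of (f a, g b)) x))"

definition tensor_module ::
    "('r, 'x) ring_scheme \<Rightarrow> ('s, 'r, 'k) bimodule \<Rightarrow> ('r, 'b, 'z) module_scheme \<Rightarrow>
     ('s, ('k \<times> 'b \<Rightarrow>\<^sub>0 int) set) module" where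
  "tensor_module R K M = (let T = tensor_group R (right_mod K) M in
     \<lparr>carrier = carrier T, mult = undefined, one = undefined, ring.zero = ring.zero T, add = add T,
      smult = (\<lambda>s. tensor_map R (right_mod K) M (\<lambda>k. s \<odot>\<^bsub>K\<^esub> k) (\<lambda>m. m))\<rparr>)"

text \<open>The \<open>i\<close>th homology group of \<open>F \<otimes>\<^sub>R N\<close>, where \<open>F\<close> is a projective resolution of the right
  \<open>R\<close>-module \<open>U\<close>.\<close>

definition Tor ::
    "('r, 'x) ring_scheme \<Rightarrow> nat \<Rightarrow> ('r, 'u, 'y) module_scheme \<Rightarrow> ('r, 'n, 'z) module_scheme \<Rightarrow>
     ((('r, 'u) label \<Rightarrow> 'r) \<times> 'n \<Rightarrow>\<^sub>0 int) set set monoid" where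
  "Tor R i U N = (let (F, \<delta>) = proj_resolution (op_ring R) U;
      T = (\<lambda>j. tensor_group R (F j) N);
      D = (\<lambda>j. tensor_map R (F j) N (\<delta> j) (\<lambda>y. y));
      cycles = (case i of 0 \<Rightarrow> carrier (T 0)
                        | Suc j \<Rightarrow> {x \<in> carrier (T i). D j x = \<zero>\<^bsub>T j\<^esub>});
      boundaries = D i ` carrier (T (Suc i))
    in (T i)\<lparr>carrier := cycles\<rparr> A_Mod boundaries)"


section \<open>\<open>(n,d)\<close>-injective and \<open>(n,d)\<close>-flat modules\<close>

text \<open>Up to isomorphism, the finitely generated modules are the quotients of the modules \<open>R\<^sup>k\<close>; so the
  type \<^typ>\<open>(nat \<Rightarrow> 'r) set\<close> of cosets suffices for the test modules \<open>U\<close>.\<close>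

definition nd_injective :: "('s, 'y) ring_scheme \<Rightarrow> enat \<Rightarrow> nat \<Rightarrow> ('s, 'm) module set" where
  "nd_injective S n d = {M. left_module S M \<and>
     (\<forall>U :: ('s, (nat \<Rightarrow> 's) set) module. fin_presented S n U \<longrightarrow> trivial_group (Ext S (d + 1) U M))}"

definition nd_flat :: "('r, 'x) ring_scheme \<Rightarrow> enat \<Rightarrow> nat \<Rightarrow> ('r, 'm) module set" where
  "nd_flat R n d = {N. left_module R N \<and>
     (\<forall>U :: ('r, (nat \<Rightarrow> 'r) set) module. fin_presented (op_ring R) n U \<longrightarrow>
        trivial_group (Tor R (d + 1) U N))}"


section \<open>Semidualizing bimodules, Auslander and Bass classes\<close>

text \<open>The homothety maps are ring homomorphisms (to the endomorphism ring or its opposite), so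
  being an isomorphism amounts to bijectivity.\<close>

definition semidualizing ::
    "('s, 'y) ring_scheme \<Rightarrow> ('r, 'x) ring_scheme \<Rightarrow> ('s, 'r, 'k) bimodule \<Rightarrow> bool" where
  "semidualizing S R K \<longleftrightarrow> is_bimodule S R K \<and>
     has_fg_proj_resolution S K \<and> has_fg_proj_resolution (op_ring R) (right_mod K) \<and>
     bij_betw (\<lambda>s. \<lambda>k\<in>carrier K. s \<odot>\<^bsub>K\<^esub> k)
       (carrier S) (carrier (hom_group (op_ring R) (right_mod K) (right_mod K))) \<and>
     bij_betw (\<lambda>r. \<lambda>k\<in>carrier K. rsmult K k r) (carrier R) (carrier (hom_group S K K)) \<and>
     (\<forall>i\<ge>1. trivial_group (Ext S i K K)) \<and>
     (\<forall>i\<ge>1. trivial_group (Ext (op_ring R) i (right_mod K) (right_mod K)))"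

text \<open>A resolution witnessing that the bimodule \<open>C\<close> is super finitely presented.\<close>

definition super_fp_resolution ::
    "('s, 'y) ring_scheme \<Rightarrow> ('r, 'x) ring_scheme \<Rightarrow> (nat \<Rightarrow> ('s, 'r, 'f) bimodule) \<Rightarrow>
     (nat \<Rightarrow> 'f \<Rightarrow> 'f) \<Rightarrow> ('f \<Rightarrow> 'c) \<Rightarrow> ('s, 'r, 'c) bimodule \<Rightarrow> bool" where
  "super_fp_resolution S R F \<delta> \<epsilon> C \<longleftrightarrow>
     is_bimodule S R C \<and> (\<forall>i. is_bimodule S R (F i)) \<and>
     resolution S \<infinity> F \<delta> \<epsilon> C \<and> resolution (op_ring R) \<infinity> (\<lambda>i. right_mod (F i)) \<delta> \<epsilon> (right_mod C) \<and>
     (\<forall>i. fg_free S (F i) \<and> fg_free (op_ring R) (right_mod (F i)))"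

definition syzygy_bimodule ::
    "(nat \<Rightarrow> ('s, 'r, 'f) bimodule) \<Rightarrow> (nat \<Rightarrow> 'f \<Rightarrow> 'f) \<Rightarrow> ('f \<Rightarrow> 'c) \<Rightarrow> ('s, 'r, 'c) bimodule \<Rightarrow> nat \<Rightarrow>
     ('s, 'r, 'f) bimodule" where
  "syzygy_bimodule F \<delta> \<epsilon> C i = (F i)\<lparr>carrier := syzygy F \<delta> \<epsilon> C i\<rparr>"

definition special_semidualizing ::
    "('s, 'y) ring_scheme \<Rightarrow> ('r, 'x) ring_scheme \<Rightarrow> nat \<Rightarrow> (nat \<Rightarrow> ('s, 'r, 'f) bimodule) \<Rightarrow>
     (nat \<Rightarrow> 'f \<Rightarrow> 'f) \<Rightarrow> ('f \<Rightarrow> 'c) \<Rightarrow> ('s, 'r, 'c) bimodule \<Rightarrow> ('s, 'r, 'f) bimodule \<Rightarrow> bool" where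
  "special_semidualizing S R d F \<delta> \<epsilon> C K \<longleftrightarrow>
     super_fp_resolution S R F \<delta> \<epsilon> C \<and> K = syzygy_bimodule F \<delta> \<epsilon> C (d - 1) \<and> semidualizing S R K"

definition auslander_unit ::
    "('r, 'x) ring_scheme \<Rightarrow> ('s, 'r, 'k) bimodule \<Rightarrow> ('r, 'm, 'z) module_scheme \<Rightarrow>
     'm \<Rightarrow> 'k \<Rightarrow> ('k \<times> 'm \<Rightarrow>\<^sub>0 int) set" where
  "auslander_unit R K M m = (\<lambda>k\<in>carrier K. tensor_class R (right_mod K) M (frag_of (k, m)))"

text \<open>The evaluation \<open>k \<otimes> f \<mapsto> f k\<close>, computed on any representative of a class of formal sums.\<close>

definition bass_counit ::
    "('s, 'r, 'k) bimodule \<Rightarrow> ('s, 'n, 'z) module_scheme \<Rightarrow> ('k \<times> ('k \<Rightarrow> 'n) \<Rightarrow>\<^sub>0 int) set \<Rightarrow> 'n" where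
  "bass_counit K N X = the_elem ((\<lambda>x.
     \<Oplus>\<^bsub>N\<^esub>p\<in>Poly_Mapping.keys x. [Poly_Mapping.lookup x p] \<cdot>\<^bsub>N\<^esub> (snd p) (fst p)) ` X)"

definition auslander_class ::
    "('s, 'y) ring_scheme \<Rightarrow> ('r, 'x) ring_scheme \<Rightarrow> ('s, 'r, 'k) bimodule \<Rightarrow> ('r, 'm) module set" where
  "auslander_class S R K = {M. left_module R M \<and>
     (\<forall>i\<ge>1. trivial_group (Tor R i (right_mod K) M)) \<and>
     (\<forall>i\<ge>1. trivial_group (Ext S i K (tensor_module R K M))) \<and>
     auslander_unit R K M \<in> lin_isos R M (hom_module S K (tensor_module R K M))}"

definition bass_class ::
    "('s, 'y) ring_scheme \<Rightarrow> ('r, 'x) ring_scheme \<Rightarrow> ('s, 'r, 'k) bimodule \<Rightarrow> ('s, 'n) module set" where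
  "bass_class S R K = {N. left_module S N \<and>
     (\<forall>i\<ge>1. trivial_group (Ext S i K N)) \<and>
     (\<forall>i\<ge>1. trivial_group (Tor R i (right_mod K) (hom_module S K N))) \<and>
     bass_counit K N \<in> lin_isos S (tensor_module R K (hom_module S K N)) N}"

end

theory Submission
  imports Defs
begin

text \<open>Since \<open>K\<close> is the \<open>d\<close>th syzygy of \<open>C\<close>, a module \<open>N\<close> in \<open>\<I>\<^sup>(\<^sup>n\<^sup>,\<^sup>d\<^sup>)(S)\<close> satisfies
  \<open>Ext\<^sup>i(K,N) = 0\<close> for \<open>i \<ge> 1\<close>. Let \<open>G \<rightarrow> K\<close> be the tail of the given resolution. As \<open>K\<close> is semidualizing, the
  complex \<open>0 \<rightarrow> S \<rightarrow> Hom(G\<^sub>0,K) \<rightarrow> Hom(G\<^sub>1,K) \<rightarrow> \<dots>\<close> of homomorphisms of right modules is exact, and its terms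
  \<open>Hom(G\<^sub>i,K)\<close> are finite powers of \<open>K\<close>. By mapping cones, its cycle modules \<open>L\<^sub>i\<close> are finitely
  \<open>\<infinity>\<close>-presented, and dimension shifting gives \<open>Ext\<^sup>1(L\<^sub>i,N) = Ext\<^sup>d\<^sup>+\<^sup>1(L\<^sub>i\<^sub>+\<^sub>d,N) = 0\<close>. So \<open>Hom\<^sub>S(-,N)\<close> keeps
  the complex exact. The result is \<open>G \<otimes>\<^sub>R Hom\<^sub>S(K,N) \<rightarrow> N \<rightarrow> 0\<close>, because \<open>G\<^sub>i\<close> is finitely generated free, and its
  exactness is the claim about the Bass class. For the Auslander class one tensors the exact complex
  \<open>0 \<rightarrow> R \<rightarrow> Hom\<^sub>S(G\<^sub>0,K) \<rightarrow> \<dots>\<close> with a module in \<open>\<F>\<^sup>(\<^sup>n\<^sup>,\<^sup>d\<^sup>)(R)\<close> instead.\<close>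

section \<open>Additive and linear maps\<close>

text \<open>The condition on \<open>N\<close> speaks of \<open>Ext\<close> in the single degree
  \<open>d + 1\<close>, but of all super finitely presented modules. To come down to degree one, a
  module has to be seen as a \<open>d\<close>th syzygy of another admissible one. The module
  \<open>K\<close> is given in this way, and for its higher \<open>Ext\<close> the syzygies of
  \<open>C\<close> take the place of \<open>C\<close>. For the \<open>L_i\<close> it is the dual
  complex, exact and endless to the right, that makes each \<open>L_i\<close> a
  \<open>d\<close>-fold syzygy of \<open>L_(i+d)\<close>, with powers of \<open>K\<close> instead of
  free modules in between. That every \<open>L_i\<close> is admissible is seen upwards from
  \<open>L_0\<close>, which is free of rank one because the homothety is bijective. Two obstacles
  are formal. \<open>Ext\<close> and \<open>Tor\<close> come from a resolution fixed by choice, and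
  the test modules have one prescribed type, whereas the \<open>L_i\<close> consist of functions
  between other types; so vanishing is first freed from the resolution and then from the type. The
  connecting steps of the long exact sequences are read off mapping cones, the same cones that
  resolve the \<open>L_i\<close>.\<close>

definition add_maps :: "('a, 'y) ring_scheme \<Rightarrow> ('b, 'z) ring_scheme \<Rightarrow> ('a \<Rightarrow> 'b) set" where
  "add_maps A B = {f \<in> carrier A \<rightarrow> carrier B.
     \<forall>x\<in>carrier A. \<forall>y\<in>carrier A. f (x \<oplus>\<^bsub>A\<^esub> y) = f x \<oplus>\<^bsub>B\<^esub> f y}"

lemma add_mapsI:
  assumes "\<And>x. x \<in> carrier A \<Longrightarrow> f x \<in> carrier B"
    and "\<And>x y. x \<in> carrier A \<Longrightarrow> y \<in> carrier A \<Longrightarrow> f (x \<oplus>\<^bsub>A\<^esub> y) = f x \<oplus>\<^bsub>B\<^esub> f y"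
  shows "f \<in> add_maps A B"
  using assms by (auto simp: add_maps_def)

lemma add_maps_closed: "f \<in> add_maps A B \<Longrightarrow> x \<in> carrier A \<Longrightarrow> f x \<in> carrier B"
  by (auto simp: add_maps_def)

lemma add_maps_add:
  "f \<in> add_maps A B \<Longrightarrow> x \<in> carrier A \<Longrightarrow> y \<in> carrier A \<Longrightarrow> f (x \<oplus>\<^bsub>A\<^esub> y) = f x \<oplus>\<^bsub>B\<^esub> f y"
  by (auto simp: add_maps_def)

lemma add_maps_zero:
  assumes "f \<in> add_maps A B" "abelian_group A" "abelian_group B"
  shows "f \<zero>\<^bsub>A\<^esub> = \<zero>\<^bsub>B\<^esub>"
proof -
  interpret A: abelian_group A by fact
  interpret B: abelian_group B by fact
  have "f \<zero>\<^bsub>A\<^esub> \<oplus>\<^bsub>B\<^esub> f \<zero>\<^bsub>A\<^esub> = f \<zero>\<^bsub>A\<^esub>" using add_maps_add[OF assms(1), of "\<zero>\<^bsub>A\<^esub>" "\<zero>\<^bsub>A\<^esub>"] by simp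
  then show ?thesis using add_maps_closed[OF assms(1) A.zero_closed] by simp
qed

lemma add_maps_minus:
  assumes "f \<in> add_maps A B" "abelian_group A" "abelian_group B" "x \<in> carrier A"
  shows "f (\<ominus>\<^bsub>A\<^esub> x) = \<ominus>\<^bsub>B\<^esub> f x"
proof -
  interpret A: abelian_group A by fact
  interpret B: abelian_group B by fact
  have "f x \<oplus>\<^bsub>B\<^esub> f (\<ominus>\<^bsub>A\<^esub> x) = \<zero>\<^bsub>B\<^esub>"
    using add_maps_add[OF assms(1,4), of "\<ominus>\<^bsub>A\<^esub> x"] add_maps_zero[OF assms(1-3)] assms(4)
    by (simp add: A.r_neg)
  then show ?thesis using add_maps_closed[OF assms(1)] assms(4) B.minus_equality B.a_comm
    by (metis A.a_inv_closed)
qed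

lemma add_maps_diff:
  assumes "f \<in> add_maps A B" "abelian_group A" "abelian_group B" "x \<in> carrier A" "y \<in> carrier A"
  shows "f (x \<ominus>\<^bsub>A\<^esub> y) = f x \<ominus>\<^bsub>B\<^esub> f y"
  using assms add_maps_minus[OF assms(1-3,5)] abelian_group.a_inv_closed[OF assms(2,5)]
  by (simp add: a_minus_def add_maps_add)

lemma add_maps_comp:
  "f \<in> add_maps A B \<Longrightarrow> g \<in> add_maps B C \<Longrightarrow> (\<lambda>x. g (f x)) \<in> add_maps A C"
  by (auto simp: add_maps_def Pi_iff)

lemma add_maps_finsum:
  assumes "f \<in> add_maps A B" "abelian_group A" "abelian_group B" "finite I" "g \<in> I \<rightarrow> carrier A"
  shows "f (finsum A g I) = finsum B (\<lambda>i. f (g i)) I"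
  using assms(4,5)
proof (induction I)
  interpret A: abelian_group A by fact
  interpret B: abelian_group B by fact
  {
    case empty
    show ?case using add_maps_zero[OF assms(1-3)] by simp
  next
    case (insert i I)
    then have "g i \<in> carrier A" "g \<in> I \<rightarrow> carrier A" by auto
    moreover then have "f (g i) \<in> carrier B" "(\<lambda>i. f (g i)) \<in> I \<rightarrow> carrier B"
      using add_maps_closed[OF assms(1)] by auto
    ultimately show ?case using insert by (simp add: add_maps_add[OF assms(1)])
  }
qed

lemma lin_mapsI:
  assumes "\<And>x. x \<in> carrier A \<Longrightarrow> f x \<in> carrier B"
    and "\<And>x y. x \<in> carrier A \<Longrightarrow> y \<in> carrier A \<Longrightarrow> f (x \<oplus>\<^bsub>A\<^esub> y) = f x \<oplus>\<^bsub>B\<^esub> f y"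
    and "\<And>r x. r \<in> carrier R \<Longrightarrow> x \<in> carrier A \<Longrightarrow> f (r \<odot>\<^bsub>A\<^esub> x) = r \<odot>\<^bsub>B\<^esub> f x"
  shows "f \<in> lin_maps R A B"
  using assms by (auto simp: lin_maps_def)

text \<open>Tensor groups are bare abelian groups and the maps between them only additive, so zeros,
  negatives and finite sums are treated for additive maps and passed on to linear ones through this
  inclusion.\<close>

lemma lin_maps_imp_add_maps: "f \<in> lin_maps R A B \<Longrightarrow> f \<in> add_maps A B"
  by (auto simp: lin_maps_def add_maps_def)

lemma lin_maps_closed: "f \<in> lin_maps R A B \<Longrightarrow> x \<in> carrier A \<Longrightarrow> f x \<in> carrier B"
  by (auto simp: lin_maps_def)

lemma lin_maps_add:
  "f \<in> lin_maps R A B \<Longrightarrow> x \<in> carrier A \<Longrightarrow> y \<in> carrier A \<Longrightarrow> f (x \<oplus>\<^bsub>A\<^esub> y) = f x \<oplus>\<^bsub>B\<^esub> f y"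
  by (auto simp: lin_maps_def)

lemma lin_maps_smult:
  "f \<in> lin_maps R A B \<Longrightarrow> r \<in> carrier R \<Longrightarrow> x \<in> carrier A \<Longrightarrow> f (r \<odot>\<^bsub>A\<^esub> x) = r \<odot>\<^bsub>B\<^esub> f x"
  by (auto simp: lin_maps_def)

lemma left_module_abelian_group: "left_module R M \<Longrightarrow> abelian_group M"
  by (rule left_module.axioms(2))

lemma left_module_ring: "left_module R M \<Longrightarrow> ring R"
  by (rule left_module.axioms(1))

lemma lin_maps_zero:
  "f \<in> lin_maps R A B \<Longrightarrow> left_module R A \<Longrightarrow> left_module R B \<Longrightarrow> f \<zero>\<^bsub>A\<^esub> = \<zero>\<^bsub>B\<^esub>"
  by (intro add_maps_zero lin_maps_imp_add_maps left_module_abelian_group)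

lemma lin_maps_minus:
  "f \<in> lin_maps R A B \<Longrightarrow> left_module R A \<Longrightarrow> left_module R B \<Longrightarrow> x \<in> carrier A \<Longrightarrow>
    f (\<ominus>\<^bsub>A\<^esub> x) = \<ominus>\<^bsub>B\<^esub> f x"
  by (intro add_maps_minus lin_maps_imp_add_maps left_module_abelian_group)

lemma lin_maps_diff:
  "f \<in> lin_maps R A B \<Longrightarrow> left_module R A \<Longrightarrow> left_module R B \<Longrightarrow> x \<in> carrier A \<Longrightarrow> y \<in> carrier A \<Longrightarrow>
    f (x \<ominus>\<^bsub>A\<^esub> y) = f x \<ominus>\<^bsub>B\<^esub> f y"
  by (intro add_maps_diff lin_maps_imp_add_maps left_module_abelian_group)

lemma lin_maps_finsum:
  "f \<in> lin_maps R A B \<Longrightarrow> left_module R A \<Longrightarrow> left_module R B \<Longrightarrow> finite I \<Longrightarrow> g \<in> I \<rightarrow> carrier A \<Longrightarrow>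
    f (finsum A g I) = finsum B (\<lambda>i. f (g i)) I"
  by (intro add_maps_finsum lin_maps_imp_add_maps left_module_abelian_group)

lemma lin_maps_comp:
  "f \<in> lin_maps R A B \<Longrightarrow> g \<in> lin_maps R B C \<Longrightarrow> (\<lambda>x. g (f x)) \<in> lin_maps R A C"
  by (auto simp: lin_maps_def Pi_iff)

text \<open>\<open>lin_maps\<close> ignores values off the carrier. \<open>A\<close> is a module so
  that the sums and multiples at which linearity is tested lie in the carrier, where
  \<open>f\<close> and \<open>g\<close> agree.\<close>

lemma lin_maps_cong:
  assumes "f \<in> lin_maps R A B" "left_module R A" "\<And>x. x \<in> carrier A \<Longrightarrow> f x = g x"
  shows "g \<in> lin_maps R A B"
proof -
  interpret left_module R A by fact
  show ?thesis using assms by (intro lin_mapsI) (auto simp: lin_maps_def Pi_iff)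
qed

lemma lin_maps_id: "(\<lambda>x. x) \<in> lin_maps R A A"
  by (auto simp: lin_maps_def)

lemma lin_maps_const_zero:
  assumes "left_module R B"
  shows "(\<lambda>x. \<zero>\<^bsub>B\<^esub>) \<in> lin_maps R A B"
proof -
  interpret B: left_module R B by fact
  show ?thesis by (intro lin_mapsI) auto
qed

lemma lin_maps_plus:
  assumes "left_module R B" "f \<in> lin_maps R A B" "g \<in> lin_maps R A B"
  shows "(\<lambda>x. f x \<oplus>\<^bsub>B\<^esub> g x) \<in> lin_maps R A B"
proof -
  interpret B: left_module R B by fact
  note c = lin_maps_closed[OF assms(2)] lin_maps_closed[OF assms(3)]
  show ?thesis
    by (intro lin_mapsI)
      (auto simp: c lin_maps_add[OF assms(2)] lin_maps_add[OF assms(3)] lin_maps_smult[OF assms(2)]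
        lin_maps_smult[OF assms(3)] B.M.a_ac B.smult_r_distr)
qed

lemma (in left_module) smult_minus:
  assumes "a \<in> carrier R" "x \<in> carrier M"
  shows "a \<odot>\<^bsub>M\<^esub> (\<ominus>\<^bsub>M\<^esub> x) = \<ominus>\<^bsub>M\<^esub> (a \<odot>\<^bsub>M\<^esub> x)"
proof -
  have "a \<odot>\<^bsub>M\<^esub> x \<oplus>\<^bsub>M\<^esub> a \<odot>\<^bsub>M\<^esub> (\<ominus>\<^bsub>M\<^esub> x) = \<zero>\<^bsub>M\<^esub>"
    using smult_r_distr[OF assms, of "\<ominus>\<^bsub>M\<^esub> x"] assms by (simp add: M.r_neg)
  then show ?thesis using assms M.minus_equality M.a_comm
    by (metis M.a_inv_closed smult_closed)
qed

lemma lin_maps_uminus: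
  assumes "left_module R B" "f \<in> lin_maps R A B"
  shows "(\<lambda>x. \<ominus>\<^bsub>B\<^esub> f x) \<in> lin_maps R A B"
proof -
  interpret B: left_module R B by fact
  note c = lin_maps_closed[OF assms(2)]
  show ?thesis
    by (intro lin_mapsI)
      (auto simp: c lin_maps_add[OF assms(2)] lin_maps_smult[OF assms(2)] B.M.minus_add B.smult_minus)
qed

lemma lin_maps_minus_fun:
  assumes "left_module R B" "f \<in> lin_maps R A B" "g \<in> lin_maps R A B"
  shows "(\<lambda>x. f x \<ominus>\<^bsub>B\<^esub> g x) \<in> lin_maps R A B"
  unfolding a_minus_def by (intro lin_maps_plus lin_maps_uminus assms)

lemma lin_maps_finsum_fun:
  assumes "left_module R B" "finite I" "\<And>i. i \<in> I \<Longrightarrow> f i \<in> lin_maps R A B"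
  shows "(\<lambda>x. finsum B (\<lambda>i. f i x) I) \<in> lin_maps R A B"
proof -
  interpret B: left_module R B by fact
  have c: "f i x \<in> carrier B" if "i \<in> I" "x \<in> carrier A" for i x
    using assms(3)[OF that(1)] that(2) by (rule lin_maps_closed)
  show ?thesis
  proof (intro lin_mapsI)
    fix x y assume xy: "x \<in> carrier A" "y \<in> carrier A"
    have "finsum B (\<lambda>i. f i (x \<oplus>\<^bsub>A\<^esub> y)) I = finsum B (\<lambda>i. f i x \<oplus>\<^bsub>B\<^esub> f i y) I"
      using xy c lin_maps_add[OF assms(3)] by (intro B.M.finsum_cong') auto
    also have "\<dots> = finsum B (\<lambda>i. f i x) I \<oplus>\<^bsub>B\<^esub> finsum B (\<lambda>i. f i y) I"
      using xy c by (intro B.M.finsum_addf) auto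
    finally show "finsum B (\<lambda>i. f i (x \<oplus>\<^bsub>A\<^esub> y)) I = \<dots>" .
  next
    fix r x assume rx: "r \<in> carrier R" "x \<in> carrier A"
    have "finsum B (\<lambda>i. f i (r \<odot>\<^bsub>A\<^esub> x)) I = finsum B (\<lambda>i. r \<odot>\<^bsub>B\<^esub> f i x) I"
      using rx c lin_maps_smult[OF assms(3)] by (intro B.M.finsum_cong') auto
    also have "\<dots> = r \<odot>\<^bsub>B\<^esub> finsum B (\<lambda>i. f i x) I"
      using rx c assms(2) by (intro B.smult_finsum[symmetric]) auto
    finally show "finsum B (\<lambda>i. f i (r \<odot>\<^bsub>A\<^esub> x)) I = \<dots>" .
  qed (use c in auto)
qed

lemma lin_isosD: "f \<in> lin_isos R A B \<Longrightarrow> f \<in> lin_maps R A B" "f \<in> lin_isos R A B \<Longrightarrow> bij_betw f (carrier A) (carrier B)"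
  by (auto simp: lin_isos_def)

lemma lin_isos_inv_into:
  assumes "left_module R A" "f \<in> lin_isos R A B"
  shows "inv_into (carrier A) f \<in> lin_isos R B A"
proof -
  interpret A: left_module R A by fact
  note f = lin_isosD[OF assms(2)]
  let ?g = "inv_into (carrier A) f"
  have g: "?g y \<in> carrier A" "f (?g y) = y" if "y \<in> carrier B" for y
    using f(2) that by (auto simp: bij_betw_def inv_into_into f_inv_into_f)
  have gf: "?g (f x) = x" if "x \<in> carrier A" for x
    using f(2) that by (auto simp: bij_betw_def)
  have "?g \<in> lin_maps R B A"
  proof (intro lin_mapsI)
    fix x y assume "x \<in> carrier B" "y \<in> carrier B"
    then have "x \<oplus>\<^bsub>B\<^esub> y = f (?g x \<oplus>\<^bsub>A\<^esub> ?g y)" using g lin_maps_add[OF f(1)] by simp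
    then show "?g (x \<oplus>\<^bsub>B\<^esub> y) = ?g x \<oplus>\<^bsub>A\<^esub> ?g y"
      using gf g \<open>x \<in> carrier B\<close> \<open>y \<in> carrier B\<close> by simp
  next
    fix r y assume "r \<in> carrier R" "y \<in> carrier B"
    then have "r \<odot>\<^bsub>B\<^esub> y = f (r \<odot>\<^bsub>A\<^esub> ?g y)" using g lin_maps_smult[OF f(1)] by simp
    then show "?g (r \<odot>\<^bsub>B\<^esub> y) = r \<odot>\<^bsub>A\<^esub> ?g y"
      using gf g \<open>r \<in> carrier R\<close> \<open>y \<in> carrier B\<close> by simp
  qed (use g in auto)
  then show ?thesis using f(2) by (simp add: lin_isos_def bij_betw_inv_into)
qed

lemma lin_isosI_inverse:
  assumes "f \<in> lin_maps R A B" "\<And>y. y \<in> carrier B \<Longrightarrow> g y \<in> carrier A"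
    "\<And>x. x \<in> carrier A \<Longrightarrow> g (f x) = x" "\<And>y. y \<in> carrier B \<Longrightarrow> f (g y) = y"
  shows "f \<in> lin_isos R A B"
proof -
  have "bij_betw f (carrier A) (carrier B)"
    by (rule bij_betwI[of _ _ _ g]) (use assms in \<open>auto simp: lin_maps_def\<close>)
  then show ?thesis using assms(1) by (simp add: lin_isos_def)
qed

section \<open>Submodules, products and free modules\<close>

text \<open>Closure under negatives comes from closure under multiples, as
  \<open>\<ominus> x\<close> is the multiple of \<open>x\<close> by minus one. Replacing only the
  carrier is how \<open>syzygy_bimodule\<close> presents a syzygy, so kernels and images take the
  same record form.\<close>

lemma left_module_submodule:
  assumes "left_module R M" "H \<subseteq> carrier M" "\<zero>\<^bsub>M\<^esub> \<in> H"
    "\<And>x y. x \<in> H \<Longrightarrow> y \<in> H \<Longrightarrow> x \<oplus>\<^bsub>M\<^esub> y \<in> H" "\<And>r x. r \<in> carrier R \<Longrightarrow> x \<in> H \<Longrightarrow> r \<odot>\<^bsub>M\<^esub> x \<in> H"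
  shows "left_module R (M\<lparr>carrier := H\<rparr>)"
proof -
  interpret left_module R M by fact
  have neg: "\<ominus>\<^bsub>M\<^esub> x \<in> H" if "x \<in> H" for x
  proof -
    have x: "x \<in> carrier M" using that assms(2) by auto
    have "x \<oplus>\<^bsub>M\<^esub> (\<ominus>\<^bsub>R\<^esub> \<one>\<^bsub>R\<^esub>) \<odot>\<^bsub>M\<^esub> x = (\<one>\<^bsub>R\<^esub> \<oplus>\<^bsub>R\<^esub> \<ominus>\<^bsub>R\<^esub> \<one>\<^bsub>R\<^esub>) \<odot>\<^bsub>M\<^esub> x"
      using x smult_l_distr[of "\<one>\<^bsub>R\<^esub>" "\<ominus>\<^bsub>R\<^esub> \<one>\<^bsub>R\<^esub>" x] by simp
    also have "\<dots> = \<zero>\<^bsub>M\<^esub>" using x by (simp add: R.r_neg)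
    finally have "\<ominus>\<^bsub>M\<^esub> x = (\<ominus>\<^bsub>R\<^esub> \<one>\<^bsub>R\<^esub>) \<odot>\<^bsub>M\<^esub> x"
      using x M.minus_equality M.a_comm by (metis R.a_inv_closed R.one_closed smult_closed)
    then show ?thesis using that assms(5) by simp
  qed
  have sub: "x \<in> carrier M" if "x \<in> H" for x using that assms(2) by auto
  have "abelian_group (M\<lparr>carrier := H\<rparr>)"
  proof (rule abelian_groupI)
    fix x assume "x \<in> carrier (M\<lparr>carrier := H\<rparr>)"
    then show "\<exists>y\<in>carrier (M\<lparr>carrier := H\<rparr>). y \<oplus>\<^bsub>M\<lparr>carrier := H\<rparr>\<^esub> x = \<zero>\<^bsub>M\<lparr>carrier := H\<rparr>\<^esub>"
      using neg sub by (intro bexI[of _ "\<ominus>\<^bsub>M\<^esub> x"]) (auto simp: M.l_neg)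
  qed (use assms(3,4) sub in \<open>auto simp: M.a_ac\<close>)
  then show ?thesis
    using R.ring_axioms assms(5) sub
    by (intro left_module.intro left_module_axioms.intro)
      (auto simp: smult_l_distr smult_r_distr smult_assoc1)
qed

lemma left_module_kernel:
  assumes "f \<in> lin_maps R A B" "left_module R A" "left_module R B"
  shows "left_module R (A\<lparr>carrier := {x \<in> carrier A. f x = \<zero>\<^bsub>B\<^esub>}\<rparr>)"
proof -
  interpret A: left_module R A by fact
  interpret B: left_module R B by fact
  show ?thesis
    using lin_maps_zero[OF assms] lin_maps_add[OF assms(1)] lin_maps_smult[OF assms(1)]
    by (intro left_module_submodule) (auto simp: A.left_module_axioms)
qed

lemma left_module_image:
  assumes "f \<in> lin_maps R A B" "left_module R A" "left_module R B"
  shows "left_module R (B\<lparr>carrier := f ` carrier A\<rparr>)"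
proof -
  interpret A: left_module R A by fact
  interpret B: left_module R B by fact
  show ?thesis
  proof (rule left_module_submodule)
    show "\<zero>\<^bsub>B\<^esub> \<in> f ` carrier A" using lin_maps_zero[OF assms] by (metis A.M.zero_closed imageI)
    show "x \<oplus>\<^bsub>B\<^esub> y \<in> f ` carrier A" if "x \<in> f ` carrier A" "y \<in> f ` carrier A" for x y
      using that lin_maps_add[OF assms(1), symmetric] by auto
    show "r \<odot>\<^bsub>B\<^esub> x \<in> f ` carrier A" if "r \<in> carrier R" "x \<in> f ` carrier A" for r x
      using that lin_maps_smult[OF assms(1), symmetric] by auto
  qed (use lin_maps_closed[OF assms(1)] B.left_module_axioms in auto)
qed

lemma lin_maps_restrict_codomain:
  "f \<in> lin_maps R A B \<Longrightarrow> f ` carrier A \<subseteq> H \<Longrightarrow> f \<in> lin_maps R A (B\<lparr>carrier := H\<rparr>)"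
  by (auto simp: lin_maps_def)

lemma lin_maps_restrict_domain:
  "f \<in> lin_maps R A B \<Longrightarrow> H \<subseteq> carrier A \<Longrightarrow> f \<in> lin_maps R (A\<lparr>carrier := H\<rparr>) B"
  by (auto simp: lin_maps_def subset_iff)

section \<open>Binary products and finitely generated free modules\<close>

definition prod_module :: "('r, 'a, 'y) module_scheme \<Rightarrow> ('r, 'b, 'z) module_scheme \<Rightarrow> ('r, 'a \<times> 'b) module"
  where
  "prod_module A B = \<lparr>carrier = carrier A \<times> carrier B, mult = undefined, one = undefined,
     ring.zero = (\<zero>\<^bsub>A\<^esub>, \<zero>\<^bsub>B\<^esub>), add = (\<lambda>(a, b) (a', b'). (a \<oplus>\<^bsub>A\<^esub> a', b \<oplus>\<^bsub>B\<^esub> b')),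
     smult = (\<lambda>r (a, b). (r \<odot>\<^bsub>A\<^esub> a, r \<odot>\<^bsub>B\<^esub> b))\<rparr>"

lemma prod_module_simps [simp]:
  "carrier (prod_module A B) = carrier A \<times> carrier B"
  "\<zero>\<^bsub>prod_module A B\<^esub> = (\<zero>\<^bsub>A\<^esub>, \<zero>\<^bsub>B\<^esub>)"
  "(a, b) \<oplus>\<^bsub>prod_module A B\<^esub> (a', b') = (a \<oplus>\<^bsub>A\<^esub> a', b \<oplus>\<^bsub>B\<^esub> b')"
  "r \<odot>\<^bsub>prod_module A B\<^esub> (a, b) = (r \<odot>\<^bsub>A\<^esub> a, r \<odot>\<^bsub>B\<^esub> b)"
  by (simp_all add: prod_module_def)

lemma left_module_prod_module:
  assumes "left_module R A" "left_module R B"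
  shows "left_module R (prod_module A B)"
proof -
  interpret A: left_module R A by fact
  interpret B: left_module R B by fact
  have "abelian_group (prod_module A B)"
  proof (rule abelian_groupI)
    fix x assume "x \<in> carrier (prod_module A B)"
    then show "\<exists>y\<in>carrier (prod_module A B). y \<oplus>\<^bsub>prod_module A B\<^esub> x = \<zero>\<^bsub>prod_module A B\<^esub>"
      by (intro bexI[of _ "(\<ominus>\<^bsub>A\<^esub> fst x, \<ominus>\<^bsub>B\<^esub> snd x)"]) (auto simp: A.M.l_neg B.M.l_neg)
  qed (auto simp: A.M.a_ac B.M.a_ac)
  then show ?thesis
    using A.R.ring_axioms
    by (intro left_module.intro left_module_axioms.intro)
      (auto simp: A.smult_l_distr A.smult_r_distr A.smult_assoc1
        B.smult_l_distr B.smult_r_distr B.smult_assoc1)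
qed

lemma lin_maps_fst: "fst \<in> lin_maps R (prod_module A B) A"
  and lin_maps_snd: "snd \<in> lin_maps R (prod_module A B) B"
  by (auto intro!: lin_mapsI)

lemma lin_maps_Pair:
  "f \<in> lin_maps R A B \<Longrightarrow> g \<in> lin_maps R A C \<Longrightarrow> (\<lambda>x. (f x, g x)) \<in> lin_maps R A (prod_module B C)"
  by (auto simp: lin_maps_def Pi_iff)

lemma free_module_simps:
  "\<zero>\<^bsub>free_module R X\<^esub> = (\<lambda>i. \<zero>\<^bsub>R\<^esub>)"
  "f \<oplus>\<^bsub>free_module R X\<^esub> g = (\<lambda>i. f i \<oplus>\<^bsub>R\<^esub> g i)"
  "r \<odot>\<^bsub>free_module R X\<^esub> f = (\<lambda>i. if i \<in> X then r \<otimes>\<^bsub>R\<^esub> f i else \<zero>\<^bsub>R\<^esub>)"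
  by (simp_all add: free_module_def)

lemma carrier_free_module_finite:
  "finite X \<Longrightarrow> carrier (free_module R X) =
     {f. (\<forall>i\<in>X. f i \<in> carrier R) \<and> (\<forall>i. i \<notin> X \<longrightarrow> f i = \<zero>\<^bsub>R\<^esub>)}"
  by (auto simp: free_module_def intro: rev_finite_subset)

text \<open>The uniqueness half of the universal property of a free module;
  \<open>lin_ext_lin_maps\<close> is the existence half.\<close>

lemma lin_map_free_module_eq:
  assumes "left_module R M" "h \<in> lin_maps R (free_module R X) M" "f \<in> carrier (free_module R X)"
  shows "h f = lin_ext R M (\<lambda>i. h (unit_vector R i)) f"
proof -
  interpret M: left_module R M by fact
  note r = M.R.ring_axioms
  note F = left_module_free_module[OF r, of X]
  interpret F: left_module R "free_module R X" by (rule F)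
  let ?A = "{i. f i \<noteq> \<zero>\<^bsub>R\<^esub>}"
  have A: "finite ?A" "?A \<subseteq> X" using assms(3) by (auto simp: free_module_def)
  have fc: "f i \<in> carrier R" for i using assms(3) by (cases "i \<in> X") (auto simp: free_module_def)
  have u: "unit_vector R i \<in> carrier (free_module R X)" if "i \<in> ?A" for i
    using unit_vector_closed[OF r, of i X] that A(2) by auto
  have "h f = h (finsum (free_module R X) (\<lambda>i. f i \<odot>\<^bsub>free_module R X\<^esub> unit_vector R i) ?A)"
    using lin_ext_unit_vectors[OF r assms(3)] by (simp add: lin_ext_def)
  also have "\<dots> = finsum M (\<lambda>i. h (f i \<odot>\<^bsub>free_module R X\<^esub> unit_vector R i)) ?A"
    using A(1) u fc by (intro lin_maps_finsum[OF assms(2) F assms(1)]) (auto intro!: F.smult_closed)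
  also have "\<dots> = finsum M (\<lambda>i. f i \<odot>\<^bsub>M\<^esub> h (unit_vector R i)) ?A"
    using fc u lin_maps_closed[OF assms(2) u] lin_maps_smult[OF assms(2)]
    by (intro M.M.finsum_cong') auto
  finally show ?thesis by (simp add: lin_ext_def)
qed

lemma lin_maps_free_module_eqI:
  assumes "left_module R M" "h \<in> lin_maps R (free_module R X) M" "h' \<in> lin_maps R (free_module R X) M"
    "\<And>i. i \<in> X \<Longrightarrow> h (unit_vector R i) = h' (unit_vector R i)" "f \<in> carrier (free_module R X)"
  shows "h f = h' f"
proof -
  interpret M: left_module R M by fact
  have A: "{i. f i \<noteq> \<zero>\<^bsub>R\<^esub>} \<subseteq> X" using assms(5) by (auto simp: free_module_def)
  have fc: "f i \<in> carrier R" for i using assms(5) by (cases "i \<in> X") (auto simp: free_module_def)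
  have "h' (unit_vector R i) \<in> carrier M" if "i \<in> X" for i
    using unit_vector_closed[OF M.R.ring_axioms that] lin_maps_closed[OF assms(3)] by blast
  then show ?thesis
    unfolding lin_map_free_module_eq[OF assms(1,2,5)] lin_map_free_module_eq[OF assms(1,3,5)] lin_ext_def
    using A fc assms(4) by (intro M.M.finsum_cong') auto
qed

lemma fg_free_free_module: "fg_free R (free_module R {..<k::nat})"
  unfolding fg_free_def lin_isos_def using lin_maps_id by (auto simp: bij_betw_def inj_on_def)

lemma fg_free_zero:
  assumes "left_module R M" "carrier M = {\<zero>\<^bsub>M\<^esub>}"
  shows "fg_free R M"
proof -
  interpret M: left_module R M by fact
  have z: "carrier (free_module R ({} :: nat set)) = {\<lambda>i. \<zero>\<^bsub>R\<^esub>}"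
    by (auto simp: free_module_def)
  have "(\<lambda>x. \<lambda>i. \<zero>\<^bsub>R\<^esub>) \<in> lin_isos R M (free_module R {..<0::nat})"
    unfolding lin_isos_def lin_maps_def
    by (auto simp: z assms(2) free_module_simps bij_betw_def)
  then show ?thesis unfolding fg_free_def by blast
qed

lemma fg_free_prod_module:
  assumes "left_module R A" "left_module R B" "fg_free R A" "fg_free R B"
  shows "fg_free R (prod_module A B)"
proof -
  interpret A: left_module R A by fact
  interpret B: left_module R B by fact
  note r = A.R.ring_axioms
  obtain k f where f: "f \<in> lin_isos R A (free_module R {..<k::nat})" using assms(3) by (auto simp: fg_free_def)
  obtain l g where g: "g \<in> lin_isos R B (free_module R {..<l::nat})" using assms(4) by (auto simp: fg_free_def)
  note f1 = lin_isosD[OF f] and g1 = lin_isosD[OF g]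
  have fc: "i < k \<Longrightarrow> f a i \<in> carrier R" "\<not> i < k \<Longrightarrow> f a i = \<zero>\<^bsub>R\<^esub>" if "a \<in> carrier A" for a i
    using lin_maps_closed[OF f1(1) that] by (auto simp: carrier_free_module_finite)
  have gc: "i < l \<Longrightarrow> g a i \<in> carrier R" "\<not> i < l \<Longrightarrow> g a i = \<zero>\<^bsub>R\<^esub>" if "a \<in> carrier B" for a i
    using lin_maps_closed[OF g1(1) that] by (auto simp: carrier_free_module_finite)
  have fi: "inv_into (carrier A) f y \<in> carrier A" "f (inv_into (carrier A) f y) = y"
    if "y \<in> carrier (free_module R {..<k})" for y
    using f1(2) that by (auto simp: bij_betw_def inv_into_into f_inv_into_f)
  have gi: "inv_into (carrier B) g y \<in> carrier B" "g (inv_into (carrier B) g y) = y"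
    if "y \<in> carrier (free_module R {..<l})" for y
    using g1(2) that by (auto simp: bij_betw_def inv_into_into f_inv_into_f)
  \<comment> \<open>\<open>h\<close> concatenates coordinate vectors, those of \<open>B\<close>
    being shifted by \<open>k\<close>; from \<open>k + l\<close> on it is zero because
    \<open>g b\<close> vanishes from \<open>l\<close> on. \<open>h'\<close> cuts a vector back into
    its two blocks.\<close>
  define h where "h = (\<lambda>(a, b). \<lambda>i. if i < k then f a i else g b (i - k))"
  define h' where "h' = (\<lambda>y. (inv_into (carrier A) f (\<lambda>i. if i < k then y i else \<zero>\<^bsub>R\<^esub>),
     inv_into (carrier B) g (\<lambda>i. y (i + k))))"
  have 1: "(\<lambda>i. if i < k then y i else \<zero>\<^bsub>R\<^esub>) \<in> carrier (free_module R {..<k})"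
    and 2: "(\<lambda>i. y (i + k)) \<in> carrier (free_module R {..<l})"
    if "y \<in> carrier (free_module R {..<k + l})" for y
    using that by (auto simp: carrier_free_module_finite)
  have "h \<in> lin_isos R (prod_module A B) (free_module R {..<k + l})"
  proof (rule lin_isosI_inverse[of _ _ _ _ h'])
    show "h \<in> lin_maps R (prod_module A B) (free_module R {..<k + l})"
    proof (intro lin_mapsI)
      fix x assume "x \<in> carrier (prod_module A B)"
      then show "h x \<in> carrier (free_module R {..<k + l})"
        using fc gc by (auto simp: carrier_free_module_finite h_def)
    next
      fix x y assume "x \<in> carrier (prod_module A B)" "y \<in> carrier (prod_module A B)"
      then show "h (x \<oplus>\<^bsub>prod_module A B\<^esub> y) = h x \<oplus>\<^bsub>free_module R {..<k + l}\<^esub> h y"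
        by (auto simp: h_def lin_maps_add[OF f1(1)] lin_maps_add[OF g1(1)] free_module_simps)
    next
      fix s x assume s: "s \<in> carrier R" and "x \<in> carrier (prod_module A B)"
      then obtain a b where x: "x = (a, b)" "a \<in> carrier A" "b \<in> carrier B" by auto
      have "f (s \<odot>\<^bsub>A\<^esub> a) = s \<odot>\<^bsub>free_module R {..<k}\<^esub> f a" "g (s \<odot>\<^bsub>B\<^esub> b) = s \<odot>\<^bsub>free_module R {..<l}\<^esub> g b"
        using s x lin_maps_smult[OF f1(1)] lin_maps_smult[OF g1(1)] by auto
      then show "h (s \<odot>\<^bsub>prod_module A B\<^esub> x) = s \<odot>\<^bsub>free_module R {..<k + l}\<^esub> h x"
        using x s by (auto simp: h_def free_module_simps fun_eq_iff)
    qed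
  next
    fix y assume "y \<in> carrier (free_module R {..<k + l})"
    then show "h' y \<in> carrier (prod_module A B)" and "h (h' y) = y"
      using fi[OF 1] gi[OF 2] by (auto simp: h_def h'_def)
  next
    fix x assume x: "x \<in> carrier (prod_module A B)"
    then obtain a b where ab: "x = (a, b)" "a \<in> carrier A" "b \<in> carrier B" by auto
    then have "(\<lambda>i. if i < k then h (a, b) i else \<zero>\<^bsub>R\<^esub>) = f a" "(\<lambda>i. h (a, b) (i + k)) = g b"
      using fc by (auto simp: h_def)
    then show "h' (h x) = x"
      using ab(2,3) f1(2) g1(2) unfolding ab(1) h'_def by (simp only: bij_betw_def inv_into_f_f)
  qed
  then show ?thesis unfolding fg_free_def by blast
qed

section \<open>Projective modules\<close>

text \<open>The condition on images takes the place of surjectivity of \<open>q\<close>: in the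
  later lifts \<open>q\<close> is often a differential, which only reaches a syzygy. Preimages are
  chosen on the basis of the free module, extended linearly and brought to \<open>P\<close> by the
  splitting \<open>i\<close>.\<close>

lemma projective_lift:
  assumes "projective R P" "left_module R B" "left_module R A" "f \<in> lin_maps R P B" "q \<in> lin_maps R A B"
    "f ` carrier P \<subseteq> q ` carrier A"
  shows "\<exists>g\<in>lin_maps R P A. \<forall>x\<in>carrier P. q (g x) = f x"
proof -
  obtain X :: "'c set" and i p where i: "i \<in> lin_maps R P (free_module R X)"
    and p: "p \<in> lin_maps R (free_module R X) P" and pi: "\<And>x. x \<in> carrier P \<Longrightarrow> p (i x) = x"
    using assms(1) unfolding projective_def by metis
  interpret A: left_module R A by fact
  have u: "unit_vector R x \<in> carrier (free_module R X)" if "x \<in> X" for x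
    using unit_vector_closed[OF A.R.ring_axioms that] .
  have "\<forall>x\<in>X. \<exists>a\<in>carrier A. q a = f (p (unit_vector R x))"
    using assms(6) lin_maps_closed[OF p u] by (metis image_eqI image_iff subsetD)
  then obtain e where e: "\<And>x. x \<in> X \<Longrightarrow> e x \<in> carrier A \<and> q (e x) = f (p (unit_vector R x))" by metis
  let ?e = "lin_ext R A e"
  have eP: "e \<in> X \<rightarrow> carrier A" using e by auto
  have el: "?e \<in> lin_maps R (free_module R X) A" by (rule lin_ext_lin_maps[OF assms(3) eP])
  have "q (?e y) = f (p y)" if "y \<in> carrier (free_module R X)" for y
  proof (rule lin_maps_free_module_eqI[OF assms(2) _ _ _ that])
    show "(\<lambda>y. q (?e y)) \<in> lin_maps R (free_module R X) B" by (rule lin_maps_comp[OF el assms(5)])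
    show "(\<lambda>y. f (p y)) \<in> lin_maps R (free_module R X) B" by (rule lin_maps_comp[OF p assms(4)])
    show "q (?e (unit_vector R x)) = f (p (unit_vector R x))" if "x \<in> X" for x
      using e that by (simp add: lin_ext_unit_vector[OF assms(3) eP that])
  qed
  then have "\<forall>x\<in>carrier P. q (?e (i x)) = f x" using pi lin_maps_closed[OF i] by simp
  moreover have "(\<lambda>x. ?e (i x)) \<in> lin_maps R P A" by (rule lin_maps_comp[OF i el])
  ultimately show ?thesis by (rule bexI)
qed

text \<open>\<open>projective\<close> wants a free module whose basis is a set of elements of
  \<open>P\<close>, so the basis \<open>{..<k}\<close> does not serve directly. The
  \<open>j\<close>th coordinate is therefore sent to the basis vector indexed by the
  \<open>j\<close>th basis element of \<open>P\<close>.\<close>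

lemma fg_free_projective:
  assumes "left_module R P" "fg_free R P"
  shows "projective R P"
proof -
  interpret P: left_module R P by fact
  note r = P.R.ring_axioms
  obtain k f where f: "f \<in> lin_isos R P (free_module R {..<k::nat})" using assms(2) by (auto simp: fg_free_def)
  note f1 = lin_isosD[OF f]
  define g where "g = inv_into (carrier P) f"
  have g: "g \<in> lin_maps R (free_module R {..<k}) P"
    using lin_isosD(1)[OF lin_isos_inv_into[OF assms(1) f]] by (simp add: g_def)
  have gf: "g (f x) = x" if "x \<in> carrier P" for x
    using f1(2) that by (simp add: g_def bij_betw_def)
  let ?G = "free_module R (carrier P)"
  let ?e = "\<lambda>j. unit_vector R (g (unit_vector R j))"
  have u: "g (unit_vector R j) \<in> carrier P" if "j < k" for j
    using unit_vector_closed[OF r, of j "{..<k}"] lin_maps_closed[OF g] that by blast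
  have e: "?e \<in> {..<k} \<rightarrow> carrier ?G" using unit_vector_closed[OF r u] by auto
  have G: "left_module R ?G" by (rule left_module_free_module[OF r])
  have id: "(\<lambda>x. x) \<in> carrier P \<rightarrow> carrier P" by auto
  have l: "lin_ext R ?G ?e \<in> lin_maps R (free_module R {..<k}) ?G" by (rule lin_ext_lin_maps[OF G e])
  have p: "lin_ext R P (\<lambda>x. x) \<in> lin_maps R ?G P" by (rule lin_ext_lin_maps[OF assms(1) id])
  have "lin_ext R P (\<lambda>x. x) (lin_ext R ?G ?e y) = g y" if "y \<in> carrier (free_module R {..<k})" for y
  proof (rule lin_maps_free_module_eqI[OF assms(1) lin_maps_comp[OF l p] g _ that])
    fix j assume "j \<in> {..<k}"
    then show "lin_ext R P (\<lambda>x. x) (lin_ext R ?G ?e (unit_vector R j)) = g (unit_vector R j)"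
      using lin_ext_unit_vector[OF G e] lin_ext_unit_vector[OF assms(1) id u] by simp
  qed
  then have "\<forall>x\<in>carrier P. lin_ext R P (\<lambda>x. x) (lin_ext R ?G ?e (f x)) = x"
    using gf lin_maps_closed[OF f1(1)] by simp
  then show ?thesis
    unfolding projective_def using assms(1) lin_maps_comp[OF f1(1) l] p by blast
qed

section \<open>Comparison of resolutions\<close>

lemma syzygy_simps:
  "syzygy F \<delta> \<epsilon> U 0 = {x \<in> carrier (F 0). \<epsilon> x = \<zero>\<^bsub>U\<^esub>}"
  "syzygy F \<delta> \<epsilon> U (Suc j) = {x \<in> carrier (F (Suc j)). \<delta> j x = \<zero>\<^bsub>F j\<^esub>}"
  by (simp_all add: syzygy_def)

lemma resolution_infinityD:
  assumes "resolution R \<infinity> F \<delta> \<epsilon> U"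
  shows "left_module R U" "left_module R (F i)" "\<epsilon> \<in> lin_maps R (F 0) U" "\<epsilon> ` carrier (F 0) = carrier U"
    "\<delta> i \<in> lin_maps R (F (Suc i)) (F i)" "\<delta> i ` carrier (F (Suc i)) = syzygy F \<delta> \<epsilon> U i"
  using assms by (auto simp: resolution_def)

lemma resolution_infinityI:
  assumes "left_module R U" "\<And>i. left_module R (F i)" "\<epsilon> \<in> lin_maps R (F 0) U" "\<epsilon> ` carrier (F 0) = carrier U"
    "\<And>i. \<delta> i \<in> lin_maps R (F (Suc i)) (F i)" "\<And>i. \<delta> i ` carrier (F (Suc i)) = syzygy F \<delta> \<epsilon> U i"
  shows "resolution R \<infinity> F \<delta> \<epsilon> U"
  using assms by (auto simp: resolution_def)

lemma resolution_mono: "resolution R \<infinity> F \<delta> \<epsilon> U \<Longrightarrow> resolution R n F \<delta> \<epsilon> U"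
  by (auto simp: resolution_def)

lemma resolution_exact:
  assumes "resolution R \<infinity> F \<delta> \<epsilon> U"
  shows "x \<in> carrier (F 0) \<Longrightarrow> \<epsilon> x = \<zero>\<^bsub>U\<^esub> \<Longrightarrow> \<exists>y\<in>carrier (F (Suc 0)). x = \<delta> 0 y"
    "x \<in> carrier (F (Suc i)) \<Longrightarrow> \<delta> i x = \<zero>\<^bsub>F i\<^esub> \<Longrightarrow> \<exists>y\<in>carrier (F (Suc (Suc i))). x = \<delta> (Suc i) y"
proof -
  show "\<exists>y\<in>carrier (F (Suc 0)). x = \<delta> 0 y" if "x \<in> carrier (F 0)" "\<epsilon> x = \<zero>\<^bsub>U\<^esub>"
  proof -
    have "x \<in> \<delta> 0 ` carrier (F (Suc 0))"
      unfolding resolution_infinityD(6)[OF assms] syzygy_simps using that by simp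
    then show ?thesis by auto
  qed
  show "\<exists>y\<in>carrier (F (Suc (Suc i))). x = \<delta> (Suc i) y" if "x \<in> carrier (F (Suc i))" "\<delta> i x = \<zero>\<^bsub>F i\<^esub>"
  proof -
    have "x \<in> \<delta> (Suc i) ` carrier (F (Suc (Suc i)))"
      unfolding resolution_infinityD(6)[OF assms] syzygy_simps using that by simp
    then show ?thesis by auto
  qed
qed

lemma resolution_comp_zero:
  assumes "resolution R \<infinity> F \<delta> \<epsilon> U"
  shows "x \<in> carrier (F (Suc 0)) \<Longrightarrow> \<epsilon> (\<delta> 0 x) = \<zero>\<^bsub>U\<^esub>"
    "x \<in> carrier (F (Suc (Suc i))) \<Longrightarrow> \<delta> i (\<delta> (Suc i) x) = \<zero>\<^bsub>F i\<^esub>"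
proof -
  show "\<epsilon> (\<delta> 0 x) = \<zero>\<^bsub>U\<^esub>" if "x \<in> carrier (F (Suc 0))"
    using resolution_infinityD(6)[OF assms, of 0] that unfolding syzygy_simps by blast
  show "\<delta> i (\<delta> (Suc i) x) = \<zero>\<^bsub>F i\<^esub>" if "x \<in> carrier (F (Suc (Suc i)))"
    using resolution_infinityD(6)[OF assms, of "Suc i"] that unfolding syzygy_simps by blast
qed

lemma ex_chain_map:
  assumes P: "resolution R \<infinity> P \<delta>P \<epsilon>P U" and proj: "\<And>i. projective R (P i)"
    and Q: "resolution R \<infinity> Q \<delta>Q \<epsilon>Q V" and a: "a \<in> lin_maps R U V"
  obtains \<phi> where "\<And>i. \<phi> i \<in> lin_maps R (P i) (Q i)"
    "\<And>x. x \<in> carrier (P 0) \<Longrightarrow> \<epsilon>Q (\<phi> 0 x) = a (\<epsilon>P x)"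
    "\<And>i x. x \<in> carrier (P (Suc i)) \<Longrightarrow> \<delta>Q i (\<phi> (Suc i) x) = \<phi> i (\<delta>P i x)"
proof -
  note P' = resolution_infinityD[OF P] and Q' = resolution_infinityD[OF Q]
  \<comment> \<open>The induction keeps the property that lets the next square be filled:
    \<open>\<phi> i\<close> maps syzygies to syzygies, so \<open>\<phi> i\<close> after
    \<open>\<delta>P i\<close> lands in the image of \<open>\<delta>Q i\<close>. The augmentations
    concern only the first step.\<close>
  define good where "good i f \<longleftrightarrow> f \<in> lin_maps R (P i) (Q i) \<and>
      (\<forall>x\<in>syzygy P \<delta>P \<epsilon>P U i. f x \<in> syzygy Q \<delta>Q \<epsilon>Q V i) \<and>
      (i = 0 \<longrightarrow> (\<forall>x\<in>carrier (P 0). \<epsilon>Q (f x) = a (\<epsilon>P x)))" for i f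
  have "\<exists>\<phi>. \<forall>i. good i (\<phi> i) \<and> (\<forall>x\<in>carrier (P (Suc i)). \<delta>Q i (\<phi> (Suc i) x) = \<phi> i (\<delta>P i x))"
  proof (rule dependent_nat_choice)
    have "\<exists>f\<in>lin_maps R (P 0) (Q 0). \<forall>x\<in>carrier (P 0). \<epsilon>Q (f x) = a (\<epsilon>P x)"
      using lin_maps_closed[OF a] lin_maps_closed[OF P'(3)] Q'(4)
      by (intro projective_lift[OF proj Q'(1) Q'(2) lin_maps_comp[OF P'(3) a] Q'(3)]) auto
    then obtain f where f: "f \<in> lin_maps R (P 0) (Q 0)" "\<And>x. x \<in> carrier (P 0) \<Longrightarrow> \<epsilon>Q (f x) = a (\<epsilon>P x)"
      by blast
    then have "good 0 f"
      using lin_maps_zero[OF a P'(1) Q'(1)] lin_maps_closed[OF f(1)] by (auto simp: good_def syzygy_simps)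
    then show "\<exists>f. good 0 f" by blast
  next
    fix f i assume g: "good i f"
    then have f: "f \<in> lin_maps R (P i) (Q i)" by (simp add: good_def)
    have "(\<lambda>x. f (\<delta>P i x)) ` carrier (P (Suc i)) \<subseteq> \<delta>Q i ` carrier (Q (Suc i))"
      unfolding Q'(6) using g P'(6)[of i] by (auto simp: good_def)
    then have "\<exists>h\<in>lin_maps R (P (Suc i)) (Q (Suc i)). \<forall>x\<in>carrier (P (Suc i)). \<delta>Q i (h x) = f (\<delta>P i x)"
      by (rule projective_lift[OF proj Q'(2) Q'(2) lin_maps_comp[OF P'(5) f] Q'(5)])
    then obtain h where h: "h \<in> lin_maps R (P (Suc i)) (Q (Suc i))"
      "\<And>x. x \<in> carrier (P (Suc i)) \<Longrightarrow> \<delta>Q i (h x) = f (\<delta>P i x)" by blast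
    then have "good (Suc i) h"
      using lin_maps_zero[OF f P'(2) Q'(2)] lin_maps_closed[OF h(1)] by (auto simp: good_def syzygy_simps)
    then show "\<exists>h. good (Suc i) h \<and> (\<forall>x\<in>carrier (P (Suc i)). \<delta>Q i (h x) = f (\<delta>P i x))"
      using h by blast
  qed
  then obtain \<phi> where "\<forall>i. good i (\<phi> i) \<and> (\<forall>x\<in>carrier (P (Suc i)). \<delta>Q i (\<phi> (Suc i) x) = \<phi> i (\<delta>P i x))"
    by blast
  then show thesis by (intro that[of \<phi>]) (auto simp: good_def)
qed

text \<open>Applied to the difference of two lifts of one map, whence the hypothesis that
  \<open>\<chi> 0\<close> dies under the augmentation. The identity is recorded from degree one on,
  where homology will be tested.\<close>

lemma ex_homotopy:
  assumes P: "resolution R \<infinity> P \<delta>P \<epsilon>P U" and proj: "\<And>i. projective R (P i)"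
    and Q: "resolution R \<infinity> Q \<delta>Q \<epsilon>Q V" and \<chi>: "\<And>i. \<chi> i \<in> lin_maps R (P i) (Q i)"
    and \<chi>0: "\<And>x. x \<in> carrier (P 0) \<Longrightarrow> \<epsilon>Q (\<chi> 0 x) = \<zero>\<^bsub>V\<^esub>"
    and \<chi>S: "\<And>i x. x \<in> carrier (P (Suc i)) \<Longrightarrow> \<delta>Q i (\<chi> (Suc i) x) = \<chi> i (\<delta>P i x)"
  obtains h where "\<And>i. h i \<in> lin_maps R (P i) (Q (Suc i))"
    "\<And>i x. x \<in> carrier (P (Suc i)) \<Longrightarrow> \<delta>Q (Suc i) (h (Suc i) x) = \<chi> (Suc i) x \<ominus>\<^bsub>Q (Suc i)\<^esub> h i (\<delta>P i x)"
proof -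
  note P' = resolution_infinityD[OF P] and Q' = resolution_infinityD[OF Q]
  \<comment> \<open>On cycles the homotopy identity loses its second term, and this is all the next step needs.\<close>
  define good where "good i h \<longleftrightarrow> h \<in> lin_maps R (P i) (Q (Suc i)) \<and>
      (\<forall>x\<in>syzygy P \<delta>P \<epsilon>P U i. \<delta>Q i (h x) = \<chi> i x)" for i h
  have "\<exists>h. \<forall>i. good i (h i) \<and> (\<forall>x\<in>carrier (P (Suc i)).
      \<delta>Q (Suc i) (h (Suc i) x) = \<chi> (Suc i) x \<ominus>\<^bsub>Q (Suc i)\<^esub> h i (\<delta>P i x))"
  proof (rule dependent_nat_choice)
    have "\<chi> 0 ` carrier (P 0) \<subseteq> \<delta>Q 0 ` carrier (Q (Suc 0))"
      unfolding Q'(6) syzygy_simps using \<chi>0 lin_maps_closed[OF \<chi>] by auto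
    then have "\<exists>h\<in>lin_maps R (P 0) (Q (Suc 0)). \<forall>x\<in>carrier (P 0). \<delta>Q 0 (h x) = \<chi> 0 x"
      by (rule projective_lift[OF proj Q'(2) Q'(2) \<chi> Q'(5)])
    then show "\<exists>h. good 0 h" by (auto simp: good_def syzygy_simps)
  next
    fix h i assume g: "good i h"
    then have h: "h \<in> lin_maps R (P i) (Q (Suc i))" by (simp add: good_def)
    interpret Qi: left_module R "Q i" by (rule Q')
    interpret QS: left_module R "Q (Suc i)" by (rule Q')
    let ?f = "\<lambda>x. \<chi> (Suc i) x \<ominus>\<^bsub>Q (Suc i)\<^esub> h (\<delta>P i x)"
    have f: "?f \<in> lin_maps R (P (Suc i)) (Q (Suc i))"
      by (intro lin_maps_minus_fun Q' \<chi> lin_maps_comp[OF P'(5) h])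
    have "\<delta>Q i (?f x) = \<zero>\<^bsub>Q i\<^esub>" if x: "x \<in> carrier (P (Suc i))" for x
    proof -
      have s: "\<delta>P i x \<in> syzygy P \<delta>P \<epsilon>P U i" using x P'(6)[of i] by blast
      have d: "\<delta>P i x \<in> carrier (P i)" using lin_maps_closed[OF P'(5) x] .
      have "\<delta>Q i (?f x) = \<delta>Q i (\<chi> (Suc i) x) \<ominus>\<^bsub>Q i\<^esub> \<delta>Q i (h (\<delta>P i x))"
        by (intro lin_maps_diff[OF Q'(5) Q'(2) Q'(2)] lin_maps_closed[OF \<chi>] lin_maps_closed[OF h] x d)
      also have "\<dots> = \<zero>\<^bsub>Q i\<^esub>"
        using g s \<chi>S[OF x] lin_maps_closed[OF \<chi> d] by (simp add: good_def Qi.M.r_neg a_minus_def)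
      finally show ?thesis .
    qed
    then have "?f ` carrier (P (Suc i)) \<subseteq> \<delta>Q (Suc i) ` carrier (Q (Suc (Suc i)))"
      unfolding Q'(6) syzygy_simps using lin_maps_closed[OF f] by auto
    then have "\<exists>h\<in>lin_maps R (P (Suc i)) (Q (Suc (Suc i))). \<forall>x\<in>carrier (P (Suc i)). \<delta>Q (Suc i) (h x) = ?f x"
      by (rule projective_lift[OF proj Q'(2) Q'(2) f Q'(5)])
    then obtain h' where h': "h' \<in> lin_maps R (P (Suc i)) (Q (Suc (Suc i)))"
      "\<And>x. x \<in> carrier (P (Suc i)) \<Longrightarrow> \<delta>Q (Suc i) (h' x) = ?f x" by blast
    have "good (Suc i) h'"
      unfolding good_def syzygy_simps
      using h' lin_maps_zero[OF h P'(2) Q'(2)] lin_maps_closed[OF \<chi>[of "Suc i"]]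
      by (auto simp: a_minus_def)
    then show "\<exists>h'. good (Suc i) h' \<and> (\<forall>x\<in>carrier (P (Suc i)). \<delta>Q (Suc i) (h' x) = ?f x)"
      using h' by blast
  qed
  then obtain h where "\<forall>i. good i (h i) \<and> (\<forall>x\<in>carrier (P (Suc i)).
      \<delta>Q (Suc i) (h (Suc i) x) = \<chi> (Suc i) x \<ominus>\<^bsub>Q (Suc i)\<^esub> h i (\<delta>P i x))" by blast
  then show thesis by (intro that[of h]) (auto simp: good_def)
qed

lemma (in abelian_group) diff_add_cancel:
  "x \<in> carrier G \<Longrightarrow> y \<in> carrier G \<Longrightarrow> (x \<ominus> y) \<oplus> y = x"
  by (simp add: a_minus_def a_assoc l_neg)

lemma (in abelian_group) add_diff_cancel:
  "x \<in> carrier G \<Longrightarrow> y \<in> carrier G \<Longrightarrow> y \<oplus> (x \<ominus> y) = x"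
  using diff_add_cancel[of x y] by (simp add: a_comm)

text \<open>Only the homotopy between \<open>\<phi>\<psi>\<close> and the identity of
  \<open>Q\<close> is recorded: it carries exactness from \<open>P\<close> to \<open>Q\<close>, and
  the converse follows by exchanging the two resolutions.\<close>

lemma ex_homotopy_equivalence:
  assumes P: "resolution R \<infinity> P \<delta>P \<epsilon>P U" and projP: "\<And>i. projective R (P i)"
    and Q: "resolution R \<infinity> Q \<delta>Q \<epsilon>Q U" and projQ: "\<And>i. projective R (Q i)"
  obtains \<phi> \<psi> h where "\<And>i. \<phi> i \<in> lin_maps R (P i) (Q i)" "\<And>i. \<psi> i \<in> lin_maps R (Q i) (P i)"
    "\<And>i. h i \<in> lin_maps R (Q i) (Q (Suc i))"
    "\<And>i x. x \<in> carrier (P (Suc i)) \<Longrightarrow> \<delta>Q i (\<phi> (Suc i) x) = \<phi> i (\<delta>P i x)"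
    "\<And>i x. x \<in> carrier (Q (Suc i)) \<Longrightarrow> \<delta>P i (\<psi> (Suc i) x) = \<psi> i (\<delta>Q i x)"
    "\<And>i x. x \<in> carrier (Q (Suc i)) \<Longrightarrow>
       \<phi> (Suc i) (\<psi> (Suc i) x) = x \<oplus>\<^bsub>Q (Suc i)\<^esub> (\<delta>Q (Suc i) (h (Suc i) x) \<oplus>\<^bsub>Q (Suc i)\<^esub> h i (\<delta>Q i x))"
proof -
  note P' = resolution_infinityD[OF P] and Q' = resolution_infinityD[OF Q]
  obtain \<phi> where \<phi>: "\<And>i. \<phi> i \<in> lin_maps R (P i) (Q i)"
    "\<And>x. x \<in> carrier (P 0) \<Longrightarrow> \<epsilon>Q (\<phi> 0 x) = \<epsilon>P x"
    "\<And>i x. x \<in> carrier (P (Suc i)) \<Longrightarrow> \<delta>Q i (\<phi> (Suc i) x) = \<phi> i (\<delta>P i x)"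
    using ex_chain_map[OF P projP Q lin_maps_id] by blast
  obtain \<psi> where \<psi>: "\<And>i. \<psi> i \<in> lin_maps R (Q i) (P i)"
    "\<And>x. x \<in> carrier (Q 0) \<Longrightarrow> \<epsilon>P (\<psi> 0 x) = \<epsilon>Q x"
    "\<And>i x. x \<in> carrier (Q (Suc i)) \<Longrightarrow> \<delta>P i (\<psi> (Suc i) x) = \<psi> i (\<delta>Q i x)"
    using ex_chain_map[OF Q projQ P lin_maps_id] by blast
  define \<chi> where "\<chi> i = (\<lambda>x. \<phi> i (\<psi> i x) \<ominus>\<^bsub>Q i\<^esub> x)" for i
  note \<phi>c = lin_maps_closed[OF \<phi>(1)] and \<psi>c = lin_maps_closed[OF \<psi>(1)] and dc = lin_maps_closed[OF Q'(5)]
  have \<chi>: "\<chi> i \<in> lin_maps R (Q i) (Q i)" for i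
    unfolding \<chi>_def by (intro lin_maps_minus_fun Q' lin_maps_comp[OF \<psi>(1) \<phi>(1)] lin_maps_id)
  have \<chi>0: "\<epsilon>Q (\<chi> 0 x) = \<zero>\<^bsub>U\<^esub>" if x: "x \<in> carrier (Q 0)" for x
  proof -
    interpret U: left_module R U by (rule Q')
    have "\<epsilon>Q (\<chi> 0 x) = \<epsilon>Q (\<phi> 0 (\<psi> 0 x)) \<ominus>\<^bsub>U\<^esub> \<epsilon>Q x"
      unfolding \<chi>_def by (intro lin_maps_diff[OF Q'(3) Q'(2) Q'(1)] \<phi>c \<psi>c x)
    then show ?thesis
      using x \<phi>(2) \<psi>(2) \<psi>c lin_maps_closed[OF Q'(3)] by (simp add: U.M.r_neg a_minus_def)
  qed
  have \<chi>S: "\<delta>Q i (\<chi> (Suc i) x) = \<chi> i (\<delta>Q i x)" if x: "x \<in> carrier (Q (Suc i))" for i x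
  proof -
    have "\<delta>Q i (\<chi> (Suc i) x) = \<delta>Q i (\<phi> (Suc i) (\<psi> (Suc i) x)) \<ominus>\<^bsub>Q i\<^esub> \<delta>Q i x"
      unfolding \<chi>_def by (intro lin_maps_diff[OF Q'(5) Q'(2) Q'(2)] \<phi>c \<psi>c x)
    then show ?thesis using x \<phi>(3) \<psi>(3) \<psi>c by (simp add: \<chi>_def)
  qed
  obtain h where h: "\<And>i. h i \<in> lin_maps R (Q i) (Q (Suc i))"
    "\<And>i x. x \<in> carrier (Q (Suc i)) \<Longrightarrow> \<delta>Q (Suc i) (h (Suc i) x) = \<chi> (Suc i) x \<ominus>\<^bsub>Q (Suc i)\<^esub> h i (\<delta>Q i x)"
    using ex_homotopy[OF Q projQ Q \<chi> \<chi>0 \<chi>S] by blast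
  have "\<phi> (Suc i) (\<psi> (Suc i) x) = x \<oplus>\<^bsub>Q (Suc i)\<^esub> (\<delta>Q (Suc i) (h (Suc i) x) \<oplus>\<^bsub>Q (Suc i)\<^esub> h i (\<delta>Q i x))"
    if x: "x \<in> carrier (Q (Suc i))" for i x
  proof -
    interpret QS: left_module R "Q (Suc i)" by (rule Q')
    have c: "\<phi> (Suc i) (\<psi> (Suc i) x) \<in> carrier (Q (Suc i))" "h i (\<delta>Q i x) \<in> carrier (Q (Suc i))"
      using \<phi>c \<psi>c lin_maps_closed[OF h(1)] dc x by auto
    show ?thesis
      unfolding h(2)[OF x] \<chi>_def using c x
      by (simp add: QS.M.diff_add_cancel QS.M.add_diff_cancel)
  qed
  then show thesis using that[of \<phi> \<psi> h] \<phi> \<psi> h(1) by blast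
qed

section \<open>Ext in terms of arbitrary projective resolutions\<close>

text \<open>The index is shifted by one: \<open>hom_exact R N P \<delta> j\<close> concerns \<open>Hom(P\<^sub>j\<^sub>+\<^sub>1,N)\<close>, because
  only positive degrees are needed.\<close>

definition hom_exact ::
    "('r, 'x) ring_scheme \<Rightarrow> ('r, 'n, 'z) module_scheme \<Rightarrow> (nat \<Rightarrow> ('r, 'f, 'y) module_scheme) \<Rightarrow>
     (nat \<Rightarrow> 'f \<Rightarrow> 'f) \<Rightarrow> nat \<Rightarrow> bool" where
  "hom_exact R N P \<delta> j \<longleftrightarrow> (\<forall>f\<in>lin_maps R (P (Suc j)) N.
     (\<forall>x\<in>carrier (P (Suc (Suc j))). f (\<delta> (Suc j) x) = \<zero>\<^bsub>N\<^esub>) \<longrightarrow>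
     (\<exists>g\<in>lin_maps R (P j) N. \<forall>x\<in>carrier (P (Suc j)). f x = g (\<delta> j x)))"

lemma hom_exact_transfer:
  assumes P: "resolution R \<infinity> P \<delta>P \<epsilon>P U" and projP: "\<And>i. projective R (P i)"
    and Q: "resolution R \<infinity> Q \<delta>Q \<epsilon>Q U" and projQ: "\<And>i. projective R (Q i)"
    and N: "left_module R N" and ex: "hom_exact R N P \<delta>P j"
  shows "hom_exact R N Q \<delta>Q j"
  unfolding hom_exact_def
proof (intro ballI impI)
  interpret N: left_module R N by fact
  note P' = resolution_infinityD[OF P] and Q' = resolution_infinityD[OF Q]
  obtain \<phi> \<psi> h where \<phi>: "\<And>i. \<phi> i \<in> lin_maps R (P i) (Q i)" and \<psi>: "\<And>i. \<psi> i \<in> lin_maps R (Q i) (P i)"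
    and h: "\<And>i. h i \<in> lin_maps R (Q i) (Q (Suc i))"
    and \<phi>\<delta>: "\<And>i x. x \<in> carrier (P (Suc i)) \<Longrightarrow> \<delta>Q i (\<phi> (Suc i) x) = \<phi> i (\<delta>P i x)"
    and \<psi>\<delta>: "\<And>i x. x \<in> carrier (Q (Suc i)) \<Longrightarrow> \<delta>P i (\<psi> (Suc i) x) = \<psi> i (\<delta>Q i x)"
    and hom: "\<And>i x. x \<in> carrier (Q (Suc i)) \<Longrightarrow>
       \<phi> (Suc i) (\<psi> (Suc i) x) = x \<oplus>\<^bsub>Q (Suc i)\<^esub> (\<delta>Q (Suc i) (h (Suc i) x) \<oplus>\<^bsub>Q (Suc i)\<^esub> h i (\<delta>Q i x))"
    using ex_homotopy_equivalence[OF P projP Q projQ] by blast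
  note \<phi>c = lin_maps_closed[OF \<phi>] and \<psi>c = lin_maps_closed[OF \<psi>] and dc = lin_maps_closed[OF Q'(5)]
    and hc = lin_maps_closed[OF h] and dPc = lin_maps_closed[OF P'(5)]
  fix f assume f: "f \<in> lin_maps R (Q (Suc j)) N"
    and z: "\<forall>x\<in>carrier (Q (Suc (Suc j))). f (\<delta>Q (Suc j) x) = \<zero>\<^bsub>N\<^esub>"
  interpret QS: left_module R "Q (Suc j)" by (rule Q')
  have "\<forall>x\<in>carrier (P (Suc (Suc j))). f (\<phi> (Suc j) (\<delta>P (Suc j) x)) = \<zero>\<^bsub>N\<^esub>"
    using z \<phi>\<delta>[symmetric] \<phi>c by simp
  then obtain g where g: "g \<in> lin_maps R (P j) N"
    "\<And>x. x \<in> carrier (P (Suc j)) \<Longrightarrow> f (\<phi> (Suc j) x) = g (\<delta>P j x)"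
    using bspec[OF ex[unfolded hom_exact_def] lin_maps_comp[OF \<phi> f]] by blast
  show "\<exists>g\<in>lin_maps R (Q j) N. \<forall>x\<in>carrier (Q (Suc j)). f x = g (\<delta>Q j x)"
  proof (intro bexI ballI)
    \<comment> \<open>Apply \<open>f\<close> to
      \<open>\<phi>\<psi> = 1 + \<delta>h + h\<delta>\<close>: the term with
      \<open>f\<delta>\<close> vanishes, and
      \<open>f\<phi>\<psi> = g\<delta>\<psi> = g\<psi>\<delta>\<close>, so that
      \<open>f = (g\<psi> - fh)\<delta>\<close>.\<close>
    show "(\<lambda>y. g (\<psi> j y) \<ominus>\<^bsub>N\<^esub> f (h j y)) \<in> lin_maps R (Q j) N"
      by (intro lin_maps_minus_fun N lin_maps_comp[OF \<psi> g(1)] lin_maps_comp[OF h f])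
    fix x assume x: "x \<in> carrier (Q (Suc j))"
    note fc = lin_maps_closed[OF f]
    have c: "h (Suc j) x \<in> carrier (Q (Suc (Suc j)))" "\<delta>Q (Suc j) (h (Suc j) x) \<in> carrier (Q (Suc j))"
      "h j (\<delta>Q j x) \<in> carrier (Q (Suc j))"
      using hc dc x by auto
    have "g (\<psi> j (\<delta>Q j x)) = f (\<phi> (Suc j) (\<psi> (Suc j) x))"
      using g(2)[OF \<psi>c[OF x]] \<psi>\<delta>[OF x] by simp
    also have "\<dots> = f x \<oplus>\<^bsub>N\<^esub> f (h j (\<delta>Q j x))"
      unfolding hom[OF x] using c x z fc by (simp add: lin_maps_add[OF f])
    finally show "f x = g (\<psi> j (\<delta>Q j x)) \<ominus>\<^bsub>N\<^esub> f (h j (\<delta>Q j x))"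
      using fc[OF x] fc[OF c(3)] by (simp add: a_minus_def N.M.a_assoc N.M.r_neg)
  qed
qed

section \<open>Homology of a three-term complex\<close>

lemma abelian_subgroup_image_kernel:
  assumes "abelian_group G" "abelian_group G'" "abelian_group G0"
    and f: "f \<in> add_maps G G'" and g: "g \<in> add_maps G0 G"
    and fg: "\<And>x. x \<in> carrier G0 \<Longrightarrow> f (g x) = \<zero>\<^bsub>G'\<^esub>"
  shows "abelian_subgroup (g ` carrier G0) (G\<lparr>carrier := {x \<in> carrier G. f x = \<zero>\<^bsub>G'\<^esub>}\<rparr>)"
proof -
  interpret G: abelian_group G by fact
  interpret G': abelian_group G' by fact
  interpret G0: abelian_group G0 by fact
  let ?Z = "{x \<in> carrier G. f x = \<zero>\<^bsub>G'\<^esub>}"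
  let ?G = "G\<lparr>carrier := ?Z\<rparr>"
  have neg: "\<ominus>\<^bsub>G\<^esub> x \<in> ?Z" if "x \<in> ?Z" for x
    using that add_maps_minus[OF f assms(1,2)] by simp
  have G: "abelian_group ?G"
  proof (rule abelian_groupI)
    fix x assume "x \<in> carrier ?G"
    then show "\<exists>y\<in>carrier ?G. y \<oplus>\<^bsub>?G\<^esub> x = \<zero>\<^bsub>?G\<^esub>"
      using neg by (intro bexI[of _ "\<ominus>\<^bsub>G\<^esub> x"]) (auto simp: G.l_neg)
  qed (use add_maps_zero[OF f assms(1,2)] add_maps_add[OF f] in \<open>auto simp: G.a_ac\<close>)
  interpret G1: abelian_group ?G by fact
  have inv: "\<ominus>\<^bsub>?G\<^esub> x = \<ominus>\<^bsub>G\<^esub> x" if "x \<in> ?Z" for x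
    by (rule G1.minus_equality) (use that neg[OF that] in \<open>auto simp: G.l_neg\<close>)
  have gz: "g x \<in> ?Z" if "x \<in> carrier G0" for x using that fg add_maps_closed[OF g] by auto
  have "subgroup (g ` carrier G0) (add_monoid ?G)"
  proof (rule group.subgroupI[OF G1.a_group])
    show "g ` carrier G0 \<subseteq> carrier (add_monoid ?G)" using gz by auto
    show "g ` carrier G0 \<noteq> {}" using G0.zero_closed by blast
  next
    fix a assume "a \<in> g ` carrier G0"
    then obtain x where x: "x \<in> carrier G0" "a = g x" by auto
    have "inv\<^bsub>add_monoid ?G\<^esub> a = \<ominus>\<^bsub>G\<^esub> a" using inv gz x unfolding a_inv_def by simp
    also have "\<dots> = g (\<ominus>\<^bsub>G0\<^esub> x)" using x add_maps_minus[OF g assms(3,1)] by simp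
    finally show "inv\<^bsub>add_monoid ?G\<^esub> a \<in> g ` carrier G0" using x by simp
  next
    fix a b assume "a \<in> g ` carrier G0" "b \<in> g ` carrier G0"
    then show "a \<otimes>\<^bsub>add_monoid ?G\<^esub> b \<in> g ` carrier G0"
      using add_maps_add[OF g, symmetric] by auto
  qed
  then show ?thesis by (intro abelian_subgroupI3 additive_subgroup.intro G)
qed

text \<open>\<open>Ext\<close> and \<open>Tor\<close> are both quotients of the kernel of the
  outgoing map by the image of the incoming one, given as \<open>A_Mod\<close>. This turns their
  vanishing into exactness on elements, once for either direction of the differentials.\<close>

lemma trivial_homology_iff:
  assumes "abelian_group G" "abelian_group G'" "abelian_group G0"
    and f: "f \<in> add_maps G G'" and g: "g \<in> add_maps G0 G"
    and fg: "\<And>x. x \<in> carrier G0 \<Longrightarrow> f (g x) = \<zero>\<^bsub>G'\<^esub>"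
  shows "trivial_group (G\<lparr>carrier := {x \<in> carrier G. f x = \<zero>\<^bsub>G'\<^esub>}\<rparr> A_Mod (g ` carrier G0)) \<longleftrightarrow>
    (\<forall>x\<in>carrier G. f x = \<zero>\<^bsub>G'\<^esub> \<longrightarrow> (\<exists>y\<in>carrier G0. x = g y))" (is "trivial_group (?G A_Mod ?B) \<longleftrightarrow> _")
proof -
  interpret abelian_subgroup ?B ?G by (rule abelian_subgroup_image_kernel[OF assms])
  have "trivial_group (?G A_Mod ?B) \<longleftrightarrow> a_rcosets\<^bsub>?G\<^esub> ?B = {?B}"
    using a_factorgroup_is_group by (simp add: trivial_group_def A_FactGroup_def')
  also have "\<dots> \<longleftrightarrow> carrier ?G \<subseteq> ?B"
  proof
    assume *: "a_rcosets\<^bsub>?G\<^esub> ?B = {?B}"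
    show "carrier ?G \<subseteq> ?B"
    proof
      fix x assume x: "x \<in> carrier ?G"
      then have "?B +>\<^bsub>?G\<^esub> x \<in> a_rcosets\<^bsub>?G\<^esub> ?B" using a_rcosetsI[OF a_subset] by blast
      then show "x \<in> ?B" using * a_rcos_self[OF x] by simp
    qed
  next
    assume "carrier ?G \<subseteq> ?B"
    then have "?B +>\<^bsub>?G\<^esub> x = ?B" if "x \<in> carrier ?G" for x
      using that a_coset_join2[OF that] additive_subgroup_axioms additive_subgroup.a_subgroup by blast
    then show "a_rcosets\<^bsub>?G\<^esub> ?B = {?B}"
      using a_subgroup_in_rcosets unfolding A_RCOSETS_def' by blast
  qed
  finally show ?thesis by auto
qed

lemma hom_group_simps:
  "carrier (hom_group R A B) = lin_maps R A B \<inter> extensional (carrier A)"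
  "\<zero>\<^bsub>hom_group R A B\<^esub> = (\<lambda>x\<in>carrier A. \<zero>\<^bsub>B\<^esub>)"
  "f \<oplus>\<^bsub>hom_group R A B\<^esub> g = (\<lambda>x\<in>carrier A. f x \<oplus>\<^bsub>B\<^esub> g x)"
  by (simp_all add: hom_group_def)

lemma restrict_lin_maps:
  "left_module R A \<Longrightarrow> f \<in> lin_maps R A B \<Longrightarrow> restrict f (carrier A) \<in> lin_maps R A B"
  by (rule lin_maps_cong) auto

lemma abelian_group_hom_group:
  assumes "left_module R A" "left_module R B"
  shows "abelian_group (hom_group R A B)"
proof -
  interpret A: left_module R A by fact
  interpret B: left_module R B by fact
  show ?thesis
  proof (rule abelian_groupI)
    fix f assume "f \<in> carrier (hom_group R A B)"
    then have f: "f \<in> lin_maps R A B" by (simp add: hom_group_simps)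
    have "restrict (\<lambda>x. \<ominus>\<^bsub>B\<^esub> f x) (carrier A) \<in> lin_maps R A B"
      by (rule restrict_lin_maps[OF assms(1) lin_maps_uminus[OF assms(2) f]])
    then show "\<exists>g\<in>carrier (hom_group R A B). g \<oplus>\<^bsub>hom_group R A B\<^esub> f = \<zero>\<^bsub>hom_group R A B\<^esub>"
      using lin_maps_closed[OF f]
      by (intro bexI[of _ "restrict (\<lambda>x. \<ominus>\<^bsub>B\<^esub> f x) (carrier A)"])
        (auto simp: hom_group_simps B.M.l_neg fun_eq_iff)
  next
    fix f g assume "f \<in> carrier (hom_group R A B)" "g \<in> carrier (hom_group R A B)"
    then show "f \<oplus>\<^bsub>hom_group R A B\<^esub> g \<in> carrier (hom_group R A B)"
      using restrict_lin_maps[OF assms(1) lin_maps_plus[OF assms(2)]] by (auto simp: hom_group_simps)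
  next
    show "\<zero>\<^bsub>hom_group R A B\<^esub> \<in> carrier (hom_group R A B)"
      using restrict_lin_maps[OF assms(1) lin_maps_const_zero[OF assms(2)]] by (auto simp: hom_group_simps)
  next
    fix f g h assume "f \<in> carrier (hom_group R A B)" "g \<in> carrier (hom_group R A B)"
      "h \<in> carrier (hom_group R A B)"
    then show "f \<oplus>\<^bsub>hom_group R A B\<^esub> g \<oplus>\<^bsub>hom_group R A B\<^esub> h = f \<oplus>\<^bsub>hom_group R A B\<^esub> (g \<oplus>\<^bsub>hom_group R A B\<^esub> h)"
      by (auto simp: hom_group_simps fun_eq_iff B.M.a_assoc lin_maps_closed)
  next
    fix f g assume "f \<in> carrier (hom_group R A B)" "g \<in> carrier (hom_group R A B)"
    then show "f \<oplus>\<^bsub>hom_group R A B\<^esub> g = g \<oplus>\<^bsub>hom_group R A B\<^esub> f"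
      by (auto simp: hom_group_simps fun_eq_iff B.M.a_comm lin_maps_closed)
  next
    fix f assume "f \<in> carrier (hom_group R A B)"
    then show "\<zero>\<^bsub>hom_group R A B\<^esub> \<oplus>\<^bsub>hom_group R A B\<^esub> f = f"
      by (auto simp: hom_group_simps fun_eq_iff lin_maps_closed extensional_def)
  qed
qed

lemma compose_add_maps:
  assumes "left_module R A'" "d \<in> lin_maps R A' A"
  shows "(\<lambda>f. compose (carrier A') f d) \<in> add_maps (hom_group R A B) (hom_group R A' B)"
  by (intro add_mapsI)
    (use lin_maps_closed[OF assms(2)] restrict_lin_maps[OF assms(1) lin_maps_comp[OF assms(2)]] in
      \<open>auto simp: hom_group_simps compose_def fun_eq_iff\<close>)

text \<open>\<open>Ext\<close> is computed from the resolution picked by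
  \<open>proj_resolution\<close>, in a type of labels. Since \<open>hom_exact\<close> is invariant
  under homotopy, vanishing can be tested on any projective resolution, carried by any type.\<close>

theorem Ext_trivial_iff:
  assumes P: "resolution R \<infinity> P \<delta> \<epsilon> U" and projP: "\<And>i. projective R (P i)" and N: "left_module R N"
  shows "trivial_group (Ext R (Suc j) U N) \<longleftrightarrow> hom_exact R N P \<delta> j"
proof -
  obtain F d where Fd: "proj_resolution R U = (F, d)" by fastforce
  obtain e where F: "resolution R \<infinity> F d e U" and projF: "\<And>i. projective R (F i)"
    using is_proj_resolution_proj_resolution[OF resolution_infinityD(1)[OF P]]
    unfolding Fd is_proj_resolution_def by auto
  note F' = resolution_infinityD[OF F]
  note H = abelian_group_hom_group[OF F'(2) N]
  interpret Fj: left_module R "F (Suc j)" by (rule F')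
  interpret N: left_module R N by (rule N)
  let ?b = "\<lambda>j f. compose (carrier (F (Suc j))) f (d j)"
  have b: "?b j \<in> add_maps (hom_group R (F j) N) (hom_group R (F (Suc j)) N)" for j
    by (rule compose_add_maps[OF F'(2,5)])
  have bb: "?b (Suc j) (?b j f) = \<zero>\<^bsub>hom_group R (F (Suc (Suc j))) N\<^esub>"
    if "f \<in> carrier (hom_group R (F j) N)" for f
  proof
    fix x
    have "f \<in> lin_maps R (F j) N" using that by (simp add: hom_group_simps)
    then show "?b (Suc j) (?b j f) x = \<zero>\<^bsub>hom_group R (F (Suc (Suc j))) N\<^esub> x"
      using resolution_comp_zero(2)[OF F] lin_maps_closed[OF F'(5)] lin_maps_zero[OF _ F'(2) N, of f j]
      by (cases "x \<in> carrier (F (Suc (Suc j)))") (simp_all add: hom_group_simps compose_def)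
  qed
  have "trivial_group (Ext R (Suc j) U N) \<longleftrightarrow>
    (\<forall>f\<in>carrier (hom_group R (F (Suc j)) N). ?b (Suc j) f = \<zero>\<^bsub>hom_group R (F (Suc (Suc j))) N\<^esub> \<longrightarrow>
       (\<exists>g\<in>carrier (hom_group R (F j) N). f = ?b j g))"
    unfolding Ext_def Fd
    by (simp, rule trivial_homology_iff[OF H H H b b]) (rule bb)
  \<comment> \<open>Both sides are exactness at the same place. The left one speaks of extensional
    functions, because these form the carrier of \<open>hom_group\<close>, so maps are cut down to
    their domain before they are compared.\<close>
  also have "\<dots> \<longleftrightarrow> hom_exact R N F d j"
  proof
    assume L: "\<forall>f\<in>carrier (hom_group R (F (Suc j)) N). ?b (Suc j) f = \<zero>\<^bsub>hom_group R (F (Suc (Suc j))) N\<^esub> \<longrightarrow>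
       (\<exists>g\<in>carrier (hom_group R (F j) N). f = ?b j g)"
    show "hom_exact R N F d j"
      unfolding hom_exact_def
    proof (intro ballI impI)
      fix f assume f: "f \<in> lin_maps R (F (Suc j)) N" and z: "\<forall>x\<in>carrier (F (Suc (Suc j))). f (d (Suc j) x) = \<zero>\<^bsub>N\<^esub>"
      let ?f = "restrict f (carrier (F (Suc j)))"
      have "?f \<in> carrier (hom_group R (F (Suc j)) N)"
        using restrict_lin_maps[OF F'(2) f] by (simp add: hom_group_simps)
      moreover have "?b (Suc j) ?f = \<zero>\<^bsub>hom_group R (F (Suc (Suc j))) N\<^esub>"
        using z lin_maps_closed[OF F'(5)] by (auto simp: hom_group_simps compose_def fun_eq_iff)
      ultimately obtain g where g: "g \<in> lin_maps R (F j) N" "?f = ?b j g"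
        using L by (auto simp: hom_group_simps)
      have "f x = g (d j x)" if "x \<in> carrier (F (Suc j))" for x
        using fun_cong[OF g(2), of x] that by (simp add: compose_def)
      then show "\<exists>g\<in>lin_maps R (F j) N. \<forall>x\<in>carrier (F (Suc j)). f x = g (d j x)" using g(1) by blast
    qed
  next
    assume ex: "hom_exact R N F d j"
    show "\<forall>f\<in>carrier (hom_group R (F (Suc j)) N). ?b (Suc j) f = \<zero>\<^bsub>hom_group R (F (Suc (Suc j))) N\<^esub> \<longrightarrow>
       (\<exists>g\<in>carrier (hom_group R (F j) N). f = ?b j g)"
    proof (intro ballI impI)
      fix f assume f: "f \<in> carrier (hom_group R (F (Suc j)) N)"
        and z: "?b (Suc j) f = \<zero>\<^bsub>hom_group R (F (Suc (Suc j))) N\<^esub>"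
      have "f (d (Suc j) x) = \<zero>\<^bsub>N\<^esub>" if "x \<in> carrier (F (Suc (Suc j)))" for x
        using fun_cong[OF z, of x] that by (simp add: compose_def hom_group_simps)
      then obtain g where g: "g \<in> lin_maps R (F j) N" "\<And>x. x \<in> carrier (F (Suc j)) \<Longrightarrow> f x = g (d j x)"
        using ex f unfolding hom_exact_def by (auto simp: hom_group_simps)
      show "\<exists>g\<in>carrier (hom_group R (F j) N). f = ?b j g"
      proof (rule bexI[of _ "restrict g (carrier (F j))"])
        show "f = ?b j (restrict g (carrier (F j)))"
          using g f lin_maps_closed[OF F'(5)] by (auto simp: compose_def hom_group_simps fun_eq_iff extensional_def)
        show "restrict g (carrier (F j)) \<in> carrier (hom_group R (F j) N)"
          using restrict_lin_maps[OF F'(2) g(1)] by (simp add: hom_group_simps)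
      qed
    qed
  qed
  also have "\<dots> \<longleftrightarrow> hom_exact R N P \<delta> j"
    using hom_exact_transfer[OF F projF P projP N] hom_exact_transfer[OF P projP F projF N] by blast
  finally show ?thesis .
qed

lemmas frag_supp_induct [consumes 1, case_names zero diff of] = free_Abelian_group_induct

section \<open>Tensor products\<close>

lemma op_ring_simps [simp]:
  "carrier (op_ring R) = carrier R" "\<one>\<^bsub>op_ring R\<^esub> = \<one>\<^bsub>R\<^esub>" "\<zero>\<^bsub>op_ring R\<^esub> = \<zero>\<^bsub>R\<^esub>"
  "x \<oplus>\<^bsub>op_ring R\<^esub> y = x \<oplus>\<^bsub>R\<^esub> y" "x \<otimes>\<^bsub>op_ring R\<^esub> y = y \<otimes>\<^bsub>R\<^esub> x"
  by (simp_all add: op_ring_def)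

text \<open>The additive extension of \<open>\<beta>\<close> to formal sums. With
  \<open>\<beta> k f = f k\<close> it is the very expression inside \<open>bass_counit\<close>,
  which is why it is written as a sum over the support.\<close>

definition frag_lift :: "('g, 'z) ring_scheme \<Rightarrow> ('a \<Rightarrow> 'b \<Rightarrow> 'g) \<Rightarrow> ('a \<times> 'b \<Rightarrow>\<^sub>0 int) \<Rightarrow> 'g" where
  "frag_lift G \<beta> x = (\<Oplus>\<^bsub>G\<^esub>p\<in>Poly_Mapping.keys x. [Poly_Mapping.lookup x p] \<cdot>\<^bsub>G\<^esub> \<beta> (fst p) (snd p))"

context abelian_group
begin

text \<open>A common finite index set lets formal sums with different supports be added; outside the
  support the multiple is by the integer zero.\<close>

lemma frag_lift_eq_finsum:
  assumes "finite T" "Poly_Mapping.keys x \<subseteq> T" "\<And>a b. (a, b) \<in> T \<Longrightarrow> \<beta> a b \<in> carrier G"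
  shows "frag_lift G \<beta> x = (\<Oplus>p\<in>T. [Poly_Mapping.lookup x p] \<cdot> \<beta> (fst p) (snd p))"
  unfolding frag_lift_def
  by (rule add.finprod_mono_neutral_cong_left)
    (use assms in \<open>auto simp: in_keys_iff add_pow_def[of G "0 :: int"] intro!: add.int_pow_closed\<close>)

lemma frag_lift_closed:
  "Poly_Mapping.keys x \<subseteq> S \<Longrightarrow> (\<And>a b. (a, b) \<in> S \<Longrightarrow> \<beta> a b \<in> carrier G) \<Longrightarrow> frag_lift G \<beta> x \<in> carrier G"
  unfolding frag_lift_def by (intro finsum_closed) (auto intro!: add.int_pow_closed)

lemma frag_lift_add:
  assumes "Poly_Mapping.keys x \<subseteq> S" "Poly_Mapping.keys y \<subseteq> S" "\<And>a b. (a, b) \<in> S \<Longrightarrow> \<beta> a b \<in> carrier G"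
  shows "frag_lift G \<beta> (x + y) = frag_lift G \<beta> x \<oplus> frag_lift G \<beta> y"
proof -
  let ?T = "Poly_Mapping.keys x \<union> Poly_Mapping.keys y"
  have \<beta>: "\<beta> (fst p) (snd p) \<in> carrier G" if "p \<in> ?T" for p
    using assms that by (cases p) auto
  have "frag_lift G \<beta> (x + y) = (\<Oplus>p\<in>?T. [Poly_Mapping.lookup (x + y) p] \<cdot> \<beta> (fst p) (snd p))"
    using assms keys_add[of x y] by (intro frag_lift_eq_finsum) auto
  also have "\<dots> = (\<Oplus>p\<in>?T. [Poly_Mapping.lookup x p] \<cdot> \<beta> (fst p) (snd p) \<oplus>
      [Poly_Mapping.lookup y p] \<cdot> \<beta> (fst p) (snd p))"
    using \<beta> by (intro finsum_cong') (auto simp: lookup_add add.int_pow_mult intro!: add.int_pow_closed)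
  also have "\<dots> = (\<Oplus>p\<in>?T. [Poly_Mapping.lookup x p] \<cdot> \<beta> (fst p) (snd p)) \<oplus>
      (\<Oplus>p\<in>?T. [Poly_Mapping.lookup y p] \<cdot> \<beta> (fst p) (snd p))"
    using \<beta> by (intro finsum_addf) (auto intro!: add.int_pow_closed)
  also have "\<dots> = frag_lift G \<beta> x \<oplus> frag_lift G \<beta> y"
    using assms by (subst (1 2) frag_lift_eq_finsum[where T = ?T]) auto
  finally show ?thesis .
qed

lemma frag_lift_zero: "frag_lift G \<beta> 0 = \<zero>"
  by (simp add: frag_lift_def)

lemma frag_lift_minus:
  assumes "Poly_Mapping.keys x \<subseteq> S" "\<And>a b. (a, b) \<in> S \<Longrightarrow> \<beta> a b \<in> carrier G"
  shows "frag_lift G \<beta> (- x) = \<ominus> frag_lift G \<beta> x"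
proof -
  have "frag_lift G \<beta> (- x) \<oplus> frag_lift G \<beta> x = \<zero>"
    using frag_lift_add[of "- x" S x \<beta>] assms by (simp add: frag_lift_zero)
  then show ?thesis
    using minus_equality frag_lift_closed[of x S \<beta>] frag_lift_closed[of "- x" S \<beta>] assms by auto
qed

lemma frag_lift_diff:
  assumes "Poly_Mapping.keys x \<subseteq> S" "Poly_Mapping.keys y \<subseteq> S" "\<And>a b. (a, b) \<in> S \<Longrightarrow> \<beta> a b \<in> carrier G"
  shows "frag_lift G \<beta> (x - y) = frag_lift G \<beta> x \<ominus> frag_lift G \<beta> y"
  using frag_lift_add[of x S "- y" \<beta>] frag_lift_minus[of y S \<beta>] assms by (simp add: a_minus_def)

lemma frag_lift_of: "\<beta> a b \<in> carrier G \<Longrightarrow> frag_lift G \<beta> (frag_of (a, b)) = \<beta> a b"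
  by (simp add: frag_lift_def)

end

section \<open>Balanced maps and the universal property of the tensor product\<close>

abbreviation tens ::
    "('r, 'x) ring_scheme \<Rightarrow> ('r, 'a, 'y) module_scheme \<Rightarrow> ('r, 'b, 'z) module_scheme \<Rightarrow>
     'a \<Rightarrow> 'b \<Rightarrow> ('a \<times> 'b \<Rightarrow>\<^sub>0 int) set" where
  "tens R A B a b \<equiv> tensor_class R A B (frag_of (a, b))"

definition balanced ::
    "('r, 'x) ring_scheme \<Rightarrow> ('r, 'a, 'y) module_scheme \<Rightarrow> ('r, 'b, 'z) module_scheme \<Rightarrow>
     ('g, 'w) ring_scheme \<Rightarrow> ('a \<Rightarrow> 'b \<Rightarrow> 'g) \<Rightarrow> bool" where
  "balanced R A B G \<beta> \<longleftrightarrow>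
     (\<forall>a\<in>carrier A. \<forall>b\<in>carrier B. \<beta> a b \<in> carrier G) \<and>
     (\<forall>a\<in>carrier A. \<forall>a'\<in>carrier A. \<forall>b\<in>carrier B. \<beta> (a \<oplus>\<^bsub>A\<^esub> a') b = \<beta> a b \<oplus>\<^bsub>G\<^esub> \<beta> a' b) \<and>
     (\<forall>a\<in>carrier A. \<forall>b\<in>carrier B. \<forall>b'\<in>carrier B. \<beta> a (b \<oplus>\<^bsub>B\<^esub> b') = \<beta> a b \<oplus>\<^bsub>G\<^esub> \<beta> a b') \<and>
     (\<forall>r\<in>carrier R. \<forall>a\<in>carrier A. \<forall>b\<in>carrier B. \<beta> (r \<odot>\<^bsub>A\<^esub> a) b = \<beta> a (r \<odot>\<^bsub>B\<^esub> b))"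

text \<open>A class is evaluated on all its representatives at once. For balanced
  \<open>\<beta>\<close> the image is a singleton, by \<open>tensor_lift_cls\<close>; the shape is
  that of \<open>bass_counit\<close>.\<close>

definition tensor_lift :: "('g, 'z) ring_scheme \<Rightarrow> ('a \<Rightarrow> 'b \<Rightarrow> 'g) \<Rightarrow> ('a \<times> 'b \<Rightarrow>\<^sub>0 int) set \<Rightarrow> 'g" where
  "tensor_lift G \<beta> X = the_elem (frag_lift G \<beta> ` X)"

lemma bass_counit_eq_tensor_lift: "bass_counit K N = tensor_lift N (\<lambda>k f. f k)"
  by (simp add: bass_counit_def tensor_lift_def frag_lift_def fun_eq_iff)

locale tensor_pair =
  fixes R :: "('r, 'x) ring_scheme" and A :: "('r, 'a, 'y) module_scheme" and B :: "('r, 'b, 'z) module_scheme"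
  assumes left: "left_module (op_ring R) A" and right: "left_module R B"
begin

sublocale A: left_module "op_ring R" A by (rule left)
sublocale B: left_module R B by (rule right)

abbreviation "FA \<equiv> free_Abelian_group (carrier A \<times> carrier B)"
abbreviation "supp x \<equiv> Poly_Mapping.keys x \<subseteq> carrier A \<times> carrier B"
abbreviation "T \<equiv> tensor_group R A B"
abbreviation "rel \<equiv> tensor_relations R A B"
abbreviation "cls \<equiv> tensor_class R A B"
abbreviation "tns \<equiv> tens R A B"

lemma supp_diff: "supp x \<Longrightarrow> supp y \<Longrightarrow> supp (x - y)"
  using keys_diff[of x y] by blast

text \<open>Induction over the generated subgroup. The support is carried along because the
  evaluations applied to relations are additive only on sums supported in the two carriers.\<close>

lemma rel_induct [consumes 1, case_names left right mid zero minus add]: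
  assumes "h \<in> rel"
    and "\<And>a a' b. a \<in> carrier A \<Longrightarrow> a' \<in> carrier A \<Longrightarrow> b \<in> carrier B \<Longrightarrow>
        P (frag_of (a \<oplus>\<^bsub>A\<^esub> a', b) - frag_of (a, b) - frag_of (a', b))"
    and "\<And>a b b'. a \<in> carrier A \<Longrightarrow> b \<in> carrier B \<Longrightarrow> b' \<in> carrier B \<Longrightarrow>
        P (frag_of (a, b \<oplus>\<^bsub>B\<^esub> b') - frag_of (a, b) - frag_of (a, b'))"
    and "\<And>r a b. r \<in> carrier R \<Longrightarrow> a \<in> carrier A \<Longrightarrow> b \<in> carrier B \<Longrightarrow>
        P (frag_of (r \<odot>\<^bsub>A\<^esub> a, b) - frag_of (a, r \<odot>\<^bsub>B\<^esub> b))"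
    and "P 0" and "\<And>x. supp x \<Longrightarrow> P x \<Longrightarrow> P (- x)" and "\<And>x y. supp x \<Longrightarrow> supp y \<Longrightarrow> P x \<Longrightarrow> P y \<Longrightarrow> P (x + y)"
  shows "supp h \<and> P h"
proof -
  have gen: "supp h \<and> P h" if "h \<in> {frag_of (a \<oplus>\<^bsub>A\<^esub> a', b) - frag_of (a, b) - frag_of (a', b) | a a' b.
         a \<in> carrier A \<and> a' \<in> carrier A \<and> b \<in> carrier B} \<union>
      {frag_of (a, b \<oplus>\<^bsub>B\<^esub> b') - frag_of (a, b) - frag_of (a, b') | a b b'.
         a \<in> carrier A \<and> b \<in> carrier B \<and> b' \<in> carrier B} \<union>
      {frag_of (r \<odot>\<^bsub>A\<^esub> a, b) - frag_of (a, r \<odot>\<^bsub>B\<^esub> b) | a b r.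
         a \<in> carrier A \<and> b \<in> carrier B \<and> r \<in> carrier R}" for h
    using that
  proof (elim UnE)
    assume "h \<in> {frag_of (a \<oplus>\<^bsub>A\<^esub> a', b) - frag_of (a, b) - frag_of (a', b) | a a' b.
         a \<in> carrier A \<and> a' \<in> carrier A \<and> b \<in> carrier B}"
    then obtain a a' b where h: "h = frag_of (a \<oplus>\<^bsub>A\<^esub> a', b) - frag_of (a, b) - frag_of (a', b)"
      "a \<in> carrier A" "a' \<in> carrier A" "b \<in> carrier B" by blast
    have "supp h" unfolding h(1) using h(2-) by (intro supp_diff) simp_all
    then show ?thesis using assms(2)[OF h(2-4)] h(1) by simp
  next
    assume "h \<in> {frag_of (a, b \<oplus>\<^bsub>B\<^esub> b') - frag_of (a, b) - frag_of (a, b') | a b b'.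
         a \<in> carrier A \<and> b \<in> carrier B \<and> b' \<in> carrier B}"
    then obtain a b b' where h: "h = frag_of (a, b \<oplus>\<^bsub>B\<^esub> b') - frag_of (a, b) - frag_of (a, b')"
      "a \<in> carrier A" "b \<in> carrier B" "b' \<in> carrier B" by blast
    have "supp h" unfolding h(1) using h(2-) by (intro supp_diff) simp_all
    then show ?thesis using assms(3)[OF h(2-4)] h(1) by simp
  next
    assume "h \<in> {frag_of (r \<odot>\<^bsub>A\<^esub> a, b) - frag_of (a, r \<odot>\<^bsub>B\<^esub> b) | a b r.
         a \<in> carrier A \<and> b \<in> carrier B \<and> r \<in> carrier R}"
    then obtain a b r where h: "h = frag_of (r \<odot>\<^bsub>A\<^esub> a, b) - frag_of (a, r \<odot>\<^bsub>B\<^esub> b)"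
      "r \<in> carrier R" "a \<in> carrier A" "b \<in> carrier B"
      by blast
    have "supp h" unfolding h(1) using h(2-) by (intro supp_diff) simp_all
    then show ?thesis using assms(4)[OF h(2-4)] h(1) by simp
  qed
  from assms(1)[unfolded tensor_relations_def] show ?thesis
  proof (induction h rule: generate.induct)
    case one
    then show ?case using assms(5) by simp
  next
    case (incl h)
    then show ?case by (rule gen)
  next
    case (inv h)
    then show ?case using gen[OF inv] assms(6) by simp
  next
    case (eng h1 h2)
    then show ?case using assms(7) keys_add[of h1 h2] by auto
  qed
qed

lemma rel_supp: "h \<in> rel \<Longrightarrow> supp h"
  using rel_induct[of h "\<lambda>_. True"] by blast

lemma rel_left: "a \<in> carrier A \<Longrightarrow> a' \<in> carrier A \<Longrightarrow> b \<in> carrier B \<Longrightarrow>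
        frag_of (a \<oplus>\<^bsub>A\<^esub> a', b) - frag_of (a, b) - frag_of (a', b) \<in> rel"
  and rel_right: "a \<in> carrier A \<Longrightarrow> b \<in> carrier B \<Longrightarrow> b' \<in> carrier B \<Longrightarrow>
        frag_of (a, b \<oplus>\<^bsub>B\<^esub> b') - frag_of (a, b) - frag_of (a, b') \<in> rel"
  and rel_mid: "r \<in> carrier R \<Longrightarrow> a \<in> carrier A \<Longrightarrow> b \<in> carrier B \<Longrightarrow>
        frag_of (r \<odot>\<^bsub>A\<^esub> a, b) - frag_of (a, r \<odot>\<^bsub>B\<^esub> b) \<in> rel"
  unfolding tensor_relations_def by (blast intro: generate.incl)+

lemma rel_subgroup: "subgroup rel FA"
  unfolding tensor_relations_def
proof (rule group.generate_is_subgroup[OF group_free_Abelian_group], rule subsetI)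
  fix x assume "x \<in> {frag_of (a \<oplus>\<^bsub>A\<^esub> a', b) - frag_of (a, b) - frag_of (a', b) | a a' b.
         a \<in> carrier A \<and> a' \<in> carrier A \<and> b \<in> carrier B} \<union>
      {frag_of (a, b \<oplus>\<^bsub>B\<^esub> b') - frag_of (a, b) - frag_of (a, b') | a b b'.
         a \<in> carrier A \<and> b \<in> carrier B \<and> b' \<in> carrier B} \<union>
      {frag_of (r \<odot>\<^bsub>A\<^esub> a, b) - frag_of (a, r \<odot>\<^bsub>B\<^esub> b) | a b r.
         a \<in> carrier A \<and> b \<in> carrier B \<and> r \<in> carrier R}"
  then have "x \<in> rel" unfolding tensor_relations_def by (rule generate.incl)
  then show "x \<in> carrier FA" using rel_supp by simp
qed

lemma rel_zero: "0 \<in> rel"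
  using subgroup.one_closed[OF rel_subgroup] by simp

lemma rel_add: "x \<in> rel \<Longrightarrow> y \<in> rel \<Longrightarrow> x + y \<in> rel"
  using subgroup.m_closed[OF rel_subgroup] by simp

lemma rel_minus: "x \<in> rel \<Longrightarrow> - x \<in> rel"
  using subgroup.m_inv_closed[OF rel_subgroup, of x] rel_supp[of x] by simp

lemma cls_def': "cls x = {h + x | h. h \<in> rel}"
  by (auto simp: tensor_class_def r_coset_def)

lemma cls_eq_iff: "cls x = cls y \<longleftrightarrow> x - y \<in> rel"
proof
  assume "cls x = cls y"
  then have "0 + x \<in> cls y" using rel_zero unfolding cls_def' by blast
  then show "x - y \<in> rel" by (auto simp: cls_def')
next
  have *: "cls x \<subseteq> cls y" if "x - y \<in> rel" for x y
  proof
    fix z assume "z \<in> cls x"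
    then obtain h where "h \<in> rel" "z = h + x" by (auto simp: cls_def')
    then have "z = (h + (x - y)) + y" "h + (x - y) \<in> rel" using that rel_add by auto
    then show "z \<in> cls y" unfolding cls_def' by blast
  qed
  assume "x - y \<in> rel"
  moreover then have "y - x \<in> rel" using rel_minus by fastforce
  ultimately show "cls x = cls y" using * by blast
qed

lemma carrier_T: "carrier T = cls ` {x. supp x}"
  by (auto simp: tensor_group_def Let_def FactGroup_def RCOSETS_def tensor_class_def)

lemma zero_T: "\<zero>\<^bsub>T\<^esub> = cls 0"
  by (simp add: tensor_group_def Let_def FactGroup_def cls_def')

lemma rel_normal: "rel \<lhd> FA"
  using comm_group.normal_iff_subgroup[OF abelian_free_Abelian_group] rel_subgroup by blast

lemma add_T: "supp x \<Longrightarrow> supp y \<Longrightarrow> cls x \<oplus>\<^bsub>T\<^esub> cls y = cls (x + y)"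
  using normal.rcos_sum[OF rel_normal, of x y]
  by (simp add: tensor_group_def Let_def FactGroup_def tensor_class_def)

lemma abelian_group_T: "abelian_group T"
proof (rule abelian_groupI)
  fix X assume "X \<in> carrier T"
  then obtain x where "X = cls x" "supp x" by (auto simp: carrier_T)
  then show "\<exists>Y\<in>carrier T. Y \<oplus>\<^bsub>T\<^esub> X = \<zero>\<^bsub>T\<^esub>"
    by (intro bexI[of _ "cls (- x)"]) (auto simp: add_T zero_T carrier_T)
next
  fix X Y assume "X \<in> carrier T" "Y \<in> carrier T"
  then obtain x y where "X = cls x" "supp x" "Y = cls y" "supp y" by (auto simp: carrier_T)
  moreover then have "supp (x + y)" using keys_add[of x y] by blast
  ultimately show "X \<oplus>\<^bsub>T\<^esub> Y \<in> carrier T" by (auto simp: add_T carrier_T)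
next
  fix X Y Z assume "X \<in> carrier T" "Y \<in> carrier T" "Z \<in> carrier T"
  then obtain x y z where xyz: "X = cls x" "supp x" "Y = cls y" "supp y" "Z = cls z" "supp z" by (auto simp: carrier_T)
  moreover then have "supp (x + y)" "supp (y + z)" using keys_add[of x y] keys_add[of y z] by blast+
  ultimately show "X \<oplus>\<^bsub>T\<^esub> Y \<oplus>\<^bsub>T\<^esub> Z = X \<oplus>\<^bsub>T\<^esub> (Y \<oplus>\<^bsub>T\<^esub> Z)" by (simp add: add_T add.assoc)
next
  fix X Y assume "X \<in> carrier T" "Y \<in> carrier T"
  then show "X \<oplus>\<^bsub>T\<^esub> Y = Y \<oplus>\<^bsub>T\<^esub> X" by (auto simp: add_T carrier_T add.commute)
qed (auto simp: zero_T carrier_T add_T)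

sublocale T: abelian_group T by (rule abelian_group_T)

lemma minus_T: "supp x \<Longrightarrow> \<ominus>\<^bsub>T\<^esub> cls x = cls (- x)"
  by (rule T.minus_equality) (auto simp: add_T zero_T carrier_T)

lemma diff_T: "supp x \<Longrightarrow> supp y \<Longrightarrow> cls x \<ominus>\<^bsub>T\<^esub> cls y = cls (x - y)"
  using add_T[of x "- y"] by (simp add: a_minus_def minus_T)

lemma tns_closed [simp, intro]: "a \<in> carrier A \<Longrightarrow> b \<in> carrier B \<Longrightarrow> tns a b \<in> carrier T"
  by (auto simp: carrier_T)

lemma tns_add_left:
  assumes "a \<in> carrier A" "a' \<in> carrier A" "b \<in> carrier B"
  shows "tns (a \<oplus>\<^bsub>A\<^esub> a') b = tns a b \<oplus>\<^bsub>T\<^esub> tns a' b"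
  using rel_left[OF assms] assms by (simp add: add_T cls_eq_iff diff_diff_add)

lemma tns_add_right:
  assumes "a \<in> carrier A" "b \<in> carrier B" "b' \<in> carrier B"
  shows "tns a (b \<oplus>\<^bsub>B\<^esub> b') = tns a b \<oplus>\<^bsub>T\<^esub> tns a b'"
  using rel_right[OF assms] assms by (simp add: add_T cls_eq_iff diff_diff_add)

lemma tns_smult:
  assumes "r \<in> carrier R" "a \<in> carrier A" "b \<in> carrier B"
  shows "tns (r \<odot>\<^bsub>A\<^esub> a) b = tns a (r \<odot>\<^bsub>B\<^esub> b)"
  using rel_mid[OF assms] by (simp add: cls_eq_iff)

lemma tns_left_add_maps: "b \<in> carrier B \<Longrightarrow> (\<lambda>a. tns a b) \<in> add_maps A T"
  by (intro add_mapsI) (auto simp: tns_add_left)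

lemma tns_right_add_maps: "a \<in> carrier A \<Longrightarrow> (\<lambda>b. tns a b) \<in> add_maps B T"
  by (intro add_mapsI) (auto simp: tns_add_right)

text \<open>Pure tensors and sums suffice as cases: zero is \<open>0 \<otimes> 0\<close>, and the
  negative of \<open>a \<otimes> b\<close> is the pure tensor of \<open>\<ominus> a\<close> and
  \<open>b\<close>.\<close>

lemma T_induct [consumes 1, case_names tns add]:
  assumes "X \<in> carrier T" and tns: "\<And>a b. a \<in> carrier A \<Longrightarrow> b \<in> carrier B \<Longrightarrow> P (tns a b)"
    and add: "\<And>X Y. X \<in> carrier T \<Longrightarrow> Y \<in> carrier T \<Longrightarrow> P X \<Longrightarrow> P Y \<Longrightarrow> P (X \<oplus>\<^bsub>T\<^esub> Y)"
  shows "P X"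
proof -
  obtain x where x: "X = cls x" "supp x" using assms(1) by (auto simp: carrier_T)
  \<comment> \<open>The induction over formal sums proceeds by differences, while \<open>P\<close>
    is known to be stable only under sums; claiming \<open>P\<close> for \<open>x\<close> and
    \<open>- x\<close> together turns a difference into a sum.\<close>
  have "P (cls x) \<and> P (cls (- x))" using x(2)
  proof (induction x rule: frag_supp_induct)
    case zero
    have "P (tns \<zero>\<^bsub>A\<^esub> \<zero>\<^bsub>B\<^esub>)" by (rule tns) auto
    moreover have "tns \<zero>\<^bsub>A\<^esub> \<zero>\<^bsub>B\<^esub> = \<zero>\<^bsub>T\<^esub>"
      by (rule add_maps_zero[OF tns_left_add_maps A.M.abelian_group_axioms T.abelian_group_axioms]) auto
    ultimately show ?case by (simp add: zero_T)
  next
    case (diff x y)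
    have "P (cls x \<oplus>\<^bsub>T\<^esub> cls (- y))" "P (cls y \<oplus>\<^bsub>T\<^esub> cls (- x))"
      using diff by (auto intro!: add simp: carrier_T)
    then show ?case using diff by (simp add: add_T)
  next
    case (of p)
    then obtain a b where p: "p = (a, b)" "a \<in> carrier A" "b \<in> carrier B" by auto
    have "tns (\<ominus>\<^bsub>A\<^esub> a) b = \<ominus>\<^bsub>T\<^esub> tns a b"
      by (rule add_maps_minus[OF tns_left_add_maps A.M.abelian_group_axioms T.abelian_group_axioms]) (use p in auto)
    then have "cls (- frag_of p) = tns (\<ominus>\<^bsub>A\<^esub> a) b" using p by (simp add: minus_T)
    then show ?case using p tns by simp
  qed
  then show ?thesis by (simp add: x)
qed

lemma add_maps_T_eqI:
  assumes "f \<in> add_maps T G" "g \<in> add_maps T G"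
    "\<And>a b. a \<in> carrier A \<Longrightarrow> b \<in> carrier B \<Longrightarrow> f (tns a b) = g (tns a b)" "X \<in> carrier T"
  shows "f X = g X"
  using assms(4) by (induction rule: T_induct) (use assms(1-3) in \<open>auto simp: add_maps_add\<close>)

text \<open>A balanced map kills the three families of generators, hence all of \<open>rel\<close>.
  It is therefore constant on each coset, and \<open>the_elem\<close> returns that constant.\<close>

lemma tensor_lift_cls:
  assumes "abelian_group G" "balanced R A B G \<beta>" "supp x"
  shows "tensor_lift G \<beta> (cls x) = frag_lift G \<beta> x"
proof -
  interpret G: abelian_group G by fact
  have \<beta>: "\<beta> a b \<in> carrier G" if "(a, b) \<in> carrier A \<times> carrier B" for a b
    using assms(2) that by (auto simp: balanced_def)
  have of: "frag_lift G \<beta> (frag_of (a, b)) = \<beta> a b" if "(a, b) \<in> carrier A \<times> carrier B" for a b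
    using G.frag_lift_of[of \<beta> a b] \<beta>[OF that] by simp
  have d: "frag_lift G \<beta> (x - y) = frag_lift G \<beta> x \<ominus>\<^bsub>G\<^esub> frag_lift G \<beta> y" if "supp x" "supp y" for x y
    by (rule G.frag_lift_diff[OF that]) (rule \<beta>)
  have cl: "frag_lift G \<beta> x \<in> carrier G" if "supp x" for x
    by (rule G.frag_lift_closed[OF that]) (rule \<beta>)
  have d3: "frag_lift G \<beta> (frag_of p - frag_of q - frag_of s) =
      \<beta> (fst p) (snd p) \<ominus>\<^bsub>G\<^esub> \<beta> (fst q) (snd q) \<ominus>\<^bsub>G\<^esub> \<beta> (fst s) (snd s)"
    if "p \<in> carrier A \<times> carrier B" "q \<in> carrier A \<times> carrier B" "s \<in> carrier A \<times> carrier B" for p q s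
  proof -
    have "supp (frag_of p - frag_of q)" using that keys_diff[of "frag_of p" "frag_of q"] by auto
    then have "frag_lift G \<beta> (frag_of p - frag_of q - frag_of s) =
        frag_lift G \<beta> (frag_of p - frag_of q) \<ominus>\<^bsub>G\<^esub> frag_lift G \<beta> (frag_of s)"
      using that by (intro d) auto
    moreover have "frag_lift G \<beta> (frag_of p - frag_of q) = frag_lift G \<beta> (frag_of p) \<ominus>\<^bsub>G\<^esub> frag_lift G \<beta> (frag_of q)"
      using that by (intro d) auto
    ultimately show ?thesis using that of by (cases p; cases q; cases s) simp
  qed
  have z: "frag_lift G \<beta> h = \<zero>\<^bsub>G\<^esub>" if "h \<in> rel" for h
  proof -
    have "supp h \<and> frag_lift G \<beta> h = \<zero>\<^bsub>G\<^esub>" using that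
    proof (induction h rule: rel_induct)
      case (left a a' b)
      then show ?case using assms(2) \<beta>
        by (subst d3) (auto simp: balanced_def a_minus_def G.a_ac G.r_neg2 G.r_neg)
    next
      case (right a b b')
      then show ?case using assms(2) \<beta>
        by (subst d3) (auto simp: balanced_def a_minus_def G.a_ac G.r_neg2 G.r_neg)
    next
      case (mid r a b)
      then have "\<beta> (r \<odot>\<^bsub>A\<^esub> a) b = \<beta> a (r \<odot>\<^bsub>B\<^esub> b)" "(r \<odot>\<^bsub>A\<^esub> a, b) \<in> carrier A \<times> carrier B"
          "(a, r \<odot>\<^bsub>B\<^esub> b) \<in> carrier A \<times> carrier B"
        using assms(2) by (auto simp: balanced_def)
      then show ?case using \<beta> of by (simp add: d a_minus_def G.r_neg)
    next
      case zero
      show ?case by (rule G.frag_lift_zero)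
    next
      case (minus x)
      then show ?case using G.frag_lift_minus[where \<beta> = \<beta> and S = "carrier A \<times> carrier B", OF _ \<beta>] by simp
    next
      case (add x y)
      then show ?case using G.frag_lift_add[where \<beta> = \<beta> and S = "carrier A \<times> carrier B", OF _ _ \<beta>] by simp
    qed
    then show ?thesis by simp
  qed
  have "frag_lift G \<beta> (h + x) = frag_lift G \<beta> x" if "h \<in> rel" for h
    using G.frag_lift_add[where \<beta> = \<beta> and S = "carrier A \<times> carrier B", OF rel_supp[OF that] assms(3) \<beta>] z[OF that] cl[OF assms(3)] by simp
  moreover have "cls x \<noteq> {}" using rel_zero by (auto simp: cls_def')
  ultimately have "frag_lift G \<beta> ` cls x = {frag_lift G \<beta> x}" by (auto simp: cls_def' image_def)
  then show ?thesis by (simp add: tensor_lift_def)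
qed

lemma tensor_lift_add_maps:
  assumes "abelian_group G" "balanced R A B G \<beta>"
  shows "tensor_lift G \<beta> \<in> add_maps T G"
proof -
  interpret G: abelian_group G by fact
  have \<beta>: "\<beta> a b \<in> carrier G" if "(a, b) \<in> carrier A \<times> carrier B" for a b
    using assms(2) that by (auto simp: balanced_def)
  show ?thesis
  proof (intro add_mapsI)
    fix X assume "X \<in> carrier T"
    then show "tensor_lift G \<beta> X \<in> carrier G"
      using tensor_lift_cls[OF assms] G.frag_lift_closed[where \<beta> = \<beta> and S = "carrier A \<times> carrier B", OF _ \<beta>] by (auto simp: carrier_T)
  next
    fix X Y assume "X \<in> carrier T" "Y \<in> carrier T"
    then obtain x y where xy: "X = cls x" "supp x" "Y = cls y" "supp y" by (auto simp: carrier_T)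
    then have "supp (x + y)" using keys_add[of x y] by blast
    then show "tensor_lift G \<beta> (X \<oplus>\<^bsub>T\<^esub> Y) = tensor_lift G \<beta> X \<oplus>\<^bsub>G\<^esub> tensor_lift G \<beta> Y"
      using xy tensor_lift_cls[OF assms] G.frag_lift_add[where \<beta> = \<beta> and S = "carrier A \<times> carrier B", OF _ _ \<beta>, of x y] by (simp add: add_T)
  qed
qed

lemma tensor_lift_tns:
  assumes "abelian_group G" "balanced R A B G \<beta>" "a \<in> carrier A" "b \<in> carrier B"
  shows "tensor_lift G \<beta> (tns a b) = \<beta> a b"
  using tensor_lift_cls[OF assms(1,2), of "frag_of (a, b)"] abelian_group.frag_lift_of[OF assms(1), of \<beta> a b] assms
  by (auto simp: balanced_def)

end

text \<open>Linearity of \<open>f\<close> and \<open>g\<close> makes the induced map on formal sums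
  carry relations to relations, so the union over representatives in \<open>tensor_map\<close> is a
  union of equal classes.\<close>

lemma tensor_map_cls:
  assumes "tensor_pair R A B" "tensor_pair R A' B'" and f: "f \<in> lin_maps (op_ring R) A A'" and g: "g \<in> lin_maps R B B'"
    and x: "Poly_Mapping.keys x \<subseteq> carrier A \<times> carrier B"
  shows "tensor_map R A' B' f g (tensor_class R A B x) =
      tensor_class R A' B' (frag_extend (\<lambda>(a, b). frag_of (f a, g b)) x)"
    "Poly_Mapping.keys (frag_extend (\<lambda>(a, b). frag_of (f a, g b)) x) \<subseteq> carrier A' \<times> carrier B'"
proof -
  interpret P: tensor_pair R A B by fact
  interpret Q: tensor_pair R A' B' by fact
  let ?e = "frag_extend (\<lambda>(a, b). frag_of (f a, g b))"
  have h: "?e h \<in> Q.rel" if "h \<in> P.rel" for h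
  proof -
    have "P.supp h \<and> ?e h \<in> Q.rel" using that
    proof (induction h rule: P.rel_induct)
      case (left a a' b)
      then show ?case using Q.rel_left[of "f a" "f a'" "g b"]
        by (simp add: frag_extend_diff lin_maps_add[OF f] lin_maps_closed[OF f] lin_maps_closed[OF g])
    next
      case (right a b b')
      then show ?case using Q.rel_right[of "f a" "g b" "g b'"]
        by (simp add: frag_extend_diff lin_maps_add[OF g] lin_maps_closed[OF f] lin_maps_closed[OF g])
    next
      case (mid r a b)
      then show ?case using Q.rel_mid[of r "f a" "g b"]
        by (simp add: frag_extend_diff lin_maps_smult[OF g] lin_maps_smult[OF f] lin_maps_closed[OF f] lin_maps_closed[OF g])
    qed (auto simp: frag_extend_minus frag_extend_add Q.rel_zero Q.rel_minus Q.rel_add)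
    then show ?thesis by simp
  qed
  have "Q.cls (?e (h + x)) = Q.cls (?e x)" if "h \<in> P.rel" for h
    using h[OF that] by (simp add: Q.cls_eq_iff frag_extend_add)
  moreover have "P.cls x \<noteq> {}" using P.rel_zero by (auto simp: P.cls_def')
  ultimately show "tensor_map R A' B' f g (P.cls x) = Q.cls (?e x)"
    unfolding tensor_map_def P.cls_def' by blast
  show "Q.supp (?e x)" using x
  proof (induction x rule: frag_supp_induct)
    case (diff x y)
    then show ?case using keys_diff[of "?e x" "?e y"] by (auto simp: frag_extend_diff)
  qed (auto simp: lin_maps_closed[OF f] lin_maps_closed[OF g])
qed

lemma tensor_map_add_maps:
  assumes "tensor_pair R A B" "tensor_pair R A' B'" "f \<in> lin_maps (op_ring R) A A'" "g \<in> lin_maps R B B'"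
  shows "tensor_map R A' B' f g \<in> add_maps (tensor_group R A B) (tensor_group R A' B')"
proof -
  interpret P: tensor_pair R A B by fact
  interpret Q: tensor_pair R A' B' by fact
  note c = tensor_map_cls[OF assms]
  show ?thesis
  proof (intro add_mapsI)
    fix X assume "X \<in> carrier P.T"
    then show "tensor_map R A' B' f g X \<in> carrier Q.T" using c by (auto simp: P.carrier_T Q.carrier_T)
  next
    fix X Y assume "X \<in> carrier P.T" "Y \<in> carrier P.T"
    then obtain x y where xy: "X = P.cls x" "P.supp x" "Y = P.cls y" "P.supp y" by (auto simp: P.carrier_T)
    then have "P.supp (x + y)" using keys_add[of x y] by blast
    then show "tensor_map R A' B' f g (X \<oplus>\<^bsub>P.T\<^esub> Y) = tensor_map R A' B' f g X \<oplus>\<^bsub>Q.T\<^esub> tensor_map R A' B' f g Y"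
      using xy c by (simp add: P.add_T Q.add_T frag_extend_add)
  qed
qed

lemma tensor_map_tens:
  assumes "tensor_pair R A B" "tensor_pair R A' B'" "f \<in> lin_maps (op_ring R) A A'" "g \<in> lin_maps R B B'"
    "a \<in> carrier A" "b \<in> carrier B"
  shows "tensor_map R A' B' f g (tens R A B a b) = tens R A' B' (f a) (g b)"
  using tensor_map_cls(1)[OF assms(1-4), of "frag_of (a, b)"] assms(5,6) by simp

section \<open>Tensoring linear maps with a fixed module\<close>

abbreviation tmap ::
    "('r, 'x) ring_scheme \<Rightarrow> ('r, 'b, 'z) module_scheme \<Rightarrow> ('r, 'c, 'y) module_scheme \<Rightarrow> ('a \<Rightarrow> 'c) \<Rightarrow>
     ('a \<times> 'b \<Rightarrow>\<^sub>0 int) set \<Rightarrow> ('c \<times> 'b \<Rightarrow>\<^sub>0 int) set" where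
  "tmap R B A' f \<equiv> tensor_map R A' B f (\<lambda>y. y)"

context
  fixes R :: "('r, 'x) ring_scheme" and B :: "('r, 'b, 'z) module_scheme"
  assumes B: "left_module R B"
begin

lemma tensor_pairI: "left_module (op_ring R) A \<Longrightarrow> tensor_pair R A B"
  using B by (simp add: tensor_pair_def)

lemma abelian_group_tensor_group: "left_module (op_ring R) A \<Longrightarrow> abelian_group (tensor_group R A B)"
  by (intro tensor_pair.abelian_group_T tensor_pairI)

lemma tmap_add_maps:
  assumes "left_module (op_ring R) A" "left_module (op_ring R) A'" "f \<in> lin_maps (op_ring R) A A'"
  shows "tmap R B A' f \<in> add_maps (tensor_group R A B) (tensor_group R A' B)"
  by (intro tensor_map_add_maps tensor_pairI assms lin_maps_id)

lemma tmap_tens: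
  assumes "left_module (op_ring R) A" "left_module (op_ring R) A'" "f \<in> lin_maps (op_ring R) A A'"
    "a \<in> carrier A" "b \<in> carrier B"
  shows "tmap R B A' f (tens R A B a b) = tens R A' B (f a) b"
  by (intro tensor_map_tens tensor_pairI assms lin_maps_id)

lemma tmap_closed:
  assumes "left_module (op_ring R) A" "left_module (op_ring R) A'" "f \<in> lin_maps (op_ring R) A A'"
    "X \<in> carrier (tensor_group R A B)"
  shows "tmap R B A' f X \<in> carrier (tensor_group R A' B)"
  by (rule add_maps_closed[OF tmap_add_maps[OF assms(1-3)] assms(4)])

lemma tmap_cong:
  assumes "left_module (op_ring R) A" "left_module (op_ring R) A'" "f \<in> lin_maps (op_ring R) A A'"
    "\<And>a. a \<in> carrier A \<Longrightarrow> f a = g a" "X \<in> carrier (tensor_group R A B)"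
  shows "tmap R B A' f X = tmap R B A' g X"
proof (rule tensor_pair.add_maps_T_eqI[OF tensor_pairI[OF assms(1)] tmap_add_maps[OF assms(1-3)] _ _ assms(5)])
  have g: "g \<in> lin_maps (op_ring R) A A'" by (rule lin_maps_cong[OF assms(3,1,4)])
  then show "tmap R B A' g \<in> add_maps (tensor_group R A B) (tensor_group R A' B)"
    by (rule tmap_add_maps[OF assms(1,2)])
  show "tmap R B A' f (tens R A B a b) = tmap R B A' g (tens R A B a b)" if "a \<in> carrier A" "b \<in> carrier B" for a b
    using tmap_tens[OF assms(1-3) that] tmap_tens[OF assms(1,2) g that] assms(4)[OF that(1)] by simp
qed

lemma tmap_comp:
  assumes "left_module (op_ring R) A" "left_module (op_ring R) A'" "left_module (op_ring R) A''"
    "f \<in> lin_maps (op_ring R) A A'" "g \<in> lin_maps (op_ring R) A' A''" "X \<in> carrier (tensor_group R A B)"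
  shows "tmap R B A'' g (tmap R B A' f X) = tmap R B A'' (\<lambda>x. g (f x)) X"
  by (rule tensor_pair.add_maps_T_eqI[OF tensor_pairI[OF assms(1)]
        add_maps_comp[OF tmap_add_maps[OF assms(1,2,4)] tmap_add_maps[OF assms(2,3,5)]]
        tmap_add_maps[OF assms(1,3) lin_maps_comp[OF assms(4,5)]] _ assms(6)])
    (simp add: tmap_tens[OF assms(1,2,4)] tmap_tens[OF assms(2,3,5)] lin_maps_closed[OF assms(4)]
      tmap_tens[OF assms(1,3) lin_maps_comp[OF assms(4,5)]])

lemma tmap_id:
  assumes "left_module (op_ring R) A" "X \<in> carrier (tensor_group R A B)"
  shows "tmap R B A (\<lambda>x. x) X = X"
proof (rule tensor_pair.add_maps_T_eqI[OF tensor_pairI[OF assms(1)] tmap_add_maps[OF assms(1,1) lin_maps_id] _ _ assms(2)])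
  show "(\<lambda>x. x) \<in> add_maps (tensor_group R A B) (tensor_group R A B)" by (intro add_mapsI refl)
qed (simp add: tmap_tens[OF assms(1,1) lin_maps_id])

lemma tmap_plus:
  assumes "left_module (op_ring R) A" "left_module (op_ring R) A'" "f \<in> lin_maps (op_ring R) A A'"
    "g \<in> lin_maps (op_ring R) A A'" "X \<in> carrier (tensor_group R A B)"
  shows "tmap R B A' (\<lambda>x. f x \<oplus>\<^bsub>A'\<^esub> g x) X = tmap R B A' f X \<oplus>\<^bsub>tensor_group R A' B\<^esub> tmap R B A' g X"
proof (rule tensor_pair.add_maps_T_eqI[OF tensor_pairI[OF assms(1)]
      tmap_add_maps[OF assms(1,2) lin_maps_plus[OF assms(2-4)]] _ _ assms(5)])
  interpret Q: tensor_pair R A' B by (rule tensor_pairI[OF assms(2)])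
  note f = tmap_add_maps[OF assms(1-3)] and g = tmap_add_maps[OF assms(1,2,4)]
  show "(\<lambda>X. tmap R B A' f X \<oplus>\<^bsub>tensor_group R A' B\<^esub> tmap R B A' g X) \<in> add_maps (tensor_group R A B) (tensor_group R A' B)"
    by (intro add_mapsI) (auto simp: add_maps_add[OF f] add_maps_add[OF g] add_maps_closed[OF f] add_maps_closed[OF g] Q.T.a_ac)
  fix a b assume ab: "a \<in> carrier A" "b \<in> carrier B"
  show "tmap R B A' (\<lambda>x. f x \<oplus>\<^bsub>A'\<^esub> g x) (tens R A B a b) =
      tmap R B A' f (tens R A B a b) \<oplus>\<^bsub>tensor_group R A' B\<^esub> tmap R B A' g (tens R A B a b)"
    using ab by (simp add: tmap_tens[OF assms(1,2) lin_maps_plus[OF assms(2-4)]] tmap_tens[OF assms(1-3)]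
        tmap_tens[OF assms(1,2,4)] Q.tns_add_left lin_maps_closed[OF assms(3)] lin_maps_closed[OF assms(4)])
qed

lemma tmap_const_zero:
  assumes "left_module (op_ring R) A" "left_module (op_ring R) A'" "X \<in> carrier (tensor_group R A B)"
  shows "tmap R B A' (\<lambda>x. \<zero>\<^bsub>A'\<^esub>) X = \<zero>\<^bsub>tensor_group R A' B\<^esub>"
proof -
  interpret Q: tensor_pair R A' B by (rule tensor_pairI[OF assms(2)])
  note z = lin_maps_const_zero[OF assms(2), of A]
  have "tmap R B A' (\<lambda>x. \<zero>\<^bsub>A'\<^esub>) X = tmap R B A' (\<lambda>x. \<zero>\<^bsub>A'\<^esub> \<oplus>\<^bsub>A'\<^esub> \<zero>\<^bsub>A'\<^esub>) X" by simp
  also have "\<dots> = tmap R B A' (\<lambda>x. \<zero>\<^bsub>A'\<^esub>) X \<oplus>\<^bsub>tensor_group R A' B\<^esub> tmap R B A' (\<lambda>x. \<zero>\<^bsub>A'\<^esub>) X"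
    by (rule tmap_plus[OF assms(1,2) z z assms(3)])
  finally show ?thesis using tmap_closed[OF assms(1,2) z assms(3)] by simp
qed

lemma tmap_uminus:
  assumes "left_module (op_ring R) A" "left_module (op_ring R) A'" "f \<in> lin_maps (op_ring R) A A'"
    "X \<in> carrier (tensor_group R A B)"
  shows "tmap R B A' (\<lambda>x. \<ominus>\<^bsub>A'\<^esub> f x) X = \<ominus>\<^bsub>tensor_group R A' B\<^esub> tmap R B A' f X"
proof -
  interpret Q: tensor_pair R A' B by (rule tensor_pairI[OF assms(2)])
  note m = lin_maps_uminus[OF assms(2,3)]
  have "tmap R B A' (\<lambda>x. \<ominus>\<^bsub>A'\<^esub> f x) X \<oplus>\<^bsub>Q.T\<^esub> tmap R B A' f X = tmap R B A' (\<lambda>x. \<ominus>\<^bsub>A'\<^esub> f x \<oplus>\<^bsub>A'\<^esub> f x) X"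
    by (rule tmap_plus[OF assms(1,2) m assms(3,4), symmetric])
  also have "\<dots> = tmap R B A' (\<lambda>x. \<zero>\<^bsub>A'\<^esub>) X"
    by (rule tmap_cong[OF assms(1,2) lin_maps_plus[OF assms(2) m assms(3)] _ assms(4)])
      (simp add: lin_maps_closed[OF assms(3)] Q.A.M.l_neg)
  finally show ?thesis
    using tmap_const_zero[OF assms(1,2,4)] tmap_closed[OF assms(1,2) m assms(4)] tmap_closed[OF assms]
    by (intro Q.T.minus_equality[symmetric]) auto
qed

lemma tmap_surj:
  assumes "left_module (op_ring R) A" "left_module (op_ring R) A'" "f \<in> lin_maps (op_ring R) A A'"
    "f ` carrier A = carrier A'" "Y \<in> carrier (tensor_group R A' B)"
  shows "\<exists>X\<in>carrier (tensor_group R A B). tmap R B A' f X = Y"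
proof -
  interpret P: tensor_pair R A B by (rule tensor_pairI[OF assms(1)])
  interpret Q: tensor_pair R A' B by (rule tensor_pairI[OF assms(2)])
  note f = tmap_add_maps[OF assms(1-3)]
  show ?thesis using assms(5)
  proof (induction Y rule: Q.T_induct)
    case (tns a' b)
    then obtain a where "a \<in> carrier A" "a' = f a" using assms(4) by auto
    then show ?case using tns tmap_tens[OF assms(1-3)] by (intro bexI[of _ "P.tns a b"]) auto
  next
    case (add X Y)
    then show ?case using add_maps_add[OF f] P.T.a_closed by metis
  qed
qed

text \<open>Exactness at the middle term. \<open>I\<close> is the image of
  \<open>Y \<otimes> B\<close>, and the computation takes place modulo \<open>I\<close> inside
  \<open>Z \<otimes> B\<close>, which stands in for the quotient group.\<close>

lemma tensor_right_exact:
  assumes Y: "left_module (op_ring R) Y" and Z: "left_module (op_ring R) Z" and W: "left_module (op_ring R) W"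
    and u: "u \<in> lin_maps (op_ring R) Y Z" and p: "p \<in> lin_maps (op_ring R) Z W"
    and surj: "p ` carrier Z = carrier W"
    and ker: "\<And>z. z \<in> carrier Z \<Longrightarrow> p z = \<zero>\<^bsub>W\<^esub> \<Longrightarrow> \<exists>y\<in>carrier Y. z = u y"
    and X: "X \<in> carrier (tensor_group R Z B)" and pX: "tmap R B W p X = \<zero>\<^bsub>tensor_group R W B\<^esub>"
  shows "\<exists>X'\<in>carrier (tensor_group R Y B). X = tmap R B Z u X'"
proof -
  interpret Y: tensor_pair R Y B by (rule tensor_pairI[OF Y])
  interpret Z: tensor_pair R Z B by (rule tensor_pairI[OF Z])
  interpret W: tensor_pair R W B by (rule tensor_pairI[OF W])
  define I where "I = tmap R B Z u ` carrier Y.T"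
  note tu = tmap_add_maps[OF Y Z u]
  have Iz: "\<zero>\<^bsub>Z.T\<^esub> \<in> I"
    using add_maps_zero[OF tu Y.abelian_group_T Z.abelian_group_T] Y.T.zero_closed unfolding I_def by (metis imageI)
  have Ia: "x \<oplus>\<^bsub>Z.T\<^esub> y \<in> I" if "x \<in> I" "y \<in> I" for x y
    using that add_maps_add[OF tu, symmetric] Y.T.a_closed unfolding I_def by auto
  have Im: "\<ominus>\<^bsub>Z.T\<^esub> x \<in> I" if "x \<in> I" for x
    using that add_maps_minus[OF tu Y.abelian_group_T Z.abelian_group_T, symmetric] unfolding I_def by auto
  have Ic: "x \<in> carrier Z.T" if "x \<in> I" for x using that add_maps_closed[OF tu] unfolding I_def by auto
  have Id: "x \<ominus>\<^bsub>Z.T\<^esub> y \<in> I" if "x \<in> I" "y \<in> I" for x y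
    using Ia[OF that(1) Im[OF that(2)]] by (simp add: a_minus_def)
  \<comment> \<open>Two lifts of one element of \<open>W\<close> differ by an element of the kernel
    of \<open>p\<close>, that is, of the image of \<open>u\<close>; so their tensors with
    \<open>b\<close> differ by an element of \<open>I\<close>.\<close>
  have key: "Z.tns z b \<ominus>\<^bsub>Z.T\<^esub> Z.tns z' b \<in> I" if "z \<in> carrier Z" "z' \<in> carrier Z" "b \<in> carrier B" "p z = p z'" for z z' b
  proof -
    have "p (z \<ominus>\<^bsub>Z\<^esub> z') = \<zero>\<^bsub>W\<^esub>"
      using lin_maps_diff[OF p Z W that(1,2)] lin_maps_closed[OF p that(1)] that(4)
      by (simp add: a_minus_def W.A.M.r_neg)
    then have "\<exists>y\<in>carrier Y. z \<ominus>\<^bsub>Z\<^esub> z' = u y" by (intro ker Z.A.M.minus_closed that)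
    then obtain y where y: "y \<in> carrier Y" "z \<ominus>\<^bsub>Z\<^esub> z' = u y" by blast
    have "Z.tns z b \<ominus>\<^bsub>Z.T\<^esub> Z.tns z' b = Z.tns (z \<ominus>\<^bsub>Z\<^esub> z') b"
      by (rule add_maps_diff[OF Z.tns_left_add_maps Z.A.M.abelian_group_axioms Z.abelian_group_T, symmetric])
        (use that in auto)
    also have "\<dots> = tmap R B Z u (Y.tns y b)" using y tmap_tens[OF Y Z u _ that(3)] by simp
    finally show ?thesis using y that by (auto simp: I_def)
  qed
  \<comment> \<open>The inverse \<open>W \<otimes> B \<rightarrow> (Z \<otimes> B) / I\<close> is defined on formal sums, from a mere set-theoretic section of \<open>p\<close>.\<close>
  define s where "s w = (SOME z. z \<in> carrier Z \<and> p z = w)" for w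
  have s: "s w \<in> carrier Z" "p (s w) = w" if "w \<in> carrier W" for w
  proof -
    have "\<exists>z. z \<in> carrier Z \<and> p z = w" using that unfolding surj[symmetric] by auto
    from someI_ex[OF this] show "s w \<in> carrier Z" "p (s w) = w" by (auto simp: s_def)
  qed
  let ?\<beta> = "\<lambda>w b. Z.tns (s w) b"
  let ?\<sigma> = "frag_lift Z.T ?\<beta>"
  have \<beta>: "?\<beta> w b \<in> carrier Z.T" if "(w, b) \<in> carrier W \<times> carrier B" for w b using that s by auto
  have \<sigma>d: "?\<sigma> (x - y) = ?\<sigma> x \<ominus>\<^bsub>Z.T\<^esub> ?\<sigma> y" if "W.supp x" "W.supp y" for x y
    by (rule Z.T.frag_lift_diff[OF that]) (rule \<beta>)
  note \<sigma>of = Z.T.frag_lift_of[where \<beta> = ?\<beta>, OF \<beta>]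
  have \<sigma>d3: "?\<sigma> (frag_of (w, b) - frag_of (w', b') - frag_of (w'', b'')) =
      ?\<beta> w b \<ominus>\<^bsub>Z.T\<^esub> (?\<beta> w' b' \<oplus>\<^bsub>Z.T\<^esub> ?\<beta> w'' b'')"
    if c: "w \<in> carrier W" "w' \<in> carrier W" "w'' \<in> carrier W" "b \<in> carrier B" "b' \<in> carrier B" "b'' \<in> carrier B"
    for w w' w'' b b' b''
  proof -
    have "W.supp (frag_of (w, b) - frag_of (w', b'))" using c keys_diff[of "frag_of (w, b)" "frag_of (w', b')"] by auto
    then show ?thesis using c s by (simp add: \<sigma>d \<sigma>of a_minus_def Z.T.minus_add Z.T.a_assoc)
  qed
  \<comment> \<open>The section \<open>s\<close> is not additive, so the relations of
    \<open>W \<otimes> B\<close> that involve the first argument are respected only modulo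
    \<open>I\<close>. Additivity in the second argument is respected exactly, as \<open>s\<close>
    does not touch it.\<close>
  have \<sigma>rel: "?\<sigma> h \<in> I" if "h \<in> W.rel" for h
  proof -
    have "W.supp h \<and> ?\<sigma> h \<in> I" using that
    proof (induction h rule: W.rel_induct)
      case (left w w' b)
      then have c: "w \<oplus>\<^bsub>W\<^esub> w' \<in> carrier W" "s w \<oplus>\<^bsub>Z\<^esub> s w' \<in> carrier Z" using s by auto
      have "?\<sigma> (frag_of (w \<oplus>\<^bsub>W\<^esub> w', b) - frag_of (w, b) - frag_of (w', b)) =
          Z.tns (s (w \<oplus>\<^bsub>W\<^esub> w')) b \<ominus>\<^bsub>Z.T\<^esub> Z.tns (s w \<oplus>\<^bsub>Z\<^esub> s w') b"
        using left s by (subst \<sigma>d3) (auto simp: Z.tns_add_left)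
      also have "\<dots> \<in> I" using left c s lin_maps_add[OF p] by (intro key) auto
      finally show ?case .
    next
      case (right w b b')
      have "?\<sigma> (frag_of (w, b \<oplus>\<^bsub>B\<^esub> b') - frag_of (w, b) - frag_of (w, b')) = \<zero>\<^bsub>Z.T\<^esub>"
        using right s Z.T.r_neg by (subst \<sigma>d3) (auto simp: Z.tns_add_right a_minus_def)
      then show ?case using Iz by simp
    next
      case (mid r w b)
      then have c: "r \<odot>\<^bsub>W\<^esub> w \<in> carrier W" "r \<odot>\<^bsub>Z\<^esub> s w \<in> carrier Z" "r \<odot>\<^bsub>B\<^esub> b \<in> carrier B" using s by auto
      have "?\<sigma> (frag_of (r \<odot>\<^bsub>W\<^esub> w, b) - frag_of (w, r \<odot>\<^bsub>B\<^esub> b)) = Z.tns (s (r \<odot>\<^bsub>W\<^esub> w)) b \<ominus>\<^bsub>Z.T\<^esub> Z.tns (r \<odot>\<^bsub>Z\<^esub> s w) b"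
        using mid c s by (simp add: \<sigma>d \<sigma>of Z.tns_smult)
      also have "\<dots> \<in> I" using mid c s lin_maps_smult[OF p] by (intro key) auto
      finally show ?case .
    next
      case zero
      show ?case using Iz by (simp add: Z.T.frag_lift_zero)
    next
      case (minus x)
      then show ?case using Z.T.frag_lift_minus[where \<beta> = ?\<beta> and S = "carrier W \<times> carrier B", OF _ \<beta>] Im by simp
    next
      case (add x y)
      then show ?case using Z.T.frag_lift_add[where \<beta> = ?\<beta> and S = "carrier W \<times> carrier B", OF _ _ \<beta>] Ia by simp
    qed
    then show ?thesis by simp
  qed
  let ?e = "frag_extend (\<lambda>(a, b). frag_of (p a, b))"
  note pcls = tensor_map_cls[OF tensor_pairI[OF Z] tensor_pairI[OF W] p lin_maps_id]
  \<comment> \<open>Going down by \<open>p\<close> and back up by the section is the identity modulo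
    \<open>I\<close>, because \<open>s (p z)\<close> and \<open>z\<close> have the same image under
    \<open>p\<close>.\<close>
  have comp: "?\<sigma> (?e x) \<ominus>\<^bsub>Z.T\<^esub> Z.cls x \<in> I" if "Z.supp x" for x
    using that
  proof (induction x rule: frag_supp_induct)
    case zero
    show ?case using Im[OF Iz] by (simp add: Z.T.frag_lift_zero Z.zero_T[symmetric] a_minus_def)
  next
    case (diff x y)
    have c: "?\<sigma> (?e x) \<in> carrier Z.T" "?\<sigma> (?e y) \<in> carrier Z.T" "Z.cls x \<in> carrier Z.T" "Z.cls y \<in> carrier Z.T"
      using diff pcls(2) Z.T.frag_lift_closed[where \<beta> = ?\<beta> and S = "carrier W \<times> carrier B", OF _ \<beta>] by (auto simp: Z.carrier_T)
    have "?\<sigma> (?e (x - y)) \<ominus>\<^bsub>Z.T\<^esub> Z.cls (x - y) =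
        (?\<sigma> (?e x) \<ominus>\<^bsub>Z.T\<^esub> ?\<sigma> (?e y)) \<ominus>\<^bsub>Z.T\<^esub> (Z.cls x \<ominus>\<^bsub>Z.T\<^esub> Z.cls y)"
      using diff pcls(2) by (simp add: frag_extend_diff \<sigma>d Z.diff_T)
    also have "\<dots> = (?\<sigma> (?e x) \<ominus>\<^bsub>Z.T\<^esub> Z.cls x) \<ominus>\<^bsub>Z.T\<^esub> (?\<sigma> (?e y) \<ominus>\<^bsub>Z.T\<^esub> Z.cls y)"
      using c by (simp add: a_minus_def Z.T.minus_add Z.T.minus_minus Z.T.a_ac)
    finally show ?case using Id diff by simp
  next
    case (of q)
    then obtain z b where q: "q = (z, b)" "z \<in> carrier Z" "b \<in> carrier B" by auto
    have "?\<sigma> (?e (frag_of q)) = Z.tns (s (p z)) b" using q lin_maps_closed[OF p] s \<sigma>of by simp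
    then show ?case using q lin_maps_closed[OF p] s by (auto intro!: key)
  qed
  obtain x where x: "X = Z.cls x" "Z.supp x" using X by (auto simp: Z.carrier_T)
  \<comment> \<open>The image of \<open>x\<close> in \<open>W \<otimes> B\<close> is zero, hence a
    relation, and \<open>\<sigma>\<close> sends it into \<open>I\<close>. Since it differs from
    \<open>X\<close> by an element of \<open>I\<close>, the class \<open>X\<close> lies in
    \<open>I\<close> too.\<close>
  have "W.cls (?e x) = W.cls 0" using pX pcls(1)[OF x(2)] by (simp add: x(1) W.zero_T)
  then have "?\<sigma> (?e x) \<in> I" using \<sigma>rel by (simp add: W.cls_eq_iff)
  then have "?\<sigma> (?e x) \<ominus>\<^bsub>Z.T\<^esub> (?\<sigma> (?e x) \<ominus>\<^bsub>Z.T\<^esub> X) \<in> I" using Id comp[OF x(2)] x(1) by simp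
  moreover have "?\<sigma> (?e x) \<ominus>\<^bsub>Z.T\<^esub> (?\<sigma> (?e x) \<ominus>\<^bsub>Z.T\<^esub> X) = X"
    using X Ic[OF \<open>?\<sigma> (?e x) \<in> I\<close>]
    by (simp add: a_minus_def Z.T.minus_add Z.T.minus_minus Z.T.r_neg2)
  ultimately show ?thesis by (auto simp: I_def)
qed

end

section \<open>Tor in terms of arbitrary projective resolutions\<close>

text \<open>As in \<open>hom_exact\<close>, index \<open>j\<close> concerns degree
  \<open>j + 1\<close>, so that both maps involved are differentials and none is the
  augmentation.\<close>

definition tensor_exact ::
    "('r, 'x) ring_scheme \<Rightarrow> ('r, 'n, 'z) module_scheme \<Rightarrow> (nat \<Rightarrow> ('r, 'f, 'y) module_scheme) \<Rightarrow>
     (nat \<Rightarrow> 'f \<Rightarrow> 'f) \<Rightarrow> nat \<Rightarrow> bool" where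
  "tensor_exact R N P \<delta> j \<longleftrightarrow> (\<forall>X\<in>carrier (tensor_group R (P (Suc j)) N).
     tmap R N (P j) (\<delta> j) X = \<zero>\<^bsub>tensor_group R (P j) N\<^esub> \<longrightarrow>
     (\<exists>Y\<in>carrier (tensor_group R (P (Suc (Suc j))) N). X = tmap R N (P (Suc j)) (\<delta> (Suc j)) Y))"

text \<open>Applied to a cycle \<open>X\<close>, the identity
  \<open>\<phi>\<psi> = 1 + \<delta>h + h\<delta>\<close> leaves \<open>X + \<delta>hX\<close> on
  the right. On the left, \<open>\<psi>X\<close> is a boundary \<open>\<delta>Y\<close>, which gives
  \<open>\<delta>\<phi>Y\<close>. Hence \<open>X = \<delta>(\<phi>Y - hX)\<close>.\<close>

lemma tensor_exact_transfer:
  assumes P: "resolution (op_ring R) \<infinity> P \<delta>P \<epsilon>P U" and projP: "\<And>i. projective (op_ring R) (P i)"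
    and Q: "resolution (op_ring R) \<infinity> Q \<delta>Q \<epsilon>Q U" and projQ: "\<And>i. projective (op_ring R) (Q i)"
    and N: "left_module R N" and ex: "tensor_exact R N P \<delta>P j"
  shows "tensor_exact R N Q \<delta>Q j"
  unfolding tensor_exact_def
proof (intro ballI impI)
  note P' = resolution_infinityD[OF P] and Q' = resolution_infinityD[OF Q]
  obtain \<phi> \<psi> h where \<phi>: "\<And>i. \<phi> i \<in> lin_maps (op_ring R) (P i) (Q i)" and \<psi>: "\<And>i. \<psi> i \<in> lin_maps (op_ring R) (Q i) (P i)"
    and h: "\<And>i. h i \<in> lin_maps (op_ring R) (Q i) (Q (Suc i))"
    and \<phi>\<delta>: "\<And>i x. x \<in> carrier (P (Suc i)) \<Longrightarrow> \<delta>Q i (\<phi> (Suc i) x) = \<phi> i (\<delta>P i x)"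
    and \<psi>\<delta>: "\<And>i x. x \<in> carrier (Q (Suc i)) \<Longrightarrow> \<delta>P i (\<psi> (Suc i) x) = \<psi> i (\<delta>Q i x)"
    and hom: "\<And>i x. x \<in> carrier (Q (Suc i)) \<Longrightarrow>
       \<phi> (Suc i) (\<psi> (Suc i) x) = x \<oplus>\<^bsub>Q (Suc i)\<^esub> (\<delta>Q (Suc i) (h (Suc i) x) \<oplus>\<^bsub>Q (Suc i)\<^esub> h i (\<delta>Q i x))"
    using ex_homotopy_equivalence[OF P projP Q projQ] by blast
  fix X assume X: "X \<in> carrier (tensor_group R (Q (Suc j)) N)"
    and z: "tmap R N (Q j) (\<delta>Q j) X = \<zero>\<^bsub>tensor_group R (Q j) N\<^esub>"
  note ag = abelian_group_tensor_group[OF N Q'(2)] abelian_group_tensor_group[OF N P'(2)]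
  interpret T: abelian_group "tensor_group R (Q (Suc j)) N" by (rule ag)
  note comp = tmap_comp[OF N] and cl = tmap_closed[OF N]
  let ?X = "tmap R N (P (Suc j)) (\<psi> (Suc j)) X"
  have X': "?X \<in> carrier (tensor_group R (P (Suc j)) N)" by (rule cl[OF Q'(2) P'(2) \<psi> X])
  have "tmap R N (P j) (\<delta>P j) ?X = tmap R N (P j) (\<lambda>x. \<delta>P j (\<psi> (Suc j) x)) X"
    by (rule comp[OF Q'(2) P'(2) P'(2) \<psi> P'(5) X])
  also have "\<dots> = tmap R N (P j) (\<lambda>x. \<psi> j (\<delta>Q j x)) X"
    by (rule tmap_cong[OF N Q'(2) P'(2) lin_maps_comp[OF \<psi> P'(5)] \<psi>\<delta> X])
  also have "\<dots> = tmap R N (P j) (\<psi> j) (tmap R N (Q j) (\<delta>Q j) X)"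
    by (rule comp[OF Q'(2) Q'(2) P'(2) Q'(5) \<psi> X, symmetric])
  also have "\<dots> = \<zero>\<^bsub>tensor_group R (P j) N\<^esub>"
    unfolding z by (rule add_maps_zero[OF tmap_add_maps[OF N Q'(2) P'(2) \<psi>] ag])
  finally obtain Y where Y: "Y \<in> carrier (tensor_group R (P (Suc (Suc j))) N)"
    "?X = tmap R N (P (Suc j)) (\<delta>P (Suc j)) Y"
    using ex X' unfolding tensor_exact_def by blast
  let ?Y = "tmap R N (Q (Suc (Suc j))) (\<phi> (Suc (Suc j))) Y"
  let ?H = "tmap R N (Q (Suc (Suc j))) (h (Suc j)) X"
  have Yc: "?Y \<in> carrier (tensor_group R (Q (Suc (Suc j))) N)" by (rule cl[OF P'(2) Q'(2) \<phi> Y(1)])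
  have Hc: "?H \<in> carrier (tensor_group R (Q (Suc (Suc j))) N)" by (rule cl[OF Q'(2) Q'(2) h X])
  note d = tmap_add_maps[OF N Q'(2) Q'(2) Q'(5), of "Suc j"]
  have "tmap R N (Q (Suc j)) (\<phi> (Suc j)) ?X = tmap R N (Q (Suc j)) (\<lambda>x. \<phi> (Suc j) (\<delta>P (Suc j) x)) Y"
    unfolding Y(2) by (rule comp[OF P'(2) P'(2) Q'(2) P'(5) \<phi> Y(1)])
  also have "\<dots> = tmap R N (Q (Suc j)) (\<lambda>x. \<delta>Q (Suc j) (\<phi> (Suc (Suc j)) x)) Y"
    by (rule tmap_cong[OF N P'(2) Q'(2) lin_maps_comp[OF P'(5) \<phi>] \<phi>\<delta>[symmetric] Y(1)])
  also have "\<dots> = tmap R N (Q (Suc j)) (\<delta>Q (Suc j)) ?Y"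
    by (rule comp[OF P'(2) Q'(2) Q'(2) \<phi> Q'(5) Y(1), symmetric])
  finally have 1: "tmap R N (Q (Suc j)) (\<phi> (Suc j)) ?X = tmap R N (Q (Suc j)) (\<delta>Q (Suc j)) ?Y" .
  note l1 = lin_maps_comp[OF h Q'(5), of "Suc j"] and l2 = lin_maps_comp[OF Q'(5) h, of j]
  have "tmap R N (Q (Suc j)) (\<phi> (Suc j)) ?X = tmap R N (Q (Suc j)) (\<lambda>x. \<phi> (Suc j) (\<psi> (Suc j) x)) X"
    by (rule comp[OF Q'(2) P'(2) Q'(2) \<psi> \<phi> X])
  also have "\<dots> = tmap R N (Q (Suc j))
      (\<lambda>x. x \<oplus>\<^bsub>Q (Suc j)\<^esub> (\<delta>Q (Suc j) (h (Suc j) x) \<oplus>\<^bsub>Q (Suc j)\<^esub> h j (\<delta>Q j x))) X"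
    by (rule tmap_cong[OF N Q'(2) Q'(2) lin_maps_comp[OF \<psi> \<phi>] hom X])
  also have "\<dots> = tmap R N (Q (Suc j)) (\<lambda>x. x) X \<oplus>\<^bsub>tensor_group R (Q (Suc j)) N\<^esub>
      tmap R N (Q (Suc j)) (\<lambda>x. \<delta>Q (Suc j) (h (Suc j) x) \<oplus>\<^bsub>Q (Suc j)\<^esub> h j (\<delta>Q j x)) X"
    by (rule tmap_plus[OF N Q'(2) Q'(2) lin_maps_id lin_maps_plus[OF Q'(2) l1 l2] X])
  also have "tmap R N (Q (Suc j)) (\<lambda>x. x) X = X" by (rule tmap_id[OF N Q'(2) X])
  also have "tmap R N (Q (Suc j)) (\<lambda>x. \<delta>Q (Suc j) (h (Suc j) x) \<oplus>\<^bsub>Q (Suc j)\<^esub> h j (\<delta>Q j x)) X =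
      tmap R N (Q (Suc j)) (\<lambda>x. \<delta>Q (Suc j) (h (Suc j) x)) X \<oplus>\<^bsub>tensor_group R (Q (Suc j)) N\<^esub>
      tmap R N (Q (Suc j)) (\<lambda>x. h j (\<delta>Q j x)) X"
    by (rule tmap_plus[OF N Q'(2) Q'(2) l1 l2 X])
  also have "tmap R N (Q (Suc j)) (\<lambda>x. \<delta>Q (Suc j) (h (Suc j) x)) X = tmap R N (Q (Suc j)) (\<delta>Q (Suc j)) ?H"
    by (rule comp[OF Q'(2) Q'(2) Q'(2) h Q'(5) X, symmetric])
  also have "tmap R N (Q (Suc j)) (\<lambda>x. h j (\<delta>Q j x)) X = tmap R N (Q (Suc j)) (h j) (tmap R N (Q j) (\<delta>Q j) X)"
    by (rule comp[OF Q'(2) Q'(2) Q'(2) Q'(5) h X, symmetric])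
  also have "\<dots> = \<zero>\<^bsub>tensor_group R (Q (Suc j)) N\<^esub>"
    unfolding z by (rule add_maps_zero[OF tmap_add_maps[OF N Q'(2) Q'(2) h] ag(1) ag(1)])
  finally have "X \<oplus>\<^bsub>tensor_group R (Q (Suc j)) N\<^esub> tmap R N (Q (Suc j)) (\<delta>Q (Suc j)) ?H =
      tmap R N (Q (Suc j)) (\<delta>Q (Suc j)) ?Y"
    unfolding 1 using add_maps_closed[OF d Hc] by simp
  then have "X = tmap R N (Q (Suc j)) (\<delta>Q (Suc j)) ?Y \<ominus>\<^bsub>tensor_group R (Q (Suc j)) N\<^esub>
      tmap R N (Q (Suc j)) (\<delta>Q (Suc j)) ?H"
    using X add_maps_closed[OF d Hc] add_maps_closed[OF d Yc]
    by (metis (no_types, lifting) T.a_assoc T.a_inv_closed T.r_neg T.r_zero a_minus_def)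
  also have "\<dots> = tmap R N (Q (Suc j)) (\<delta>Q (Suc j)) (?Y \<ominus>\<^bsub>tensor_group R (Q (Suc (Suc j))) N\<^esub> ?H)"
    by (rule add_maps_diff[OF d ag(1) ag(1) Yc Hc, symmetric])
  finally show "\<exists>Y\<in>carrier (tensor_group R (Q (Suc (Suc j))) N). X = tmap R N (Q (Suc j)) (\<delta>Q (Suc j)) Y"
    using abelian_group.minus_closed[OF ag(1) Yc Hc] by blast
qed

text \<open>The counterpart of \<open>Ext_trivial_iff\<close>. No extensional functions intervene
  here: once homology is unfolded, the statement is \<open>tensor_exact\<close> for the chosen
  resolution.\<close>

theorem Tor_trivial_iff:
  assumes P: "resolution (op_ring R) \<infinity> P \<delta> \<epsilon> U" and projP: "\<And>i. projective (op_ring R) (P i)" and N: "left_module R N"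
  shows "trivial_group (Tor R (Suc j) U N) \<longleftrightarrow> tensor_exact R N P \<delta> j"
proof -
  obtain F d where Fd: "proj_resolution (op_ring R) U = (F, d)" by fastforce
  obtain e where F: "resolution (op_ring R) \<infinity> F d e U" and projF: "\<And>i. projective (op_ring R) (F i)"
    using is_proj_resolution_proj_resolution[OF resolution_infinityD(1)[OF P]]
    unfolding Fd is_proj_resolution_def by auto
  note F' = resolution_infinityD[OF F]
  note ag = abelian_group_tensor_group[OF N F'(2)]
  note D = tmap_add_maps[OF N F'(2) F'(2) F'(5)]
  have DD: "tmap R N (F j) (d j) (tmap R N (F (Suc j)) (d (Suc j)) X) = \<zero>\<^bsub>tensor_group R (F j) N\<^esub>"
    if X: "X \<in> carrier (tensor_group R (F (Suc (Suc j))) N)" for X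
  proof -
    have "tmap R N (F j) (d j) (tmap R N (F (Suc j)) (d (Suc j)) X) = tmap R N (F j) (\<lambda>x. d j (d (Suc j) x)) X"
      by (rule tmap_comp[OF N F'(2) F'(2) F'(2) F'(5) F'(5) X])
    also have "\<dots> = tmap R N (F j) (\<lambda>x. \<zero>\<^bsub>F j\<^esub>) X"
      by (rule tmap_cong[OF N F'(2) F'(2) lin_maps_comp[OF F'(5) F'(5)] _ X]) (rule resolution_comp_zero(2)[OF F])
    finally show ?thesis using tmap_const_zero[OF N F'(2) F'(2) X] by simp
  qed
  have "trivial_group (Tor R (Suc j) U N) \<longleftrightarrow> tensor_exact R N F d j"
    unfolding Tor_def Fd tensor_exact_def
    by (simp, rule trivial_homology_iff[OF ag ag ag D D]) (rule DD)
  also have "\<dots> \<longleftrightarrow> tensor_exact R N P \<delta> j"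
    using tensor_exact_transfer[OF F projF P projP N] tensor_exact_transfer[OF P projP F projF N] by blast
  finally show ?thesis .
qed

section \<open>Finitely presented modules\<close>

lemma resolution_infinityI':
  assumes "left_module R U" "\<And>i. left_module R (F i)" "\<epsilon> \<in> lin_maps R (F 0) U" "\<epsilon> ` carrier (F 0) = carrier U"
    "\<And>i. \<delta> i \<in> lin_maps R (F (Suc i)) (F i)"
    "\<And>x. x \<in> carrier (F (Suc 0)) \<Longrightarrow> \<epsilon> (\<delta> 0 x) = \<zero>\<^bsub>U\<^esub>"
    "\<And>i x. x \<in> carrier (F (Suc (Suc i))) \<Longrightarrow> \<delta> i (\<delta> (Suc i) x) = \<zero>\<^bsub>F i\<^esub>"
    "\<And>x. x \<in> carrier (F 0) \<Longrightarrow> \<epsilon> x = \<zero>\<^bsub>U\<^esub> \<Longrightarrow> \<exists>y\<in>carrier (F (Suc 0)). x = \<delta> 0 y"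
    "\<And>i x. x \<in> carrier (F (Suc i)) \<Longrightarrow> \<delta> i x = \<zero>\<^bsub>F i\<^esub> \<Longrightarrow> \<exists>y\<in>carrier (F (Suc (Suc i))). x = \<delta> (Suc i) y"
  shows "resolution R \<infinity> F \<delta> \<epsilon> U"
proof (rule resolution_infinityI[OF assms(1-5)])
  fix i
  show "\<delta> i ` carrier (F (Suc i)) = syzygy F \<delta> \<epsilon> U i"
  proof (cases i)
    case 0
    then show ?thesis
      using assms(6,8) lin_maps_closed[OF assms(5)[of 0]] by (auto simp: syzygy_simps image_iff)
  next
    case (Suc k)
    then show ?thesis
      using assms(7,9)[of _ k] lin_maps_closed[OF assms(5)[of "Suc k"]] by (auto simp: syzygy_simps image_iff)
  qed
qed

lemma resolution_target_iso:
  assumes F: "resolution R \<infinity> F \<delta> \<epsilon> U" and a: "a \<in> lin_isos R U V" and V: "left_module R V"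
  shows "resolution R \<infinity> F \<delta> (\<lambda>x. a (\<epsilon> x)) V"
proof -
  note F' = resolution_infinityD[OF F] and a1 = lin_isosD(1)[OF a]
  have inj: "inj_on a (carrier U)" and im: "a ` carrier U = carrier V"
    using lin_isosD(2)[OF a] by (auto simp: bij_betw_def)
  have a0: "a u = \<zero>\<^bsub>V\<^esub> \<longleftrightarrow> u = \<zero>\<^bsub>U\<^esub>" if "u \<in> carrier U" for u
  proof -
    interpret U: left_module R U by (rule F')
    show ?thesis using lin_maps_zero[OF a1 F'(1) V] inj_onD[OF inj _ that U.M.zero_closed] by auto
  qed
  show ?thesis
  proof (rule resolution_infinityI'[OF V F'(2) lin_maps_comp[OF F'(3) a1] _ F'(5)])
    show "(\<lambda>x. a (\<epsilon> x)) ` carrier (F 0) = carrier V"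
      using im unfolding F'(4)[symmetric] by (simp add: image_image)
  qed (use a0 lin_maps_zero[OF a1 F'(1) V] lin_maps_closed[OF F'(3)] lin_maps_closed[OF F'(5)] resolution_comp_zero[OF F] resolution_exact[OF F] in auto)
qed

text \<open>Moves a resolution to isomorphic modules of another type. \<open>fin_presented\<close>
  admits only modules carried by \<open>nat \<Rightarrow> 'r\<close>, whereas the resolutions met
  later consist of syzygies, pairs or functions.\<close>

lemma resolution_iso:
  assumes F: "resolution R \<infinity> F \<delta> \<epsilon> U" and \<theta>: "\<And>i. \<theta> i \<in> lin_isos R (F i) (G i)" and G: "\<And>i. left_module R (G i)"
  shows "\<exists>\<delta>' \<epsilon>'. resolution R \<infinity> G \<delta>' \<epsilon>' U"
proof -
  note F' = resolution_infinityD[OF F] and \<theta>1 = lin_isosD(1)[OF \<theta>]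
  define \<eta> where "\<eta> i = inv_into (carrier (F i)) (\<theta> i)" for i
  have \<eta>: "\<eta> i \<in> lin_maps R (G i) (F i)" for i
    using lin_isosD(1)[OF lin_isos_inv_into[OF F'(2) \<theta>]] by (simp add: \<eta>_def)
  have \<eta>\<theta>: "\<eta> i (\<theta> i x) = x" if "x \<in> carrier (F i)" for i x
    using lin_isosD(2)[OF \<theta>[of i]] that by (simp add: \<eta>_def bij_betw_def)
  have \<theta>\<eta>: "\<theta> i (\<eta> i x) = x" if "x \<in> carrier (G i)" for i x
    using lin_isosD(2)[OF \<theta>[of i]] that by (simp add: \<eta>_def bij_betw_def f_inv_into_f)
  have \<theta>0: "\<theta> i \<zero>\<^bsub>F i\<^esub> = \<zero>\<^bsub>G i\<^esub>" for i by (rule lin_maps_zero[OF \<theta>1 F'(2) G])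
  have \<eta>0: "\<eta> i \<zero>\<^bsub>G i\<^esub> = \<zero>\<^bsub>F i\<^esub>" for i by (rule lin_maps_zero[OF \<eta> G F'(2)])
  note c = lin_maps_closed[OF \<theta>1] lin_maps_closed[OF \<eta>] lin_maps_closed[OF F'(5)] lin_maps_closed[OF F'(3)]
  have "resolution R \<infinity> G (\<lambda>i x. \<theta> i (\<delta> i (\<eta> (Suc i) x))) (\<lambda>x. \<epsilon> (\<eta> 0 x)) U"
  proof (rule resolution_infinityI'[OF F'(1) G lin_maps_comp[OF \<eta> F'(3)] _
        lin_maps_comp[OF lin_maps_comp[OF \<eta> F'(5)] \<theta>1]])
    show "(\<lambda>x. \<epsilon> (\<eta> 0 x)) ` carrier (G 0) = carrier U"
    proof
      show "carrier U \<subseteq> (\<lambda>x. \<epsilon> (\<eta> 0 x)) ` carrier (G 0)"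
      proof
        fix u assume "u \<in> carrier U"
        then obtain x where "x \<in> carrier (F 0)" "u = \<epsilon> x" using F'(4) by auto
        then show "u \<in> (\<lambda>x. \<epsilon> (\<eta> 0 x)) ` carrier (G 0)" using \<eta>\<theta>[of x 0] c by (metis (no_types, lifting) image_eqI)
      qed
    qed (use c in auto)
  next
    fix x assume "x \<in> carrier (G (Suc 0))"
    then show "\<epsilon> (\<eta> 0 (\<theta> 0 (\<delta> 0 (\<eta> (Suc 0) x)))) = \<zero>\<^bsub>U\<^esub>" using \<eta>\<theta> c resolution_comp_zero(1)[OF F] by simp
  next
    fix i x assume "x \<in> carrier (G (Suc (Suc i)))"
    then show "\<theta> i (\<delta> i (\<eta> (Suc i) (\<theta> (Suc i) (\<delta> (Suc i) (\<eta> (Suc (Suc i)) x))))) = \<zero>\<^bsub>G i\<^esub>"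
      using \<eta>\<theta> c resolution_comp_zero(2)[OF F] \<theta>0 by simp
  next
    fix x assume x: "x \<in> carrier (G 0)" "\<epsilon> (\<eta> 0 x) = \<zero>\<^bsub>U\<^esub>"
    then obtain y where y: "y \<in> carrier (F (Suc 0))" "\<eta> 0 x = \<delta> 0 y" using resolution_exact(1)[OF F] c by blast
    then have "x = \<theta> 0 (\<delta> 0 (\<eta> (Suc 0) (\<theta> (Suc 0) y)))" using \<eta>\<theta> \<theta>\<eta>[of x 0] x by simp
    then show "\<exists>y\<in>carrier (G (Suc 0)). x = \<theta> 0 (\<delta> 0 (\<eta> (Suc 0) y))" using c y by blast
  next
    fix i x assume x: "x \<in> carrier (G (Suc i))" "\<theta> i (\<delta> i (\<eta> (Suc i) x)) = \<zero>\<^bsub>G i\<^esub>"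
    then have "\<delta> i (\<eta> (Suc i) x) = \<zero>\<^bsub>F i\<^esub>" using \<eta>\<theta> \<eta>0 c by metis
    then obtain y where y: "y \<in> carrier (F (Suc (Suc i)))" "\<eta> (Suc i) x = \<delta> (Suc i) y"
      using resolution_exact(2)[OF F] c x by blast
    then have "x = \<theta> (Suc i) (\<delta> (Suc i) (\<eta> (Suc (Suc i)) (\<theta> (Suc (Suc i)) y)))" using \<eta>\<theta> \<theta>\<eta>[of x "Suc i"] x by simp
    then show "\<exists>y\<in>carrier (G (Suc (Suc i))). x = \<theta> (Suc i) (\<delta> (Suc i) (\<eta> (Suc (Suc i)) y))" using c y by blast
  qed
  then show ?thesis by blast
qed

text \<open>The given modules may have any type, since they are replaced by the standard
  \<open>free_module R {..<k}\<close>. An infinite resolution serves every \<open>n\<close> at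
  once.\<close>

lemma fin_presentedI:
  assumes F: "resolution R \<infinity> F \<delta> \<epsilon> U" and "\<And>i. fg_free R (F i)"
  shows "fin_presented R n U"
proof -
  have "\<forall>i. \<exists>k \<theta>. \<theta> \<in> lin_isos R (F i) (free_module R {..<k::nat})"
    using assms(2) unfolding fg_free_def by blast
  then obtain k \<theta> where \<theta>: "\<And>i. \<theta> i \<in> lin_isos R (F i) (free_module R {..<k i::nat})" by metis
  have "left_module R (free_module R {..<k i})" for i
    by (rule left_module_free_module[OF left_module_ring[OF resolution_infinityD(1)[OF F]]])
  then obtain \<delta>' \<epsilon>' where "resolution R \<infinity> (\<lambda>i. free_module R {..<k i}) \<delta>' \<epsilon>' U"
    using resolution_iso[OF F \<theta>] by blast
  from resolution_mono[OF this] show ?thesis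
    unfolding fin_presented_def using fg_free_free_module by blast
qed

lemma fin_presentedE:
  fixes R :: "('r, 'x) ring_scheme"
  assumes "fin_presented R \<infinity> U"
  obtains F :: "nat \<Rightarrow> ('r, nat \<Rightarrow> 'r) module" and \<delta> \<epsilon> where "resolution R \<infinity> F \<delta> \<epsilon> U" "\<And>i. fg_free R (F i)" "\<And>i. projective R (F i)"
proof -
  obtain F :: "nat \<Rightarrow> ('r, nat \<Rightarrow> 'r) module" and \<delta> \<epsilon> where "resolution R \<infinity> F \<delta> \<epsilon> U" "\<And>i. fg_free R (F i)"
    using assms unfolding fin_presented_def by auto
  then show thesis using that fg_free_projective resolution_infinityD(2) by metis
qed

lemma fin_presented_left_module: "fin_presented R \<infinity> U \<Longrightarrow> left_module R U"
  by (erule fin_presentedE) (rule resolution_infinityD(1))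

lemma fin_presented_iso:
  assumes "fin_presented R \<infinity> U" "a \<in> lin_isos R U V" "left_module R V"
  shows "fin_presented R \<infinity> V"
  using assms(1) by (rule fin_presentedE) (rule fin_presentedI[OF resolution_target_iso[OF _ assms(2,3)]])

lemma fin_presented_fg_free:
  assumes "left_module R U" "fg_free R U"
  shows "fin_presented R \<infinity> U"
proof -
  interpret U: left_module R U by fact
  let ?Z = "U\<lparr>carrier := {\<zero>\<^bsub>U\<^esub>}\<rparr>"
  have Z: "left_module R ?Z" by (rule left_module_submodule[OF assms(1)]) auto
  \<comment> \<open>\<open>U\<close> itself in degree zero and its zero submodule above it; all
    modules share one type, and every map can be written as the identity function.\<close>
  let ?F = "\<lambda>i. if i = 0 then U else ?Z"
  have "resolution R \<infinity> ?F (\<lambda>i x. x) (\<lambda>x. x) U"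
    by (rule resolution_infinityI') (use Z assms(1) in \<open>auto simp: lin_maps_def\<close>)
  then show ?thesis
    by (rule fin_presentedI) (use assms(2) fg_free_zero[OF Z] in auto)
qed

section \<open>Invariance under isomorphism and copies in a prescribed type\<close>

lemma ex_std_resolution:
  fixes R :: "('r, 'x) ring_scheme" and U :: "('r, 'u, 'z) module_scheme"
  assumes "left_module R U"
  obtains F :: "nat \<Rightarrow> ('r, ('r, 'u) label \<Rightarrow> 'r) module" and \<delta> \<epsilon>
    where "resolution R \<infinity> F \<delta> \<epsilon> U" "\<And>i. projective R (F i)"
  using ex_proj_resolution[OF assms] unfolding is_proj_resolution_def by blast

text \<open>An isomorphism of the resolved modules changes only the augmentation, which
  \<open>hom_exact\<close> does not mention; both sides are the same condition on one
  resolution.\<close>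

lemma Ext_trivial_iso:
  fixes R :: "('a, 'x) ring_scheme" and U :: "('a, 'c, 'y) module_scheme"
  assumes "left_module R U" "a \<in> lin_isos R U V" "left_module R V" "left_module R N"
  shows "trivial_group (Ext R (Suc j) U N) \<longleftrightarrow> trivial_group (Ext R (Suc j) V N)"
proof -
  obtain F :: "nat \<Rightarrow> ('a, ('a, 'c) label \<Rightarrow> 'a) module" and \<delta> \<epsilon>
    where F: "resolution R \<infinity> F \<delta> \<epsilon> U" and proj: "\<And>i. projective R (F i)"
    using ex_std_resolution[OF assms(1)] by metis
  show ?thesis
    unfolding Ext_trivial_iff[OF F proj assms(4)]
      Ext_trivial_iff[OF resolution_target_iso[OF F assms(2,3)] proj assms(4)] ..
qed

lemma Tor_trivial_iso:
  fixes R :: "('a, 'x) ring_scheme" and U :: "('a, 'c, 'y) module_scheme"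
  assumes "left_module (op_ring R) U" "a \<in> lin_isos (op_ring R) U V" "left_module (op_ring R) V" "left_module R N"
  shows "trivial_group (Tor R (Suc j) U N) \<longleftrightarrow> trivial_group (Tor R (Suc j) V N)"
proof -
  obtain F :: "nat \<Rightarrow> ('a, ('a, 'c) label \<Rightarrow> 'a) module" and \<delta> \<epsilon>
    where F: "resolution (op_ring R) \<infinity> F \<delta> \<epsilon> U" and proj: "\<And>i. projective (op_ring R) (F i)"
    using ex_std_resolution[OF assms(1)] by metis
  show ?thesis
    unfolding Tor_trivial_iff[OF F proj assms(4)]
      Tor_trivial_iff[OF resolution_target_iso[OF F assms(2,3)] proj assms(4)] ..
qed

text \<open>The structure of \<open>U\<close> carried over along an injection; it serves to move a
  module to another type.\<close>

definition transport_module :: "('a \<Rightarrow> 'b) \<Rightarrow> ('r, 'a, 'y) module_scheme \<Rightarrow> ('r, 'b) module" where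
  "transport_module f U = \<lparr>carrier = f ` carrier U, mult = undefined, one = undefined, ring.zero = f \<zero>\<^bsub>U\<^esub>,
     add = (\<lambda>x y. f (inv_into (carrier U) f x \<oplus>\<^bsub>U\<^esub> inv_into (carrier U) f y)),
     smult = (\<lambda>r x. f (r \<odot>\<^bsub>U\<^esub> inv_into (carrier U) f x))\<rparr>"

lemma transport_module:
  assumes "left_module R U" "inj_on f (carrier U)"
  shows "left_module R (transport_module f U)" "f \<in> lin_isos R U (transport_module f U)"
proof -
  interpret U: left_module R U by fact
  have inv: "inv_into (carrier U) f (f x) = x" if "x \<in> carrier U" for x using assms(2) that by simp
  have [simp]: "carrier (transport_module f U) = f ` carrier U" "\<zero>\<^bsub>transport_module f U\<^esub> = f \<zero>\<^bsub>U\<^esub>"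
    "x \<in> carrier U \<Longrightarrow> y \<in> carrier U \<Longrightarrow> f x \<oplus>\<^bsub>transport_module f U\<^esub> f y = f (x \<oplus>\<^bsub>U\<^esub> y)"
    "x \<in> carrier U \<Longrightarrow> r \<odot>\<^bsub>transport_module f U\<^esub> f x = f (r \<odot>\<^bsub>U\<^esub> x)" for x y r
    by (simp_all add: transport_module_def inv)
  have "abelian_group (transport_module f U)"
  proof (rule abelian_groupI)
    fix x assume "x \<in> carrier (transport_module f U)"
    then obtain u where "u \<in> carrier U" "x = f u" by auto
    then show "\<exists>y\<in>carrier (transport_module f U). y \<oplus>\<^bsub>transport_module f U\<^esub> x = \<zero>\<^bsub>transport_module f U\<^esub>"
      by (intro bexI[of _ "f (\<ominus>\<^bsub>U\<^esub> u)"]) (auto simp: U.M.l_neg)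
  qed (auto simp: U.M.a_ac)
  then show "left_module R (transport_module f U)"
    using U.R.ring_axioms
    by (intro left_module.intro left_module_axioms.intro)
      (auto simp: U.smult_l_distr U.smult_r_distr U.smult_assoc1)
  show "f \<in> lin_isos R U (transport_module f U)"
    using assms(2) by (auto simp: lin_isos_def lin_maps_def bij_betw_def)
qed

text \<open>\<open>nd_injective\<close> and \<open>nd_flat\<close> test only modules with elements
  in \<open>(nat \<Rightarrow> 'r) set\<close>. An element of \<open>U\<close> is coded by its fibre
  under the augmentation of a resolution; fibres are nonempty, so different elements have different
  fibres.\<close>

lemma fin_presented_small_copy:
  fixes R :: "('r, 'x) ring_scheme"
  assumes "fin_presented R \<infinity> U"
  obtains V :: "('r, (nat \<Rightarrow> 'r) set) module" and a where "left_module R V" "a \<in> lin_isos R U V"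
proof -
  obtain F :: "nat \<Rightarrow> ('r, nat \<Rightarrow> 'r) module" and \<delta> \<epsilon> where F: "resolution R \<infinity> F \<delta> \<epsilon> U"
    using fin_presentedE[OF assms] by metis
  note F' = resolution_infinityD[OF F]
  have "inj_on (\<lambda>u. {x \<in> carrier (F 0). \<epsilon> x = u}) (carrier U)"
  proof (rule inj_onI)
    fix u v assume "u \<in> carrier U" and eq: "{x \<in> carrier (F 0). \<epsilon> x = u} = {x \<in> carrier (F 0). \<epsilon> x = v}"
    then have "u \<in> \<epsilon> ` carrier (F 0)" using F'(4) by simp
    then obtain x where x: "x \<in> {x \<in> carrier (F 0). \<epsilon> x = u}" by auto
    then have "x \<in> {x \<in> carrier (F 0). \<epsilon> x = v}" unfolding eq .
    with x show "u = v" by simp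
  qed
  then show thesis using that transport_module[OF F'(1)] by blast
qed

text \<open>Frees the condition from the prescribed type of test modules: a super finitely presented
  module of any type has a copy there, and the copy is finitely \<open>n\<close>-presented for
  whatever \<open>n\<close> is given.\<close>

lemma nd_injective_Ext:
  fixes R :: "('a, 'x) ring_scheme"
  assumes "N \<in> nd_injective R n d" "fin_presented R \<infinity> U"
  shows "trivial_group (Ext R (Suc d) U N)"
proof -
  note U = fin_presented_left_module[OF assms(2)]
  have N: "left_module R N" using assms(1) by (simp add: nd_injective_def)
  obtain V :: "('a, (nat \<Rightarrow> 'a) set) module" and a where V: "left_module R V" "a \<in> lin_isos R U V"
    using fin_presented_small_copy[OF assms(2)] by metis
  have "fin_presented R n V"
    using fin_presented_iso[OF assms(2) V(2,1)] resolution_mono unfolding fin_presented_def by (metis enat_ord_code(3))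
  then have "trivial_group (Ext R (Suc d) V N)" using assms(1) by (simp add: nd_injective_def)
  then show ?thesis using Ext_trivial_iso[OF U V(2,1) N] by simp
qed

lemma nd_flat_Tor:
  fixes R :: "('a, 'x) ring_scheme"
  assumes "N \<in> nd_flat R n d" "fin_presented (op_ring R) \<infinity> U"
  shows "trivial_group (Tor R (Suc d) U N)"
proof -
  note U = fin_presented_left_module[OF assms(2)]
  have N: "left_module R N" using assms(1) by (simp add: nd_flat_def)
  obtain V :: "('a, (nat \<Rightarrow> 'a) set) module" and a where V: "left_module (op_ring R) V" "a \<in> lin_isos (op_ring R) U V"
    using fin_presented_small_copy[OF assms(2)] by metis
  have "fin_presented (op_ring R) n V"
    using fin_presented_iso[OF assms(2) V(2,1)] resolution_mono unfolding fin_presented_def by (metis enat_ord_code(3))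
  then have "trivial_group (Tor R (Suc d) V N)" using assms(1) by (simp add: nd_flat_def)
  then show ?thesis using Tor_trivial_iso[OF U V(2,1) N] by simp
qed

text \<open>The differential \<open>\<delta> m\<close>, regarded as a map onto its image, becomes
  the augmentation. The tail thus starts at \<open>F (Suc m)\<close>, one step after the module that
  contains the syzygy.\<close>

lemma resolution_syzygy:
  assumes F: "resolution R \<infinity> F \<delta> \<epsilon> U"
  shows "resolution R \<infinity> (\<lambda>j. F (Suc m + j)) (\<lambda>j. \<delta> (Suc m + j)) (\<delta> m) ((F m)\<lparr>carrier := syzygy F \<delta> \<epsilon> U m\<rparr>)"
proof -
  note F' = resolution_infinityD[OF F]
  have sub: "\<delta> m ` carrier (F (Suc m)) = syzygy F \<delta> \<epsilon> U m" by (rule F')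
  show ?thesis
  proof (rule resolution_infinityI')
    show "left_module R ((F m)\<lparr>carrier := syzygy F \<delta> \<epsilon> U m\<rparr>)"
      using left_module_image[OF F'(5)[of m] F'(2) F'(2)] unfolding sub .
    show "\<delta> m \<in> lin_maps R (F (Suc m + 0)) ((F m)\<lparr>carrier := syzygy F \<delta> \<epsilon> U m\<rparr>)"
      using lin_maps_restrict_codomain[OF F'(5)] sub by (metis Nat.add_0_right order_refl)
  qed (use F' sub resolution_comp_zero(2)[OF F] resolution_exact(2)[OF F] in auto)
qed

section \<open>Direct products\<close>

lemma lin_maps_inl: "left_module R B \<Longrightarrow> (\<lambda>x. (x, \<zero>\<^bsub>B\<^esub>)) \<in> lin_maps R A (prod_module A B)"
  by (intro lin_maps_Pair lin_maps_id lin_maps_const_zero)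

lemma lin_maps_inr: "left_module R A \<Longrightarrow> (\<lambda>x. (\<zero>\<^bsub>A\<^esub>, x)) \<in> lin_maps R B (prod_module A B)"
  by (intro lin_maps_Pair lin_maps_id lin_maps_const_zero)

lemma lin_maps_map_prod:
  "f \<in> lin_maps R A A' \<Longrightarrow> g \<in> lin_maps R B B' \<Longrightarrow> map_prod f g \<in> lin_maps R (prod_module A B) (prod_module A' B')"
  by (auto simp: lin_maps_def Pi_iff)

lemma lin_maps_prod_split:
  assumes "left_module R A" "left_module R B" "f \<in> lin_maps R (prod_module A B) N" "x \<in> carrier A" "y \<in> carrier B"
  shows "f (x, y) = f (x, \<zero>\<^bsub>B\<^esub>) \<oplus>\<^bsub>N\<^esub> f (\<zero>\<^bsub>A\<^esub>, y)"
proof -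
  interpret A: left_module R A by fact
  interpret B: left_module R B by fact
  show ?thesis using lin_maps_add[OF assms(3), of "(x, \<zero>\<^bsub>B\<^esub>)" "(\<zero>\<^bsub>A\<^esub>, y)"] assms(4,5) by simp
qed

lemma resolution_prod:
  assumes F: "resolution R \<infinity> F \<delta> \<epsilon> A" and G: "resolution R \<infinity> G \<gamma> \<eta> B"
  shows "resolution R \<infinity> (\<lambda>i. prod_module (F i) (G i)) (\<lambda>i. map_prod (\<delta> i) (\<gamma> i)) (map_prod \<epsilon> \<eta>) (prod_module A B)"
proof -
  note F' = resolution_infinityD[OF F] and G' = resolution_infinityD[OF G]
  show ?thesis
  proof (rule resolution_infinityI')
    show "map_prod \<epsilon> \<eta> ` carrier (prod_module (F 0) (G 0)) = carrier (prod_module A B)"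
      by (simp add: map_prod_surj_on F'(4) G'(4))
  next
    fix x assume "x \<in> carrier (prod_module (F 0) (G 0))" "map_prod \<epsilon> \<eta> x = \<zero>\<^bsub>prod_module A B\<^esub>"
    then show "\<exists>y\<in>carrier (prod_module (F (Suc 0)) (G (Suc 0))). x = map_prod (\<delta> 0) (\<gamma> 0) y"
      using resolution_exact(1)[OF F, of "fst x"] resolution_exact(1)[OF G, of "snd x"] by fastforce
  next
    fix i x assume "x \<in> carrier (prod_module (F (Suc i)) (G (Suc i)))"
      "map_prod (\<delta> i) (\<gamma> i) x = \<zero>\<^bsub>prod_module (F i) (G i)\<^esub>"
    then show "\<exists>y\<in>carrier (prod_module (F (Suc (Suc i))) (G (Suc (Suc i)))). x = map_prod (\<delta> (Suc i)) (\<gamma> (Suc i)) y"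
      using resolution_exact(2)[OF F, of "fst x"] resolution_exact(2)[OF G, of "snd x"] by fastforce
  qed (use F' G' resolution_comp_zero[OF F] resolution_comp_zero[OF G] in
      \<open>auto intro: left_module_prod_module lin_maps_map_prod\<close>)
qed

lemma fin_presented_prod:
  assumes "fin_presented R \<infinity> A" "fin_presented R \<infinity> B"
  shows "fin_presented R \<infinity> (prod_module A B)"
  by (rule fin_presentedE[OF assms(1)], rule fin_presentedE[OF assms(2)], rule fin_presentedI[OF resolution_prod])
    (auto intro: fg_free_prod_module dest: resolution_infinityD(2))

lemma hom_exact_prod:
  assumes F: "resolution R \<infinity> F \<delta> \<epsilon> A" and G: "resolution R \<infinity> G \<gamma> \<eta> B" and N: "left_module R N"
    and exF: "hom_exact R N F \<delta> j" and exG: "hom_exact R N G \<gamma> j"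
  shows "hom_exact R N (\<lambda>i. prod_module (F i) (G i)) (\<lambda>i. map_prod (\<delta> i) (\<gamma> i)) j"
  unfolding hom_exact_def
proof (intro ballI impI)
  note F' = resolution_infinityD[OF F] and G' = resolution_infinityD[OF G]
  fix f assume f: "f \<in> lin_maps R (prod_module (F (Suc j)) (G (Suc j))) N"
    and z: "\<forall>x\<in>carrier (prod_module (F (Suc (Suc j))) (G (Suc (Suc j)))). f (map_prod (\<delta> (Suc j)) (\<gamma> (Suc j)) x) = \<zero>\<^bsub>N\<^esub>"
  interpret Fj: left_module R "F (Suc (Suc j))" by (rule F')
  interpret Gj: left_module R "G (Suc (Suc j))" by (rule G')
  let ?f = "\<lambda>x. f (x, \<zero>\<^bsub>G (Suc j)\<^esub>)" and ?g = "\<lambda>y. f (\<zero>\<^bsub>F (Suc j)\<^esub>, y)"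
  have "\<forall>x\<in>carrier (F (Suc (Suc j))). ?f (\<delta> (Suc j) x) = \<zero>\<^bsub>N\<^esub>"
    using z lin_maps_zero[OF G'(5) G'(2) G'(2), of "Suc j"] Gj.M.zero_closed by force
  then obtain u where u: "u \<in> lin_maps R (F j) N" "\<And>x. x \<in> carrier (F (Suc j)) \<Longrightarrow> ?f x = u (\<delta> j x)"
    using bspec[OF exF[unfolded hom_exact_def] lin_maps_comp[OF lin_maps_inl[OF G'(2)] f]] by blast
  have "\<forall>y\<in>carrier (G (Suc (Suc j))). ?g (\<gamma> (Suc j) y) = \<zero>\<^bsub>N\<^esub>"
    using z lin_maps_zero[OF F'(5) F'(2) F'(2), of "Suc j"] Fj.M.zero_closed by force
  then obtain v where v: "v \<in> lin_maps R (G j) N" "\<And>y. y \<in> carrier (G (Suc j)) \<Longrightarrow> ?g y = v (\<gamma> j y)"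
    using bspec[OF exG[unfolded hom_exact_def] lin_maps_comp[OF lin_maps_inr[OF F'(2)] f]] by blast
  show "\<exists>g\<in>lin_maps R (prod_module (F j) (G j)) N.
      \<forall>x\<in>carrier (prod_module (F (Suc j)) (G (Suc j))). f x = g (map_prod (\<delta> j) (\<gamma> j) x)"
  proof (rule bexI)
    show "(\<lambda>x. u (fst x) \<oplus>\<^bsub>N\<^esub> v (snd x)) \<in> lin_maps R (prod_module (F j) (G j)) N"
      by (intro lin_maps_plus N lin_maps_comp[OF lin_maps_fst u(1)] lin_maps_comp[OF lin_maps_snd v(1)])
    show "\<forall>x\<in>carrier (prod_module (F (Suc j)) (G (Suc j))).
        f x = u (fst (map_prod (\<delta> j) (\<gamma> j) x)) \<oplus>\<^bsub>N\<^esub> v (snd (map_prod (\<delta> j) (\<gamma> j) x))"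
      using u(2) v(2) lin_maps_prod_split[OF F'(2) G'(2) f] by auto
  qed
qed

lemma Ext_trivial_prod:
  fixes R :: "('a, 'x) ring_scheme"
  assumes "fin_presented R \<infinity> A" "fin_presented R \<infinity> B" "left_module R N"
    "trivial_group (Ext R (Suc j) A N)" "trivial_group (Ext R (Suc j) B N)"
  shows "trivial_group (Ext R (Suc j) (prod_module A B) N)"
proof -
  obtain F :: "nat \<Rightarrow> ('a, nat \<Rightarrow> 'a) module" and \<delta> \<epsilon> where F: "resolution R \<infinity> F \<delta> \<epsilon> A" "\<And>i. fg_free R (F i)" "\<And>i. projective R (F i)"
    using fin_presentedE[OF assms(1)] by metis
  obtain G :: "nat \<Rightarrow> ('a, nat \<Rightarrow> 'a) module" and \<gamma> \<eta> where G: "resolution R \<infinity> G \<gamma> \<eta> B" "\<And>i. fg_free R (G i)" "\<And>i. projective R (G i)"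
    using fin_presentedE[OF assms(2)] by metis
  note F' = resolution_infinityD[OF F(1)] and G' = resolution_infinityD[OF G(1)]
  have proj: "projective R (prod_module (F i) (G i))" for i
    by (intro fg_free_projective fg_free_prod_module left_module_prod_module F G F' G')
  show ?thesis
    unfolding Ext_trivial_iff[OF resolution_prod[OF F(1) G(1)] proj assms(3)]
    using assms(4,5) unfolding Ext_trivial_iff[OF F(1,3) assms(3)] Ext_trivial_iff[OF G(1,3) assms(3)]
    by (rule hom_exact_prod[OF F(1) G(1) assms(3)])
qed

section \<open>Tensored diagrams and products of resolutions\<close>

context
  fixes R :: "('r, 'x) ring_scheme" and N :: "('r, 'n, 'z) module_scheme"
  assumes N: "left_module R N"
begin

lemma tmap_square:
  assumes "left_module (op_ring R) A" "left_module (op_ring R) A1" "left_module (op_ring R) A2" "left_module (op_ring R) B"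
    "f \<in> lin_maps (op_ring R) A A1" "g \<in> lin_maps (op_ring R) A1 B"
    "f' \<in> lin_maps (op_ring R) A A2" "g' \<in> lin_maps (op_ring R) A2 B"
    "\<And>x. x \<in> carrier A \<Longrightarrow> g (f x) = g' (f' x)" "X \<in> carrier (tensor_group R A N)"
  shows "tmap R N B g (tmap R N A1 f X) = tmap R N B g' (tmap R N A2 f' X)"
  using tmap_comp[OF N assms(1,2,4,5,6,10)] tmap_comp[OF N assms(1,3,4,7,8,10)]
    tmap_cong[OF N assms(1,4) lin_maps_comp[OF assms(5,6)] assms(9,10)] by simp

lemma tmap_comp_zero:
  assumes "left_module (op_ring R) A" "left_module (op_ring R) A1" "left_module (op_ring R) B"
    "f \<in> lin_maps (op_ring R) A A1" "g \<in> lin_maps (op_ring R) A1 B"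
    "\<And>x. x \<in> carrier A \<Longrightarrow> g (f x) = \<zero>\<^bsub>B\<^esub>" "X \<in> carrier (tensor_group R A N)"
  shows "tmap R N B g (tmap R N A1 f X) = \<zero>\<^bsub>tensor_group R B N\<^esub>"
  using tmap_comp[OF N assms(1,2,3,4,5,7)] tmap_cong[OF N assms(1,3) lin_maps_comp[OF assms(4,5)] assms(6,7)]
    tmap_const_zero[OF N assms(1,3,7)] by simp

lemma tmap_comp_id:
  assumes "left_module (op_ring R) A" "left_module (op_ring R) A1"
    "f \<in> lin_maps (op_ring R) A A1" "g \<in> lin_maps (op_ring R) A1 A"
    "\<And>x. x \<in> carrier A \<Longrightarrow> g (f x) = x" "X \<in> carrier (tensor_group R A N)"
  shows "tmap R N A g (tmap R N A1 f X) = X"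
  using tmap_comp[OF N assms(1,2,1,3,4,6)] tmap_cong[OF N assms(1,1) lin_maps_comp[OF assms(3,4)] assms(5,6)]
    tmap_id[OF N assms(1,6)] by simp

lemma tmap_zero:
  assumes "left_module (op_ring R) A" "left_module (op_ring R) A'" "f \<in> lin_maps (op_ring R) A A'"
  shows "tmap R N A' f \<zero>\<^bsub>tensor_group R A N\<^esub> = \<zero>\<^bsub>tensor_group R A' N\<^esub>"
  by (intro add_maps_zero tmap_add_maps abelian_group_tensor_group N assms)

lemma tensor_exact_prod:
  assumes F: "resolution (op_ring R) \<infinity> F \<delta> \<epsilon> A" and G: "resolution (op_ring R) \<infinity> G \<gamma> \<eta> B"
    and exF: "tensor_exact R N F \<delta> j" and exG: "tensor_exact R N G \<gamma> j"
  shows "tensor_exact R N (\<lambda>i. prod_module (F i) (G i)) (\<lambda>i. map_prod (\<delta> i) (\<gamma> i)) j"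
  unfolding tensor_exact_def
proof (intro ballI impI)
  note F' = resolution_infinityD[OF F] and G' = resolution_infinityD[OF G]
  define P where "P i = prod_module (F i) (G i)" for i
  define d where "d i = map_prod (\<delta> i) (\<gamma> i)" for i
  have P: "left_module (op_ring R) (P i)" for i unfolding P_def by (rule left_module_prod_module[OF F'(2) G'(2)])
  have d: "d i \<in> lin_maps (op_ring R) (P (Suc i)) (P i)" for i
    unfolding P_def d_def by (rule lin_maps_map_prod[OF F'(5) G'(5)])
  have fst: "fst \<in> lin_maps (op_ring R) (P i) (F i)" and snd: "snd \<in> lin_maps (op_ring R) (P i) (G i)" for i
    unfolding P_def by (rule lin_maps_fst lin_maps_snd)+
  have inl: "(\<lambda>x. (x, \<zero>\<^bsub>G i\<^esub>)) \<in> lin_maps (op_ring R) (F i) (P i)"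
    and inr: "(\<lambda>y. (\<zero>\<^bsub>F i\<^esub>, y)) \<in> lin_maps (op_ring R) (G i) (P i)" for i
    unfolding P_def by (rule lin_maps_inl[OF G'(2)] lin_maps_inr[OF F'(2)])+
  fix X assume "X \<in> carrier (tensor_group R (prod_module (F (Suc j)) (G (Suc j))) N)"
    and "tmap R N (prod_module (F j) (G j)) (map_prod (\<delta> j) (\<gamma> j)) X = \<zero>\<^bsub>tensor_group R (prod_module (F j) (G j)) N\<^esub>"
  then have X: "X \<in> carrier (tensor_group R (P (Suc j)) N)"
    and z: "tmap R N (P j) (d j) X = \<zero>\<^bsub>tensor_group R (P j) N\<^esub>" by (simp_all add: P_def d_def)
  let ?X1 = "tmap R N (F (Suc j)) fst X" and ?X2 = "tmap R N (G (Suc j)) snd X"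
  have X1: "?X1 \<in> carrier (tensor_group R (F (Suc j)) N)" by (rule tmap_closed[OF N P F'(2) fst X])
  have X2: "?X2 \<in> carrier (tensor_group R (G (Suc j)) N)" by (rule tmap_closed[OF N P G'(2) snd X])
  have "tmap R N (F j) (\<delta> j) ?X1 = tmap R N (F j) fst (tmap R N (P j) (d j) X)"
    by (rule tmap_square[OF P F'(2) P F'(2) fst F'(5) d fst _ X]) (auto simp: d_def)
  then have "tmap R N (F j) (\<delta> j) ?X1 = \<zero>\<^bsub>tensor_group R (F j) N\<^esub>"
    unfolding z by (simp add: tmap_zero[OF P F'(2) fst])
  then obtain Y1 where Y1: "Y1 \<in> carrier (tensor_group R (F (Suc (Suc j))) N)" "?X1 = tmap R N (F (Suc j)) (\<delta> (Suc j)) Y1"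
    using exF X1 unfolding tensor_exact_def by blast
  have "tmap R N (G j) (\<gamma> j) ?X2 = tmap R N (G j) snd (tmap R N (P j) (d j) X)"
    by (rule tmap_square[OF P G'(2) P G'(2) snd G'(5) d snd _ X]) (auto simp: d_def)
  then have "tmap R N (G j) (\<gamma> j) ?X2 = \<zero>\<^bsub>tensor_group R (G j) N\<^esub>"
    unfolding z by (simp add: tmap_zero[OF P G'(2) snd])
  then obtain Y2 where Y2: "Y2 \<in> carrier (tensor_group R (G (Suc (Suc j))) N)" "?X2 = tmap R N (G (Suc j)) (\<gamma> (Suc j)) Y2"
    using exG X2 unfolding tensor_exact_def by blast
  let ?Z1 = "tmap R N (P (Suc (Suc j))) (\<lambda>x. (x, \<zero>\<^bsub>G (Suc (Suc j))\<^esub>)) Y1"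
  let ?Z2 = "tmap R N (P (Suc (Suc j))) (\<lambda>y. (\<zero>\<^bsub>F (Suc (Suc j))\<^esub>, y)) Y2"
  interpret T: abelian_group "tensor_group R (P (Suc (Suc j))) N" by (rule abelian_group_tensor_group[OF N P])
  have Z1: "?Z1 \<in> carrier (tensor_group R (P (Suc (Suc j))) N)" by (rule tmap_closed[OF N F'(2) P inl Y1(1)])
  have Z2: "?Z2 \<in> carrier (tensor_group R (P (Suc (Suc j))) N)" by (rule tmap_closed[OF N G'(2) P inr Y2(1)])
  have "tmap R N (P (Suc j)) (d (Suc j)) ?Z1 = tmap R N (P (Suc j)) (\<lambda>x. (x, \<zero>\<^bsub>G (Suc j)\<^esub>)) ?X1"
    unfolding Y1(2)
    by (rule tmap_square[OF F'(2) P F'(2) P inl d F'(5) inl _ Y1(1)])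
      (simp add: d_def lin_maps_zero[OF G'(5) G'(2) G'(2)])
  moreover have "tmap R N (P (Suc j)) (d (Suc j)) ?Z2 = tmap R N (P (Suc j)) (\<lambda>y. (\<zero>\<^bsub>F (Suc j)\<^esub>, y)) ?X2"
    unfolding Y2(2)
    by (rule tmap_square[OF G'(2) P G'(2) P inr d G'(5) inr _ Y2(1)])
      (simp add: d_def lin_maps_zero[OF F'(5) F'(2) F'(2)])
  \<comment> \<open>The identity of a product is the sum of the two projections followed by the
    inclusions, so \<open>X\<close> is recovered from \<open>?X1\<close> and
    \<open>?X2\<close>.\<close>
  moreover have "tmap R N (P (Suc j)) (\<lambda>x. (x, \<zero>\<^bsub>G (Suc j)\<^esub>)) ?X1 \<oplus>\<^bsub>tensor_group R (P (Suc j)) N\<^esub>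
      tmap R N (P (Suc j)) (\<lambda>y. (\<zero>\<^bsub>F (Suc j)\<^esub>, y)) ?X2 = X"
  proof -
    interpret Fj: left_module "op_ring R" "F (Suc j)" by (rule F')
    interpret Gj: left_module "op_ring R" "G (Suc j)" by (rule G')
    note l1 = lin_maps_comp[OF fst inl, of "Suc j"] and l2 = lin_maps_comp[OF snd inr, of "Suc j"]
    have "tmap R N (P (Suc j)) (\<lambda>x. (fst x, \<zero>\<^bsub>G (Suc j)\<^esub>) \<oplus>\<^bsub>P (Suc j)\<^esub> (\<zero>\<^bsub>F (Suc j)\<^esub>, snd x)) X = tmap R N (P (Suc j)) (\<lambda>x. x) X"
      by (rule tmap_cong[OF N P P lin_maps_plus[OF P l1 l2] _ X]) (auto simp: P_def)
    then show ?thesis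
      using tmap_plus[OF N P P l1 l2 X] tmap_id[OF N P X]
        tmap_comp[OF N P F'(2) P fst inl X] tmap_comp[OF N P G'(2) P snd inr X] by simp
  qed
  ultimately have "X = tmap R N (P (Suc j)) (d (Suc j)) (?Z1 \<oplus>\<^bsub>tensor_group R (P (Suc (Suc j))) N\<^esub> ?Z2)"
    using add_maps_add[OF tmap_add_maps[OF N P P d] Z1 Z2] by simp
  then show "\<exists>Y\<in>carrier (tensor_group R (prod_module (F (Suc (Suc j))) (G (Suc (Suc j)))) N).
      X = tmap R N (prod_module (F (Suc j)) (G (Suc j))) (map_prod (\<delta> (Suc j)) (\<gamma> (Suc j))) Y"
    using T.a_closed[OF Z1 Z2] unfolding P_def d_def by blast
qed

end

lemma Tor_trivial_prod:
  fixes R :: "('a, 'x) ring_scheme"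
  assumes "fin_presented (op_ring R) \<infinity> A" "fin_presented (op_ring R) \<infinity> B" "left_module R N"
    "trivial_group (Tor R (Suc j) A N)" "trivial_group (Tor R (Suc j) B N)"
  shows "trivial_group (Tor R (Suc j) (prod_module A B) N)"
proof -
  obtain F :: "nat \<Rightarrow> ('a, nat \<Rightarrow> 'a) module" and \<delta> \<epsilon> where F: "resolution (op_ring R) \<infinity> F \<delta> \<epsilon> A"
    "\<And>i. fg_free (op_ring R) (F i)" "\<And>i. projective (op_ring R) (F i)"
    using fin_presentedE[OF assms(1)] by metis
  obtain G :: "nat \<Rightarrow> ('a, nat \<Rightarrow> 'a) module" and \<gamma> \<eta> where G: "resolution (op_ring R) \<infinity> G \<gamma> \<eta> B"
    "\<And>i. fg_free (op_ring R) (G i)" "\<And>i. projective (op_ring R) (G i)"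
    using fin_presentedE[OF assms(2)] by metis
  note F' = resolution_infinityD[OF F(1)] and G' = resolution_infinityD[OF G(1)]
  have proj: "projective (op_ring R) (prod_module (F i) (G i))" for i
    by (intro fg_free_projective fg_free_prod_module left_module_prod_module F G F' G')
  show ?thesis
    unfolding Tor_trivial_iff[OF resolution_prod[OF F(1) G(1)] proj assms(3)]
    using assms(4,5) unfolding Tor_trivial_iff[OF F(1,3) assms(3)] Tor_trivial_iff[OF G(1,3) assms(3)]
    by (rule tensor_exact_prod[OF assms(3) F(1) G(1)])
qed

section \<open>Mapping cones and dimension shifting\<close>

text \<open>The choice of preimages in \<open>w\<close> is harmless: two of them differ by an
  element of the kernel of \<open>e\<close>, which \<open>u\<close> kills.\<close>

lemma lin_maps_factor:
  assumes "left_module R A" "left_module R B" "left_module R N" and e: "e \<in> lin_maps R A B" and surj: "e ` carrier A = carrier B"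
    and u: "u \<in> lin_maps R A N" and z: "\<And>x. x \<in> carrier A \<Longrightarrow> e x = \<zero>\<^bsub>B\<^esub> \<Longrightarrow> u x = \<zero>\<^bsub>N\<^esub>"
  shows "\<exists>w\<in>lin_maps R B N. \<forall>x\<in>carrier A. w (e x) = u x"
proof -
  interpret A: left_module R A by fact
  interpret B: left_module R B by fact
  interpret N: left_module R N by fact
  define w where "w y = u (inv_into (carrier A) e y)" for y
  have w: "w (e x) = u x" if x: "x \<in> carrier A" for x
  proof -
    let ?x = "inv_into (carrier A) e (e x)"
    have x': "?x \<in> carrier A" "e ?x = e x" using x by (auto intro: inv_into_into f_inv_into_f)
    have "e (?x \<ominus>\<^bsub>A\<^esub> x) = \<zero>\<^bsub>B\<^esub>"
      using lin_maps_diff[OF e assms(1,2) x'(1) x] x'(2) lin_maps_closed[OF e x] by (simp add: a_minus_def B.M.r_neg)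
    then have "u ?x \<ominus>\<^bsub>N\<^esub> u x = \<zero>\<^bsub>N\<^esub>"
      using z[OF A.M.minus_closed[OF x'(1) x]] lin_maps_diff[OF u assms(1,3) x'(1) x] by simp
    then show ?thesis
      unfolding w_def using lin_maps_closed[OF u] x x'(1) N.M.diff_add_cancel N.M.l_zero by metis
  qed
  have "w \<in> lin_maps R B N"
  proof (intro lin_mapsI)
    fix y assume "y \<in> carrier B"
    then obtain x where "x \<in> carrier A" "y = e x" using surj by auto
    then show "w y \<in> carrier N" using w lin_maps_closed[OF u] by simp
  next
    fix y y' assume "y \<in> carrier B" "y' \<in> carrier B"
    then have "y \<in> e ` carrier A" "y' \<in> e ` carrier A" by (simp_all add: surj)
    then obtain x x' where "x \<in> carrier A" "y = e x" "x' \<in> carrier A" "y' = e x'" by auto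
    then show "w (y \<oplus>\<^bsub>B\<^esub> y') = w y \<oplus>\<^bsub>N\<^esub> w y'"
      using w lin_maps_add[OF u] lin_maps_add[OF e, symmetric] by simp
  next
    fix r y assume "r \<in> carrier R" "y \<in> carrier B"
    then obtain x where "x \<in> carrier A" "y = e x" "r \<in> carrier R" using surj by auto
    then show "w (r \<odot>\<^bsub>B\<^esub> y) = r \<odot>\<^bsub>N\<^esub> w y"
      using w lin_maps_smult[OF u] lin_maps_smult[OF e, symmetric] by simp
  qed
  then show ?thesis using w by blast
qed

text \<open>A short exact sequence from \<open>A\<close> over \<open>B\<close> to \<open>C\<close>,
  resolutions of the first two modules, and a chain map \<open>\<phi>\<close> over \<open>a\<close>.
  The cone of \<open>\<phi>\<close> resolves \<open>C\<close>. It yields both the finite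
  presentation of \<open>C\<close> and, by splitting its maps into components, the required pieces
  of the long exact sequences.\<close>

locale mapping_cone =
  fixes R :: "('r, 'x) ring_scheme"
    and A :: "('r, 'a, 'y1) module_scheme" and B :: "('r, 'b, 'y2) module_scheme" and C :: "('r, 'c, 'y3) module_scheme"
    and a :: "'a \<Rightarrow> 'b" and b :: "'b \<Rightarrow> 'c"
    and P :: "nat \<Rightarrow> ('r, 'p) module" and \<delta>P \<epsilon>P and Q :: "nat \<Rightarrow> ('r, 'q) module" and \<delta>Q \<epsilon>Q
    and \<phi> :: "nat \<Rightarrow> 'p \<Rightarrow> 'q"
  assumes P: "resolution R \<infinity> P \<delta>P \<epsilon>P A" and Q: "resolution R \<infinity> Q \<delta>Q \<epsilon>Q B" and C: "left_module R C"
    and a: "a \<in> lin_maps R A B" and b: "b \<in> lin_maps R B C"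
    and a_inj: "\<And>x. x \<in> carrier A \<Longrightarrow> a x = \<zero>\<^bsub>B\<^esub> \<Longrightarrow> x = \<zero>\<^bsub>A\<^esub>"
    and b_surj: "b ` carrier B = carrier C"
    and ba: "\<And>x. x \<in> carrier A \<Longrightarrow> b (a x) = \<zero>\<^bsub>C\<^esub>"
    and ker_b: "\<And>y. y \<in> carrier B \<Longrightarrow> b y = \<zero>\<^bsub>C\<^esub> \<Longrightarrow> \<exists>x\<in>carrier A. y = a x"
    and \<phi>: "\<And>i. \<phi> i \<in> lin_maps R (P i) (Q i)"
    and \<phi>\<epsilon>: "\<And>x. x \<in> carrier (P 0) \<Longrightarrow> \<epsilon>Q (\<phi> 0 x) = a (\<epsilon>P x)"
    and \<phi>\<delta>: "\<And>i x. x \<in> carrier (P (Suc i)) \<Longrightarrow> \<delta>Q i (\<phi> (Suc i) x) = \<phi> i (\<delta>P i x)"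
begin

lemmas P' = resolution_infinityD[OF P] and Q' = resolution_infinityD[OF Q]

text \<open>The cone is \<open>X\<^sub>i = Q\<^sub>i \<oplus> P\<^sub>i\<^sub>-\<^sub>1\<close>. In degree \<open>0\<close> the second factor is the zero submodule of
  \<open>P\<^sub>0\<close>, so that all \<open>X\<^sub>i\<close> have one type.\<close>

definition P1 :: "nat \<Rightarrow> ('r, 'p) module" where
  "P1 i = (case i of 0 \<Rightarrow> (P 0)\<lparr>carrier := {\<zero>\<^bsub>P 0\<^esub>}\<rparr> | Suc k \<Rightarrow> P k)"

text \<open>The second component of the differential of the cone. With the minus sign the two cross
  terms \<open>\<delta>Q \<phi> p\<close> and \<open>\<phi> (\<ominus> \<delta>P p)\<close> cancel
  in the square of the differential. In degree zero the target is the zero submodule.\<close>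

definition \<delta>1 :: "nat \<Rightarrow> 'p \<Rightarrow> 'p" where
  "\<delta>1 i p = (case i of 0 \<Rightarrow> \<zero>\<^bsub>P 0\<^esub> | Suc k \<Rightarrow> \<ominus>\<^bsub>P k\<^esub> \<delta>P k p)"

definition X :: "nat \<Rightarrow> ('r, 'q \<times> 'p) module" where
  "X i = prod_module (Q i) (P1 i)"

definition \<delta>X :: "nat \<Rightarrow> 'q \<times> 'p \<Rightarrow> 'q \<times> 'p" where
  "\<delta>X i = (\<lambda>x. (\<delta>Q i (fst x) \<oplus>\<^bsub>Q i\<^esub> \<phi> i (snd x), \<delta>1 i (snd x)))"

definition \<epsilon>X :: "'q \<times> 'p \<Rightarrow> 'c" where
  "\<epsilon>X x = b (\<epsilon>Q (fst x))"

lemma P1_Suc [simp]: "P1 (Suc k) = P k" by (simp add: P1_def)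
lemma \<delta>1_Suc: "\<delta>1 (Suc k) p = \<ominus>\<^bsub>P k\<^esub> \<delta>P k p" by (simp add: \<delta>1_def)
lemma zero_P1_0: "\<zero>\<^bsub>P1 0\<^esub> = \<zero>\<^bsub>P 0\<^esub>" "carrier (P1 0) = {\<zero>\<^bsub>P 0\<^esub>}" by (simp_all add: P1_def)

lemma left_module_zero_submodule: "left_module R M \<Longrightarrow> left_module R (M\<lparr>carrier := {\<zero>\<^bsub>M\<^esub>}\<rparr>)"
proof (rule left_module_submodule)
  assume "left_module R M"
  then interpret left_module R M .
  show "{\<zero>\<^bsub>M\<^esub>} \<subseteq> carrier M" "\<And>x y. x \<in> {\<zero>\<^bsub>M\<^esub>} \<Longrightarrow> y \<in> {\<zero>\<^bsub>M\<^esub>} \<Longrightarrow> x \<oplus>\<^bsub>M\<^esub> y \<in> {\<zero>\<^bsub>M\<^esub>}"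
    "\<And>r x. r \<in> carrier R \<Longrightarrow> x \<in> {\<zero>\<^bsub>M\<^esub>} \<Longrightarrow> r \<odot>\<^bsub>M\<^esub> x \<in> {\<zero>\<^bsub>M\<^esub>}" by auto
qed auto

lemma P1: "left_module R (P1 i)"
  using P' left_module_zero_submodule[OF P'(2), of 0] by (simp add: P1_def split: nat.split)

lemma X: "left_module R (X i)"
  unfolding X_def by (rule left_module_prod_module[OF Q'(2) P1])

lemma carrier_X: "carrier (X i) = carrier (Q i) \<times> carrier (P1 i)" by (simp add: X_def)

lemma fst_X: "fst \<in> lin_maps R (X i) (Q i)" unfolding X_def by (rule lin_maps_fst)
lemma snd_X: "snd \<in> lin_maps R (X i) (P1 i)" unfolding X_def by (rule lin_maps_snd)
lemma inl_X: "(\<lambda>q. (q, \<zero>\<^bsub>P1 i\<^esub>)) \<in> lin_maps R (Q i) (X i)" unfolding X_def by (rule lin_maps_inl[OF P1])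
lemma inr_X: "(\<lambda>p. (\<zero>\<^bsub>Q i\<^esub>, p)) \<in> lin_maps R (P1 i) (X i)" unfolding X_def by (rule lin_maps_inr[OF Q'(2)])

lemma \<delta>1: "\<delta>1 i \<in> lin_maps R (P i) (P1 i)"
proof (cases i)
  case 0
  have "(\<lambda>x. \<zero>\<^bsub>P1 0\<^esub>) \<in> lin_maps R (P 0) (P1 0)" by (rule lin_maps_const_zero[OF P1])
  moreover have "\<delta>1 0 = (\<lambda>x. \<zero>\<^bsub>P1 0\<^esub>)" by (simp add: fun_eq_iff \<delta>1_def zero_P1_0)
  ultimately show ?thesis using 0 by simp
next
  case (Suc k)
  have "\<delta>1 (Suc k) = (\<lambda>p. \<ominus>\<^bsub>P k\<^esub> \<delta>P k p)" by (simp add: fun_eq_iff \<delta>1_Suc)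
  then show ?thesis using lin_maps_uminus[OF P'(2) P'(5), of k] Suc by simp
qed

lemma \<delta>X: "\<delta>X i \<in> lin_maps R (X (Suc i)) (X i)"
proof -
  have s: "snd \<in> lin_maps R (X (Suc i)) (P i)" using snd_X[of "Suc i"] by simp
  show ?thesis
    unfolding \<delta>X_def X_def[of i]
    by (intro lin_maps_Pair lin_maps_plus Q'(2) lin_maps_comp[OF fst_X Q'(5)] lin_maps_comp[OF s \<phi>] lin_maps_comp[OF s \<delta>1])
qed

lemma \<epsilon>X: "\<epsilon>X \<in> lin_maps R (X 0) C"
  unfolding \<epsilon>X_def by (rule lin_maps_comp[OF lin_maps_comp[OF fst_X Q'(3)] b])

lemma \<delta>X_Pair: "\<delta>X i (q, p) = (\<delta>Q i q \<oplus>\<^bsub>Q i\<^esub> \<phi> i p, \<delta>1 i p)" by (simp add: \<delta>X_def)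

text \<open>For a cycle \<open>(q, p)\<close> of the cone, first \<open>p\<close> is shown to be a
  boundary; correcting \<open>q\<close> by \<open>\<phi>\<close> of a preimage then leaves a cycle
  of \<open>Q\<close>, which is a boundary as well.\<close>

lemma exact_X:
  assumes q: "q \<in> carrier (Q (Suc i))" and p: "p \<in> carrier (P i)" and z: "\<delta>Q i q \<oplus>\<^bsub>Q i\<^esub> \<phi> i p = \<zero>\<^bsub>Q i\<^esub>"
    and ip: "\<And>k. i = Suc k \<Longrightarrow> \<delta>P k p = \<zero>\<^bsub>P k\<^esub>"
  shows "\<exists>y\<in>carrier (X (Suc (Suc i))). (q, p) = \<delta>X (Suc i) y"
proof -
  interpret Pi: left_module R "P i" by (rule P')
  interpret Qi: left_module R "Q i" by (rule Q')
  interpret PS: left_module R "P (Suc i)" by (rule P')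
  interpret QS: left_module R "Q (Suc i)" by (rule Q')
  have c: "\<delta>Q i q \<in> carrier (Q i)" "\<phi> i p \<in> carrier (Q i)"
    using lin_maps_closed[OF Q'(5) q] lin_maps_closed[OF \<phi> p] by auto
  have "\<exists>p'\<in>carrier (P (Suc i)). p = \<delta>P i p'"
  proof (cases i)
    case 0
    interpret B: left_module R B by (rule Q')
    have q0: "q \<in> carrier (Q (Suc 0))" and p0: "p \<in> carrier (P 0)" using q p 0 by auto
    \<comment> \<open>In degree zero the second component imposes nothing on \<open>p\<close>.
      Instead the augmentation of \<open>Q\<close> shows that \<open>\<epsilon>P p\<close> is killed
      by \<open>a\<close>, and here injectivity of \<open>a\<close> enters.\<close>
    have "a (\<epsilon>P p) = \<epsilon>Q (\<delta>Q 0 q) \<oplus>\<^bsub>B\<^esub> \<epsilon>Q (\<phi> 0 p)"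
      using resolution_comp_zero(1)[OF Q q0] \<phi>\<epsilon>[OF p0] lin_maps_closed[OF a lin_maps_closed[OF P'(3) p0]] by simp
    also have "\<dots> = \<epsilon>Q (\<delta>Q 0 q \<oplus>\<^bsub>Q 0\<^esub> \<phi> 0 p)"
      by (rule lin_maps_add[OF Q'(3), symmetric]) (use c 0 in auto)
    also have "\<dots> = \<zero>\<^bsub>B\<^esub>" using z 0 lin_maps_zero[OF Q'(3) Q'(2) Q'(1)] by simp
    finally show ?thesis
      using a_inj lin_maps_closed[OF P'(3) p0] resolution_exact(1)[OF P p0] 0 by simp
  next
    case (Suc k)
    then show ?thesis using ip[OF Suc] resolution_exact(2)[OF P] p by simp
  qed
  then obtain p' where p': "p' \<in> carrier (P (Suc i))" "p = \<delta>P i p'" by blast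
  \<comment> \<open>The sign compensates for the one in \<open>\<delta>1\<close>: the second
    component of the preimage must be the negative of \<open>p'\<close>.\<close>
  let ?p = "\<ominus>\<^bsub>P (Suc i)\<^esub> p'"
  have \<phi>p: "\<phi> (Suc i) ?p \<in> carrier (Q (Suc i))" using lin_maps_closed[OF \<phi>] p' by simp
  have "\<delta>Q i (q \<ominus>\<^bsub>Q (Suc i)\<^esub> \<phi> (Suc i) ?p) = \<delta>Q i q \<ominus>\<^bsub>Q i\<^esub> \<phi> i (\<delta>P i ?p)"
    using lin_maps_diff[OF Q'(5) Q'(2) Q'(2) q \<phi>p] \<phi>\<delta> p' by simp
  also have "\<dots> = \<delta>Q i q \<oplus>\<^bsub>Q i\<^esub> \<phi> i p"
    using p' p c lin_maps_minus[OF P'(5) P'(2) P'(2) p'(1)] lin_maps_minus[OF \<phi> P'(2) Q'(2) p]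
    by (simp add: a_minus_def)
  finally obtain q' where q': "q' \<in> carrier (Q (Suc (Suc i)))" "q \<ominus>\<^bsub>Q (Suc i)\<^esub> \<phi> (Suc i) ?p = \<delta>Q (Suc i) q'"
    using resolution_exact(2)[OF Q QS.M.minus_closed[OF q \<phi>p]] z by auto
  have "\<delta>X (Suc i) (q', ?p) = (q, p)"
    using q'(2)[symmetric] QS.M.diff_add_cancel[OF q \<phi>p] p' lin_maps_minus[OF P'(5) P'(2) P'(2) p'(1)] p
    by (simp add: \<delta>X_Pair \<delta>1_Suc)
  then show ?thesis using q' p' by (intro bexI[of _ "(q', ?p)"]) (auto simp: carrier_X)
qed

lemma resolution_X: "resolution R \<infinity> X \<delta>X \<epsilon>X C"
proof (rule resolution_infinityI'[OF C X \<epsilon>X _ \<delta>X])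
  show "\<epsilon>X ` carrier (X 0) = carrier C"
    unfolding b_surj[symmetric] Q'(4)[symmetric] by (auto simp: \<epsilon>X_def carrier_X zero_P1_0 image_iff)
next
  fix x assume "x \<in> carrier (X (Suc 0))"
  then obtain q p where x: "x = (q, p)" "q \<in> carrier (Q (Suc 0))" "p \<in> carrier (P 0)" by (auto simp: carrier_X)
  interpret B: left_module R B by (rule Q')
  have "\<epsilon>Q (\<delta>Q 0 q \<oplus>\<^bsub>Q 0\<^esub> \<phi> 0 p) = \<epsilon>Q (\<delta>Q 0 q) \<oplus>\<^bsub>B\<^esub> \<epsilon>Q (\<phi> 0 p)"
    by (intro lin_maps_add[OF Q'(3)] lin_maps_closed[OF Q'(5)] lin_maps_closed[OF \<phi>] x)
  also have "\<dots> = a (\<epsilon>P p)"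
    using x resolution_comp_zero(1)[OF Q] \<phi>\<epsilon> lin_maps_closed[OF a lin_maps_closed[OF P'(3)]] by simp
  finally show "\<epsilon>X (\<delta>X 0 x) = \<zero>\<^bsub>C\<^esub>" using x ba lin_maps_closed[OF P'(3)] by (simp add: \<epsilon>X_def \<delta>X_Pair)
next
  fix i x assume "x \<in> carrier (X (Suc (Suc i)))"
  then obtain q p where x: "x = (q, p)" "q \<in> carrier (Q (Suc (Suc i)))" "p \<in> carrier (P (Suc i))" by (auto simp: carrier_X)
  interpret Pi: left_module R "P i" by (rule P')
  interpret Qi: left_module R "Q i" by (rule Q')
  have dp: "\<delta>P i p \<in> carrier (P i)" using lin_maps_closed[OF P'(5) x(3)] .
  have \<phi>dp: "\<phi> i (\<delta>P i p) \<in> carrier (Q i)" using lin_maps_closed[OF \<phi> dp] .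
  have "\<delta>Q i (\<delta>Q (Suc i) q \<oplus>\<^bsub>Q (Suc i)\<^esub> \<phi> (Suc i) p) = \<delta>Q i (\<delta>Q (Suc i) q) \<oplus>\<^bsub>Q i\<^esub> \<delta>Q i (\<phi> (Suc i) p)"
    by (intro lin_maps_add[OF Q'(5)] lin_maps_closed[OF Q'(5)] lin_maps_closed[OF \<phi>] x)
  also have "\<dots> = \<phi> i (\<delta>P i p)"
    using x resolution_comp_zero(2)[OF Q] \<phi>\<delta> \<phi>dp by simp
  finally have 1: "\<delta>Q i (\<delta>Q (Suc i) q \<oplus>\<^bsub>Q (Suc i)\<^esub> \<phi> (Suc i) p) \<oplus>\<^bsub>Q i\<^esub> \<phi> i (\<ominus>\<^bsub>P i\<^esub> \<delta>P i p) = \<zero>\<^bsub>Q i\<^esub>"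
    using lin_maps_minus[OF \<phi> P'(2) Q'(2) dp] \<phi>dp by (simp add: Qi.M.r_neg)
  have 2: "\<delta>1 i (\<ominus>\<^bsub>P i\<^esub> \<delta>P i p) = \<zero>\<^bsub>P1 i\<^esub>"
  proof (cases i)
    case 0
    then show ?thesis by (simp add: \<delta>1_def zero_P1_0)
  next
    case (Suc k)
    interpret Pk: left_module R "P k" by (rule P')
    show ?thesis
      using Suc x dp resolution_comp_zero(2)[OF P] lin_maps_minus[OF P'(5) P'(2) P'(2), of "\<delta>P i p" k]
      by (simp add: \<delta>1_Suc)
  qed
  show "\<delta>X i (\<delta>X (Suc i) x) = \<zero>\<^bsub>X i\<^esub>"
    using 1 2 x by (simp add: \<delta>X_Pair \<delta>1_Suc X_def)
next
  fix x assume "x \<in> carrier (X 0)" and z: "\<epsilon>X x = \<zero>\<^bsub>C\<^esub>"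
  then obtain q where x: "x = (q, \<zero>\<^bsub>P 0\<^esub>)" "q \<in> carrier (Q 0)" by (auto simp: carrier_X zero_P1_0)
  interpret Q0: left_module R "Q 0" by (rule Q')
  interpret B: left_module R B by (rule Q')
  \<comment> \<open>Exactness at \<open>B\<close> provides \<open>y\<close>; a lift \<open>p\<close>
    of \<open>y\<close> to \<open>P 0\<close> corrects \<open>q\<close> to an element of the kernel
    of \<open>\<epsilon>Q\<close>, which is a boundary.\<close>
  obtain y where y: "y \<in> carrier A" "\<epsilon>Q q = a y"
    using z ker_b lin_maps_closed[OF Q'(3) x(2)] x(1) by (auto simp: \<epsilon>X_def)
  have "y \<in> \<epsilon>P ` carrier (P 0)" using y(1) P'(4) by simp
  then obtain p where p: "p \<in> carrier (P 0)" "y = \<epsilon>P p" by auto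
  have \<phi>p: "\<phi> 0 p \<in> carrier (Q 0)" by (rule lin_maps_closed[OF \<phi> p(1)])
  have "\<epsilon>Q (q \<ominus>\<^bsub>Q 0\<^esub> \<phi> 0 p) = \<zero>\<^bsub>B\<^esub>"
    using lin_maps_diff[OF Q'(3) Q'(2) Q'(1) x(2) \<phi>p] \<phi>\<epsilon>[OF p(1)] y p lin_maps_closed[OF a y(1)]
    by (simp add: a_minus_def B.M.r_neg)
  then obtain q' where q': "q' \<in> carrier (Q (Suc 0))" "q \<ominus>\<^bsub>Q 0\<^esub> \<phi> 0 p = \<delta>Q 0 q'"
    using resolution_exact(1)[OF Q Q0.M.minus_closed[OF x(2) \<phi>p]] by blast
  have "\<delta>X 0 (q', p) = x"
    using q'(2)[symmetric] Q0.M.diff_add_cancel[OF x(2) \<phi>p] x by (simp add: \<delta>X_Pair \<delta>1_def)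
  then show "\<exists>y\<in>carrier (X (Suc 0)). x = \<delta>X 0 y"
    using q' p by (intro bexI[of _ "(q', p)"]) (auto simp: carrier_X)
next
  fix i x assume "x \<in> carrier (X (Suc i))" and z: "\<delta>X i x = \<zero>\<^bsub>X i\<^esub>"
  then obtain q p where x: "x = (q, p)" "q \<in> carrier (Q (Suc i))" "p \<in> carrier (P i)" by (auto simp: carrier_X)
  have "\<delta>P k p = \<zero>\<^bsub>P k\<^esub>" if "i = Suc k" for k
  proof -
    interpret Pk: left_module R "P k" by (rule P')
    have "\<ominus>\<^bsub>P k\<^esub> \<delta>P k p = \<zero>\<^bsub>P k\<^esub>" using z x that by (simp add: \<delta>X_Pair X_def \<delta>1_Suc)
    then show ?thesis using lin_maps_closed[OF P'(5), of p k] x that Pk.M.r_neg Pk.M.r_zero by metis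
  qed
  then show "\<exists>y\<in>carrier (X (Suc (Suc i))). x = \<delta>X (Suc i) y"
    unfolding x(1) using z x by (intro exact_X) (auto simp: \<delta>X_Pair X_def)
qed

lemma fg_free_X:
  assumes "\<And>i. fg_free R (P i)" "\<And>i. fg_free R (Q i)"
  shows "fg_free R (X i)"
proof -
  have "fg_free R (P1 i)"
    using assms(1) fg_free_zero[OF P1, of 0] by (cases i) (auto simp: zero_P1_0)
  then show ?thesis unfolding X_def by (rule fg_free_prod_module[OF Q'(2) P1 assms(2)])
qed

text \<open>A cocycle \<open>f\<close> on \<open>P i\<close>, composed with the second projection,
  is a cocycle on \<open>X (Suc i)\<close>. If it is the coboundary of \<open>g\<close>, let
  \<open>u\<close> and \<open>v\<close> be the restrictions of \<open>g\<close> to the two summands.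
  Pairs \<open>(q, 0)\<close> show that \<open>u\<close> is a cocycle on \<open>Q\<close>, and pairs
  \<open>(0, p)\<close> give the formula for \<open>f\<close>.\<close>

lemma hom_exact_X:
  assumes N: "left_module R N" and ex: "hom_exact R N X \<delta>X i" and f: "f \<in> lin_maps R (P i) N"
    and z: "\<And>x. x \<in> carrier (P (Suc i)) \<Longrightarrow> f (\<delta>P i x) = \<zero>\<^bsub>N\<^esub>"
  obtains u v where "u \<in> lin_maps R (Q i) N" "v \<in> lin_maps R (P1 i) N"
    "\<And>q. q \<in> carrier (Q (Suc i)) \<Longrightarrow> u (\<delta>Q i q) = \<zero>\<^bsub>N\<^esub>"
    "\<And>p. p \<in> carrier (P i) \<Longrightarrow> f p = u (\<phi> i p) \<oplus>\<^bsub>N\<^esub> v (\<delta>1 i p)"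
proof -
  interpret N: left_module R N by fact
  interpret Pi: left_module R "P i" by (rule P')
  interpret Qi: left_module R "Q i" by (rule Q')
  interpret QS: left_module R "Q (Suc i)" by (rule Q')
  have s: "snd \<in> lin_maps R (X (Suc i)) (P i)" using snd_X[of "Suc i"] by simp
  have "\<forall>x\<in>carrier (X (Suc (Suc i))). f (snd (\<delta>X (Suc i) x)) = \<zero>\<^bsub>N\<^esub>"
    using z lin_maps_minus[OF f P'(2) N lin_maps_closed[OF P'(5)]] by (auto simp: carrier_X \<delta>X_def \<delta>1_Suc)
  then obtain g where g: "g \<in> lin_maps R (X i) N" "\<And>x. x \<in> carrier (X (Suc i)) \<Longrightarrow> f (snd x) = g (\<delta>X i x)"
    using bspec[OF ex[unfolded hom_exact_def] lin_maps_comp[OF s f]] by blast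
  let ?u = "\<lambda>q. g (q, \<zero>\<^bsub>P1 i\<^esub>)" and ?v = "\<lambda>p. g (\<zero>\<^bsub>Q i\<^esub>, p)"
  have u: "?u \<in> lin_maps R (Q i) N" by (rule lin_maps_comp[OF inl_X g(1)])
  have v: "?v \<in> lin_maps R (P1 i) N" by (rule lin_maps_comp[OF inr_X g(1)])
  have f_eq: "f p = ?u (\<delta>Q i q \<oplus>\<^bsub>Q i\<^esub> \<phi> i p) \<oplus>\<^bsub>N\<^esub> ?v (\<delta>1 i p)" if "q \<in> carrier (Q (Suc i))" "p \<in> carrier (P i)" for q p
    using g(2)[of "(q, p)"] that
      lin_maps_prod_split[OF Q'(2) P1 g(1)[unfolded X_def], of "\<delta>Q i q \<oplus>\<^bsub>Q i\<^esub> \<phi> i p" "\<delta>1 i p"]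
      lin_maps_closed[OF Q'(5)] lin_maps_closed[OF \<phi>] lin_maps_closed[OF \<delta>1]
    by (simp add: carrier_X \<delta>X_Pair)
  show thesis
  proof (rule that[OF u v])
    fix q assume q: "q \<in> carrier (Q (Suc i))"
    have "\<zero>\<^bsub>N\<^esub> = ?u (\<delta>Q i q \<oplus>\<^bsub>Q i\<^esub> \<zero>\<^bsub>Q i\<^esub>) \<oplus>\<^bsub>N\<^esub> ?v \<zero>\<^bsub>P1 i\<^esub>"
      using f_eq[OF q Pi.M.zero_closed] lin_maps_zero[OF f P'(2) N] lin_maps_zero[OF \<phi> P'(2) Q'(2)]
        lin_maps_zero[OF \<delta>1 P'(2) P1] by simp
    also have "\<dots> = ?u (\<delta>Q i q)"
      using lin_maps_closed[OF Q'(5) q] lin_maps_closed[OF u] lin_maps_zero[OF v P1 N] by simp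
    finally show "?u (\<delta>Q i q) = \<zero>\<^bsub>N\<^esub>" ..
  next
    fix p assume p: "p \<in> carrier (P i)"
    show "f p = ?u (\<phi> i p) \<oplus>\<^bsub>N\<^esub> ?v (\<delta>1 i p)"
      using f_eq[OF QS.M.zero_closed p] lin_maps_zero[OF Q'(5) Q'(2) Q'(2)] lin_maps_closed[OF \<phi> p] by simp
  qed
qed

text \<open>The piece \<open>Ext^(j+1)(B) -> Ext^(j+1)(A) -> Ext^(j+2)(C)\<close> of the long exact
  sequence. By exactness for \<open>Q\<close> the cocycle \<open>u\<close> is
  \<open>w\<delta>\<close>, so
  \<open>f = w\<delta>\<phi> - v\<delta> = (w\<phi> - v)\<delta>\<close>.\<close>

lemma hom_exact_shift:
  assumes N: "left_module R N" and exX: "hom_exact R N X \<delta>X (Suc j)" and exQ: "hom_exact R N Q \<delta>Q j"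
  shows "hom_exact R N P \<delta>P j"
  unfolding hom_exact_def
proof (intro ballI impI)
  fix f assume f: "f \<in> lin_maps R (P (Suc j)) N" and z: "\<forall>x\<in>carrier (P (Suc (Suc j))). f (\<delta>P (Suc j) x) = \<zero>\<^bsub>N\<^esub>"
  have z': "\<And>x. x \<in> carrier (P (Suc (Suc j))) \<Longrightarrow> f (\<delta>P (Suc j) x) = \<zero>\<^bsub>N\<^esub>" using z by blast
  obtain u v where u: "u \<in> lin_maps R (Q (Suc j)) N" and v: "v \<in> lin_maps R (P1 (Suc j)) N"
    and uz: "\<And>q. q \<in> carrier (Q (Suc (Suc j))) \<Longrightarrow> u (\<delta>Q (Suc j) q) = \<zero>\<^bsub>N\<^esub>"
    and fuv: "\<And>p. p \<in> carrier (P (Suc j)) \<Longrightarrow> f p = u (\<phi> (Suc j) p) \<oplus>\<^bsub>N\<^esub> v (\<delta>1 (Suc j) p)"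
    using hom_exact_X[OF N exX f z'] by blast
  obtain w where w: "w \<in> lin_maps R (Q j) N" "\<And>q. q \<in> carrier (Q (Suc j)) \<Longrightarrow> u q = w (\<delta>Q j q)"
    using exQ u uz unfolding hom_exact_def by blast
  have v': "v \<in> lin_maps R (P j) N" using v by simp
  show "\<exists>g\<in>lin_maps R (P j) N. \<forall>x\<in>carrier (P (Suc j)). f x = g (\<delta>P j x)"
  proof (intro bexI ballI)
    show "(\<lambda>p. w (\<phi> j p) \<ominus>\<^bsub>N\<^esub> v p) \<in> lin_maps R (P j) N"
      by (intro lin_maps_minus_fun N lin_maps_comp[OF \<phi> w(1)] v')
    fix p assume p: "p \<in> carrier (P (Suc j))"
    then show "f p = w (\<phi> j (\<delta>P j p)) \<ominus>\<^bsub>N\<^esub> v (\<delta>P j p)"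
      using fuv[OF p] w(2)[OF lin_maps_closed[OF \<phi> p]] \<phi>\<delta>[OF p]
        lin_maps_minus[OF v' P'(2) N lin_maps_closed[OF P'(5) p]]
      by (simp add: \<delta>1_Suc a_minus_def)
  qed
qed

text \<open>The piece \<open>Hom(B) -> Hom(A) -> Ext^1(C)\<close>. The map
  \<open>f\<epsilon>P\<close> is a cocycle on \<open>P 0\<close>; the resulting \<open>u\<close>
  kills the boundaries in \<open>Q 0\<close>, so it descends to \<open>B\<close> and there extends
  \<open>f\<close>. The term with \<open>v\<close> disappears, as \<open>\<delta>1 0\<close> is
  zero.\<close>

lemma hom_extend:
  assumes N: "left_module R N" and ex: "hom_exact R N X \<delta>X 0" and f: "f \<in> lin_maps R A N"
  shows "\<exists>g\<in>lin_maps R B N. \<forall>x\<in>carrier A. g (a x) = f x"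
proof -
  interpret N: left_module R N by fact
  have z: "f (\<epsilon>P (\<delta>P 0 x)) = \<zero>\<^bsub>N\<^esub>" if "x \<in> carrier (P (Suc 0))" for x
    using resolution_comp_zero(1)[OF P that] lin_maps_zero[OF f P'(1) N] by simp
  obtain u v where u: "u \<in> lin_maps R (Q 0) N" and v: "v \<in> lin_maps R (P1 0) N"
    and uz: "\<And>q. q \<in> carrier (Q (Suc 0)) \<Longrightarrow> u (\<delta>Q 0 q) = \<zero>\<^bsub>N\<^esub>"
    and fuv: "\<And>p. p \<in> carrier (P 0) \<Longrightarrow> f (\<epsilon>P p) = u (\<phi> 0 p) \<oplus>\<^bsub>N\<^esub> v (\<delta>1 0 p)"
    using hom_exact_X[OF N ex lin_maps_comp[OF P'(3) f] z] by blast
  have "\<exists>w\<in>lin_maps R B N. \<forall>q\<in>carrier (Q 0). w (\<epsilon>Q q) = u q"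
    by (rule lin_maps_factor[OF Q'(2) Q'(1) N Q'(3) Q'(4) u]) (use uz resolution_exact(1)[OF Q] in auto)
  then obtain w where w: "w \<in> lin_maps R B N" "\<And>q. q \<in> carrier (Q 0) \<Longrightarrow> w (\<epsilon>Q q) = u q" by blast
  have "w (a x) = f x" if "x \<in> carrier A" for x
  proof -
    have "x \<in> \<epsilon>P ` carrier (P 0)" using that P'(4) by simp
    then obtain p where p: "p \<in> carrier (P 0)" "x = \<epsilon>P p" by auto
    have "v (\<delta>1 0 p) = \<zero>\<^bsub>N\<^esub>" using lin_maps_zero[OF v P1 N] by (simp add: \<delta>1_def zero_P1_0)
    then have "f x = u (\<phi> 0 p)" using fuv p lin_maps_closed[OF u lin_maps_closed[OF \<phi>]] by simp
    also have "\<dots> = w (a x)" using w(2)[OF lin_maps_closed[OF \<phi>]] \<phi>\<epsilon> p by simp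
    finally show ?thesis ..
  qed
  then show ?thesis using w(1) by blast
qed

end

text \<open>The element of the cone with components \<open>-W\<close> and \<open>Z\<close> is a
  cycle, hence a boundary; its second component exhibits \<open>Z\<close> as a boundary in
  \<open>P\<close>. The modules are over \<open>R\<close>, and to be tensored they must be right
  modules, whence the equation \<open>R = op_ring R'\<close>.\<close>

lemma (in mapping_cone) tensor_exact_X:
  assumes R: "R = op_ring R'" and N: "left_module R' N" and ex: "tensor_exact R' N X \<delta>X i"
    and Z: "Z \<in> carrier (tensor_group R' (P i) N)" and W: "W \<in> carrier (tensor_group R' (Q (Suc i)) N)"
    and ZW: "tmap R' N (Q i) (\<phi> i) Z = tmap R' N (Q i) (\<delta>Q i) W"
    and z: "tmap R' N (P1 i) (\<delta>1 i) Z = \<zero>\<^bsub>tensor_group R' (P1 i) N\<^esub>"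
  shows "\<exists>Y\<in>carrier (tensor_group R' (P (Suc i)) N). Z = tmap R' N (P i) (\<delta>P i) Y"
proof -
  note ag = abelian_group_tensor_group[OF N]
  note Pm = P'(2)[unfolded R] and Qm = Q'(2)[unfolded R] and Xm = X[unfolded R] and P1m = P1[unfolded R]
  note dPm = P'(5)[unfolded R] and dQm = Q'(5)[unfolded R] and \<phi>m = \<phi>[unfolded R] and dXm = \<delta>X[unfolded R]
  note d1m = \<delta>1[unfolded R] and inlm = inl_X[unfolded R] and inrm = inr_X[unfolded R] and fstm = fst_X[unfolded R] and sndm = snd_X[unfolded R]
  interpret TX: abelian_group "tensor_group R' (X (Suc i)) N" by (rule ag[OF Xm])
  interpret TXi: abelian_group "tensor_group R' (X i) N" by (rule ag[OF Xm])
  interpret TP: abelian_group "tensor_group R' (P i) N" by (rule ag[OF Pm])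
  interpret Pi: left_module R "P i" by (rule P')
  interpret Qi: left_module R "Q i" by (rule Q')
  interpret P1i: left_module R "P1 i" by (rule P1)
  interpret QS: left_module R "Q (Suc i)" by (rule Q')
  have snd': "snd \<in> lin_maps (op_ring R') (X (Suc i)) (P i)" using sndm[of "Suc i"] by simp
  have inr': "(\<lambda>p. (\<zero>\<^bsub>Q (Suc i)\<^esub>, p)) \<in> lin_maps (op_ring R') (P i) (X (Suc i))" using inrm[of "Suc i"] by simp
  have inl': "(\<lambda>q. (q, \<zero>\<^bsub>P i\<^esub>)) \<in> lin_maps (op_ring R') (Q (Suc i)) (X (Suc i))" using inlm[of "Suc i"] by simp
  let ?V1 = "tmap R' N (X (Suc i)) (\<lambda>p. (\<zero>\<^bsub>Q (Suc i)\<^esub>, p)) Z"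
  let ?V2 = "tmap R' N (X (Suc i)) (\<lambda>q. (q, \<zero>\<^bsub>P i\<^esub>)) W"
  have V1: "?V1 \<in> carrier (tensor_group R' (X (Suc i)) N)" by (rule tmap_closed[OF N Pm Xm inr' Z])
  have V2: "?V2 \<in> carrier (tensor_group R' (X (Suc i)) N)" by (rule tmap_closed[OF N Qm Xm inl' W])
  let ?V = "?V1 \<ominus>\<^bsub>tensor_group R' (X (Suc i)) N\<^esub> ?V2"
  have V: "?V \<in> carrier (tensor_group R' (X (Suc i)) N)" using V1 V2 by simp
  let ?L = "tmap R' N (X i) (\<lambda>q. (q, \<zero>\<^bsub>P1 i\<^esub>)) (tmap R' N (Q i) (\<phi> i) Z)"
  have L: "?L \<in> carrier (tensor_group R' (X i) N)" by (rule tmap_closed[OF N Qm Xm inlm tmap_closed[OF N Pm Qm \<phi>m Z]])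
  note l1 = lin_maps_comp[OF \<phi>m inlm, of i] and l2 = lin_maps_comp[OF d1m inrm, of i]
  have "tmap R' N (X i) (\<delta>X i) ?V1 = tmap R' N (X i) (\<lambda>p. \<delta>X i (\<zero>\<^bsub>Q (Suc i)\<^esub>, p)) Z"
    by (rule tmap_comp[OF N Pm Xm Xm inr' dXm Z])
  also have "\<dots> = tmap R' N (X i) (\<lambda>p. (\<phi> i p, \<zero>\<^bsub>P1 i\<^esub>) \<oplus>\<^bsub>X i\<^esub> (\<zero>\<^bsub>Q i\<^esub>, \<delta>1 i p)) Z"
    by (rule tmap_cong[OF N Pm Xm lin_maps_comp[OF inr' dXm] _ Z])
      (simp add: \<delta>X_Pair X_def lin_maps_zero[OF Q'(5) Q'(2) Q'(2)] lin_maps_closed[OF \<phi>] lin_maps_closed[OF \<delta>1])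
  also have "\<dots> = tmap R' N (X i) (\<lambda>p. (\<phi> i p, \<zero>\<^bsub>P1 i\<^esub>)) Z \<oplus>\<^bsub>tensor_group R' (X i) N\<^esub> tmap R' N (X i) (\<lambda>p. (\<zero>\<^bsub>Q i\<^esub>, \<delta>1 i p)) Z"
    by (rule tmap_plus[OF N Pm Xm l1 l2 Z])
  also have "tmap R' N (X i) (\<lambda>p. (\<phi> i p, \<zero>\<^bsub>P1 i\<^esub>)) Z = ?L" by (rule tmap_comp[OF N Pm Qm Xm \<phi>m inlm Z, symmetric])
  also have "tmap R' N (X i) (\<lambda>p. (\<zero>\<^bsub>Q i\<^esub>, \<delta>1 i p)) Z = \<zero>\<^bsub>tensor_group R' (X i) N\<^esub>"
    using tmap_comp[OF N Pm P1m Xm d1m inrm Z] tmap_zero[OF N P1m Xm inrm] z by simp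
  finally have 1: "tmap R' N (X i) (\<delta>X i) ?V1 = ?L" using L by simp
  have "tmap R' N (X i) (\<delta>X i) ?V2 = tmap R' N (X i) (\<lambda>q. (q, \<zero>\<^bsub>P1 i\<^esub>)) (tmap R' N (Q i) (\<delta>Q i) W)"
    by (rule tmap_square[OF N Qm Xm Qm Xm inl' dXm dQm inlm _ W])
      (simp add: \<delta>X_Pair lin_maps_zero[OF \<phi> P'(2) Q'(2)] lin_maps_zero[OF \<delta>1 P'(2) P1] lin_maps_closed[OF Q'(5)])
  then have 2: "tmap R' N (X i) (\<delta>X i) ?V2 = ?L" by (simp add: ZW)
  have "tmap R' N (X i) (\<delta>X i) ?V = \<zero>\<^bsub>tensor_group R' (X i) N\<^esub>"
    using add_maps_diff[OF tmap_add_maps[OF N Xm Xm dXm] ag[OF Xm] ag[OF Xm] V1 V2] L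
    by (simp add: 1 2 a_minus_def TXi.r_neg)
  then obtain Y where Y: "Y \<in> carrier (tensor_group R' (X (Suc (Suc i))) N)" "?V = tmap R' N (X (Suc i)) (\<delta>X (Suc i)) Y"
    using ex V unfolding tensor_exact_def by blast
  have snd'': "snd \<in> lin_maps (op_ring R') (X (Suc (Suc i))) (P (Suc i))" using sndm[of "Suc (Suc i)"] by simp
  have um: "(\<lambda>x. \<ominus>\<^bsub>P (Suc i)\<^esub> snd x) \<in> lin_maps (op_ring R') (X (Suc (Suc i))) (P (Suc i))"
    by (rule lin_maps_uminus[OF Pm snd''])
  have "tmap R' N (P i) snd ?V1 = Z" by (rule tmap_comp_id[OF N Pm Xm inr' snd' _ Z]) simp
  moreover have "tmap R' N (P i) snd ?V2 = \<zero>\<^bsub>tensor_group R' (P i) N\<^esub>"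
    by (rule tmap_comp_zero[OF N Qm Xm Pm inl' snd' _ W]) simp
  ultimately have "Z = tmap R' N (P i) snd ?V"
    using add_maps_diff[OF tmap_add_maps[OF N Xm Pm snd'] ag[OF Xm] ag[OF Pm] V1 V2] Z by (simp add: a_minus_def)
  also have "\<dots> = tmap R' N (P i) (\<delta>P i) (tmap R' N (P (Suc i)) (\<lambda>x. \<ominus>\<^bsub>P (Suc i)\<^esub> snd x) Y)"
    unfolding Y(2)
    by (rule tmap_square[OF N Xm Xm Pm Pm dXm snd' um dPm _ Y(1)])
      (auto simp: \<delta>X_def carrier_X \<delta>1_Suc lin_maps_minus[OF P'(5) P'(2) P'(2)])
  finally show ?thesis using tmap_closed[OF N Xm Pm um Y(1)] by blast
qed

text \<open>The piece \<open>Tor_(j+2)(C) -> Tor_(j+1)(A) -> Tor_(j+1)(B)\<close>: the image of a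
  cycle \<open>Z\<close> in the complex of \<open>Q\<close> is a boundary of some \<open>W\<close>,
  and \<open>tensor_exact_X\<close> applies to the pair.\<close>

lemma (in mapping_cone) tensor_exact_shift:
  assumes R: "R = op_ring R'" and N: "left_module R' N"
    and exX: "tensor_exact R' N X \<delta>X (Suc j)" and exQ: "tensor_exact R' N Q \<delta>Q j"
  shows "tensor_exact R' N P \<delta>P j"
  unfolding tensor_exact_def
proof (intro ballI impI)
  note Pm = P'(2)[unfolded R] and Qm = Q'(2)[unfolded R] and dPm = P'(5)[unfolded R] and dQm = Q'(5)[unfolded R] and \<phi>m = \<phi>[unfolded R]
  fix Z assume Z: "Z \<in> carrier (tensor_group R' (P (Suc j)) N)"
    and z: "tmap R' N (P j) (\<delta>P j) Z = \<zero>\<^bsub>tensor_group R' (P j) N\<^esub>"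
  interpret T: abelian_group "tensor_group R' (P j) N" by (rule abelian_group_tensor_group[OF N Pm])
  have "tmap R' N (Q j) (\<delta>Q j) (tmap R' N (Q (Suc j)) (\<phi> (Suc j)) Z) = tmap R' N (Q j) (\<phi> j) (tmap R' N (P j) (\<delta>P j) Z)"
    by (rule tmap_square[OF N Pm Qm Pm Qm \<phi>m dQm dPm \<phi>m \<phi>\<delta> Z])
  then have "tmap R' N (Q j) (\<delta>Q j) (tmap R' N (Q (Suc j)) (\<phi> (Suc j)) Z) = \<zero>\<^bsub>tensor_group R' (Q j) N\<^esub>"
    unfolding z by (simp add: tmap_zero[OF N Pm Qm \<phi>m])
  then obtain W where W: "W \<in> carrier (tensor_group R' (Q (Suc (Suc j))) N)"
    "tmap R' N (Q (Suc j)) (\<phi> (Suc j)) Z = tmap R' N (Q (Suc j)) (\<delta>Q (Suc j)) W"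
    using exQ tmap_closed[OF N Pm Qm \<phi>m Z] unfolding tensor_exact_def by blast
  have "tmap R' N (P j) (\<lambda>p. \<ominus>\<^bsub>P j\<^esub> \<delta>P j p) Z = \<zero>\<^bsub>tensor_group R' (P j) N\<^esub>"
    using tmap_uminus[OF N Pm Pm dPm Z] z by simp
  then have "tmap R' N (P1 (Suc j)) (\<delta>1 (Suc j)) Z = \<zero>\<^bsub>tensor_group R' (P1 (Suc j)) N\<^esub>"
    by (simp add: \<delta>1_Suc[abs_def])
  then show "\<exists>Y\<in>carrier (tensor_group R' (P (Suc (Suc j))) N). Z = tmap R' N (P (Suc j)) (\<delta>P (Suc j)) Y"
    by (rule tensor_exact_X[OF R N exX Z W])
qed

text \<open>The piece \<open>Tor_1(C) -> A \<otimes> N -> B \<otimes> N\<close>. Lift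
  \<open>Z\<close> to \<open>P 0\<close>; right exactness makes its image in \<open>Q 0\<close> a
  boundary, so by \<open>tensor_exact_X\<close> the lift is a boundary and dies under
  \<open>\<epsilon>P\<close>.\<close>

lemma (in mapping_cone) tensor_injective:
  assumes R: "R = op_ring R'" and N: "left_module R' N" and ex: "tensor_exact R' N X \<delta>X 0"
    and Z: "Z \<in> carrier (tensor_group R' A N)" and aZ: "tmap R' N B a Z = \<zero>\<^bsub>tensor_group R' B N\<^esub>"
  shows "Z = \<zero>\<^bsub>tensor_group R' A N\<^esub>"
proof -
  note Pm = P'(2)[unfolded R] and Qm = Q'(2)[unfolded R] and dPm = P'(5)[unfolded R] and dQm = Q'(5)[unfolded R] and \<phi>m = \<phi>[unfolded R]
    and Am = P'(1)[unfolded R] and Bm = Q'(1)[unfolded R] and ePm = P'(3)[unfolded R] and eQm = Q'(3)[unfolded R] and am = a[unfolded R]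
    and P1m = P1[unfolded R]
  obtain Z' where Z': "Z' \<in> carrier (tensor_group R' (P 0) N)" "tmap R' N A \<epsilon>P Z' = Z"
    using tmap_surj[OF N Pm Am ePm P'(4) Z] by blast
  have "tmap R' N B \<epsilon>Q (tmap R' N (Q 0) (\<phi> 0) Z') = tmap R' N B a (tmap R' N A \<epsilon>P Z')"
    by (rule tmap_square[OF N Pm Qm Am Bm \<phi>m eQm ePm am \<phi>\<epsilon> Z'(1)])
  then have "tmap R' N B \<epsilon>Q (tmap R' N (Q 0) (\<phi> 0) Z') = \<zero>\<^bsub>tensor_group R' B N\<^esub>" by (simp add: Z'(2) aZ)
  then obtain W where W: "W \<in> carrier (tensor_group R' (Q (Suc 0)) N)"
    "tmap R' N (Q 0) (\<phi> 0) Z' = tmap R' N (Q 0) (\<delta>Q 0) W"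
    using tensor_right_exact[OF N Qm Qm Bm dQm eQm Q'(4) resolution_exact(1)[OF Q] tmap_closed[OF N Pm Qm \<phi>m Z'(1)]] by blast
  have "tmap R' N (P1 0) (\<lambda>p. \<zero>\<^bsub>P1 0\<^esub>) Z' = \<zero>\<^bsub>tensor_group R' (P1 0) N\<^esub>" by (rule tmap_const_zero[OF N Pm P1m Z'(1)])
  moreover have "\<delta>1 0 = (\<lambda>p. \<zero>\<^bsub>P1 0\<^esub>)" by (simp add: fun_eq_iff \<delta>1_def zero_P1_0)
  ultimately obtain Y where Y: "Y \<in> carrier (tensor_group R' (P (Suc 0)) N)" "Z' = tmap R' N (P 0) (\<delta>P 0) Y"
    using tensor_exact_X[OF R N ex Z'(1) W] by auto
  show ?thesis
    unfolding Z'(2)[symmetric] Y(2)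
    by (rule tmap_comp_zero[OF N Pm Pm Am dPm ePm resolution_comp_zero(1)[OF P] Y(1)])
qed

section \<open>Short exact sequences\<close>

text \<open>The data of a mapping cone with the resolutions hidden. \<open>C\<close> is a mere
  module, because its finite presentation is what the cone delivers.\<close>

locale short_exact =
  fixes R :: "('r, 'x) ring_scheme"
    and A :: "('r, 'a, 'y1) module_scheme" and B :: "('r, 'b, 'y2) module_scheme" and C :: "('r, 'c, 'y3) module_scheme"
    and a :: "'a \<Rightarrow> 'b" and b :: "'b \<Rightarrow> 'c"
  assumes fpA: "fin_presented R \<infinity> A" and fpB: "fin_presented R \<infinity> B" and C: "left_module R C"
    and a: "a \<in> lin_maps R A B" and b: "b \<in> lin_maps R B C"
    and a_inj: "\<And>x. x \<in> carrier A \<Longrightarrow> a x = \<zero>\<^bsub>B\<^esub> \<Longrightarrow> x = \<zero>\<^bsub>A\<^esub>"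
    and b_surj: "b ` carrier B = carrier C"
    and ba: "\<And>x. x \<in> carrier A \<Longrightarrow> b (a x) = \<zero>\<^bsub>C\<^esub>"
    and ker_b: "\<And>y. y \<in> carrier B \<Longrightarrow> b y = \<zero>\<^bsub>C\<^esub> \<Longrightarrow> \<exists>x\<in>carrier A. y = a x"
begin

lemma ex_mapping_cone:
  obtains P :: "nat \<Rightarrow> ('r, nat \<Rightarrow> 'r) module" and \<delta>P \<epsilon>P and Q :: "nat \<Rightarrow> ('r, nat \<Rightarrow> 'r) module" and \<delta>Q \<epsilon>Q \<phi>
  where "mapping_cone R A B C a b P \<delta>P \<epsilon>P Q \<delta>Q \<epsilon>Q \<phi>" "\<And>i. fg_free R (P i)" "\<And>i. fg_free R (Q i)"
proof -
  obtain P :: "nat \<Rightarrow> ('r, nat \<Rightarrow> 'r) module" and \<delta>P \<epsilon>P where P: "resolution R \<infinity> P \<delta>P \<epsilon>P A"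
    "\<And>i. fg_free R (P i)" "\<And>i. projective R (P i)"
    using fin_presentedE[OF fpA] by metis
  obtain Q :: "nat \<Rightarrow> ('r, nat \<Rightarrow> 'r) module" and \<delta>Q \<epsilon>Q where Q: "resolution R \<infinity> Q \<delta>Q \<epsilon>Q B"
    "\<And>i. fg_free R (Q i)" "\<And>i. projective R (Q i)"
    using fin_presentedE[OF fpB] by metis
  obtain \<phi> where "\<And>i. \<phi> i \<in> lin_maps R (P i) (Q i)"
    "\<And>x. x \<in> carrier (P 0) \<Longrightarrow> \<epsilon>Q (\<phi> 0 x) = a (\<epsilon>P x)"
    "\<And>i x. x \<in> carrier (P (Suc i)) \<Longrightarrow> \<delta>Q i (\<phi> (Suc i) x) = \<phi> i (\<delta>P i x)"
    using ex_chain_map[OF P(1,3) Q(1) a] by blast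
  then have "mapping_cone R A B C a b P \<delta>P \<epsilon>P Q \<delta>Q \<epsilon>Q \<phi>"
    by (intro mapping_cone.intro) (use P Q C a b a_inj b_surj ba ker_b in auto)
  then show thesis using that P(2) Q(2) by blast
qed

text \<open>The cone of a map between finitely generated free resolutions consists of finitely
  generated free modules.\<close>

lemma fin_presented_cokernel: "fin_presented R \<infinity> C"
proof -
  obtain P :: "nat \<Rightarrow> ('r, nat \<Rightarrow> 'r) module" and \<delta>P \<epsilon>P and Q :: "nat \<Rightarrow> ('r, nat \<Rightarrow> 'r) module" and \<delta>Q \<epsilon>Q \<phi>
    where c: "mapping_cone R A B C a b P \<delta>P \<epsilon>P Q \<delta>Q \<epsilon>Q \<phi>" and free: "\<And>i. fg_free R (P i)" "\<And>i. fg_free R (Q i)"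
    using ex_mapping_cone by metis
  interpret mapping_cone R A B C a b P \<delta>P \<epsilon>P Q \<delta>Q \<epsilon>Q \<phi> by (rule c)
  show ?thesis by (rule fin_presentedI[OF resolution_X fg_free_X[OF free]])
qed

lemma Ext_shift:
  assumes N: "left_module R N" and "trivial_group (Ext R (Suc (Suc j)) C N)" "trivial_group (Ext R (Suc j) B N)"
  shows "trivial_group (Ext R (Suc j) A N)"
proof -
  obtain P :: "nat \<Rightarrow> ('r, nat \<Rightarrow> 'r) module" and \<delta>P \<epsilon>P and Q :: "nat \<Rightarrow> ('r, nat \<Rightarrow> 'r) module" and \<delta>Q \<epsilon>Q \<phi>
    where c: "mapping_cone R A B C a b P \<delta>P \<epsilon>P Q \<delta>Q \<epsilon>Q \<phi>" and free: "\<And>i. fg_free R (P i)" "\<And>i. fg_free R (Q i)"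
    using ex_mapping_cone by metis
  interpret mapping_cone R A B C a b P \<delta>P \<epsilon>P Q \<delta>Q \<epsilon>Q \<phi> by (rule c)
  note projP = fg_free_projective[OF P'(2) free(1)] and projQ = fg_free_projective[OF Q'(2) free(2)]
    and projX = fg_free_projective[OF X fg_free_X[OF free]]
  show ?thesis
    using hom_exact_shift[OF N] assms(2,3)
    unfolding Ext_trivial_iff[OF P projP N] Ext_trivial_iff[OF Q projQ N] Ext_trivial_iff[OF resolution_X projX N] .
qed

lemma extend_lin_map:
  assumes N: "left_module R N" and "trivial_group (Ext R (Suc 0) C N)" and f: "f \<in> lin_maps R A N"
  shows "\<exists>g\<in>lin_maps R B N. \<forall>x\<in>carrier A. g (a x) = f x"
proof -
  obtain P :: "nat \<Rightarrow> ('r, nat \<Rightarrow> 'r) module" and \<delta>P \<epsilon>P and Q :: "nat \<Rightarrow> ('r, nat \<Rightarrow> 'r) module" and \<delta>Q \<epsilon>Q \<phi>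
    where c: "mapping_cone R A B C a b P \<delta>P \<epsilon>P Q \<delta>Q \<epsilon>Q \<phi>" and free: "\<And>i. fg_free R (P i)" "\<And>i. fg_free R (Q i)"
    using ex_mapping_cone by metis
  interpret mapping_cone R A B C a b P \<delta>P \<epsilon>P Q \<delta>Q \<epsilon>Q \<phi> by (rule c)
  note projX = fg_free_projective[OF X fg_free_X[OF free]]
  show ?thesis
    using hom_extend[OF N _ f] assms(2) unfolding Ext_trivial_iff[OF resolution_X projX N] .
qed

lemma Tor_shift:
  assumes R: "R = op_ring R'" and N: "left_module R' N"
    and "trivial_group (Tor R' (Suc (Suc j)) C N)" "trivial_group (Tor R' (Suc j) B N)"
  shows "trivial_group (Tor R' (Suc j) A N)"
proof -
  obtain P :: "nat \<Rightarrow> ('r, nat \<Rightarrow> 'r) module" and \<delta>P \<epsilon>P and Q :: "nat \<Rightarrow> ('r, nat \<Rightarrow> 'r) module" and \<delta>Q \<epsilon>Q \<phi>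
    where c: "mapping_cone R A B C a b P \<delta>P \<epsilon>P Q \<delta>Q \<epsilon>Q \<phi>" and free: "\<And>i. fg_free R (P i)" "\<And>i. fg_free R (Q i)"
    using ex_mapping_cone by metis
  interpret mapping_cone R A B C a b P \<delta>P \<epsilon>P Q \<delta>Q \<epsilon>Q \<phi> by (rule c)
  note projP = fg_free_projective[OF P'(2) free(1)] and projQ = fg_free_projective[OF Q'(2) free(2)]
    and projX = fg_free_projective[OF X fg_free_X[OF free]]
  show ?thesis
    using tensor_exact_shift[OF R N] assms(3,4)
    unfolding Tor_trivial_iff[OF P[unfolded R] projP[unfolded R] N] Tor_trivial_iff[OF Q[unfolded R] projQ[unfolded R] N]
      Tor_trivial_iff[OF resolution_X[unfolded R] projX[unfolded R] N] .
qed

lemma tmap_injective: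
  assumes R: "R = op_ring R'" and N: "left_module R' N" and "trivial_group (Tor R' (Suc 0) C N)"
    and Z: "Z \<in> carrier (tensor_group R' A N)" and aZ: "tmap R' N B a Z = \<zero>\<^bsub>tensor_group R' B N\<^esub>"
  shows "Z = \<zero>\<^bsub>tensor_group R' A N\<^esub>"
proof -
  obtain P :: "nat \<Rightarrow> ('r, nat \<Rightarrow> 'r) module" and \<delta>P \<epsilon>P and Q :: "nat \<Rightarrow> ('r, nat \<Rightarrow> 'r) module" and \<delta>Q \<epsilon>Q \<phi>
    where c: "mapping_cone R A B C a b P \<delta>P \<epsilon>P Q \<delta>Q \<epsilon>Q \<phi>" and free: "\<And>i. fg_free R (P i)" "\<And>i. fg_free R (Q i)"
    using ex_mapping_cone by metis
  interpret mapping_cone R A B C a b P \<delta>P \<epsilon>P Q \<delta>Q \<epsilon>Q \<phi> by (rule c)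
  note projX = fg_free_projective[OF X fg_free_X[OF free]]
  show ?thesis
    using tensor_injective[OF R N _ Z aZ] assms(3)
    unfolding Tor_trivial_iff[OF resolution_X[unfolded R] projX[unfolded R] N] .
qed

end

section \<open>Exact cosequences of finitely presented modules\<close>

text \<open>The sequence is exact from degree one on. In degree zero a kernel remains and is
  required to be super finitely presented; in the application it is a copy of the ring, so it plays
  the part of the initial term.\<close>

locale coresolution =
  fixes A :: "('a, 'x) ring_scheme" and E :: "nat \<Rightarrow> ('a, 'e, 'y) module_scheme" and D :: "nat \<Rightarrow> 'e \<Rightarrow> 'e"
  assumes fpE: "\<And>i. fin_presented A \<infinity> (E i)" and D: "\<And>i. D i \<in> lin_maps A (E i) (E (Suc i))"
    and DD: "\<And>i x. x \<in> carrier (E i) \<Longrightarrow> D (Suc i) (D i x) = \<zero>\<^bsub>E (Suc (Suc i))\<^esub>"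
    and D_exact: "\<And>i x. x \<in> carrier (E (Suc i)) \<Longrightarrow> D (Suc i) x = \<zero>\<^bsub>E (Suc (Suc i))\<^esub> \<Longrightarrow> \<exists>y\<in>carrier (E i). x = D i y"
    and fpL0: "fin_presented A \<infinity> ((E 0)\<lparr>carrier := {x \<in> carrier (E 0). D 0 x = \<zero>\<^bsub>E (Suc 0)\<^esub>}\<rparr>)"
begin

definition L :: "nat \<Rightarrow> ('a, 'e, 'y) module_scheme" where
  "L i = (E i)\<lparr>carrier := {x \<in> carrier (E i). D i x = \<zero>\<^bsub>E (Suc i)\<^esub>}\<rparr>"

lemma E: "left_module A (E i)" by (rule fin_presented_left_module[OF fpE])

lemma L: "left_module A (L i)" unfolding L_def by (rule left_module_kernel[OF D E E])

lemma carrier_L: "carrier (L i) = {x \<in> carrier (E i). D i x = \<zero>\<^bsub>E (Suc i)\<^esub>}" and zero_L: "\<zero>\<^bsub>L i\<^esub> = \<zero>\<^bsub>E i\<^esub>"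
  by (simp_all add: L_def)

lemma incl_L: "(\<lambda>x. x) \<in> lin_maps A (L i) (E i)"
  unfolding L_def by (rule lin_maps_restrict_domain[OF lin_maps_id]) auto

lemma D_L: "D i \<in> lin_maps A (E i) (L (Suc i))"
  unfolding L_def by (rule lin_maps_restrict_codomain[OF D]) (use lin_maps_closed[OF D] DD in auto)

lemma D_L_surj: "D i ` carrier (E i) = carrier (L (Suc i))"
  using lin_maps_closed[OF D] DD D_exact by (auto simp: carrier_L image_iff)

text \<open>Exactness identifies \<open>L (Suc i)\<close> with the cokernel of the inclusion of
  \<open>L i\<close> into \<open>E i\<close>, so finite presentation climbs from one kernel to the
  next.\<close>

lemma fpL: "fin_presented A \<infinity> (L i)"
proof (induction i)
  case 0
  then show ?case using fpL0 by (simp add: L_def)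
next
  case (Suc i)
  have "short_exact A (L i) (E i) (L (Suc i)) (\<lambda>x. x) (D i)"
    by (intro short_exact.intro Suc fpE L incl_L D_L D_L_surj) (auto simp: carrier_L zero_L)
  then show ?case by (rule short_exact.fin_presented_cokernel)
qed

lemma short_exact: "short_exact A (L i) (E i) (L (Suc i)) (\<lambda>x. x) (D i)"
  by (intro short_exact.intro fpL fpE L incl_L D_L D_L_surj) (auto simp: carrier_L zero_L)

text \<open>Each shift lowers the degree by one and pays with a step from \<open>L i\<close> to
  \<open>L (Suc i)\<close>. Assuming the vanishing in one degree for all \<open>i\<close> makes this
  affordable, since the sequence does not end on the right.\<close>

lemma Ext_L:
  assumes N: "left_module A N" and "\<And>i j. trivial_group (Ext A (Suc j) (E i) N)" "\<And>i. trivial_group (Ext A (Suc d) (L i) N)"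
  shows "trivial_group (Ext A (Suc 0) (L i) N)"
  using assms(3)
proof (induction d)
  case 0
  then show ?case by simp
next
  case (Suc d)
  have "trivial_group (Ext A (Suc d) (L i) N)" for i
    by (rule short_exact.Ext_shift[OF short_exact N Suc.prems assms(2)])
  then show ?case by (rule Suc.IH)
qed

lemma Tor_L:
  assumes A: "A = op_ring R" and N: "left_module R N" and "\<And>i j. trivial_group (Tor R (Suc j) (E i) N)"
    "\<And>i. trivial_group (Tor R (Suc d) (L i) N)"
  shows "trivial_group (Tor R (Suc 0) (L i) N)"
  using assms(4)
proof (induction d)
  case 0
  then show ?case by simp
next
  case (Suc d)
  have "trivial_group (Tor R (Suc d) (L i) N)" for i
    by (rule short_exact.Tor_shift[OF short_exact A N Suc.prems assms(3)])
  then show ?case by (rule Suc.IH)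
qed

context
  fixes N :: "('a, 'n, 'z) module_scheme"
  assumes N: "left_module A N" and ExtL: "\<And>i. trivial_group (Ext A (Suc 0) (L i) N)"
begin

lemma extend_from_L:
  assumes "f \<in> lin_maps A (L i) N"
  shows "\<exists>g\<in>lin_maps A (E i) N. \<forall>x\<in>carrier (L i). g x = f x"
  by (rule short_exact.extend_lin_map[OF short_exact N ExtL assms])

text \<open>Exactness of the sequence of maps into \<open>N\<close>: vanishing on \<open>L i\<close>
  lets \<open>f\<close> descend along \<open>D i\<close> to \<open>L (Suc i)\<close>, and from there
  it extends to \<open>E (Suc i)\<close>.\<close>

lemma factor_through_D:
  assumes f: "f \<in> lin_maps A (E i) N" and z: "\<And>x. x \<in> carrier (L i) \<Longrightarrow> f x = \<zero>\<^bsub>N\<^esub>"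
  shows "\<exists>g\<in>lin_maps A (E (Suc i)) N. \<forall>x\<in>carrier (E i). f x = g (D i x)"
proof -
  obtain w where w: "w \<in> lin_maps A (L (Suc i)) N" "\<And>x. x \<in> carrier (E i) \<Longrightarrow> w (D i x) = f x"
    using lin_maps_factor[OF E L N D_L D_L_surj f] z by (auto simp: carrier_L zero_L)
  then obtain g where "g \<in> lin_maps A (E (Suc i)) N" "\<And>x. x \<in> carrier (L (Suc i)) \<Longrightarrow> g x = w x"
    using extend_from_L by blast
  then show ?thesis using w lin_maps_closed[OF D_L] by (intro bexI[of _ g]) auto
qed

end

context
  fixes R :: "('a, 'x) ring_scheme" and N :: "('a, 'n, 'z) module_scheme"
  assumes A: "A = op_ring R" and N: "left_module R N" and TorL: "\<And>i. trivial_group (Tor R (Suc 0) (L i) N)"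
begin

lemma tensor_incl_L_inj:
  assumes "Z \<in> carrier (tensor_group R (L i) N)" "tmap R N (E i) (\<lambda>x. x) Z = \<zero>\<^bsub>tensor_group R (E i) N\<^esub>"
  shows "Z = \<zero>\<^bsub>tensor_group R (L i) N\<^esub>"
  by (rule short_exact.tmap_injective[OF short_exact A N TorL assms])

text \<open>\<open>D i\<close> is a surjection onto \<open>L (Suc i)\<close> followed by an
  inclusion that stays injective after tensoring; what remains is right exactness for the
  surjection.\<close>

lemma tensor_kernel_D:
  assumes Z: "Z \<in> carrier (tensor_group R (E i) N)" and z: "tmap R N (E (Suc i)) (D i) Z = \<zero>\<^bsub>tensor_group R (E (Suc i)) N\<^esub>"
  shows "\<exists>W\<in>carrier (tensor_group R (L i) N). Z = tmap R N (E i) (\<lambda>x. x) W"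
proof -
  note Em = E[unfolded A] and Lm = L[unfolded A] and Dm = D_L[unfolded A] and Im = incl_L[unfolded A]
  let ?Z = "tmap R N (L (Suc i)) (D i) Z"
  have "tmap R N (E (Suc i)) (\<lambda>x. x) ?Z = tmap R N (E (Suc i)) (D i) Z"
    by (rule tmap_comp[OF N Em Lm Em Dm Im Z])
  then have "?Z = \<zero>\<^bsub>tensor_group R (L (Suc i)) N\<^esub>"
    using z by (intro tensor_incl_L_inj tmap_closed[OF N Em Lm Dm Z]) simp
  then show ?thesis
    by (intro tensor_right_exact[OF N Lm Em Lm Im Dm D_L_surj _ Z]) (auto simp: carrier_L zero_L)
qed

text \<open>In positive degree the kernel \<open>L (Suc i)\<close> is covered by \<open>E i\<close>,
  and tensoring preserves this surjection.\<close>

lemma tensor_kernel_D_Suc: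
  assumes Z: "Z \<in> carrier (tensor_group R (E (Suc i)) N)"
    and z: "tmap R N (E (Suc (Suc i))) (D (Suc i)) Z = \<zero>\<^bsub>tensor_group R (E (Suc (Suc i))) N\<^esub>"
  shows "\<exists>W\<in>carrier (tensor_group R (E i) N). Z = tmap R N (E (Suc i)) (D i) W"
proof -
  note Em = E[unfolded A] and Lm = L[unfolded A] and Dm = D_L[unfolded A] and Im = incl_L[unfolded A]
  obtain V where V: "V \<in> carrier (tensor_group R (L (Suc i)) N)" "Z = tmap R N (E (Suc i)) (\<lambda>x. x) V"
    using tensor_kernel_D[OF Z z] by blast
  obtain W where W: "W \<in> carrier (tensor_group R (E i) N)" "tmap R N (L (Suc i)) (D i) W = V"
    using tmap_surj[OF N Em Lm Dm D_L_surj V(1)] by blast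
  have "Z = tmap R N (E (Suc i)) (D i) W"
    unfolding V(2) W(2)[symmetric] by (rule tmap_comp[OF N Em Lm Em Dm Im W(1)])
  then show ?thesis using W(1) by blast
qed

end

end

section \<open>Powers of a module\<close>

text \<open>All powers live in one type, with entries zero from \<open>k\<close> on. Iterated
  products would change the type at each step, and then no induction on \<open>k\<close> could be
  stated.\<close>

definition pow_module :: "nat \<Rightarrow> ('r, 'a, 'y) module_scheme \<Rightarrow> ('r, nat \<Rightarrow> 'a) module" where
  "pow_module k M = \<lparr>carrier = {f. (\<forall>i<k. f i \<in> carrier M) \<and> (\<forall>i\<ge>k. f i = \<zero>\<^bsub>M\<^esub>)}, mult = undefined, one = undefined,
     ring.zero = (\<lambda>i. \<zero>\<^bsub>M\<^esub>), add = (\<lambda>f g i. f i \<oplus>\<^bsub>M\<^esub> g i), smult = (\<lambda>r f i. r \<odot>\<^bsub>M\<^esub> f i)\<rparr>"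

lemma pow_module_simps:
  "carrier (pow_module k M) = {f. (\<forall>i<k. f i \<in> carrier M) \<and> (\<forall>i\<ge>k. f i = \<zero>\<^bsub>M\<^esub>)}"
  "\<zero>\<^bsub>pow_module k M\<^esub> = (\<lambda>i. \<zero>\<^bsub>M\<^esub>)" "f \<oplus>\<^bsub>pow_module k M\<^esub> g = (\<lambda>i. f i \<oplus>\<^bsub>M\<^esub> g i)"
  "r \<odot>\<^bsub>pow_module k M\<^esub> f = (\<lambda>i. r \<odot>\<^bsub>M\<^esub> f i)"
  by (simp_all add: pow_module_def)

lemma left_module_pow_module:
  assumes "left_module R M"
  shows "left_module R (pow_module k M)"
proof -
  interpret M: left_module R M by fact
  have c: "f i \<in> carrier M" if "f \<in> carrier (pow_module k M)" for f i
    using that by (cases "i < k") (auto simp: pow_module_simps)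
  have "abelian_group (pow_module k M)"
  proof (rule abelian_groupI)
    fix f assume f: "f \<in> carrier (pow_module k M)"
    then have "(\<lambda>i. \<ominus>\<^bsub>M\<^esub> f i) \<in> carrier (pow_module k M)"
      using M.M.r_neg[OF M.M.zero_closed] M.M.l_zero[OF M.M.a_inv_closed[OF M.M.zero_closed]] by (auto simp: pow_module_simps)
    then show "\<exists>g\<in>carrier (pow_module k M). g \<oplus>\<^bsub>pow_module k M\<^esub> f = \<zero>\<^bsub>pow_module k M\<^esub>"
      using c[OF f] by (intro bexI[of _ "\<lambda>i. \<ominus>\<^bsub>M\<^esub> f i"]) (auto simp: pow_module_simps M.M.l_neg)
  next
    fix f g h assume "f \<in> carrier (pow_module k M)" "g \<in> carrier (pow_module k M)" "h \<in> carrier (pow_module k M)"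
    from this[THEN c] show "f \<oplus>\<^bsub>pow_module k M\<^esub> g \<oplus>\<^bsub>pow_module k M\<^esub> h = f \<oplus>\<^bsub>pow_module k M\<^esub> (g \<oplus>\<^bsub>pow_module k M\<^esub> h)"
      by (simp add: pow_module_simps(3) M.M.a_assoc)
  next
    fix f g assume "f \<in> carrier (pow_module k M)" "g \<in> carrier (pow_module k M)"
    from this[THEN c] show "f \<oplus>\<^bsub>pow_module k M\<^esub> g = g \<oplus>\<^bsub>pow_module k M\<^esub> f"
      by (simp add: pow_module_simps(3) M.M.a_comm)
  next
    fix f assume "f \<in> carrier (pow_module k M)"
    from this[THEN c] show "\<zero>\<^bsub>pow_module k M\<^esub> \<oplus>\<^bsub>pow_module k M\<^esub> f = f"
      by (simp add: pow_module_simps(2,3))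
  qed (auto simp: pow_module_simps)
  then show ?thesis
  proof (intro left_module.intro left_module_axioms.intro)
    show "ring R" by (rule M.R.ring_axioms)
    fix r f assume "r \<in> carrier R" and f: "f \<in> carrier (pow_module k M)"
    then show "r \<odot>\<^bsub>pow_module k M\<^esub> f \<in> carrier (pow_module k M)" by (auto simp: pow_module_simps)
    {
      fix s assume "s \<in> carrier R"
      then show "(r \<oplus>\<^bsub>R\<^esub> s) \<odot>\<^bsub>pow_module k M\<^esub> f = r \<odot>\<^bsub>pow_module k M\<^esub> f \<oplus>\<^bsub>pow_module k M\<^esub> s \<odot>\<^bsub>pow_module k M\<^esub> f"
        and "(r \<otimes>\<^bsub>R\<^esub> s) \<odot>\<^bsub>pow_module k M\<^esub> f = r \<odot>\<^bsub>pow_module k M\<^esub> (s \<odot>\<^bsub>pow_module k M\<^esub> f)"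
        using \<open>r \<in> carrier R\<close> c[OF f] by (simp_all add: pow_module_simps(3,4) M.smult_l_distr M.smult_assoc1)
    next
      fix g assume "g \<in> carrier (pow_module k M)"
      then show "r \<odot>\<^bsub>pow_module k M\<^esub> (f \<oplus>\<^bsub>pow_module k M\<^esub> g) = r \<odot>\<^bsub>pow_module k M\<^esub> f \<oplus>\<^bsub>pow_module k M\<^esub> r \<odot>\<^bsub>pow_module k M\<^esub> g"
        using \<open>r \<in> carrier R\<close> c[OF f] c[of g] by (simp add: pow_module_simps(3,4) M.smult_r_distr)
    }
  next
    fix f assume f: "f \<in> carrier (pow_module k M)"
    show "\<one>\<^bsub>R\<^esub> \<odot>\<^bsub>pow_module k M\<^esub> f = f" using c[OF f] by (simp add: pow_module_simps(4))
  qed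
qed

lemma pow_module_Suc:
  assumes "left_module R M"
  shows "(\<lambda>(f, x). f(k := x)) \<in> lin_isos R (prod_module (pow_module k M) M) (pow_module (Suc k) M)"
proof -
  interpret M: left_module R M by fact
  show ?thesis
  proof (rule lin_isosI_inverse[where g = "\<lambda>f. (f(k := \<zero>\<^bsub>M\<^esub>), f k)"])
    show "(\<lambda>(f, x). f(k := x)) \<in> lin_maps R (prod_module (pow_module k M) M) (pow_module (Suc k) M)"
      by (rule lin_mapsI) (auto simp: pow_module_simps fun_eq_iff)
  qed (auto simp: pow_module_simps fun_eq_iff)
qed

text \<open>With \<open>U\<close> zero, identity maps are zero maps as well, so the constant
  sequence is exact.\<close>

lemma resolution_zero_module:
  assumes "left_module R U" "carrier U = {\<zero>\<^bsub>U\<^esub>}"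
  shows "resolution R \<infinity> (\<lambda>_. U) (\<lambda>_ x. x) (\<lambda>x. x) U" "fg_free R U" "projective R U"
proof -
  show "resolution R \<infinity> (\<lambda>_. U) (\<lambda>_ x. x) (\<lambda>x. x) U"
    by (rule resolution_infinityI') (use assms in \<open>auto simp: lin_maps_id\<close>)
  show "fg_free R U" by (rule fg_free_zero[OF assms])
  then show "projective R U" by (rule fg_free_projective[OF assms(1)])
qed

lemma Ext_zero_module:
  assumes "left_module R U" "carrier U = {\<zero>\<^bsub>U\<^esub>}" "left_module R N"
  shows "trivial_group (Ext R (Suc j) U N)"
  unfolding Ext_trivial_iff[OF resolution_zero_module(1,3)[OF assms(1,2)] assms(3)] hom_exact_def by blast

lemma Tor_zero_module:
  assumes "left_module (op_ring R) U" "carrier U = {\<zero>\<^bsub>U\<^esub>}" "left_module R N"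
  shows "trivial_group (Tor R (Suc j) U N)"
  unfolding Tor_trivial_iff[OF resolution_zero_module(1,3)[OF assms(1,2)] assms(3)] tensor_exact_def
  using tmap_id[OF assms(3,1)] by force

lemma pow_module_0: "carrier (pow_module 0 M) = {\<zero>\<^bsub>pow_module 0 M\<^esub>}"
  by (auto simp: pow_module_simps)

lemma fin_presented_pow_module:
  assumes "fin_presented R \<infinity> M"
  shows "fin_presented R \<infinity> (pow_module k M)"
proof (induction k)
  note M = fin_presented_left_module[OF assms]
  case 0
  show ?case
    by (rule fin_presented_fg_free[OF left_module_pow_module[OF M] fg_free_zero[OF left_module_pow_module[OF M] pow_module_0]])
next
  note M = fin_presented_left_module[OF assms]
  case (Suc k)
  show ?case
    by (rule fin_presented_iso[OF fin_presented_prod[OF Suc assms] pow_module_Suc[OF M] left_module_pow_module[OF M]])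
qed

lemma Ext_pow_module:
  assumes "fin_presented R \<infinity> M" "left_module R N" "trivial_group (Ext R (Suc j) M N)"
  shows "trivial_group (Ext R (Suc j) (pow_module k M) N)"
proof (induction k)
  note M = fin_presented_left_module[OF assms(1)]
  case 0
  show ?case by (rule Ext_zero_module[OF left_module_pow_module[OF M] pow_module_0 assms(2)])
next
  note M = fin_presented_left_module[OF assms(1)]
  case (Suc k)
  then show ?case
    using Ext_trivial_prod[OF fin_presented_pow_module[OF assms(1)] assms(1,2) Suc assms(3)]
      Ext_trivial_iso[OF left_module_prod_module[OF left_module_pow_module[OF M] M] pow_module_Suc[OF M]
        left_module_pow_module[OF M] assms(2)] by blast
qed

lemma Tor_pow_module:
  assumes "fin_presented (op_ring R) \<infinity> M" "left_module R N" "trivial_group (Tor R (Suc j) M N)"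
  shows "trivial_group (Tor R (Suc j) (pow_module k M) N)"
proof (induction k)
  note M = fin_presented_left_module[OF assms(1)]
  case 0
  show ?case by (rule Tor_zero_module[OF left_module_pow_module[OF M] pow_module_0 assms(2)])
next
  note M = fin_presented_left_module[OF assms(1)]
  case (Suc k)
  then show ?case
    using Tor_trivial_prod[OF fin_presented_pow_module[OF assms(1)] assms(1,2) Suc assms(3)]
      Tor_trivial_iso[OF left_module_prod_module[OF left_module_pow_module[OF M] M] pow_module_Suc[OF M]
        left_module_pow_module[OF M] assms(2)] by blast
qed

section \<open>Duals with respect to a bimodule\<close>

text \<open>Basis vectors \<open>e\<close> and coordinate forms \<open>\<pi>\<close>, the form in
  which finite freeness is used for Hom and tensor computations. The last condition makes the
  coordinates of a combination equal to its coefficients.\<close>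

definition dual_basis ::
    "('r, 'x) ring_scheme \<Rightarrow> ('r, 'f, 'y) module_scheme \<Rightarrow> nat \<Rightarrow> (nat \<Rightarrow> 'f) \<Rightarrow> (nat \<Rightarrow> 'f \<Rightarrow> 'r) \<Rightarrow> bool" where
  "dual_basis R F k e \<pi> \<longleftrightarrow> (\<forall>j<k. e j \<in> carrier F) \<and>
     (\<forall>j. \<forall>x\<in>carrier F. \<pi> j x \<in> carrier R) \<and>
     (\<forall>j. \<forall>x\<in>carrier F. \<forall>y\<in>carrier F. \<pi> j (x \<oplus>\<^bsub>F\<^esub> y) = \<pi> j x \<oplus>\<^bsub>R\<^esub> \<pi> j y) \<and>
     (\<forall>j<k. \<forall>r\<in>carrier R. \<forall>x\<in>carrier F. \<pi> j (r \<odot>\<^bsub>F\<^esub> x) = r \<otimes>\<^bsub>R\<^esub> \<pi> j x) \<and>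
     (\<forall>x\<in>carrier F. (\<Oplus>\<^bsub>F\<^esub>j\<in>{..<k}. \<pi> j x \<odot>\<^bsub>F\<^esub> e j) = x) \<and>
     (\<forall>i<k. \<forall>j<k. \<pi> j (e i) = (if i = j then \<one>\<^bsub>R\<^esub> else \<zero>\<^bsub>R\<^esub>))"

lemma dual_basisD:
  assumes "dual_basis R F k e \<pi>"
  shows "j < k \<Longrightarrow> e j \<in> carrier F" "x \<in> carrier F \<Longrightarrow> \<pi> j x \<in> carrier R"
    "x \<in> carrier F \<Longrightarrow> y \<in> carrier F \<Longrightarrow> \<pi> j (x \<oplus>\<^bsub>F\<^esub> y) = \<pi> j x \<oplus>\<^bsub>R\<^esub> \<pi> j y"
    "j < k \<Longrightarrow> r \<in> carrier R \<Longrightarrow> x \<in> carrier F \<Longrightarrow> \<pi> j (r \<odot>\<^bsub>F\<^esub> x) = r \<otimes>\<^bsub>R\<^esub> \<pi> j x"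
    "x \<in> carrier F \<Longrightarrow> (\<Oplus>\<^bsub>F\<^esub>j\<in>{..<k}. \<pi> j x \<odot>\<^bsub>F\<^esub> e j) = x"
    "i < k \<Longrightarrow> j < k \<Longrightarrow> \<pi> j (e i) = (if i = j then \<one>\<^bsub>R\<^esub> else \<zero>\<^bsub>R\<^esub>)"
  using assms unfolding dual_basis_def by blast+

lemma ex_dual_basis:
  assumes "left_module R F" "fg_free R F"
  shows "\<exists>k e \<pi>. dual_basis R F k e \<pi>"
proof -
  interpret F: left_module R F by fact
  note r = F.R.ring_axioms
  obtain k \<theta> where \<theta>: "\<theta> \<in> lin_isos R F (free_module R {..<k::nat})" using assms(2) unfolding fg_free_def by blast
  note \<theta>1 = lin_isosD[OF \<theta>]
  define \<eta> where "\<eta> = inv_into (carrier F) \<theta>"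
  have \<eta>: "\<eta> \<in> lin_maps R (free_module R {..<k}) F"
    using lin_isosD(1)[OF lin_isos_inv_into[OF assms(1) \<theta>]] by (simp add: \<eta>_def)
  have \<eta>\<theta>: "\<eta> (\<theta> x) = x" if "x \<in> carrier F" for x using \<theta>1(2) that by (simp add: \<eta>_def bij_betw_def)
  have \<theta>\<eta>: "\<theta> (\<eta> x) = x" if "x \<in> carrier (free_module R {..<k})" for x
    using \<theta>1(2) that by (simp add: \<eta>_def bij_betw_def f_inv_into_f)
  have u: "unit_vector R j \<in> carrier (free_module R {..<k})" if "j < k" for j
    using unit_vector_closed[OF r, of j "{..<k}"] that by simp
  define e where "e j = \<eta> (unit_vector R j)" for j
  have ec: "e j \<in> carrier F" if "j < k" for j unfolding e_def by (rule lin_maps_closed[OF \<eta> u[OF that]])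
  have \<theta>c: "\<theta> x j \<in> carrier R" if "x \<in> carrier F" for x j
    using lin_maps_closed[OF \<theta>1(1) that] by (cases "j < k") (auto simp: carrier_free_module_finite)
  have \<theta>a: "\<theta> (x \<oplus>\<^bsub>F\<^esub> y) j = \<theta> x j \<oplus>\<^bsub>R\<^esub> \<theta> y j" if "x \<in> carrier F" "y \<in> carrier F" for x y j
    using lin_maps_add[OF \<theta>1(1) that] by (simp add: free_module_simps)
  have \<theta>s: "\<theta> (s \<odot>\<^bsub>F\<^esub> x) j = s \<otimes>\<^bsub>R\<^esub> \<theta> x j" if "j < k" "s \<in> carrier R" "x \<in> carrier F" for s x j
    using lin_maps_smult[OF \<theta>1(1) that(2,3)] that(1) by (simp add: free_module_simps)
  have \<theta>x: "(\<Oplus>\<^bsub>F\<^esub>j\<in>{..<k}. \<theta> x j \<odot>\<^bsub>F\<^esub> e j) = x" if x: "x \<in> carrier F" for x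
  proof -
    have "x = lin_ext R F e (\<theta> x)"
      using lin_map_free_module_eq[OF assms(1) \<eta> lin_maps_closed[OF \<theta>1(1) x]] \<eta>\<theta>[OF x] by (simp add: e_def[abs_def])
    also have "\<dots> = (\<Oplus>\<^bsub>F\<^esub>j\<in>{..<k}. \<theta> x j \<odot>\<^bsub>F\<^esub> e j)"
      by (rule lin_ext_eq_finsum[OF assms(1) _ lin_maps_closed[OF \<theta>1(1) x]])
        (use ec lin_maps_closed[OF \<theta>1(1) x] in \<open>auto simp: free_module_def\<close>)
    finally show ?thesis ..
  qed
  have \<theta>e: "\<theta> (e i) j = (if i = j then \<one>\<^bsub>R\<^esub> else \<zero>\<^bsub>R\<^esub>)" if "i < k" for i j
    using \<theta>\<eta>[OF u[OF that]] by (auto simp: e_def unit_vector_def)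
  have "dual_basis R F k e (\<lambda>j x. \<theta> x j)"
    unfolding dual_basis_def using ec \<theta>c \<theta>a \<theta>s \<theta>x \<theta>e by auto
  then show ?thesis by blast
qed

lemma abelian_group_cong:
  assumes "abelian_group G" "carrier H = carrier G" "\<zero>\<^bsub>H\<^esub> = \<zero>\<^bsub>G\<^esub>" "add H = add G"
  shows "abelian_group H"
proof -
  interpret G: abelian_group G by fact
  show ?thesis
    by (rule abelian_groupI) (use assms(2-4) G.l_neg in \<open>auto simp: G.a_ac\<close>)
qed

text \<open>An \<open>(A,B\<^sup>o\<^sup>p)\<close>-bimodule, given by an \<open>A\<close>-module and a \<open>B\<close>-module with the same underlying
  group. Both sides of the theorem use this, with the roles of \<open>S\<close> and \<open>R\<^sup>o\<^sup>p\<close> exchanged.\<close>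

locale two_actions =
  fixes A :: "('a, 'x) ring_scheme" and B :: "('b, 'y) ring_scheme"
    and KA :: "('a, 'k, 'z) module_scheme" and KB :: "('b, 'k, 'w) module_scheme"
  assumes KA: "left_module A KA" and KB: "left_module B KB"
    and carrier_KB: "carrier KB = carrier KA" and zero_KB: "\<zero>\<^bsub>KB\<^esub> = \<zero>\<^bsub>KA\<^esub>" and add_KB: "\<And>x y. x \<oplus>\<^bsub>KB\<^esub> y = x \<oplus>\<^bsub>KA\<^esub> y"
    and commute: "\<And>a b x. a \<in> carrier A \<Longrightarrow> b \<in> carrier B \<Longrightarrow> x \<in> carrier KA \<Longrightarrow>
       a \<odot>\<^bsub>KA\<^esub> (b \<odot>\<^bsub>KB\<^esub> x) = b \<odot>\<^bsub>KB\<^esub> (a \<odot>\<^bsub>KA\<^esub> x)"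
begin

sublocale KA: left_module A KA by (rule KA)
sublocale KB: left_module B KB by (rule KB)

definition dual :: "('b, 'f, 'v) module_scheme \<Rightarrow> ('a, 'f \<Rightarrow> 'k) module" where
  "dual F = \<lparr>carrier = carrier (hom_group B F KB), mult = undefined, one = undefined,
     ring.zero = ring.zero (hom_group B F KB), add = add (hom_group B F KB),
     smult = (\<lambda>a f. \<lambda>x\<in>carrier F. a \<odot>\<^bsub>KA\<^esub> f x)\<rparr>"

lemma dual_simps:
  "carrier (dual F) = lin_maps B F KB \<inter> extensional (carrier F)"
  "\<zero>\<^bsub>dual F\<^esub> = (\<lambda>x\<in>carrier F. \<zero>\<^bsub>KA\<^esub>)"
  "f \<oplus>\<^bsub>dual F\<^esub> g = (\<lambda>x\<in>carrier F. f x \<oplus>\<^bsub>KA\<^esub> g x)"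
  "a \<odot>\<^bsub>dual F\<^esub> f = (\<lambda>x\<in>carrier F. a \<odot>\<^bsub>KA\<^esub> f x)"
  by (simp_all add: dual_def hom_group_simps zero_KB add_KB)

lemma dual_lin: "f \<in> carrier (dual F) \<Longrightarrow> f \<in> lin_maps B F KB" by (simp add: dual_simps)

lemma dual_closed: "f \<in> carrier (dual F) \<Longrightarrow> x \<in> carrier F \<Longrightarrow> f x \<in> carrier KA"
  using lin_maps_closed[OF dual_lin] by (simp add: carrier_KB)

lemma dual_eqI:
  "f \<in> carrier (dual F) \<Longrightarrow> g \<in> carrier (dual F) \<Longrightarrow> (\<And>x. x \<in> carrier F \<Longrightarrow> f x = g x) \<Longrightarrow> f = g"
  by (auto simp: dual_simps intro: extensionalityI)

lemma restrict_dual: "left_module B F \<Longrightarrow> f \<in> lin_maps B F KB \<Longrightarrow> restrict f (carrier F) \<in> carrier (dual F)"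
  using restrict_lin_maps by (auto simp: dual_simps)

lemma smult_A_lin: "a \<in> carrier A \<Longrightarrow> (\<lambda>k. a \<odot>\<^bsub>KA\<^esub> k) \<in> lin_maps B KB KB"
  by (rule lin_mapsI) (auto simp: carrier_KB add_KB commute KA.smult_r_distr)

lemma smult_B_lin: "b \<in> carrier B \<Longrightarrow> (\<lambda>k. b \<odot>\<^bsub>KB\<^esub> k) \<in> lin_maps A KA KA"
  using KB.smult_closed KB.smult_r_distr by (intro lin_mapsI) (auto simp: carrier_KB add_KB commute)

lemma left_module_dual:
  assumes "left_module B F"
  shows "left_module A (dual F)"
proof -
  interpret F: left_module B F by fact
  interpret D: abelian_group "dual F"
    by (rule abelian_group_cong[OF abelian_group_hom_group[OF assms KB]]) (simp_all add: dual_def)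
  note l = dual_lin dual_closed
  show ?thesis
  proof (intro left_module.intro left_module_axioms.intro)
    show "ring A" by (rule KA.R.ring_axioms)
    show "abelian_group (dual F)" by (rule D.abelian_group_axioms)
    fix r f assume r: "r \<in> carrier A" and f: "f \<in> carrier (dual F)"
    show "r \<odot>\<^bsub>dual F\<^esub> f \<in> carrier (dual F)"
      using restrict_dual[OF assms lin_maps_comp[OF dual_lin[OF f] smult_A_lin[OF r]]] by (simp add: dual_simps(4))
    {
      fix s assume s: "s \<in> carrier A"
      show "(r \<oplus>\<^bsub>A\<^esub> s) \<odot>\<^bsub>dual F\<^esub> f = r \<odot>\<^bsub>dual F\<^esub> f \<oplus>\<^bsub>dual F\<^esub> s \<odot>\<^bsub>dual F\<^esub> f"
        and "(r \<otimes>\<^bsub>A\<^esub> s) \<odot>\<^bsub>dual F\<^esub> f = r \<odot>\<^bsub>dual F\<^esub> (s \<odot>\<^bsub>dual F\<^esub> f)"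
        using r s dual_closed[OF f] by (auto simp: dual_simps fun_eq_iff KA.smult_l_distr KA.smult_assoc1)
    next
      fix g assume g: "g \<in> carrier (dual F)"
      show "r \<odot>\<^bsub>dual F\<^esub> (f \<oplus>\<^bsub>dual F\<^esub> g) = r \<odot>\<^bsub>dual F\<^esub> f \<oplus>\<^bsub>dual F\<^esub> r \<odot>\<^bsub>dual F\<^esub> g"
        using r dual_closed[OF f] dual_closed[OF g] by (auto simp: dual_simps fun_eq_iff KA.smult_r_distr)
    }
  next
    fix f assume f: "f \<in> carrier (dual F)"
    show "\<one>\<^bsub>A\<^esub> \<odot>\<^bsub>dual F\<^esub> f = f"
      using dual_closed[OF f] f by (auto simp: dual_simps(1,4) fun_eq_iff extensional_def)
  qed
qed

lemma dual_map:
  assumes "left_module B F'" "d \<in> lin_maps B F' F"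
  shows "(\<lambda>f. compose (carrier F') f d) \<in> lin_maps A (dual F) (dual F')"
proof (rule lin_mapsI)
  note d = lin_maps_closed[OF assms(2)]
  show "compose (carrier F') f d \<in> carrier (dual F')" if "f \<in> carrier (dual F)" for f
    using restrict_dual[OF assms(1) lin_maps_comp[OF assms(2) dual_lin[OF that]]] by (simp add: compose_def)
  show "compose (carrier F') (f \<oplus>\<^bsub>dual F\<^esub> g) d = compose (carrier F') f d \<oplus>\<^bsub>dual F'\<^esub> compose (carrier F') g d" for f g
    using d by (auto simp: dual_simps compose_def fun_eq_iff)
  show "compose (carrier F') (a \<odot>\<^bsub>dual F\<^esub> f) d = a \<odot>\<^bsub>dual F'\<^esub> compose (carrier F') f d" for a f
    using d by (auto simp: dual_simps compose_def fun_eq_iff)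
qed

lemma finsum_KB:
  assumes "finite I" "f \<in> I \<rightarrow> carrier KA"
  shows "finsum KB f I = finsum KA f I"
  using assms
proof (induction I)
  case (insert i I)
  then have "f i \<in> carrier KA" "f \<in> I \<rightarrow> carrier KA" by auto
  then show ?case using insert.hyps insert.IH by (simp add: add_KB carrier_KB)
qed (simp add: zero_KB)

text \<open>The map that sends the \<open>j\<close>th basis vector to \<open>m\<close> and the
  others to zero, that is, the inclusion of the \<open>j\<close>th copy of \<open>K\<close> into
  \<open>Hom(F,K)\<close>.\<close>

definition coef :: "(nat \<Rightarrow> 'f \<Rightarrow> 'b) \<Rightarrow> ('b, 'f, 'v) module_scheme \<Rightarrow> nat \<Rightarrow> 'k \<Rightarrow> 'f \<Rightarrow> 'k" where
  "coef \<pi> F j m = (\<lambda>x\<in>carrier F. \<pi> j x \<odot>\<^bsub>KB\<^esub> m)"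

lemma coef_apply: "x \<in> carrier F \<Longrightarrow> coef \<pi> F j m x = \<pi> j x \<odot>\<^bsub>KB\<^esub> m"
  by (simp add: coef_def)

lemma smult_KB_closed: "b \<in> carrier B \<Longrightarrow> m \<in> carrier KA \<Longrightarrow> b \<odot>\<^bsub>KB\<^esub> m \<in> carrier KA"
  using KB.smult_closed by (simp add: carrier_KB)

lemma finsum_dual_apply:
  assumes "left_module B F" "finite I" "g \<in> I \<rightarrow> carrier (dual F)" "x \<in> carrier F"
  shows "finsum (dual F) g I x = finsum KA (\<lambda>j. g j x) I"
  using assms(2-4)
proof (induction I)
  interpret D: left_module A "dual F" by (rule left_module_dual[OF assms(1)])
  {
    case empty
    then show ?case by (simp add: dual_simps)
  next
    case (insert i I)
    then have "g i \<in> carrier (dual F)" "g \<in> I \<rightarrow> carrier (dual F)" by auto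
    moreover then have "g i x \<in> carrier KA" "(\<lambda>j. g j x) \<in> I \<rightarrow> carrier KA"
      using dual_closed[of _ F x] insert.prems(2) by auto
    ultimately show ?case using insert by (simp add: dual_simps(3))
  }
qed

context
  fixes F :: "('b, 'f, 'v) module_scheme" and k e \<pi>
  assumes F: "left_module B F" and basis: "dual_basis B F k e \<pi>"
begin

lemmas \<pi> = dual_basisD[OF basis]

lemma coef_closed: "j < k \<Longrightarrow> m \<in> carrier KA \<Longrightarrow> coef \<pi> F j m \<in> carrier (dual F)"
  unfolding coef_def
  by (rule restrict_dual[OF F], rule lin_mapsI)
    (use \<pi> smult_KB_closed in \<open>auto simp: carrier_KB KB.smult_l_distr KB.smult_assoc1\<close>)

lemma coef_lin: "j < k \<Longrightarrow> coef \<pi> F j \<in> lin_maps A KA (dual F)"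
proof (rule lin_mapsI)
  fix m m' assume "m \<in> carrier KA" "m' \<in> carrier KA"
  then show "coef \<pi> F j (m \<oplus>\<^bsub>KA\<^esub> m') = coef \<pi> F j m \<oplus>\<^bsub>dual F\<^esub> coef \<pi> F j m'"
    using \<pi>(2) KB.smult_r_distr by (auto simp: coef_def dual_simps fun_eq_iff carrier_KB add_KB)
next
  fix a m assume "a \<in> carrier A" "m \<in> carrier KA"
  then show "coef \<pi> F j (a \<odot>\<^bsub>KA\<^esub> m) = a \<odot>\<^bsub>dual F\<^esub> coef \<pi> F j m"
    using \<pi>(2) by (auto simp: coef_def dual_simps fun_eq_iff commute)
qed (rule coef_closed)

lemma coef_basis:
  "i < k \<Longrightarrow> j < k \<Longrightarrow> m \<in> carrier KA \<Longrightarrow> coef \<pi> F j m (e i) = (if i = j then m else \<zero>\<^bsub>KA\<^esub>)"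
  using \<pi>(1) \<pi>(6) KB.smult_one KB.smult_zero_left by (simp add: coef_apply carrier_KB zero_KB)

lemma dual_expand:
  assumes f: "f \<in> carrier (dual F)"
  shows "(\<Oplus>\<^bsub>dual F\<^esub>j\<in>{..<k}. coef \<pi> F j (f (e j))) = f"
proof -
  interpret F: left_module B F by (rule F)
  interpret D: left_module A "dual F" by (rule left_module_dual[OF F])
  have fe: "(\<lambda>j. coef \<pi> F j (f (e j))) \<in> {..<k} \<rightarrow> carrier (dual F)" using coef_closed \<pi>(1) dual_closed[OF f] by auto
  show ?thesis
  proof (rule dual_eqI[OF D.M.finsum_closed[OF fe] f])
    fix x assume x: "x \<in> carrier F"
    have "(\<Oplus>\<^bsub>dual F\<^esub>j\<in>{..<k}. coef \<pi> F j (f (e j))) x = finsum KA (\<lambda>j. coef \<pi> F j (f (e j)) x) {..<k}"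
      by (rule finsum_dual_apply[OF F]) (use fe x in auto)
    also have "\<dots> = finsum KA (\<lambda>j. f (\<pi> j x \<odot>\<^bsub>F\<^esub> e j)) {..<k}"
      by (rule KA.M.finsum_cong')
        (use \<pi>(1,2) x dual_closed[OF f] smult_KB_closed lin_maps_smult[OF dual_lin[OF f]] in \<open>auto simp: coef_apply\<close>)
    \<comment> \<open>\<open>f\<close> is linear for the \<open>B\<close>-structure; before it can
      be taken out of the sum, the sum is rewritten in the record \<open>KB\<close>, which has the
      same addition.\<close>
    also have "\<dots> = finsum KB (\<lambda>j. f (\<pi> j x \<odot>\<^bsub>F\<^esub> e j)) {..<k}"
      by (rule finsum_KB[symmetric]) (use \<pi>(1,2) x dual_closed[OF f] smult_KB_closed in auto)
    also have "\<dots> = f (\<Oplus>\<^bsub>F\<^esub>j\<in>{..<k}. \<pi> j x \<odot>\<^bsub>F\<^esub> e j)"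
      by (rule lin_maps_finsum[OF dual_lin[OF f] F KB, symmetric]) (use \<pi>(1,2) x in auto)
    also have "\<dots> = f x" using \<pi>(5)[OF x] by simp
    finally show "(\<Oplus>\<^bsub>dual F\<^esub>j\<in>{..<k}. coef \<pi> F j (f (e j))) x = f x" .
  qed
qed

text \<open>A map on a free module is given by arbitrary values on the basis; the inverse reads off
  these values and pads them with zeros. Through this isomorphism the duals inherit from
  \<open>K\<close> the finite presentation and the vanishing of \<open>Ext\<close> and
  \<open>Tor\<close>.\<close>

lemma dual_iso_pow_module:
  "(\<lambda>g. \<Oplus>\<^bsub>dual F\<^esub>j\<in>{..<k}. coef \<pi> F j (g j)) \<in> lin_isos A (pow_module k KA) (dual F)" (is "?\<theta> \<in> _")
proof -
  interpret D: left_module A "dual F" by (rule left_module_dual[OF F])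
  have coord: "(\<lambda>g. g j) \<in> lin_maps A (pow_module k KA) KA" if "j < k" for j
    by (rule lin_mapsI) (use that in \<open>auto simp: pow_module_simps\<close>)
  have ev: "(\<lambda>f. f x) \<in> lin_maps A (dual F) KA" if "x \<in> carrier F" for x
    by (rule lin_mapsI) (use that dual_closed in \<open>auto simp: dual_simps(3,4)\<close>)
  have \<theta>: "?\<theta> \<in> lin_maps A (pow_module k KA) (dual F)"
    by (rule lin_maps_finsum_fun[OF D.left_module_axioms]) (auto intro: lin_maps_comp[OF coord coef_lin])
  show ?thesis
  proof (rule lin_isosI_inverse[where g = "\<lambda>f j. if j < k then f (e j) else \<zero>\<^bsub>KA\<^esub>", OF \<theta>])
    fix f assume f: "f \<in> carrier (dual F)"
    then show "(\<lambda>j. if j < k then f (e j) else \<zero>\<^bsub>KA\<^esub>) \<in> carrier (pow_module k KA)"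
      using dual_closed[OF f] \<pi>(1) by (auto simp: pow_module_simps)
    have "(\<Oplus>\<^bsub>dual F\<^esub>j\<in>{..<k}. coef \<pi> F j (if j < k then f (e j) else \<zero>\<^bsub>KA\<^esub>)) = (\<Oplus>\<^bsub>dual F\<^esub>j\<in>{..<k}. coef \<pi> F j (f (e j)))"
      by (rule D.M.finsum_cong') (use coef_closed \<pi>(1) dual_closed[OF f] in auto)
    then show "(\<Oplus>\<^bsub>dual F\<^esub>j\<in>{..<k}. coef \<pi> F j (if j < k then f (e j) else \<zero>\<^bsub>KA\<^esub>)) = f" using dual_expand[OF f] by simp
  next
    fix g assume g: "g \<in> carrier (pow_module k KA)"
    have gc: "g j \<in> carrier KA" if "j < k" for j using g that by (auto simp: pow_module_simps)
    show "(\<lambda>j. if j < k then ?\<theta> g (e j) else \<zero>\<^bsub>KA\<^esub>) = g"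
    proof
      fix i
      show "(if i < k then ?\<theta> g (e i) else \<zero>\<^bsub>KA\<^esub>) = g i"
      proof (cases "i < k")
        case True
        have "?\<theta> g (e i) = finsum KA (\<lambda>j. coef \<pi> F j (g j) (e i)) {..<k}"
          by (rule finsum_dual_apply[OF F]) (use coef_closed gc \<pi>(1) True in auto)
        also have "\<dots> = finsum KA (\<lambda>j. if i = j then g j else \<zero>\<^bsub>KA\<^esub>) {..<k}"
          by (rule KA.M.finsum_cong') (use coef_basis True gc in auto)
        also have "\<dots> = g i" by (rule KA.M.finsum_singleton) (use True gc in auto)
        finally show ?thesis using True by simp
      qed (use g in \<open>auto simp: pow_module_simps\<close>)
    qed
  qed
qed

end

lemma fin_presented_dual:
  assumes "left_module B F" "fg_free B F" "fin_presented A \<infinity> KA"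
  shows "fin_presented A \<infinity> (dual F)"
proof -
  obtain k e \<pi> where "dual_basis B F k e \<pi>" using ex_dual_basis[OF assms(1,2)] by blast
  from dual_iso_pow_module[OF assms(1) this] show ?thesis
    by (rule fin_presented_iso[OF fin_presented_pow_module[OF assms(3)] _ left_module_dual[OF assms(1)]])
qed

lemma Ext_dual:
  assumes "left_module B F" "fg_free B F" "fin_presented A \<infinity> KA" "left_module A N" "trivial_group (Ext A (Suc j) KA N)"
  shows "trivial_group (Ext A (Suc j) (dual F) N)"
proof -
  obtain k e \<pi> where "dual_basis B F k e \<pi>" using ex_dual_basis[OF assms(1,2)] by blast
  note \<theta> = dual_iso_pow_module[OF assms(1) this]
  from Ext_trivial_iso[OF left_module_pow_module[OF KA] \<theta> left_module_dual[OF assms(1)] assms(4)]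
    Ext_pow_module[OF assms(3-5)]
  show ?thesis by (rule iffD1)
qed

lemma Tor_dual:
  assumes "left_module B F" "fg_free B F" "fin_presented A \<infinity> KA" and A: "A = op_ring R"
    and N: "left_module R N" "trivial_group (Tor R (Suc j) KA N)"
  shows "trivial_group (Tor R (Suc j) (dual F) N)"
proof -
  obtain k e \<pi> where "dual_basis B F k e \<pi>" using ex_dual_basis[OF assms(1,2)] by blast
  note \<theta> = dual_iso_pow_module[OF assms(1) this]
  from Tor_trivial_iso[OF left_module_pow_module[OF KA, unfolded A] \<theta>[unfolded A] left_module_dual[OF assms(1), unfolded A] N(1)]
    Tor_pow_module[OF assms(3)[unfolded A] N]
  show ?thesis by (rule iffD1)
qed

end

text \<open>What one half of the theorem takes from \<open>semidualizing\<close>. \<open>G\<close>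
  resolves \<open>K\<close> over \<open>B\<close>, while the duals are modules over
  \<open>A\<close>: the homothety identifies \<open>A\<close> with the kernel in degree zero, and
  \<open>ExtB\<close> gives exactness beyond it.\<close>

locale dual_resolution = two_actions A B KA KB
  for A :: "('a, 'x) ring_scheme" and B :: "('b, 'y) ring_scheme"
    and KA :: "('a, 'k, 'z) module_scheme" and KB :: "('b, 'k, 'w) module_scheme" +
  fixes G :: "nat \<Rightarrow> ('b, 'f, 'v) module_scheme" and \<delta> :: "nat \<Rightarrow> 'f \<Rightarrow> 'f" and \<epsilon> :: "'f \<Rightarrow> 'k"
  assumes G: "resolution B \<infinity> G \<delta> \<epsilon> KB" and free: "\<And>i. fg_free B (G i)" and fpKA: "fin_presented A \<infinity> KA"
    and homothety: "bij_betw (\<lambda>a. \<lambda>k\<in>carrier KB. a \<odot>\<^bsub>KA\<^esub> k) (carrier A) (carrier (hom_group B KB KB))"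
    and ExtB: "\<And>i. trivial_group (Ext B (Suc i) KB KB)"
begin

lemmas G' = resolution_infinityD[OF G]

definition D :: "nat \<Rightarrow> ('f \<Rightarrow> 'k) \<Rightarrow> ('f \<Rightarrow> 'k)" where
  "D i f = compose (carrier (G (Suc i))) f (\<delta> i)"

lemma D_apply: "x \<in> carrier (G (Suc i)) \<Longrightarrow> D i f x = f (\<delta> i x)" by (simp add: D_def compose_def)

lemma D: "D i \<in> lin_maps A (dual (G i)) (dual (G (Suc i)))"
  using dual_map[OF G'(2) G'(5)] by (simp add: D_def[abs_def])

lemma E: "left_module A (dual (G i))" by (rule left_module_dual[OF G'(2)])

lemma D_zero_iff:
  assumes "f \<in> carrier (dual (G i))"
  shows "D i f = \<zero>\<^bsub>dual (G (Suc i))\<^esub> \<longleftrightarrow> (\<forall>x\<in>carrier (G (Suc i)). f (\<delta> i x) = \<zero>\<^bsub>KA\<^esub>)"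
proof -
  interpret Ei: left_module A "dual (G (Suc i))" by (rule E)
  have "D i f = \<zero>\<^bsub>dual (G (Suc i))\<^esub> \<longleftrightarrow> (\<forall>x\<in>carrier (G (Suc i)). D i f x = \<zero>\<^bsub>dual (G (Suc i))\<^esub> x)"
    using dual_eqI[OF lin_maps_closed[OF D assms] Ei.M.zero_closed] by metis
  then show ?thesis by (simp add: dual_simps(2) D_apply)
qed

text \<open>The homothety followed by composition with \<open>\<epsilon>\<close>. Its image turns
  out to be the kernel of \<open>D 0\<close>.\<close>

definition \<eta> :: "'a \<Rightarrow> 'f \<Rightarrow> 'k" where
  "\<eta> a = (\<lambda>x\<in>carrier (G 0). a \<odot>\<^bsub>KA\<^esub> \<epsilon> x)"

lemma \<eta>_closed: "a \<in> carrier A \<Longrightarrow> \<eta> a \<in> carrier (dual (G 0))"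
  unfolding \<eta>_def by (rule restrict_dual[OF G'(2) lin_maps_comp[OF G'(3) smult_A_lin]])

lemma \<epsilon>_closed: "x \<in> carrier (G 0) \<Longrightarrow> \<epsilon> x \<in> carrier KA"
  using lin_maps_closed[OF G'(3)] by (simp add: carrier_KB)

lemma \<eta>_add: "a \<in> carrier A \<Longrightarrow> a' \<in> carrier A \<Longrightarrow> \<eta> (a \<oplus>\<^bsub>A\<^esub> a') = \<eta> a \<oplus>\<^bsub>dual (G 0)\<^esub> \<eta> a'"
  using \<epsilon>_closed by (auto simp: \<eta>_def dual_simps fun_eq_iff KA.smult_l_distr)

lemma \<eta>_smult: "a \<in> carrier A \<Longrightarrow> a' \<in> carrier A \<Longrightarrow> \<eta> (a \<otimes>\<^bsub>A\<^esub> a') = a \<odot>\<^bsub>dual (G 0)\<^esub> \<eta> a'"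
  using \<epsilon>_closed by (auto simp: \<eta>_def dual_simps fun_eq_iff KA.smult_assoc1)

lemma D_\<eta>: "a \<in> carrier A \<Longrightarrow> D 0 (\<eta> a) = \<zero>\<^bsub>dual (G (Suc 0))\<^esub>"
  unfolding D_zero_iff[OF \<eta>_closed]
  using resolution_comp_zero(1)[OF G] lin_maps_closed[OF G'(5)] by (simp add: \<eta>_def zero_KB)

text \<open>A map that kills the image of \<open>\<delta> 0\<close> kills the kernel of
  \<open>\<epsilon>\<close>, so it factors through \<open>\<epsilon>\<close> as an endomorphism of
  \<open>KB\<close>; by \<open>homothety\<close> this endomorphism is multiplication by some
  \<open>a\<close>.\<close>

lemma kernel_D0:
  assumes f: "f \<in> carrier (dual (G 0))" and z: "D 0 f = \<zero>\<^bsub>dual (G (Suc 0))\<^esub>"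
  shows "\<exists>a\<in>carrier A. f = \<eta> a"
proof -
  have z': "f (\<delta> 0 x) = \<zero>\<^bsub>KA\<^esub>" if "x \<in> carrier (G (Suc 0))" for x using z D_zero_iff[OF f] that by blast
  obtain h where h: "h \<in> lin_maps B KB KB" "\<And>x. x \<in> carrier (G 0) \<Longrightarrow> h (\<epsilon> x) = f x"
    using lin_maps_factor[OF G'(2) KB KB G'(3,4) dual_lin[OF f]] resolution_exact(1)[OF G] z' zero_KB by metis
  have "restrict h (carrier KB) \<in> carrier (hom_group B KB KB)"
    using restrict_lin_maps[OF KB h(1)] by (simp add: hom_group_simps)
  then have "restrict h (carrier KB) \<in> (\<lambda>a. \<lambda>k\<in>carrier KB. a \<odot>\<^bsub>KA\<^esub> k) ` carrier A"
    using homothety by (simp add: bij_betw_def)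
  then obtain a where a: "a \<in> carrier A" "restrict h (carrier KB) = (\<lambda>k\<in>carrier KB. a \<odot>\<^bsub>KA\<^esub> k)" by auto
  have "h k = a \<odot>\<^bsub>KA\<^esub> k" if "k \<in> carrier KB" for k using fun_cong[OF a(2), of k] that by simp
  then have "f = \<eta> a"
    using h(2) lin_maps_closed[OF G'(3)] by (intro dual_eqI[OF f \<eta>_closed[OF a(1)]]) (simp add: \<eta>_def)
  then show ?thesis using a(1) by blast
qed

lemma \<eta>_inj:
  assumes "a \<in> carrier A" "a' \<in> carrier A" "\<eta> a = \<eta> a'"
  shows "a = a'"
proof -
  have "a \<odot>\<^bsub>KA\<^esub> k = a' \<odot>\<^bsub>KA\<^esub> k" if "k \<in> carrier KB" for k
  proof -
    have "k \<in> \<epsilon> ` carrier (G 0)" using that G'(4) by simp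
    then obtain x where "x \<in> carrier (G 0)" "k = \<epsilon> x" by auto
    then show ?thesis using fun_cong[OF assms(3), of x] by (simp add: \<eta>_def)
  qed
  then have "(\<lambda>k\<in>carrier KB. a \<odot>\<^bsub>KA\<^esub> k) = (\<lambda>k\<in>carrier KB. a' \<odot>\<^bsub>KA\<^esub> k)" by auto
  then show ?thesis using homothety assms(1,2) unfolding bij_betw_def inj_on_def by blast
qed

text \<open>By \<open>kernel_D0\<close> and \<open>\<eta>_inj\<close> the kernel is a copy of
  \<open>A\<close>, hence free of rank one. An element of the free module on \<open>{..<1}\<close>
  is determined by its entry at \<open>0\<close>.\<close>

lemma fin_presented_kernel_D0:
  "fin_presented A \<infinity> ((dual (G 0))\<lparr>carrier := {f \<in> carrier (dual (G 0)). D 0 f = \<zero>\<^bsub>dual (G (Suc 0))\<^esub>}\<rparr>)"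
  (is "fin_presented A \<infinity> ?L")
proof -
  let ?F = "free_module A {..<1::nat}"
  have F: "left_module A ?F" by (rule left_module_free_module[OF KA.R.ring_axioms])
  have L: "left_module A ?L" by (rule left_module_kernel[OF D E E])
  have F0: "y 0 \<in> carrier A" if "y \<in> carrier ?F" for y using that by (auto simp: carrier_free_module_finite)
  have "(\<lambda>y. \<eta> (y 0)) \<in> lin_isos A ?F ?L"
    unfolding lin_isos_def
  proof (intro CollectI conjI)
    show "(\<lambda>y. \<eta> (y 0)) \<in> lin_maps A ?F ?L"
      by (rule lin_mapsI) (use F0 \<eta>_closed D_\<eta> \<eta>_add \<eta>_smult in \<open>auto simp: free_module_simps\<close>)
    show "bij_betw (\<lambda>y. \<eta> (y 0)) (carrier ?F) (carrier ?L)"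
      unfolding bij_betw_def
    proof
      show "inj_on (\<lambda>y. \<eta> (y 0)) (carrier ?F)"
      proof (rule inj_onI)
        fix y y' assume y: "y \<in> carrier ?F" "y' \<in> carrier ?F" "\<eta> (y 0) = \<eta> (y' 0)"
        then have "y 0 = y' 0" using \<eta>_inj F0 by blast
        moreover have "y i = y' i" if "i \<noteq> 0" for i using y(1,2) that by (auto simp: carrier_free_module_finite)
        ultimately show "y = y'" by (metis ext)
      qed
      show "(\<lambda>y. \<eta> (y 0)) ` carrier ?F = carrier ?L"
      proof
        show "(\<lambda>y. \<eta> (y 0)) ` carrier ?F \<subseteq> carrier ?L" using F0 \<eta>_closed D_\<eta> by auto
        show "carrier ?L \<subseteq> (\<lambda>y. \<eta> (y 0)) ` carrier ?F"
        proof
          fix f assume "f \<in> carrier ?L"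
          then obtain a where "a \<in> carrier A" "f = \<eta> a" using kernel_D0 by auto
          then show "f \<in> (\<lambda>y. \<eta> (y 0)) ` carrier ?F"
            by (intro image_eqI[of _ _ "\<lambda>i. if i = 0 then a else \<zero>\<^bsub>A\<^esub>"]) (auto simp: carrier_free_module_finite)
        qed
      qed
    qed
  qed
  then show ?thesis
    by (rule fin_presented_iso[OF fin_presented_fg_free[OF F fg_free_free_module] _ L])
qed

lemma coresolution: "coresolution A (\<lambda>i. dual (G i)) D"
proof (rule coresolution.intro)
  show "fin_presented A \<infinity> (dual (G i))" for i by (rule fin_presented_dual[OF G'(2) free fpKA])
  show "D i \<in> lin_maps A (dual (G i)) (dual (G (Suc i)))" for i by (rule D)
  show "D (Suc i) (D i f) = \<zero>\<^bsub>dual (G (Suc (Suc i)))\<^esub>" if f: "f \<in> carrier (dual (G i))" for i f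
    unfolding D_zero_iff[OF lin_maps_closed[OF D f]]
    using lin_maps_closed[OF G'(5)] D_apply resolution_comp_zero(2)[OF G] lin_maps_zero[OF dual_lin[OF f] G'(2) KB]
    by (simp add: zero_KB)
  show "\<exists>g\<in>carrier (dual (G i)). f = D i g"
    if f: "f \<in> carrier (dual (G (Suc i)))" and z: "D (Suc i) f = \<zero>\<^bsub>dual (G (Suc (Suc i)))\<^esub>" for i f
  proof -
    \<comment> \<open>The vanishing of \<open>Ext\<close> of \<open>K\<close> with itself over
      \<open>B\<close>, read on the resolution \<open>G\<close>; it is precisely exactness of the
      dual sequence in positive degrees.\<close>
    have "hom_exact B KB G \<delta> i"
      using ExtB Ext_trivial_iff[OF G fg_free_projective[OF G'(2) free] KB] by blast
    moreover have "\<forall>x\<in>carrier (G (Suc (Suc i))). f (\<delta> (Suc i) x) = \<zero>\<^bsub>KB\<^esub>"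
      using z D_zero_iff[OF f] by (simp add: zero_KB)
    ultimately obtain g where g: "g \<in> lin_maps B (G i) KB" "\<And>x. x \<in> carrier (G (Suc i)) \<Longrightarrow> f x = g (\<delta> i x)"
      using dual_lin[OF f] unfolding hom_exact_def by blast
    note r = restrict_dual[OF G'(2) g(1)]
    have "f = D i (restrict g (carrier (G i)))"
      using g(2) lin_maps_closed[OF G'(5)] by (intro dual_eqI[OF f lin_maps_closed[OF D r]]) (simp add: D_apply)
    then show ?thesis using r by blast
  qed
  show "fin_presented A \<infinity> ((dual (G 0))\<lparr>carrier := {f \<in> carrier (dual (G 0)). D 0 f = \<zero>\<^bsub>dual (G (Suc 0))\<^esub>}\<rparr>)"
    by (rule fin_presented_kernel_D0)
qed

sublocale co: coresolution A "\<lambda>i. dual (G i)" D by (rule coresolution)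

lemma carrier_L0: "carrier (co.L 0) = \<eta> ` carrier A"
  using kernel_D0 \<eta>_closed D_\<eta> by (auto simp: co.carrier_L)

text \<open>\<open>L 0\<close> is free of rank one on the image of \<open>\<one>\<close> under
  \<open>\<eta>\<close>, and this is the coordinate with respect to that basis.\<close>

definition \<eta>_inv :: "('f \<Rightarrow> 'k) \<Rightarrow> 'a" where
  "\<eta>_inv = inv_into (carrier A) \<eta>"

lemma \<eta>_inv_\<eta>: "a \<in> carrier A \<Longrightarrow> \<eta>_inv (\<eta> a) = a"
  unfolding \<eta>_inv_def using \<eta>_inj by (intro inv_into_f_f inj_onI)

lemma \<eta>_inv_closed: "f \<in> carrier (co.L 0) \<Longrightarrow> \<eta>_inv f \<in> carrier A"
  unfolding carrier_L0 using \<eta>_inv_\<eta> by auto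

lemma \<eta>_inv_add:
  "f \<in> carrier (co.L 0) \<Longrightarrow> g \<in> carrier (co.L 0) \<Longrightarrow> \<eta>_inv (f \<oplus>\<^bsub>co.L 0\<^esub> g) = \<eta>_inv f \<oplus>\<^bsub>A\<^esub> \<eta>_inv g"
  unfolding carrier_L0 using \<eta>_inv_\<eta> by (auto simp: co.L_def simp flip: \<eta>_add)

lemma \<eta>_inv_smult:
  "a \<in> carrier A \<Longrightarrow> f \<in> carrier (co.L 0) \<Longrightarrow> \<eta>_inv (a \<odot>\<^bsub>co.L 0\<^esub> f) = a \<otimes>\<^bsub>A\<^esub> \<eta>_inv f"
  unfolding carrier_L0 using \<eta>_inv_\<eta> by (auto simp: co.L_def simp flip: \<eta>_smult)

end

section \<open>The Bass class\<close>

lemma right_mod_simps [simp]: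
  "carrier (right_mod K) = carrier K" "\<zero>\<^bsub>right_mod K\<^esub> = \<zero>\<^bsub>K\<^esub>" "x \<oplus>\<^bsub>right_mod K\<^esub> y = x \<oplus>\<^bsub>K\<^esub> y"
  "r \<odot>\<^bsub>right_mod K\<^esub> x = rsmult K x r"
  by (simp_all add: right_mod_def)

lemma hom_module_simps:
  "carrier (hom_module S K N) = lin_maps S K N \<inter> extensional (carrier K)"
  "\<zero>\<^bsub>hom_module S K N\<^esub> = (\<lambda>k\<in>carrier K. \<zero>\<^bsub>N\<^esub>)"
  "f \<oplus>\<^bsub>hom_module S K N\<^esub> g = (\<lambda>k\<in>carrier K. f k \<oplus>\<^bsub>N\<^esub> g k)"
  "r \<odot>\<^bsub>hom_module S K N\<^esub> f = (\<lambda>k\<in>carrier K. f (rsmult K k r))"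
  by (simp_all add: hom_module_def hom_group_simps)

lemma tensor_module_simps:
  "carrier (tensor_module R K M) = carrier (tensor_group R (right_mod K) M)"
  "\<zero>\<^bsub>tensor_module R K M\<^esub> = \<zero>\<^bsub>tensor_group R (right_mod K) M\<^esub>"
  "x \<oplus>\<^bsub>tensor_module R K M\<^esub> y = x \<oplus>\<^bsub>tensor_group R (right_mod K) M\<^esub> y"
  "s \<odot>\<^bsub>tensor_module R K M\<^esub> x = tmap R M (right_mod K) (\<lambda>k. s \<odot>\<^bsub>K\<^esub> k) x"
  by (simp_all add: tensor_module_def Let_def)

section \<open>Module structures on Hom and on the tensor product\<close>

locale is_bimod =
  fixes R :: "('r, 'x) ring_scheme" and S :: "('s, 'y) ring_scheme" and K :: "('s, 'r, 'k) bimodule"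
  assumes ring_R: "ring R" and bimodule: "is_bimodule S R K"
begin

lemma left_K: "left_module S K" and right_K: "left_module (op_ring R) (right_mod K)"
  and rsmult_smult: "s \<in> carrier S \<Longrightarrow> r \<in> carrier R \<Longrightarrow> x \<in> carrier K \<Longrightarrow>
    rsmult K (s \<odot>\<^bsub>K\<^esub> x) r = s \<odot>\<^bsub>K\<^esub> rsmult K x r"
  using bimodule by (auto simp: is_bimodule_def)

sublocale R: ring R by (rule ring_R)
sublocale KS: left_module S K by (rule left_K)
sublocale KR: left_module "op_ring R" "right_mod K" by (rule right_K)

text \<open>In \<open>SR\<close> right modules are dualised into left \<open>S\<close>-modules,
  which serves the Bass class; in \<open>RS\<close> left modules are dualised into right
  \<open>R\<close>-modules, which serves the Auslander class.\<close>

sublocale SR: two_actions S "op_ring R" K "right_mod K"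
  by (intro two_actions.intro left_K right_K) (auto simp: rsmult_smult)

sublocale RS: two_actions "op_ring R" S "right_mod K" K
  by (intro two_actions.intro left_K right_K) (auto simp: rsmult_smult)

lemma rsmult_lin: "r \<in> carrier R \<Longrightarrow> (\<lambda>k. rsmult K k r) \<in> lin_maps S K K"
  using SR.smult_B_lin[of r] by simp

lemma smult_lin: "s \<in> carrier S \<Longrightarrow> (\<lambda>k. s \<odot>\<^bsub>K\<^esub> k) \<in> lin_maps (op_ring R) (right_mod K) (right_mod K)"
  by (rule SR.smult_A_lin)

lemma rsmult_simps:
  "r \<in> carrier R \<Longrightarrow> x \<in> carrier K \<Longrightarrow> rsmult K x r \<in> carrier K"
  "r \<in> carrier R \<Longrightarrow> r' \<in> carrier R \<Longrightarrow> x \<in> carrier K \<Longrightarrow> rsmult K x (r \<oplus>\<^bsub>R\<^esub> r') = rsmult K x r \<oplus>\<^bsub>K\<^esub> rsmult K x r'"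
  "r \<in> carrier R \<Longrightarrow> r' \<in> carrier R \<Longrightarrow> x \<in> carrier K \<Longrightarrow> rsmult K x (r \<otimes>\<^bsub>R\<^esub> r') = rsmult K (rsmult K x r) r'"
  "x \<in> carrier K \<Longrightarrow> rsmult K x \<one>\<^bsub>R\<^esub> = x"
  using KR.smult_closed[of r x] KR.smult_l_distr[of r r' x] KR.smult_assoc1[of r' r x] KR.smult_one[of x] by simp_all

lemma left_module_hom_module:
  assumes "left_module S N"
  shows "left_module R (hom_module S K N)"
proof -
  interpret N: left_module S N by fact
  interpret H: abelian_group "hom_module S K N"
    by (rule abelian_group_cong[OF abelian_group_hom_group[OF left_K assms]]) (simp_all add: hom_module_def)
  show ?thesis
  proof (intro left_module.intro left_module_axioms.intro)
    show "ring R" by (rule ring_R)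
    show "abelian_group (hom_module S K N)" by (rule H.abelian_group_axioms)
    fix r f assume r: "r \<in> carrier R" and f: "f \<in> carrier (hom_module S K N)"
    then have fl: "f \<in> lin_maps S K N" by (simp add: hom_module_simps)
    show "r \<odot>\<^bsub>hom_module S K N\<^esub> f \<in> carrier (hom_module S K N)"
      using restrict_lin_maps[OF left_K lin_maps_comp[OF rsmult_lin[OF r] fl]] by (simp add: hom_module_simps)
    {
      fix s assume s: "s \<in> carrier R"
      show "(r \<oplus>\<^bsub>R\<^esub> s) \<odot>\<^bsub>hom_module S K N\<^esub> f = r \<odot>\<^bsub>hom_module S K N\<^esub> f \<oplus>\<^bsub>hom_module S K N\<^esub> s \<odot>\<^bsub>hom_module S K N\<^esub> f"
        and "(r \<otimes>\<^bsub>R\<^esub> s) \<odot>\<^bsub>hom_module S K N\<^esub> f = r \<odot>\<^bsub>hom_module S K N\<^esub> (s \<odot>\<^bsub>hom_module S K N\<^esub> f)"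
        using r s lin_maps_add[OF fl] by (auto simp: hom_module_simps fun_eq_iff rsmult_simps)
    next
      fix g assume g: "g \<in> carrier (hom_module S K N)"
      show "r \<odot>\<^bsub>hom_module S K N\<^esub> (f \<oplus>\<^bsub>hom_module S K N\<^esub> g) = r \<odot>\<^bsub>hom_module S K N\<^esub> f \<oplus>\<^bsub>hom_module S K N\<^esub> r \<odot>\<^bsub>hom_module S K N\<^esub> g"
        using r by (auto simp: hom_module_simps fun_eq_iff rsmult_simps)
    }
  next
    fix f assume f: "f \<in> carrier (hom_module S K N)"
    then show "\<one>\<^bsub>R\<^esub> \<odot>\<^bsub>hom_module S K N\<^esub> f = f"
      by (auto simp: hom_module_simps fun_eq_iff rsmult_simps extensional_def)
  qed
qed

lemma left_module_tensor_module:
  assumes M: "left_module R M"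
  shows "left_module S (tensor_module R K M)"
proof -
  interpret P: tensor_pair R "right_mod K" M by (rule tensor_pairI[OF M right_K])
  interpret T: abelian_group "tensor_module R K M"
    by (rule abelian_group_cong[OF P.abelian_group_T]) (simp_all add: tensor_module_def Let_def)
  have l: "tmap R M (right_mod K) (\<lambda>k. s \<odot>\<^bsub>K\<^esub> k) \<in> add_maps P.T P.T" if "s \<in> carrier S" for s
    by (rule tmap_add_maps[OF M right_K right_K smult_lin[OF that]])
  show ?thesis
  proof (intro left_module.intro left_module_axioms.intro)
    show "ring S" by (rule KS.R.ring_axioms)
    show "abelian_group (tensor_module R K M)" by (rule T.abelian_group_axioms)
    fix r x assume r: "r \<in> carrier S" and "x \<in> carrier (tensor_module R K M)"
    then have x: "x \<in> carrier P.T" by (simp add: tensor_module_simps)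
    show "r \<odot>\<^bsub>tensor_module R K M\<^esub> x \<in> carrier (tensor_module R K M)"
      using add_maps_closed[OF l[OF r] x] by (simp add: tensor_module_simps)
    {
      fix s assume s: "s \<in> carrier S"
      have "tmap R M (right_mod K) (\<lambda>k. (r \<oplus>\<^bsub>S\<^esub> s) \<odot>\<^bsub>K\<^esub> k) x =
          tmap R M (right_mod K) (\<lambda>k. r \<odot>\<^bsub>K\<^esub> k \<oplus>\<^bsub>right_mod K\<^esub> s \<odot>\<^bsub>K\<^esub> k) x"
        by (rule tmap_cong[OF M right_K right_K smult_lin _ x]) (use r s in \<open>auto simp: KS.smult_l_distr\<close>)
      then show "(r \<oplus>\<^bsub>S\<^esub> s) \<odot>\<^bsub>tensor_module R K M\<^esub> x = r \<odot>\<^bsub>tensor_module R K M\<^esub> x \<oplus>\<^bsub>tensor_module R K M\<^esub> s \<odot>\<^bsub>tensor_module R K M\<^esub> x"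
        using tmap_plus[OF M right_K right_K smult_lin[OF r] smult_lin[OF s] x] by (simp add: tensor_module_simps)
      have "tmap R M (right_mod K) (\<lambda>k. (r \<otimes>\<^bsub>S\<^esub> s) \<odot>\<^bsub>K\<^esub> k) x = tmap R M (right_mod K) (\<lambda>k. r \<odot>\<^bsub>K\<^esub> (s \<odot>\<^bsub>K\<^esub> k)) x"
        by (rule tmap_cong[OF M right_K right_K smult_lin _ x]) (use r s in \<open>auto simp: KS.smult_assoc1\<close>)
      then show "(r \<otimes>\<^bsub>S\<^esub> s) \<odot>\<^bsub>tensor_module R K M\<^esub> x = r \<odot>\<^bsub>tensor_module R K M\<^esub> (s \<odot>\<^bsub>tensor_module R K M\<^esub> x)"
        using tmap_comp[OF M right_K right_K right_K smult_lin[OF s] smult_lin[OF r] x] by (simp add: tensor_module_simps)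
    next
      fix y assume "y \<in> carrier (tensor_module R K M)"
      then show "r \<odot>\<^bsub>tensor_module R K M\<^esub> (x \<oplus>\<^bsub>tensor_module R K M\<^esub> y) = r \<odot>\<^bsub>tensor_module R K M\<^esub> x \<oplus>\<^bsub>tensor_module R K M\<^esub> r \<odot>\<^bsub>tensor_module R K M\<^esub> y"
        using add_maps_add[OF l[OF r] x] by (simp add: tensor_module_simps)
    }
  next
    fix x assume "x \<in> carrier (tensor_module R K M)"
    then have x: "x \<in> carrier P.T" by (simp add: tensor_module_simps)
    have "tmap R M (right_mod K) (\<lambda>k. \<one>\<^bsub>S\<^esub> \<odot>\<^bsub>K\<^esub> k) x = tmap R M (right_mod K) (\<lambda>k. k) x"
      by (rule tmap_cong[OF M right_K right_K smult_lin _ x]) auto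
    then show "\<one>\<^bsub>S\<^esub> \<odot>\<^bsub>tensor_module R K M\<^esub> x = x"
      using tmap_id[OF M right_K x] by (simp add: tensor_module_simps)
  qed
qed

end

locale bass_setup = is_bimod R S K
  for R :: "('r, 'x) ring_scheme" and S :: "('s, 'y) ring_scheme" and K :: "('s, 'r, 'k) bimodule" +
  fixes N :: "('s, 'n, 'z) module_scheme"
  assumes N: "left_module S N"
begin

sublocale N: left_module S N by (rule N)

abbreviation "H \<equiv> hom_module S K N"

lemma H: "left_module R H" by (rule left_module_hom_module[OF N])

sublocale H: left_module R H by (rule H)

lemma H_lin: "h \<in> carrier H \<Longrightarrow> h \<in> lin_maps S K N" by (simp add: hom_module_simps)

text \<open>For a finitely generated free right module \<open>F\<close> this identifies \<open>F \<otimes>\<^sub>R Hom\<^sub>S(K,N)\<close> with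
  \<open>Hom\<^sub>S(Hom(F,K),N)\<close>.\<close>

definition \<tau> :: "('f \<times> ('k \<Rightarrow> 'n) \<Rightarrow>\<^sub>0 int) set \<Rightarrow> ('f \<Rightarrow> 'k) \<Rightarrow> 'n" where
  "\<tau> X f = tensor_lift N (\<lambda>x h. h (f x)) X"

lemma balanced_\<tau>:
  assumes "f \<in> lin_maps (op_ring R) F (right_mod K)"
  shows "balanced R F H N (\<lambda>x h. h (f x))"
  unfolding balanced_def
  using lin_maps_closed[OF assms] lin_maps_add[OF assms] lin_maps_smult[OF assms]
    lin_maps_closed[OF H_lin] lin_maps_add[OF H_lin]
  by (auto simp: hom_module_simps(3,4))

context
  fixes F :: "('r, 'f, 'v) module_scheme"
  assumes F: "left_module (op_ring R) F"
begin

interpretation F: left_module "op_ring R" F by (rule F)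
interpretation P: tensor_pair R F H by (rule tensor_pairI[OF H F])

lemma \<tau>_add_maps: "f \<in> carrier (SR.dual F) \<Longrightarrow> (\<lambda>X. \<tau> X f) \<in> add_maps P.T N"
  unfolding \<tau>_def by (rule P.tensor_lift_add_maps[OF N.M.abelian_group_axioms balanced_\<tau>[OF SR.dual_lin]])

lemma \<tau>_tens:
  assumes "f \<in> carrier (SR.dual F)" "x \<in> carrier F" "h \<in> carrier H"
  shows "\<tau> (tens R F H x h) f = h (f x)"
  unfolding \<tau>_def
  using P.tensor_lift_tns[OF N.M.abelian_group_axioms balanced_\<tau>[OF SR.dual_lin[OF assms(1)]] assms(2,3)] .

lemma \<tau>_lin_maps:
  assumes "X \<in> carrier P.T"
  shows "\<tau> X \<in> lin_maps S (SR.dual F) N"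
proof -
  interpret E: left_module S "SR.dual F" by (rule SR.left_module_dual[OF F])
  show ?thesis using assms
  proof (induction X rule: P.T_induct)
    case (tns x h)
    note h = H_lin[OF tns(2)]
    have ev: "(\<lambda>f. f x) \<in> lin_maps S (SR.dual F) K"
      by (rule lin_mapsI) (use tns(1) SR.dual_closed in \<open>auto simp: SR.dual_simps(3,4)\<close>)
    show ?case
      by (rule lin_maps_cong[OF lin_maps_comp[OF ev h] E.left_module_axioms]) (simp add: \<tau>_tens tns)
  next
    case (add X Y)
    show ?case
      by (rule lin_maps_cong[OF lin_maps_plus[OF N add(3,4)] E.left_module_axioms])
        (simp add: add_maps_add[OF \<tau>_add_maps] add)
  qed
qed

text \<open>\<open>X\<close> is recovered from its values as the sum of the
  \<open>e j \<otimes> c j X\<close>, where \<open>c j X\<close> evaluates \<open>\<tau> X\<close>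
  on the \<open>j\<close>th copy of \<open>K\<close> in the dual. Both sides are additive in
  \<open>X\<close>, so the formula is checked on pure tensors.\<close>

lemma \<tau>_injective:
  assumes free: "fg_free (op_ring R) F" and X: "X \<in> carrier P.T" and z: "\<And>f. f \<in> carrier (SR.dual F) \<Longrightarrow> \<tau> X f = \<zero>\<^bsub>N\<^esub>"
  shows "X = \<zero>\<^bsub>P.T\<^esub>"
proof -
  obtain k e \<pi> where basis: "dual_basis (op_ring R) F k e \<pi>" using ex_dual_basis[OF F free] by blast
  note \<pi> = dual_basisD[OF basis]
  note coef = SR.coef_lin[OF F basis]
  define c where "c j X = (\<lambda>k\<in>carrier K. \<tau> X (SR.coef \<pi> F j k))" for j X
  have cc: "c j X \<in> carrier H" if "j < k" "X \<in> carrier P.T" for j X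
    using restrict_lin_maps[OF left_K lin_maps_comp[OF coef[OF that(1)] \<tau>_lin_maps[OF that(2)]]]
    by (simp add: c_def hom_module_simps)
  have ca: "c j \<in> add_maps P.T H" if j: "j < k" for j
    by (intro add_mapsI cc[OF j])
      (auto simp: c_def hom_module_simps(3) fun_eq_iff add_maps_add[OF \<tau>_add_maps] lin_maps_closed[OF coef[OF j]])
  have ct: "c j (P.tns x h) = \<pi> j x \<odot>\<^bsub>H\<^esub> h" if "j < k" "x \<in> carrier F" "h \<in> carrier H" for j x h
    using that lin_maps_closed[OF coef] by (auto simp: c_def hom_module_simps(4) fun_eq_iff \<tau>_tens SR.coef_apply)
  have fin: "(\<lambda>X. \<Oplus>\<^bsub>P.T\<^esub>j\<in>{..<k}. P.tns (e j) (c j X)) \<in> add_maps P.T P.T"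
  proof (rule add_mapsI)
    fix X Y assume XY: "X \<in> carrier P.T" "Y \<in> carrier P.T"
    have "(\<Oplus>\<^bsub>P.T\<^esub>j\<in>{..<k}. P.tns (e j) (c j (X \<oplus>\<^bsub>P.T\<^esub> Y))) =
        (\<Oplus>\<^bsub>P.T\<^esub>j\<in>{..<k}. P.tns (e j) (c j X) \<oplus>\<^bsub>P.T\<^esub> P.tns (e j) (c j Y))"
      by (rule P.T.finsum_cong') (use XY \<pi>(1) cc in \<open>auto simp: add_maps_add[OF ca] P.tns_add_right\<close>)
    also have "\<dots> = (\<Oplus>\<^bsub>P.T\<^esub>j\<in>{..<k}. P.tns (e j) (c j X)) \<oplus>\<^bsub>P.T\<^esub> (\<Oplus>\<^bsub>P.T\<^esub>j\<in>{..<k}. P.tns (e j) (c j Y))"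
      by (rule P.T.finsum_addf) (use XY \<pi>(1) cc in auto)
    finally show "(\<Oplus>\<^bsub>P.T\<^esub>j\<in>{..<k}. P.tns (e j) (c j (X \<oplus>\<^bsub>P.T\<^esub> Y))) = \<dots>" .
  qed (use \<pi>(1) cc in \<open>auto intro!: P.T.finsum_closed\<close>)
  have "(\<Oplus>\<^bsub>P.T\<^esub>j\<in>{..<k}. P.tns (e j) (c j X)) = X"
  proof (rule P.add_maps_T_eqI[OF fin _ _ X])
    show "(\<lambda>X. X) \<in> add_maps P.T P.T" by (intro add_mapsI refl)
    fix x h assume xh: "x \<in> carrier F" "h \<in> carrier H"
    have "(\<Oplus>\<^bsub>P.T\<^esub>j\<in>{..<k}. P.tns (e j) (c j (P.tns x h))) = (\<Oplus>\<^bsub>P.T\<^esub>j\<in>{..<k}. P.tns (\<pi> j x \<odot>\<^bsub>F\<^esub> e j) h)"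
      by (rule P.T.finsum_cong') (use xh \<pi>(1,2) in \<open>auto simp: ct P.tns_smult\<close>)
    also have "\<dots> = P.tns (\<Oplus>\<^bsub>F\<^esub>j\<in>{..<k}. \<pi> j x \<odot>\<^bsub>F\<^esub> e j) h"
      by (rule add_maps_finsum[OF P.tns_left_add_maps[OF xh(2)] F.M.abelian_group_axioms P.T.abelian_group_axioms, symmetric])
        (use xh \<pi>(1,2) in auto)
    finally show "(\<Oplus>\<^bsub>P.T\<^esub>j\<in>{..<k}. P.tns (e j) (c j (P.tns x h))) = P.tns x h" using \<pi>(5)[OF xh(1)] by simp
  qed
  moreover have "c j X = \<zero>\<^bsub>H\<^esub>" if "j < k" for j
    using z lin_maps_closed[OF coef[OF that]] by (auto simp: c_def hom_module_simps(2) fun_eq_iff)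
  moreover have "P.tns (e j) \<zero>\<^bsub>H\<^esub> = \<zero>\<^bsub>P.T\<^esub>" if "j < k" for j
    by (rule add_maps_zero[OF P.tns_right_add_maps[OF \<pi>(1)[OF that]] H.M.abelian_group_axioms P.T.abelian_group_axioms])
  ultimately show ?thesis using P.T.finsum_cong'[of "{..<k}" "{..<k}" "\<lambda>_. \<zero>\<^bsub>P.T\<^esub>" "\<lambda>j. P.tns (e j) (c j X)"] by simp
qed

text \<open>A map on the dual is the sum of its restrictions to the copies of \<open>K\<close>. Each
  restriction is an element \<open>h j\<close> of \<open>H\<close>, and the witness is the sum of
  the \<open>e j \<otimes> h j\<close>.\<close>

lemma \<tau>_surjective:
  assumes free: "fg_free (op_ring R) F" and g: "g \<in> lin_maps S (SR.dual F) N"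
  shows "\<exists>X\<in>carrier P.T. \<forall>f\<in>carrier (SR.dual F). \<tau> X f = g f"
proof -
  obtain k e \<pi> where basis: "dual_basis (op_ring R) F k e \<pi>" using ex_dual_basis[OF F free] by blast
  note \<pi> = dual_basisD[OF basis]
  note coef = SR.coef_lin[OF F basis]
  define h where "h j = (\<lambda>k\<in>carrier K. g (SR.coef \<pi> F j k))" for j
  have hc: "h j \<in> carrier H" if "j < k" for j
    using restrict_lin_maps[OF left_K lin_maps_comp[OF coef[OF that] g]] by (simp add: h_def hom_module_simps)
  let ?X = "\<Oplus>\<^bsub>P.T\<^esub>j\<in>{..<k}. P.tns (e j) (h j)"
  have tc: "(\<lambda>j. P.tns (e j) (h j)) \<in> {..<k} \<rightarrow> carrier P.T" using hc \<pi>(1) by auto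
  have "\<tau> ?X f = g f" if f: "f \<in> carrier (SR.dual F)" for f
  proof -
    have fe: "f (e j) \<in> carrier K" if "j < k" for j using SR.dual_closed[OF f \<pi>(1)[OF that]] .
    have "\<tau> ?X f = (\<Oplus>\<^bsub>N\<^esub>j\<in>{..<k}. \<tau> (P.tns (e j) (h j)) f)"
      by (rule add_maps_finsum[OF \<tau>_add_maps[OF f] P.T.abelian_group_axioms N.M.abelian_group_axioms _ tc]) simp
    also have "\<dots> = (\<Oplus>\<^bsub>N\<^esub>j\<in>{..<k}. g (SR.coef \<pi> F j (f (e j))))"
      by (rule N.M.finsum_cong')
        (use hc \<pi>(1) fe lin_maps_closed[OF g] lin_maps_closed[OF coef] in \<open>auto simp: \<tau>_tens[OF f] h_def\<close>)
    also have "\<dots> = g (\<Oplus>\<^bsub>SR.dual F\<^esub>j\<in>{..<k}. SR.coef \<pi> F j (f (e j)))"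
      by (rule lin_maps_finsum[OF g SR.left_module_dual[OF F] N, symmetric]) (use fe lin_maps_closed[OF coef] in auto)
    also have "\<dots> = g f" using SR.dual_expand[OF F basis f] by simp
    finally show ?thesis .
  qed
  then show ?thesis using P.T.finsum_closed[OF tc] by blast
qed

end

text \<open>Translates between the complex of the \<open>G i \<otimes> H\<close> and the complex of
  maps from the duals to \<open>N\<close>: tensoring with \<open>d\<close> becomes composition with
  the dual of \<open>d\<close>.\<close>

lemma \<tau>_natural:
  assumes F': "left_module (op_ring R) F'" and F: "left_module (op_ring R) F" and d: "d \<in> lin_maps (op_ring R) F' F"
    and f: "f \<in> carrier (SR.dual F)" and X: "X \<in> carrier (tensor_group R F' H)"
  shows "\<tau> (tmap R H F d X) f = \<tau> X (compose (carrier F') f d)"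
proof -
  have fd: "compose (carrier F') f d \<in> carrier (SR.dual F')"
    by (rule lin_maps_closed[OF SR.dual_map[OF F' d] f])
  show ?thesis
    by (rule tensor_pair.add_maps_T_eqI[OF tensor_pairI[OF H F']
          add_maps_comp[OF tmap_add_maps[OF H F' F d] \<tau>_add_maps[OF F f]] \<tau>_add_maps[OF F' fd] _ X])
      (simp add: tmap_tens[OF H F' F d] \<tau>_tens[OF F f] \<tau>_tens[OF F' fd] lin_maps_closed[OF d], simp add: compose_def)
qed

section \<open>The evaluation map\<close>

sublocale PK: tensor_pair R "right_mod K" H by (rule tensor_pairI[OF H right_K])

lemma bass_counit_add_maps: "bass_counit K N \<in> add_maps PK.T N"
  unfolding bass_counit_eq_tensor_lift
  by (rule PK.tensor_lift_add_maps[OF N.M.abelian_group_axioms balanced_\<tau>[OF lin_maps_id]])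

lemma bass_counit_tens: "k \<in> carrier K \<Longrightarrow> h \<in> carrier H \<Longrightarrow> bass_counit K N (PK.tns k h) = h k"
  unfolding bass_counit_eq_tensor_lift
  using PK.tensor_lift_tns[OF N.M.abelian_group_axioms balanced_\<tau>[OF lin_maps_id], of k h] by simp

lemma bass_counit_lin: "bass_counit K N \<in> lin_maps S (tensor_module R K H) N"
proof (rule lin_mapsI)
  note c = bass_counit_add_maps
  fix s X assume s: "s \<in> carrier S" and "X \<in> carrier (tensor_module R K H)"
  then have X: "X \<in> carrier PK.T" by (simp add: tensor_module_simps)
  have "(\<lambda>X. s \<odot>\<^bsub>N\<^esub> bass_counit K N X) \<in> add_maps PK.T N"
    by (rule add_mapsI) (use s add_maps_closed[OF c] in \<open>auto simp: add_maps_add[OF c] N.smult_r_distr\<close>)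
  then have "bass_counit K N (tmap R H (right_mod K) (\<lambda>k. s \<odot>\<^bsub>K\<^esub> k) X) = s \<odot>\<^bsub>N\<^esub> bass_counit K N X"
    by (rule PK.add_maps_T_eqI[OF add_maps_comp[OF tmap_add_maps[OF H right_K right_K smult_lin[OF s]] c] _ _ X])
      (use s in \<open>simp add: tmap_tens[OF H right_K right_K smult_lin] bass_counit_tens lin_maps_smult[OF H_lin]\<close>)
  then show "bass_counit K N (s \<odot>\<^bsub>tensor_module R K H\<^esub> X) = s \<odot>\<^bsub>N\<^esub> bass_counit K N X"
    by (simp add: tensor_module_simps)
qed (auto simp: tensor_module_simps add_maps_closed[OF bass_counit_add_maps] add_maps_add[OF bass_counit_add_maps])

end

locale bass_resolution = bass_setup R S K N + dual_resolution S "op_ring R" K "right_mod K" G \<delta> \<epsilon>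
  for R :: "('r, 'x) ring_scheme" and S :: "('s, 'y) ring_scheme" and K :: "('s, 'r, 'k) bimodule"
    and N :: "('s, 'n, 'z) module_scheme"
    and G :: "nat \<Rightarrow> ('r, 'f, 'v) module_scheme" and \<delta> :: "nat \<Rightarrow> 'f \<Rightarrow> 'f" and \<epsilon> :: "'f \<Rightarrow> 'k" +
  assumes ExtL: "\<And>i. trivial_group (Ext S (Suc 0) (co.L i) N)"
begin

text \<open>A map \<open>\<tau> X\<close> that vanishes on \<open>L i\<close> factors as
  \<open>g\<close> after \<open>D i\<close>, and \<open>g\<close> is \<open>\<tau> Y\<close> for
  some \<open>Y\<close>; then \<open>X\<close> and the boundary of \<open>Y\<close> have the same
  values, so they are equal. Both \<open>Tor_trivial\<close> and the injectivity of the evaluation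
  rest on this.\<close>

lemma \<tau>_vanish_imp_boundary:
  assumes X: "X \<in> carrier (tensor_group R (G i) H)" and z: "\<And>f. f \<in> carrier (co.L i) \<Longrightarrow> \<tau> X f = \<zero>\<^bsub>N\<^esub>"
  shows "\<exists>Y\<in>carrier (tensor_group R (G (Suc i)) H). X = tmap R H (G i) (\<delta> i) Y"
proof -
  interpret T: abelian_group "tensor_group R (G i) H" by (rule abelian_group_tensor_group[OF H G'(2)])
  obtain g where g: "g \<in> lin_maps S (SR.dual (G (Suc i))) N" "\<And>f. f \<in> carrier (SR.dual (G i)) \<Longrightarrow> \<tau> X f = g (D i f)"
    using co.factor_through_D[OF N ExtL \<tau>_lin_maps[OF G'(2) X] z] by blast
  obtain Y where Y: "Y \<in> carrier (tensor_group R (G (Suc i)) H)" "\<And>f. f \<in> carrier (SR.dual (G (Suc i))) \<Longrightarrow> \<tau> Y f = g f"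
    using \<tau>_surjective[OF G'(2) free g(1)] by blast
  let ?Y = "tmap R H (G i) (\<delta> i) Y"
  have Yc: "?Y \<in> carrier (tensor_group R (G i) H)" by (rule tmap_closed[OF H G'(2) G'(2) G'(5) Y(1)])
  have "X \<ominus>\<^bsub>tensor_group R (G i) H\<^esub> ?Y = \<zero>\<^bsub>tensor_group R (G i) H\<^esub>"
  proof (rule \<tau>_injective[OF G'(2) free T.minus_closed[OF X Yc]])
    fix f assume f: "f \<in> carrier (SR.dual (G i))"
    have "\<tau> ?Y f = \<tau> X f"
      using \<tau>_natural[OF G'(2) G'(2) G'(5) f Y(1)] Y(2) g(2)[OF f] lin_maps_closed[OF D f] by (simp add: D_def)
    then show "\<tau> (X \<ominus>\<^bsub>tensor_group R (G i) H\<^esub> ?Y) f = \<zero>\<^bsub>N\<^esub>"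
      using add_maps_diff[OF \<tau>_add_maps[OF G'(2) f] T.abelian_group_axioms N.M.abelian_group_axioms X Yc]
        add_maps_closed[OF \<tau>_add_maps[OF G'(2) f] X] by (simp add: a_minus_def N.M.r_neg)
  qed
  then have "X = ?Y" using T.diff_add_cancel[OF X Yc] Yc by simp
  then show ?thesis using Y(1) by blast
qed

text \<open>Elements of \<open>L (Suc i)\<close> have the form \<open>D i g\<close>, and
  \<open>\<tau> X (D i g)\<close> is the value at \<open>g\<close> of the boundary of
  \<open>X\<close>; so a cycle vanishes on \<open>L (Suc i)\<close>.\<close>

lemma Tor_trivial: "trivial_group (Tor R (Suc i) (right_mod K) H)"
  unfolding Tor_trivial_iff[OF G fg_free_projective[OF G'(2) free] H] tensor_exact_def
proof (intro ballI impI \<tau>_vanish_imp_boundary)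
  fix X f assume X: "X \<in> carrier (tensor_group R (G (Suc i)) H)"
    and z: "tmap R H (G i) (\<delta> i) X = \<zero>\<^bsub>tensor_group R (G i) H\<^esub>" and "f \<in> carrier (co.L (Suc i))"
  then obtain g where g: "g \<in> carrier (SR.dual (G i))" "f = D i g" using co.D_L_surj[of i] by auto
  show "\<tau> X f = \<zero>\<^bsub>N\<^esub>"
    using \<tau>_natural[OF G'(2) G'(2) G'(5) g(1) X] g
      add_maps_zero[OF \<tau>_add_maps[OF G'(2) g(1)] abelian_group_tensor_group[OF H G'(2)] N.M.abelian_group_axioms]
    by (simp add: z D_def)
qed

text \<open>The link between the complex and the evaluation map: on \<open>L 0\<close>, which
  consists of the \<open>\<eta> a\<close>, the values of \<open>\<tau> X\<close> are the multiples
  of one element of \<open>N\<close>, the evaluation of the image of \<open>X\<close> in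
  \<open>K \<otimes> H\<close>.\<close>

lemma \<tau>_\<eta>:
  assumes X: "X \<in> carrier (tensor_group R (G 0) H)" and a: "a \<in> carrier S"
  shows "\<tau> X (\<eta> a) = a \<odot>\<^bsub>N\<^esub> bass_counit K N (tmap R H (right_mod K) \<epsilon> X)"
proof (rule tensor_pair.add_maps_T_eqI[OF tensor_pairI[OF H G'(2)] \<tau>_add_maps[OF G'(2) \<eta>_closed[OF a]] _ _ X])
  note c = add_maps_comp[OF tmap_add_maps[OF H G'(2) right_K G'(3)] bass_counit_add_maps]
  show "(\<lambda>X. a \<odot>\<^bsub>N\<^esub> bass_counit K N (tmap R H (right_mod K) \<epsilon> X)) \<in> add_maps (tensor_group R (G 0) H) N"
    by (rule add_mapsI) (use a add_maps_closed[OF c] in \<open>auto simp: add_maps_add[OF c] N.smult_r_distr\<close>)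
  show "\<tau> (tens R (G 0) H x h) (\<eta> a) = a \<odot>\<^bsub>N\<^esub> bass_counit K N (tmap R H (right_mod K) \<epsilon> (tens R (G 0) H x h))"
    if "x \<in> carrier (G 0)" "h \<in> carrier H" for x h
    using that a \<epsilon>_closed lin_maps_smult[OF H_lin]
    by (simp add: \<tau>_tens[OF G'(2) \<eta>_closed] tmap_tens[OF H G'(2) right_K G'(3)] bass_counit_tens) (simp add: \<eta>_def)
qed

text \<open>If the evaluation of \<open>Z\<close> is zero, a lift of \<open>Z\<close> to
  \<open>G 0 \<otimes> H\<close> vanishes on \<open>L 0\<close>, so it is a boundary and
  \<open>Z\<close> is zero. Surjectivity extends a map from \<open>L 0\<close> to the dual of
  \<open>G 0\<close>.\<close>

lemma bass_counit_iso: "bass_counit K N \<in> lin_isos S (tensor_module R K H) N"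
proof -
  note c = bass_counit_add_maps
  have inj0: "Z = \<zero>\<^bsub>PK.T\<^esub>" if Z: "Z \<in> carrier PK.T" and z: "bass_counit K N Z = \<zero>\<^bsub>N\<^esub>" for Z
  proof -
    obtain X where X: "X \<in> carrier (tensor_group R (G 0) H)" "tmap R H (right_mod K) \<epsilon> X = Z"
      using tmap_surj[OF H G'(2) right_K G'(3,4) Z] by blast
    have "\<tau> X f = \<zero>\<^bsub>N\<^esub>" if "f \<in> carrier (co.L 0)" for f
      using that \<tau>_\<eta>[OF X(1)] X(2) z by (auto simp: carrier_L0)
    then obtain Y where Y: "Y \<in> carrier (tensor_group R (G (Suc 0)) H)" "X = tmap R H (G 0) (\<delta> 0) Y"
      using \<tau>_vanish_imp_boundary[OF X(1)] by blast
    show ?thesis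
      unfolding X(2)[symmetric] Y(2)
      by (rule tmap_comp_zero[OF H G'(2) G'(2) right_K G'(5) G'(3) resolution_comp_zero(1)[OF G] Y(1)])
  qed
  have "inj_on (bass_counit K N) (carrier PK.T)"
  proof (rule inj_onI)
    fix X Y assume XY: "X \<in> carrier PK.T" "Y \<in> carrier PK.T" "bass_counit K N X = bass_counit K N Y"
    have "bass_counit K N (X \<ominus>\<^bsub>PK.T\<^esub> Y) = \<zero>\<^bsub>N\<^esub>"
      using add_maps_diff[OF c PK.T.abelian_group_axioms N.M.abelian_group_axioms XY(1,2)] XY(3)
        add_maps_closed[OF c XY(2)] by (simp add: a_minus_def N.M.r_neg)
    then have "X \<ominus>\<^bsub>PK.T\<^esub> Y = \<zero>\<^bsub>PK.T\<^esub>" using inj0 PK.T.minus_closed[OF XY(1,2)] by blast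
    then show "X = Y" using PK.T.diff_add_cancel[OF XY(1,2)] XY(2) by simp
  qed
  moreover have "bass_counit K N ` carrier PK.T = carrier N"
  proof
    show "carrier N \<subseteq> bass_counit K N ` carrier PK.T"
    proof
      fix n assume n: "n \<in> carrier N"
      \<comment> \<open>The map on the rank-one module \<open>L 0\<close> that takes its basis
        vector to \<open>n\<close>. Extended to the dual of \<open>G 0\<close> and written as
        \<open>\<tau> X\<close>, it returns \<open>n\<close> at that basis vector.\<close>
      have "(\<lambda>f. \<eta>_inv f \<odot>\<^bsub>N\<^esub> n) \<in> lin_maps S (co.L 0) N"
        by (rule lin_mapsI)
          (use n \<eta>_inv_closed in \<open>auto simp: \<eta>_inv_add \<eta>_inv_smult N.smult_l_distr N.smult_assoc1\<close>)
      then obtain g where g: "g \<in> lin_maps S (SR.dual (G 0)) N" "\<And>f. f \<in> carrier (co.L 0) \<Longrightarrow> g f = \<eta>_inv f \<odot>\<^bsub>N\<^esub> n"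
        using co.extend_from_L[OF N ExtL] by blast
      obtain X where X: "X \<in> carrier (tensor_group R (G 0) H)" "\<And>f. f \<in> carrier (SR.dual (G 0)) \<Longrightarrow> \<tau> X f = g f"
        using \<tau>_surjective[OF G'(2) free g(1)] by blast
      have Xc: "tmap R H (right_mod K) \<epsilon> X \<in> carrier PK.T" by (rule tmap_closed[OF H G'(2) right_K G'(3) X(1)])
      have "bass_counit K N (tmap R H (right_mod K) \<epsilon> X) = \<tau> X (\<eta> \<one>\<^bsub>S\<^esub>)"
        using \<tau>_\<eta>[OF X(1) KS.R.one_closed] add_maps_closed[OF c Xc] by simp
      also have "\<dots> = n"
        using X(2)[OF \<eta>_closed[OF KS.R.one_closed]] g(2)[of "\<eta> \<one>\<^bsub>S\<^esub>"] n by (simp add: carrier_L0 \<eta>_inv_\<eta>)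
      finally show "n \<in> bass_counit K N ` carrier PK.T" using Xc by blast
    qed
  qed (use add_maps_closed[OF c] in auto)
  ultimately show ?thesis
    using bass_counit_lin by (simp add: lin_isos_def bij_betw_def tensor_module_simps)
qed

end

section \<open>The Auslander class\<close>

locale auslander_setup = is_bimod R S K
  for R :: "('r, 'x) ring_scheme" and S :: "('s, 'y) ring_scheme" and K :: "('s, 'r, 'k) bimodule" +
  fixes M :: "('r, 'm, 'z) module_scheme"
  assumes M: "left_module R M"
begin

sublocale M: left_module R M by (rule M)
sublocale PK: tensor_pair R "right_mod K" M by (rule tensor_pairI[OF M right_K])

abbreviation "TM \<equiv> tensor_module R K M"

lemma TM: "left_module S TM" by (rule left_module_tensor_module[OF M])

sublocale TM: left_module S TM by (rule TM)

text \<open>For a finitely generated free left module \<open>F\<close> this identifies \<open>Hom\<^sub>S(F,K) \<otimes>\<^sub>R M\<close> with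
  \<open>Hom\<^sub>S(F, K \<otimes>\<^sub>R M)\<close>.\<close>

definition \<sigma> :: "(('f \<Rightarrow> 'k) \<times> 'm \<Rightarrow>\<^sub>0 int) set \<Rightarrow> 'f \<Rightarrow> ('k \<times> 'm \<Rightarrow>\<^sub>0 int) set" where
  "\<sigma> Z x = tmap R M (right_mod K) (\<lambda>f. f x) Z"

lemma ev_lin: "x \<in> carrier F \<Longrightarrow> (\<lambda>f. f x) \<in> lin_maps (op_ring R) (RS.dual F) (right_mod K)"
  by (rule lin_mapsI) (use RS.dual_closed in \<open>auto simp: RS.dual_simps(3,4)\<close>)

context
  fixes F :: "('s, 'f, 'v) module_scheme"
  assumes F: "left_module S F"
begin

interpretation F: left_module S F by (rule F)

lemma dual_F: "left_module (op_ring R) (RS.dual F)" by (rule RS.left_module_dual[OF F])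

interpretation E: left_module "op_ring R" "RS.dual F" by (rule dual_F)
interpretation P: tensor_pair R "RS.dual F" M by (rule tensor_pairI[OF M dual_F])

lemma \<sigma>_add_maps: "x \<in> carrier F \<Longrightarrow> (\<lambda>Z. \<sigma> Z x) \<in> add_maps P.T PK.T"
  unfolding \<sigma>_def by (rule tmap_add_maps[OF M dual_F right_K ev_lin])

lemma \<sigma>_tens:
  "x \<in> carrier F \<Longrightarrow> f \<in> carrier (RS.dual F) \<Longrightarrow> m \<in> carrier M \<Longrightarrow> \<sigma> (P.tns f m) x = PK.tns (f x) m"
  unfolding \<sigma>_def by (rule tmap_tens[OF M dual_F right_K ev_lin])

lemma \<sigma>_lin_maps:
  assumes Z: "Z \<in> carrier P.T"
  shows "\<sigma> Z \<in> lin_maps S F TM"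
proof (rule lin_mapsI)
  fix x assume x: "x \<in> carrier F"
  show "\<sigma> Z x \<in> carrier TM" using add_maps_closed[OF \<sigma>_add_maps[OF x] Z] by (simp add: tensor_module_simps)
  {
    fix y assume y: "y \<in> carrier F"
    have "tmap R M (right_mod K) (\<lambda>f. f (x \<oplus>\<^bsub>F\<^esub> y)) Z = tmap R M (right_mod K) (\<lambda>f. f x \<oplus>\<^bsub>right_mod K\<^esub> f y) Z"
      by (rule tmap_cong[OF M dual_F right_K ev_lin _ Z])
        (use x y lin_maps_add[OF RS.dual_lin] in auto)
    then show "\<sigma> Z (x \<oplus>\<^bsub>F\<^esub> y) = \<sigma> Z x \<oplus>\<^bsub>TM\<^esub> \<sigma> Z y"
      using tmap_plus[OF M dual_F right_K ev_lin[OF x] ev_lin[OF y] Z] by (simp add: \<sigma>_def tensor_module_simps)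
  next
    fix s assume s: "s \<in> carrier S"
    have "tmap R M (right_mod K) (\<lambda>f. f (s \<odot>\<^bsub>F\<^esub> x)) Z = tmap R M (right_mod K) (\<lambda>f. s \<odot>\<^bsub>K\<^esub> f x) Z"
      by (rule tmap_cong[OF M dual_F right_K ev_lin _ Z])
        (use x s lin_maps_smult[OF RS.dual_lin] in auto)
    then show "\<sigma> Z (s \<odot>\<^bsub>F\<^esub> x) = s \<odot>\<^bsub>TM\<^esub> \<sigma> Z x"
      using tmap_comp[OF M dual_F right_K right_K ev_lin[OF x] smult_lin[OF s] Z] by (simp add: \<sigma>_def tensor_module_simps)
  }
qed

text \<open>The reconstruction formula is now \<open>Z\<close> as the sum of the
  \<open>?u j (\<sigma> Z (e j))\<close>, where \<open>?u j\<close> is induced by the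
  \<open>j\<close>th inclusion of \<open>K\<close> into the dual; again it is checked on pure
  tensors.\<close>

lemma \<sigma>_injective:
  assumes free: "fg_free S F" and Z: "Z \<in> carrier P.T" and z: "\<And>x. x \<in> carrier F \<Longrightarrow> \<sigma> Z x = \<zero>\<^bsub>PK.T\<^esub>"
  shows "Z = \<zero>\<^bsub>P.T\<^esub>"
proof -
  obtain k e \<pi> where basis: "dual_basis S F k e \<pi>" using ex_dual_basis[OF F free] by blast
  note \<pi> = dual_basisD[OF basis]
  note coef = RS.coef_lin[OF F basis]
  let ?u = "\<lambda>j. tmap R M (RS.dual F) (RS.coef \<pi> F j)"
  have u: "?u j \<in> add_maps PK.T P.T" if "j < k" for j by (rule tmap_add_maps[OF M right_K dual_F coef[OF that]])
  have uc: "?u j (\<sigma> X (e j)) \<in> carrier P.T" if "j < k" "X \<in> carrier P.T" for j X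
    by (rule add_maps_closed[OF u add_maps_closed[OF \<sigma>_add_maps]]) (use that \<pi>(1) in auto)
  have fin: "(\<lambda>X. \<Oplus>\<^bsub>P.T\<^esub>j\<in>{..<k}. ?u j (\<sigma> X (e j))) \<in> add_maps P.T P.T"
  proof (rule add_mapsI)
    fix X Y assume XY: "X \<in> carrier P.T" "Y \<in> carrier P.T"
    have "(\<Oplus>\<^bsub>P.T\<^esub>j\<in>{..<k}. ?u j (\<sigma> (X \<oplus>\<^bsub>P.T\<^esub> Y) (e j))) =
        (\<Oplus>\<^bsub>P.T\<^esub>j\<in>{..<k}. ?u j (\<sigma> X (e j)) \<oplus>\<^bsub>P.T\<^esub> ?u j (\<sigma> Y (e j)))"
      by (rule P.T.finsum_cong')
        (use XY \<pi>(1) uc in \<open>auto simp: add_maps_add[OF \<sigma>_add_maps] add_maps_add[OF u] add_maps_closed[OF \<sigma>_add_maps]\<close>)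
    also have "\<dots> = (\<Oplus>\<^bsub>P.T\<^esub>j\<in>{..<k}. ?u j (\<sigma> X (e j))) \<oplus>\<^bsub>P.T\<^esub> (\<Oplus>\<^bsub>P.T\<^esub>j\<in>{..<k}. ?u j (\<sigma> Y (e j)))"
      by (rule P.T.finsum_addf) (use XY uc in auto)
    finally show "(\<Oplus>\<^bsub>P.T\<^esub>j\<in>{..<k}. ?u j (\<sigma> (X \<oplus>\<^bsub>P.T\<^esub> Y) (e j))) = \<dots>" .
  qed (use uc in \<open>auto intro!: P.T.finsum_closed\<close>)
  have "(\<Oplus>\<^bsub>P.T\<^esub>j\<in>{..<k}. ?u j (\<sigma> Z (e j))) = Z"
  proof (rule P.add_maps_T_eqI[OF fin _ _ Z])
    show "(\<lambda>X. X) \<in> add_maps P.T P.T" by (intro add_mapsI refl)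
    fix f m assume fm: "f \<in> carrier (RS.dual F)" "m \<in> carrier M"
    have fe: "f (e j) \<in> carrier K" if "j < k" for j using RS.dual_closed[OF fm(1) \<pi>(1)[OF that]] by simp
    have "(\<Oplus>\<^bsub>P.T\<^esub>j\<in>{..<k}. ?u j (\<sigma> (P.tns f m) (e j))) = (\<Oplus>\<^bsub>P.T\<^esub>j\<in>{..<k}. P.tns (RS.coef \<pi> F j (f (e j))) m)"
      by (rule P.T.finsum_cong')
        (use fm fe \<pi>(1) lin_maps_closed[OF coef] in \<open>auto simp: \<sigma>_tens tmap_tens[OF M right_K dual_F coef]\<close>)
    also have "\<dots> = P.tns (\<Oplus>\<^bsub>RS.dual F\<^esub>j\<in>{..<k}. RS.coef \<pi> F j (f (e j))) m"
      by (rule add_maps_finsum[OF P.tns_left_add_maps[OF fm(2)] E.M.abelian_group_axioms P.T.abelian_group_axioms, symmetric])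
        (use fe lin_maps_closed[OF coef] in auto)
    finally show "(\<Oplus>\<^bsub>P.T\<^esub>j\<in>{..<k}. ?u j (\<sigma> (P.tns f m) (e j))) = P.tns f m"
      using RS.dual_expand[OF F basis fm(1)] by simp
  qed
  moreover have "?u j (\<sigma> Z (e j)) = \<zero>\<^bsub>P.T\<^esub>" if "j < k" for j
    using z[OF \<pi>(1)[OF that]] add_maps_zero[OF u[OF that] PK.T.abelian_group_axioms P.T.abelian_group_axioms] by simp
  ultimately show ?thesis using P.T.finsum_cong'[of "{..<k}" "{..<k}" "\<lambda>_. \<zero>\<^bsub>P.T\<^esub>" "\<lambda>j. ?u j (\<sigma> Z (e j))"] by simp
qed

text \<open>The value of \<open>g\<close> at the \<open>j\<close>th basis vector is carried into the
  tensor product by the \<open>j\<close>th inclusion of \<open>K\<close> into the dual; the sum of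
  these elements has the prescribed values.\<close>

lemma \<sigma>_surjective:
  assumes free: "fg_free S F" and g: "g \<in> lin_maps S F TM"
  shows "\<exists>Z\<in>carrier P.T. \<forall>x\<in>carrier F. \<sigma> Z x = g x"
proof -
  obtain k e \<pi> where basis: "dual_basis S F k e \<pi>" using ex_dual_basis[OF F free] by blast
  note \<pi> = dual_basisD[OF basis]
  note coef = RS.coef_lin[OF F basis]
  let ?u = "\<lambda>j. tmap R M (RS.dual F) (RS.coef \<pi> F j)"
  have ge: "g (e j) \<in> carrier PK.T" if "j < k" for j
    using lin_maps_closed[OF g \<pi>(1)[OF that]] by (simp add: tensor_module_simps)
  have uc: "(\<lambda>j. ?u j (g (e j))) \<in> {..<k} \<rightarrow> carrier P.T"
    using tmap_closed[OF M right_K dual_F coef ge] by auto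
  let ?Z = "\<Oplus>\<^bsub>P.T\<^esub>j\<in>{..<k}. ?u j (g (e j))"
  \<comment> \<open>\<open>PK.T\<close> and \<open>TM\<close> have the same elements and the same
    addition but are different records, so their finite sums have to be identified.\<close>
  have fin: "finsum PK.T f I = finsum TM f I" if "finite I" "f \<in> I \<rightarrow> carrier TM" for f I
    using that
  proof (induction I)
    case (insert i I)
    then have "f i \<in> carrier TM" "f \<in> I \<rightarrow> carrier TM" by auto
    then show ?case using insert.hyps insert.IH by (simp add: tensor_module_simps)
  qed (simp add: tensor_module_simps)
  have "\<sigma> ?Z x = g x" if x: "x \<in> carrier F" for x
  proof -
    have 1: "\<sigma> (?u j (g (e j))) x = \<pi> j x \<odot>\<^bsub>TM\<^esub> g (e j)" if j: "j < k" for j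
      unfolding \<sigma>_def tensor_module_simps
      using tmap_comp[OF M right_K dual_F right_K coef[OF j] ev_lin[OF x] ge[OF j]] x by (simp add: RS.coef_apply)
    have "\<sigma> ?Z x = (\<Oplus>\<^bsub>PK.T\<^esub>j\<in>{..<k}. \<sigma> (?u j (g (e j))) x)"
      by (rule add_maps_finsum[OF \<sigma>_add_maps[OF x] P.T.abelian_group_axioms PK.T.abelian_group_axioms _ uc]) simp
    also have "\<dots> = (\<Oplus>\<^bsub>TM\<^esub>j\<in>{..<k}. \<sigma> (?u j (g (e j))) x)"
      by (rule fin) (use 1 x \<pi>(1,2) lin_maps_closed[OF g] in auto)
    also have "\<dots> = (\<Oplus>\<^bsub>TM\<^esub>j\<in>{..<k}. g (\<pi> j x \<odot>\<^bsub>F\<^esub> e j))"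
      by (rule TM.M.finsum_cong') (use 1 x \<pi>(1,2) lin_maps_closed[OF g] lin_maps_smult[OF g] in auto)
    also have "\<dots> = g (\<Oplus>\<^bsub>F\<^esub>j\<in>{..<k}. \<pi> j x \<odot>\<^bsub>F\<^esub> e j)"
      by (rule lin_maps_finsum[OF g F TM, symmetric]) (use \<pi>(1,2) x in auto)
    finally show ?thesis using \<pi>(5)[OF x] by simp
  qed
  then show ?thesis using P.T.finsum_closed[OF uc] by blast
qed

end

lemma \<sigma>_natural:
  assumes F': "left_module S F'" and F: "left_module S F" and d: "d \<in> lin_maps S F' F"
    and Z: "Z \<in> carrier (tensor_group R (RS.dual F) M)" and x: "x \<in> carrier F'"
  shows "\<sigma> (tmap R M (RS.dual F') (\<lambda>f. compose (carrier F') f d) Z) x = \<sigma> Z (d x)"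
proof -
  note d' = RS.dual_map[OF F' d]
  have "\<sigma> (tmap R M (RS.dual F') (\<lambda>f. compose (carrier F') f d) Z) x =
      tmap R M (right_mod K) (\<lambda>f. compose (carrier F') f d x) Z"
    unfolding \<sigma>_def by (rule tmap_comp[OF M dual_F[OF F] dual_F[OF F'] right_K d' ev_lin[OF x] Z])
  also have "\<dots> = \<sigma> Z (d x)"
    unfolding \<sigma>_def
    by (rule tmap_cong[OF M dual_F[OF F] right_K lin_maps_comp[OF d' ev_lin[OF x]] _ Z]) (use x in \<open>simp add: compose_def\<close>)
  finally show ?thesis .
qed

section \<open>The unit map\<close>

lemma auslander_unit_apply: "k \<in> carrier K \<Longrightarrow> auslander_unit R K M m k = PK.tns k m"
  by (simp add: auslander_unit_def)

lemma auslander_unit_closed: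
  assumes "m \<in> carrier M"
  shows "auslander_unit R K M m \<in> carrier (hom_module S K TM)"
proof -
  have "(\<lambda>k. PK.tns k m) \<in> lin_maps S K TM"
  proof (rule lin_mapsI)
    fix s k assume "s \<in> carrier S" "k \<in> carrier K"
    then show "PK.tns (s \<odot>\<^bsub>K\<^esub> k) m = s \<odot>\<^bsub>TM\<^esub> PK.tns k m"
      using tmap_tens[OF M right_K right_K smult_lin] assms by (simp add: tensor_module_simps)
  next
    fix k k' assume "k \<in> carrier K" "k' \<in> carrier K"
    then show "PK.tns (k \<oplus>\<^bsub>K\<^esub> k') m = PK.tns k m \<oplus>\<^bsub>TM\<^esub> PK.tns k' m"
      using PK.tns_add_left[of k k' m] assms by (simp add: tensor_module_simps)
  qed (use assms in \<open>simp add: tensor_module_simps PK.tns_closed\<close>)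
  then show ?thesis
    using restrict_lin_maps[OF left_K] by (simp add: auslander_unit_def hom_module_simps)
qed

lemma auslander_unit_lin: "auslander_unit R K M \<in> lin_maps R M (hom_module S K TM)"
proof (rule lin_mapsI)
  fix m m' assume "m \<in> carrier M" "m' \<in> carrier M"
  then show "auslander_unit R K M (m \<oplus>\<^bsub>M\<^esub> m') = auslander_unit R K M m \<oplus>\<^bsub>hom_module S K TM\<^esub> auslander_unit R K M m'"
    using PK.tns_add_right by (auto simp: auslander_unit_def hom_module_simps tensor_module_simps fun_eq_iff)
next
  fix r m assume "r \<in> carrier R" "m \<in> carrier M"
  then show "auslander_unit R K M (r \<odot>\<^bsub>M\<^esub> m) = r \<odot>\<^bsub>hom_module S K TM\<^esub> auslander_unit R K M m"
    using PK.tns_smult[of r _ m] by (auto simp: auslander_unit_def hom_module_simps fun_eq_iff rsmult_simps)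
qed (rule auslander_unit_closed)

end

locale auslander_resolution = auslander_setup R S K M + dual_resolution "op_ring R" S "right_mod K" K G \<delta> \<epsilon>
  for R :: "('r, 'x) ring_scheme" and S :: "('s, 'y) ring_scheme" and K :: "('s, 'r, 'k) bimodule"
    and M :: "('r, 'm, 'z) module_scheme"
    and G :: "nat \<Rightarrow> ('s, 'f, 'v) module_scheme" and \<delta> :: "nat \<Rightarrow> 'f \<Rightarrow> 'f" and \<epsilon> :: "'f \<Rightarrow> 'k" +
  assumes TorL: "\<And>i. trivial_group (Tor R (Suc 0) (co.L i) M)"
begin

lemma \<sigma>_D:
  assumes "Z \<in> carrier (tensor_group R (RS.dual (G i)) M)" "x \<in> carrier (G (Suc i))"
  shows "\<sigma> (tmap R M (RS.dual (G (Suc i))) (D i) Z) x = \<sigma> Z (\<delta> i x)"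
  using \<sigma>_natural[OF G'(2) G'(2) G'(5) assms] by (simp add: D_def[abs_def])

text \<open>Injectivity of \<open>\<sigma>\<close> one degree further: \<open>\<sigma>\<close> of
  the image under \<open>D i\<close> is \<open>\<sigma> Z\<close> composed with
  \<open>\<delta> i\<close>.\<close>

lemma tmap_D_zero:
  assumes Z: "Z \<in> carrier (tensor_group R (RS.dual (G i)) M)"
    and z: "\<And>x. x \<in> carrier (G (Suc i)) \<Longrightarrow> \<sigma> Z (\<delta> i x) = \<zero>\<^bsub>PK.T\<^esub>"
  shows "tmap R M (RS.dual (G (Suc i))) (D i) Z = \<zero>\<^bsub>tensor_group R (RS.dual (G (Suc i))) M\<^esub>"
  by (rule \<sigma>_injective[OF G'(2) free tmap_closed[OF M E E D Z]]) (simp add: \<sigma>_D[OF Z] z)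

text \<open>A cocycle is \<open>\<sigma> Z\<close> for some \<open>Z\<close> that \<open>D\<close>
  kills. The cosequence stays exact after tensoring, so \<open>Z\<close> comes from some
  \<open>W\<close> under \<open>D\<close>, and the cocycle is \<open>\<sigma> W\<close> composed
  with \<open>\<delta> i\<close>.\<close>

lemma Ext_trivial: "trivial_group (Ext S (Suc i) K TM)"
  unfolding Ext_trivial_iff[OF G fg_free_projective[OF G'(2) free] TM] hom_exact_def
proof (intro ballI impI)
  fix g assume g: "g \<in> lin_maps S (G (Suc i)) TM" and z: "\<forall>x\<in>carrier (G (Suc (Suc i))). g (\<delta> (Suc i) x) = \<zero>\<^bsub>TM\<^esub>"
  obtain Z where Z: "Z \<in> carrier (tensor_group R (RS.dual (G (Suc i))) M)" "\<And>x. x \<in> carrier (G (Suc i)) \<Longrightarrow> \<sigma> Z x = g x"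
    using \<sigma>_surjective[OF G'(2) free g] by blast
  have "tmap R M (RS.dual (G (Suc (Suc i)))) (D (Suc i)) Z = \<zero>\<^bsub>tensor_group R (RS.dual (G (Suc (Suc i)))) M\<^esub>"
    by (rule tmap_D_zero[OF Z(1)]) (use z Z(2) lin_maps_closed[OF G'(5)] in \<open>simp add: tensor_module_simps\<close>)
  then obtain W where W: "W \<in> carrier (tensor_group R (RS.dual (G i)) M)" "Z = tmap R M (RS.dual (G (Suc i))) (D i) W"
    using co.tensor_kernel_D_Suc[OF refl M TorL Z(1)] by blast
  have "\<forall>x\<in>carrier (G (Suc i)). g x = \<sigma> W (\<delta> i x)" using Z(2) \<sigma>_D[OF W(1)] W(2) by simp
  then show "\<exists>h\<in>lin_maps S (G i) TM. \<forall>x\<in>carrier (G (Suc i)). g x = h (\<delta> i x)"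
    using \<sigma>_lin_maps[OF G'(2) W(1)] by blast
qed

section \<open>The rank-one kernel tensored with \<open>M\<close>\<close>

sublocale P0: tensor_pair R "RS.dual (G 0)" M by (rule tensor_pairI[OF M E])
sublocale L0: tensor_pair R "co.L 0" M by (rule tensor_pairI[OF M co.L])

abbreviation "one_L \<equiv> \<eta> \<one>\<^bsub>R\<^esub>"

lemma one_L: "one_L \<in> carrier (co.L 0)" by (simp add: carrier_L0)

lemma tmap_incl_L0: "f \<in> carrier (co.L 0) \<Longrightarrow> m \<in> carrier M \<Longrightarrow>
    tmap R M (RS.dual (G 0)) (\<lambda>f. f) (L0.tns f m) = P0.tns f m"
  by (rule tmap_tens[OF M co.L E co.incl_L])

lemma \<sigma>_one: "x \<in> carrier (G 0) \<Longrightarrow> m \<in> carrier M \<Longrightarrow> \<sigma> (P0.tns one_L m) x = PK.tns (\<epsilon> x) m"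
  using \<sigma>_tens[OF G'(2) _ \<eta>_closed] \<epsilon>_closed by (simp add: \<eta>_def rsmult_simps)

text \<open>\<open>L 0\<close> is generated by \<open>one_L\<close>, so in a pure tensor the scalar
  moves across to the second factor, and sums of such tensors collapse to one.\<close>

lemma L0_tensor_eq_tns:
  assumes "W \<in> carrier L0.T"
  shows "\<exists>m\<in>carrier M. W = L0.tns one_L m"
  using assms
proof (induction W rule: L0.T_induct)
  case (tns f m)
  then obtain r where r: "r \<in> carrier R" "f = \<eta> r" by (auto simp: carrier_L0)
  then have "f = r \<odot>\<^bsub>co.L 0\<^esub> one_L" using \<eta>_smult[of r "\<one>\<^bsub>R\<^esub>"] by (simp add: co.L_def)
  then show ?case using L0.tns_smult[OF r(1) one_L tns(2)] r tns(2) by (intro bexI[of _ "r \<odot>\<^bsub>M\<^esub> m"]) auto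
next
  case (add X Y)
  then show ?case using L0.tns_add_right[OF one_L] M.M.a_closed by metis
qed

text \<open>The coordinate \<open>\<eta>_inv\<close> provides a map back to \<open>M\<close>. It is
  balanced because \<open>\<eta>_inv_smult\<close> multiplies in the opposite ring: a scalar acting
  on \<open>f\<close> appears on the right of the coordinate, next to \<open>m\<close>.\<close>

lemma L0_tns_inj:
  assumes m: "m \<in> carrier M" and z: "L0.tns one_L m = \<zero>\<^bsub>L0.T\<^esub>"
  shows "m = \<zero>\<^bsub>M\<^esub>"
proof -
  have b: "balanced R (co.L 0) M M (\<lambda>f m. \<eta>_inv f \<odot>\<^bsub>M\<^esub> m)"
    unfolding balanced_def
    using \<eta>_inv_closed \<eta>_inv_add \<eta>_inv_smult
    by (auto simp: M.smult_l_distr M.smult_r_distr M.smult_assoc1)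
  have "tensor_lift M (\<lambda>f m. \<eta>_inv f \<odot>\<^bsub>M\<^esub> m) (L0.tns one_L m) = \<eta>_inv one_L \<odot>\<^bsub>M\<^esub> m"
    by (rule L0.tensor_lift_tns[OF M.M.abelian_group_axioms b one_L m])
  then show ?thesis
    using z add_maps_zero[OF L0.tensor_lift_add_maps[OF M.M.abelian_group_axioms b] L0.T.abelian_group_axioms M.M.abelian_group_axioms]
      m by (simp add: \<eta>_inv_\<eta>)
qed

text \<open>At \<open>\<epsilon> x\<close> the unit of \<open>m\<close> is \<open>\<sigma>\<close>
  of \<open>one_L \<otimes> m\<close>, evaluated at \<open>x\<close>. Read through
  \<open>\<epsilon>\<close>, the unit is therefore the identification of \<open>M\<close> with
  \<open>L 0 \<otimes> M\<close>, followed by the inclusion into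
  \<open>dual (G 0) \<otimes> M\<close> and by \<open>\<sigma>\<close>. After tensoring, the
  inclusion stays injective and its image is the kernel of \<open>D 0\<close>.\<close>

lemma auslander_unit_iso: "auslander_unit R K M \<in> lin_isos R M (hom_module S K TM)"
proof -
  let ?\<mu> = "auslander_unit R K M"
  note HM = left_module_hom_module[OF TM]
  interpret HM: left_module R "hom_module S K TM" by (rule HM)
  have inj0: "m = \<zero>\<^bsub>M\<^esub>" if m: "m \<in> carrier M" and z: "?\<mu> m = \<zero>\<^bsub>hom_module S K TM\<^esub>" for m
  proof -
    have "PK.tns (\<epsilon> x) m = \<zero>\<^bsub>PK.T\<^esub>" if "x \<in> carrier (G 0)" for x
      using fun_cong[OF z, of "\<epsilon> x"] \<epsilon>_closed[OF that] by (simp add: auslander_unit_apply hom_module_simps tensor_module_simps)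
    then have "P0.tns one_L m = \<zero>\<^bsub>P0.T\<^esub>"
      using m by (intro \<sigma>_injective[OF G'(2) free]) (auto simp: \<sigma>_one \<eta>_closed)
    then have "L0.tns one_L m = \<zero>\<^bsub>L0.T\<^esub>"
      using tmap_incl_L0[OF one_L m] one_L m by (intro co.tensor_incl_L_inj[OF refl M TorL]) auto
    then show ?thesis by (rule L0_tns_inj[OF m])
  qed
  have "inj_on ?\<mu> (carrier M)"
  proof (rule inj_onI)
    fix m m' assume mm: "m \<in> carrier M" "m' \<in> carrier M" "?\<mu> m = ?\<mu> m'"
    have "?\<mu> (m \<ominus>\<^bsub>M\<^esub> m') = \<zero>\<^bsub>hom_module S K TM\<^esub>"
      using lin_maps_diff[OF auslander_unit_lin M HM mm(1,2)] mm(3) auslander_unit_closed[OF mm(2)]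
      by (simp add: a_minus_def HM.M.r_neg)
    then have "m \<ominus>\<^bsub>M\<^esub> m' = \<zero>\<^bsub>M\<^esub>" using inj0 M.M.minus_closed[OF mm(1,2)] by blast
    then show "m = m'" using M.M.diff_add_cancel[OF mm(1,2)] mm(2) by simp
  qed
  moreover have "?\<mu> ` carrier M = carrier (hom_module S K TM)"
  proof
    show "carrier (hom_module S K TM) \<subseteq> ?\<mu> ` carrier M"
    proof
      fix f assume f: "f \<in> carrier (hom_module S K TM)"
      then have fl: "f \<in> lin_maps S K TM" by (simp add: hom_module_simps)
      \<comment> \<open>Composed with \<open>\<epsilon>\<close>, the map \<open>f\<close> lives on
        the free module \<open>G 0\<close> and vanishes on the image of \<open>\<delta> 0\<close>;
        the corresponding \<open>Z\<close> is killed by \<open>D 0\<close> and so comes from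
        \<open>L 0 \<otimes> M\<close>.\<close>
      obtain Z where Z: "Z \<in> carrier P0.T" "\<And>x. x \<in> carrier (G 0) \<Longrightarrow> \<sigma> Z x = f (\<epsilon> x)"
        using \<sigma>_surjective[OF G'(2) free lin_maps_comp[OF G'(3) fl]] by blast
      have "tmap R M (RS.dual (G (Suc 0))) (D 0) Z = \<zero>\<^bsub>tensor_group R (RS.dual (G (Suc 0))) M\<^esub>"
        by (rule tmap_D_zero[OF Z(1)])
          (use Z(2) lin_maps_closed[OF G'(5)] resolution_comp_zero(1)[OF G] lin_maps_zero[OF fl left_K TM] in
            \<open>simp add: tensor_module_simps\<close>)
      then obtain W where W: "W \<in> carrier L0.T" "Z = tmap R M (RS.dual (G 0)) (\<lambda>f. f) W"
        using co.tensor_kernel_D[OF refl M TorL Z(1)] by blast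
      then obtain m where m: "m \<in> carrier M" "W = L0.tns one_L m" using L0_tensor_eq_tns by blast
      have Zm: "Z = P0.tns one_L m" using W(2) m tmap_incl_L0[OF one_L m(1)] by simp
      have "f k = ?\<mu> m k" if "k \<in> carrier K" for k
      proof -
        have "k \<in> \<epsilon> ` carrier (G 0)" using that G'(4) by simp
        then obtain x where x: "x \<in> carrier (G 0)" "k = \<epsilon> x" by auto
        then show ?thesis using Z(2)[OF x(1)] \<sigma>_one[OF x(1) m(1)] Zm that by (simp add: auslander_unit_apply)
      qed
      then have "f = ?\<mu> m"
        using f auslander_unit_closed[OF m(1)] by (auto simp: hom_module_simps intro: extensionalityI)
      then show "f \<in> ?\<mu> ` carrier M" using m(1) by blast
    qed
  qed (use auslander_unit_closed in auto)
  ultimately show ?thesis using auslander_unit_lin by (simp add: lin_isos_def bij_betw_def)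
qed

end

section \<open>The main theorem\<close>

lemma syzygy_right_mod: "syzygy (\<lambda>i. right_mod (F i)) \<delta> \<epsilon> (right_mod C) i = syzygy F \<delta> \<epsilon> C i"
  by (cases i) (simp_all add: syzygy_simps)

lemma syzygy_fin_presented:
  assumes "resolution R \<infinity> F \<delta> \<epsilon> U" "\<And>i. fg_free R (F i)"
  shows "fin_presented R \<infinity> ((F m)\<lparr>carrier := syzygy F \<delta> \<epsilon> U m\<rparr>)"
  by (rule fin_presentedI[OF resolution_syzygy[OF assms(1)] assms(2)])

text \<open>\<open>Ext\<close> of the \<open>m\<close>th syzygy in degree \<open>i + 1\<close> is
  \<open>Ext\<close> of \<open>U\<close> in degree \<open>m + i + 2\<close>. With
  \<open>d = m + 1\<close> this is degree \<open>d + 1\<close> for \<open>U\<close> itself if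
  \<open>i = 0\<close>, and degree \<open>d + 1\<close> for the syzygy with index
  \<open>i - 1\<close> otherwise. The case split is due to the numbering of syzygies, which does not
  include \<open>U\<close>. In terms of \<open>hom_exact\<close> all of these are the same condition
  up to index arithmetic.\<close>

lemma nd_injective_Ext_syzygy:
  assumes F: "resolution R \<infinity> F \<delta> \<epsilon> U" and free: "\<And>i. fg_free R (F i)" and N: "N \<in> nd_injective R n (Suc m)"
  shows "trivial_group (Ext R (Suc i) ((F m)\<lparr>carrier := syzygy F \<delta> \<epsilon> U m\<rparr>) N)"
proof -
  have Nm: "left_module R N" using N by (simp add: nd_injective_def)
  note proj = fg_free_projective[OF resolution_infinityD(2)[OF F] free]
  have "hom_exact R N (\<lambda>j. F (Suc m + j)) (\<lambda>j. \<delta> (Suc m + j)) i"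
  proof (cases i)
    case 0
    have "hom_exact R N F \<delta> (Suc m)"
      using nd_injective_Ext[OF N fin_presentedI[OF F free]] Ext_trivial_iff[OF F proj Nm] by blast
    then show ?thesis using 0 by (simp add: hom_exact_def)
  next
    case (Suc p)
    have "hom_exact R N (\<lambda>j. F (Suc p + j)) (\<lambda>j. \<delta> (Suc p + j)) (Suc m)"
      using nd_injective_Ext[OF N syzygy_fin_presented[OF F free]] Ext_trivial_iff[OF resolution_syzygy[OF F] proj Nm] by blast
    then show ?thesis using Suc by (simp add: hom_exact_def add.commute)
  qed
  then show ?thesis using Ext_trivial_iff[OF resolution_syzygy[OF F] proj Nm] by blast
qed

text \<open>The same shift of indices as for \<open>Ext\<close>, now on the resolution by right
  modules.\<close>

lemma nd_flat_Tor_syzygy: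
  assumes F: "resolution (op_ring R) \<infinity> F \<delta> \<epsilon> U" and free: "\<And>i. fg_free (op_ring R) (F i)" and N: "N \<in> nd_flat R n (Suc m)"
  shows "trivial_group (Tor R (Suc i) ((F m)\<lparr>carrier := syzygy F \<delta> \<epsilon> U m\<rparr>) N)"
proof -
  have Nm: "left_module R N" using N by (simp add: nd_flat_def)
  note proj = fg_free_projective[OF resolution_infinityD(2)[OF F] free]
  have "tensor_exact R N (\<lambda>j. F (Suc m + j)) (\<lambda>j. \<delta> (Suc m + j)) i"
  proof (cases i)
    case 0
    have "tensor_exact R N F \<delta> (Suc m)"
      using nd_flat_Tor[OF N fin_presentedI[OF F free]] Tor_trivial_iff[OF F proj Nm] by blast
    then show ?thesis using 0 by (simp add: tensor_exact_def)
  next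
    case (Suc p)
    have "tensor_exact R N (\<lambda>j. F (Suc p + j)) (\<lambda>j. \<delta> (Suc p + j)) (Suc m)"
      using nd_flat_Tor[OF N syzygy_fin_presented[OF F free]] Tor_trivial_iff[OF resolution_syzygy[OF F] proj Nm] by blast
    then show ?thesis using Suc by (simp add: tensor_exact_def add.commute)
  qed
  then show ?thesis using Tor_trivial_iff[OF resolution_syzygy[OF F] proj Nm] by blast
qed

theorem theorem3p8:
  fixes R :: "('r, 'x) ring_scheme" and S :: "('s, 'y) ring_scheme"
    and F :: "nat \<Rightarrow> ('s, 'r, 'f) bimodule" and \<delta> :: "nat \<Rightarrow> 'f \<Rightarrow> 'f" and \<epsilon> :: "'f \<Rightarrow> 'c"
    and C :: "('s, 'r, 'c) bimodule" and K :: "('s, 'r, 'f) bimodule"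
    and d :: nat and n :: enat
  assumes "ring R" and "ring S"
    and "d \<ge> 1" and "n > enat (d + 1)"
    and "special_semidualizing S R d F \<delta> \<epsilon> C K"
  shows "(nd_injective S n d :: ('s, 'm) module set) \<subseteq> bass_class S R K \<and>
         (nd_flat R n d :: ('r, 'm2) module set) \<subseteq> auslander_class S R K"
proof -
  obtain m where d: "d = Suc m" using assms(3) by (cases d) auto
  have sp: "super_fp_resolution S R F \<delta> \<epsilon> C" and Keq: "K = (F m)\<lparr>carrier := syzygy F \<delta> \<epsilon> C m\<rparr>"
    and semi: "semidualizing S R K"
    using assms(5) unfolding special_semidualizing_def syzygy_bimodule_def d diff_Suc_1 by blast+
  have FS: "resolution S \<infinity> F \<delta> \<epsilon> C" "\<And>i. fg_free S (F i)"
    and FR: "resolution (op_ring R) \<infinity> (\<lambda>i. right_mod (F i)) \<delta> \<epsilon> (right_mod C)" "\<And>i. fg_free (op_ring R) (right_mod (F i))"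
    using sp by (simp_all add: super_fp_resolution_def)
  \<comment> \<open>Forgetting the left action commutes with passing to the syzygy, so the right
    resolution can be treated like the left one.\<close>
  have KReq: "right_mod K = (right_mod (F m))\<lparr>carrier := syzygy (\<lambda>i. right_mod (F i)) \<delta> \<epsilon> (right_mod C) m\<rparr>"
    unfolding Keq syzygy_right_mod by (simp add: right_mod_def)
  \<comment> \<open>As \<open>d = Suc m\<close>, the kernel leaving \<open>F m\<close> is resolved
    by \<open>F d\<close>, \<open>F (d + 1)\<close> and so on, with \<open>\<delta> m\<close> as
    augmentation. The same tail serves over both rings.\<close>
  let ?GS = "\<lambda>j. F (Suc m + j)" and ?GR = "\<lambda>j. right_mod (F (Suc m + j))" and ?\<delta> = "\<lambda>j. \<delta> (Suc m + j)"
  have GS: "resolution S \<infinity> ?GS ?\<delta> (\<delta> m) K" unfolding Keq by (rule resolution_syzygy[OF FS(1)])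
  have GR: "resolution (op_ring R) \<infinity> ?GR ?\<delta> (\<delta> m) (right_mod K)"
    unfolding KReq by (rule resolution_syzygy[OF FR(1)])
  have fpS: "fin_presented S \<infinity> K" by (rule fin_presentedI[OF GS FS(2)])
  have fpR: "fin_presented (op_ring R) \<infinity> (right_mod K)" by (rule fin_presentedI[OF GR FR(2)])
  have bi: "is_bimodule S R K"
    and hS: "bij_betw (\<lambda>s. \<lambda>k\<in>carrier K. s \<odot>\<^bsub>K\<^esub> k) (carrier S) (carrier (hom_group (op_ring R) (right_mod K) (right_mod K)))"
    and hR: "bij_betw (\<lambda>r. \<lambda>k\<in>carrier K. rsmult K k r) (carrier R) (carrier (hom_group S K K))"
    and ES: "\<And>i. trivial_group (Ext S (Suc i) K K)"
    and ER: "\<And>i. trivial_group (Ext (op_ring R) (Suc i) (right_mod K) (right_mod K))"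
    using semi by (simp_all add: semidualizing_def)
  interpret is_bimod R S K by (intro is_bimod.intro assms(1) bi)
  \<comment> \<open>The two classes quantify over \<open>i \<ge> 1\<close>, whereas the vanishing
    results are stated in degree \<open>Suc i\<close>.\<close>
  have ge1: "(\<forall>i\<ge>Suc 0. P i) \<longleftrightarrow> (\<forall>i. P (Suc i))" for P
    by (metis Suc_le_D Suc_le_mono le0)
  \<comment> \<open>The Bass class dualises the right resolution into \<open>K\<close>, which gives
    left \<open>S\<close>-modules to test \<open>N\<close> on; the Auslander class dualises the left
    resolution, which gives right \<open>R\<close>-modules to tensor with \<open>M\<close>.\<close>
  interpret dS: dual_resolution S "op_ring R" K "right_mod K" ?GR ?\<delta> "\<delta> m"
    by (intro dual_resolution.intro dual_resolution_axioms.intro SR.two_actions_axioms GR FR(2) fpS ER)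
      (use hS in simp)
  interpret dR: dual_resolution "op_ring R" S "right_mod K" K ?GS ?\<delta> "\<delta> m"
    by (intro dual_resolution.intro dual_resolution_axioms.intro RS.two_actions_axioms GS FS(2) fpR ES)
      (use hR in simp)
  have "N \<in> bass_class S R K" if N: "N \<in> nd_injective S n d" for N :: "('s, 'm) module"
  proof -
    have Nm: "left_module S N" using N by (simp add: nd_injective_def)
    have ExtK: "trivial_group (Ext S (Suc i) K N)" for i
      unfolding Keq by (rule nd_injective_Ext_syzygy[OF FS N[unfolded d]])
    \<comment> \<open>The terms of the cosequence are powers of \<open>K\<close> up to isomorphism,
      where all positive \<open>Ext\<close> vanish, and every \<open>L i\<close> is an admissible
      test module in degree \<open>d + 1\<close>.\<close>
    have "trivial_group (Ext S (Suc 0) (dS.co.L i) N)" for i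
    proof (rule dS.co.Ext_L[OF Nm])
      show "trivial_group (Ext S (Suc j) (SR.dual (?GR i)) N)" for i j
        by (rule SR.Ext_dual[OF dS.G'(2) FR(2) fpS Nm ExtK])
      show "trivial_group (Ext S (Suc d) (dS.co.L i) N)" for i
        by (rule nd_injective_Ext[OF N dS.co.fpL])
    qed
    then interpret bass_resolution R S K N ?GR ?\<delta> "\<delta> m"
      by (intro bass_resolution.intro bass_resolution_axioms.intro bass_setup.intro bass_setup_axioms.intro
          is_bimod_axioms Nm dS.dual_resolution_axioms)
    show ?thesis using Nm ExtK Tor_trivial bass_counit_iso by (simp add: bass_class_def ge1)
  qed
  moreover have "M \<in> auslander_class S R K" if M: "M \<in> nd_flat R n d" for M :: "('r, 'm2) module"
  proof -
    have Mm: "left_module R M" using M by (simp add: nd_flat_def)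
    have TorK: "trivial_group (Tor R (Suc i) (right_mod K) M)" for i
      unfolding KReq by (rule nd_flat_Tor_syzygy[OF FR M[unfolded d]])
    \<comment> \<open>The same two inputs for \<open>Tor\<close>: vanishing on the duals, which
      comes from \<open>TorK\<close>, and the flatness condition on each \<open>L i\<close> in
      degree \<open>d + 1\<close>.\<close>
    have "trivial_group (Tor R (Suc 0) (dR.co.L i) M)" for i
    proof (rule dR.co.Tor_L[OF refl Mm])
      show "trivial_group (Tor R (Suc j) (RS.dual (?GS i)) M)" for i j
        by (rule RS.Tor_dual[OF dR.G'(2) FS(2) fpR refl Mm TorK])
      show "trivial_group (Tor R (Suc d) (dR.co.L i) M)" for i
        by (rule nd_flat_Tor[OF M dR.co.fpL])
    qed
    then interpret auslander_resolution R S K M ?GS ?\<delta> "\<delta> m"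
      by (intro auslander_resolution.intro auslander_resolution_axioms.intro auslander_setup.intro
          auslander_setup_axioms.intro is_bimod_axioms Mm dR.dual_resolution_axioms)
    show ?thesis using Mm TorK Ext_trivial auslander_unit_iso by (simp add: auslander_class_def ge1)
  qed
  ultimately show ?thesis by blast
qed

end
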